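(* Let $M$ be a compact connected complex manifold of complex dimension $n\geq 2$, and let $\omega$ be a Hermitian metric on $M$ whose holomorphic sectional curvature is nonnegative, $HSC(\omega)\geq 0$. Then the Kodaira dimension satisfies $\kappa(M)\leq 0$. Moreover, $\kappa(M)=0$ holds if and only if the following three conditions all hold: $HSC(\omega)\equiv 0$; $\omega$ is conformally balanced; and $K_M$ is a holomorphic torsion, i.e. $mK_M=\mathcal{O}_M$ (as holomorphic line bundles) for some positive integer $m$.
   Context: A Hermitian metric is identified with its associated positive $(1,1)$-form $\omega=\sqrt{-1}\,g_{i\bar j}\,dz^i\wedge d\bar z^j$ (summation convention). The curvature tensor of the Chern connection on $(T^{1,0}M,\omega)$ has components $$R_{i\bar jk\bar l}=-\frac{\partial^2 g_{k\bar l}}{\partial z^i\partial\bar z^j}+g^{p\bar q}\frac{\partial g_{k\bar q}}{\partial z^i}\frac{\partial g_{p\bar l}}{\partial\bar z^j},\qquad (g^{i\bar j})=(g_{i\bar j})^{-1}.$$ The holomorphic sectional curvature $HSC(\omega)$ is the function $H_p(v)=R_{i\bar jk\bar l}|_p\,v^i\bar v^jv^k\bar v^l$ for $p\in M$ and $v=v^i\frac{\partial}{\partial z^i}\in T^{1,0}_pM$. $HSC(\omega)\geq 0$ means $H_p(v)\ge 0$ for all $(p,v)$, and $HSC(\omega)\equiv 0$ means $H_p(v)=0$ for all $(p,v)$. A Hermitian metric $\omega$ is balanced if $d\omega^{n-1}=0$; it is conformally balanced if $e^u\omega$ is balanced for some $u\in C^\infty(M;\mathbb{R})$. $K_M$ is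 the canonical line bundle and $mK_M$ its $m$-th tensor power. $\kappa(M)$ is the Kodaira dimension of $M$; $\kappa(M)<0$ means $H^0(M,mK_M)=0$ for all positive integers $m$. *)

theory Defs
  imports "HOL-Analysis.Analysis" "HOL-Library.Function_Algebras"
begin

section \<open>Smooth and holomorphic functions of several variables\<close>

primrec Ck_on ::
  "nat \<Rightarrow> ('e::real_normed_vector \<Rightarrow> 'f::real_normed_vector) \<Rightarrow> 'e set \<Rightarrow> bool" where
  "Ck_on 0 f S \<longleftrightarrow> continuous_on S f"
| "Ck_on (Suc k) f S \<longleftrightarrow>
     (\<forall>x\<in>S. f differentiable (at x)) \<and>
     (\<forall>v. Ck_on k (\<lambda>x. frechet_derivative f (at x) v) S)"

text \<open>Meant for open sets \<open>S\<close>; all derivatives are over the reals.\<close>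

definition smooth_fun_on ::
  "('e::real_normed_vector \<Rightarrow> 'f::real_normed_vector) \<Rightarrow> 'e set \<Rightarrow> bool" where
  "smooth_fun_on f S \<longleftrightarrow> (\<forall>k. Ck_on k f S)"

definition holo_fun_on :: "(complex^'n \<Rightarrow> complex) \<Rightarrow> (complex^'n) set \<Rightarrow> bool" where
  "holo_fun_on f S \<longleftrightarrow>
     (\<forall>z\<in>S. \<exists>D. (f has_derivative D) (at z) \<and> (\<forall>a v. D (a *s v) = a * D v))"

definition d_z :: "'n \<Rightarrow> (complex^'n \<Rightarrow> complex) \<Rightarrow> complex^'n \<Rightarrow> complex" where
  "d_z i f z = (frechet_derivative f (at z) (axis i 1)
                - \<i> * frechet_derivative f (at z) (axis i \<i>)) / 2"

definition d_zbar :: "'n \<Rightarrow> (complex^'n \<Rightarrow> complex) \<Rightarrow> complex^'n \<Rightarrow> complex" where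
  "d_zbar i f z = (frechet_derivative f (at z) (axis i 1)
                   + \<i> * frechet_derivative f (at z) (axis i \<i>)) / 2"


section \<open>Complex manifolds\<close>

text \<open>
  The manifold is the type \<open>'a\<close>, its complex dimension is \<open>CARD('n)\<close>. A chart is a pair of a
  domain and a coordinate map, the latter only meaningful on the domain.
\<close>

type_synonym ('a, 'n) chart = "'a set \<times> ('a \<Rightarrow> complex^'n)"

definition coord_rep :: "('a, 'n) chart \<Rightarrow> ('a \<Rightarrow> 'b) \<Rightarrow> complex^'n \<Rightarrow> 'b" where
  "coord_rep c f = f \<circ> inv_into (fst c) (snd c)"

definition complex_atlas :: "('a::topological_space, 'n::finite) chart set \<Rightarrow> bool" where
  "complex_atlas A \<longleftrightarrow>
     (\<Union>c\<in>A. fst c) = UNIV \<and>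
     (\<forall>(U, \<phi>)\<in>A. open U \<and> open (\<phi> ` U) \<and> (\<exists>\<psi>. homeomorphism U (\<phi> ` U) \<phi> \<psi>)) \<and>
     (\<forall>c\<in>A. \<forall>d\<in>A. \<forall>k.
        holo_fun_on (coord_rep c (\<lambda>p. snd d p $ k)) (snd c ` (fst c \<inter> fst d)))"

definition smooth_on_manifold ::
  "('a, 'n::finite) chart set \<Rightarrow> ('a \<Rightarrow> real) \<Rightarrow> bool" where
  "smooth_on_manifold A u \<longleftrightarrow> (\<forall>c\<in>A. smooth_fun_on (coord_rep c u) (snd c ` fst c))"

definition pd_z :: "('a, 'n::finite) chart \<Rightarrow> 'n \<Rightarrow> ('a \<Rightarrow> complex) \<Rightarrow> 'a \<Rightarrow> complex" where
  "pd_z c i f p = d_z i (coord_rep c f) (snd c p)"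

definition pd_zbar :: "('a, 'n::finite) chart \<Rightarrow> 'n \<Rightarrow> ('a \<Rightarrow> complex) \<Rightarrow> 'a \<Rightarrow> complex" where
  "pd_zbar c i f p = d_zbar i (coord_rep c f) (snd c p)"

text \<open>
  With \<open>z\<close> the coordinates of \<open>c\<close> and \<open>w\<close> those of \<open>d\<close>, entry \<open>(k, i)\<close> is the partial
  derivative of \<open>w\<^sup>k\<close> with respect to \<open>z\<^sup>i\<close>.
\<close>

definition transition_jacobian ::
  "('a, 'n::finite) chart \<Rightarrow> ('a, 'n) chart \<Rightarrow> 'a \<Rightarrow> complex^'n^'n" where
  "transition_jacobian c d p = (\<chi> k i. pd_z c i (\<lambda>q. snd d q $ k) p)"


section \<open>Hermitian metrics and holomorphic sectional curvature\<close>

text \<open>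
  A tensor field is given by its components in the charts of the atlas, subject to the
  transformation law: \<open>g c p $ i $ j\<close> is the component of index \<open>i\<close>, \<open>j\<close>-bar at \<open>p\<close> with
  respect to the coordinates of \<open>c\<close>.
\<close>

type_synonym ('a, 'n) metric = "('a, 'n) chart \<Rightarrow> 'a \<Rightarrow> complex^'n^'n"

definition hermitian_metric ::
  "('a, 'n::finite) chart set \<Rightarrow> ('a, 'n) metric \<Rightarrow> bool" where
  "hermitian_metric A g \<longleftrightarrow>
     (\<forall>c\<in>A.
        (\<forall>i j. smooth_fun_on (coord_rep c (\<lambda>p. g c p $ i $ j)) (snd c ` fst c)) \<and>
        (\<forall>p\<in>fst c.
           (\<forall>i j. g c p $ j $ i = cnj (g c p $ i $ j)) \<and>
           (\<forall>v. v \<noteq> 0 \<longrightarrow> Re (\<Sum>i\<in>UNIV. \<Sum>j\<in>UNIV. g c p $ i $ j * v $ i * cnj (v $ j)) > 0))) \<and>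
     (\<forall>c\<in>A. \<forall>d\<in>A. \<forall>p\<in>fst c \<inter> fst d. \<forall>i j.
        g c p $ i $ j =
          (\<Sum>k\<in>UNIV. \<Sum>l\<in>UNIV. transition_jacobian c d p $ k $ i
             * cnj (transition_jacobian c d p $ l $ j) * g d p $ k $ l))"

text \<open>
  The upper-index components are characterised by: the sum over \<open>q\<close> of
  \<open>metric_inv g c x p q * g c x $ k $ q\<close> is the Kronecker delta of \<open>p\<close> and \<open>k\<close>. Hence they are
  the entries of the transpose of the inverse matrix.
\<close>

definition metric_inv :: "('a, 'n::finite) metric \<Rightarrow> ('a, 'n) chart \<Rightarrow> 'a \<Rightarrow> 'n \<Rightarrow> 'n \<Rightarrow> complex"
  where "metric_inv g c x p q = matrix_inv (g c x) $ q $ p"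

definition chern_curvature ::
  "('a, 'n::finite) metric \<Rightarrow> ('a, 'n) chart \<Rightarrow> 'a \<Rightarrow> 'n \<Rightarrow> 'n \<Rightarrow> 'n \<Rightarrow> 'n \<Rightarrow> complex" where
  "chern_curvature g c x i j k l =
     - pd_z c i (pd_zbar c j (\<lambda>y. g c y $ k $ l)) x
     + (\<Sum>p\<in>UNIV. \<Sum>q\<in>UNIV. metric_inv g c x p q
          * pd_z c i (\<lambda>y. g c y $ k $ q) x * pd_zbar c j (\<lambda>y. g c y $ p $ l) x)"

text \<open>\<open>v\<close> lists the components of a (1,0)-vector at \<open>p\<close> in the coordinate frame of \<open>c\<close>.\<close>

definition hol_sect_curv ::
  "('a, 'n::finite) metric \<Rightarrow> ('a, 'n) chart \<Rightarrow> 'a \<Rightarrow> complex^'n \<Rightarrow> complex" where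
  "hol_sect_curv g c p v =
     (\<Sum>i\<in>UNIV. \<Sum>j\<in>UNIV. \<Sum>k\<in>UNIV. \<Sum>l\<in>UNIV.
        chern_curvature g c p i j k l * v $ i * cnj (v $ j) * v $ k * cnj (v $ l))"

definition HSC_nonneg :: "('a, 'n::finite) chart set \<Rightarrow> ('a, 'n) metric \<Rightarrow> bool" where
  "HSC_nonneg A g \<longleftrightarrow> (\<forall>c\<in>A. \<forall>p\<in>fst c. \<forall>v. hol_sect_curv g c p v \<in> \<real>\<^sub>\<ge>\<^sub>0)"

definition HSC_zero :: "('a, 'n::finite) chart set \<Rightarrow> ('a, 'n) metric \<Rightarrow> bool" where
  "HSC_zero A g \<longleftrightarrow> (\<forall>c\<in>A. \<forall>p\<in>fst c. \<forall>v. hol_sect_curv g c p v = 0)"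


section \<open>Differential forms in coordinates; balanced metrics\<close>

text \<open>
  A complex-valued \<open>k\<close>-form at a point is a function of a sequence of tangent vectors that
  only depends on the entries with index below \<open>k\<close>. The degrees are passed explicitly.
\<close>

type_synonym 'n form = "(nat \<Rightarrow> complex^'n) \<Rightarrow> complex"

definition wedge :: "nat \<Rightarrow> nat \<Rightarrow> 'n form \<Rightarrow> 'n form \<Rightarrow> 'n form" where
  "wedge k l \<alpha> \<beta> v =
     (\<Sum>\<sigma> | \<sigma> permutes {..<k + l}.
        of_int (sign \<sigma>) * \<alpha> (\<lambda>i. v (\<sigma> i)) * \<beta> (\<lambda>i. v (\<sigma> (k + i)))) / (fact k * fact l)"

primrec wedge_power2 :: "'n form \<Rightarrow> nat \<Rightarrow> 'n form" \<comment> \<open>powers of a 2-form\<close> where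
  "wedge_power2 \<alpha> 0 = (\<lambda>v. 1)"
| "wedge_power2 \<alpha> (Suc k) = wedge 2 (2 * k) \<alpha> (wedge_power2 \<alpha> k)"

definition ext_deriv :: "nat \<Rightarrow> (complex^'n \<Rightarrow> 'n form) \<Rightarrow> complex^'n::finite \<Rightarrow> 'n form" where
  "ext_deriv k \<eta> z v =
     (\<Sum>i\<le>k. (- 1) ^ i *
        frechet_derivative (\<lambda>y. \<eta> y (\<lambda>j. if j < i then v j else v (Suc j))) (at z) (v i))"

definition dz_form :: "'n::finite \<Rightarrow> 'n form" where
  "dz_form i v = v 0 $ i"

definition dzbar_form :: "'n::finite \<Rightarrow> 'n form" where
  "dzbar_form i v = cnj (v 0 $ i)"

definition fundamental_form :: "complex^'n^'n \<Rightarrow> 'n::finite form" where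
  "fundamental_form G v =
     \<i> * (\<Sum>i\<in>UNIV. \<Sum>j\<in>UNIV. G $ i $ j * wedge 1 1 (dz_form i) (dzbar_form j) v)"

definition balanced :: "('a, 'n::finite) chart set \<Rightarrow> ('a, 'n) metric \<Rightarrow> bool" where
  "balanced A g \<longleftrightarrow>
     (\<forall>c\<in>A. \<forall>z\<in>snd c ` fst c. \<forall>v.
        ext_deriv (2 * (CARD('n) - 1))
          (\<lambda>y. wedge_power2 (fundamental_form (coord_rep c (g c) y)) (CARD('n) - 1)) z v = 0)"

definition conformally_balanced :: "('a, 'n::finite) chart set \<Rightarrow> ('a, 'n) metric \<Rightarrow> bool" where
  "conformally_balanced A g \<longleftrightarrow>
     (\<exists>u. smooth_on_manifold A u \<and> balanced A (\<lambda>c p. exp (u p) *\<^sub>R g c p))"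


section \<open>Holomorphic line bundles and Kodaira dimension\<close>

text \<open>
  A holomorphic line bundle trivialised over the chart domains is given by its transition
  functions \<open>t c d\<close> on the overlaps: local representatives of a section satisfy
  \<open>s c = t c d * s d\<close>.
\<close>

type_synonym ('a, 'n) line_bundle = "('a, 'n) chart \<Rightarrow> ('a, 'n) chart \<Rightarrow> 'a \<Rightarrow> complex"

definition trivial_bundle :: "('a, 'n) line_bundle" where
  "trivial_bundle c d p = 1"

text \<open>
  The canonical bundle in the frames given by the wedge product of the differentials of the
  coordinates; changing from \<open>c\<close> to \<open>d\<close> multiplies the frame by the Jacobian determinant.
\<close>

definition canonical_bundle :: "('a, 'n::finite) line_bundle" where
  "canonical_bundle c d p = det (transition_jacobian c d p)"

definition bundle_power :: "nat \<Rightarrow> ('a, 'n) line_bundle \<Rightarrow> ('a, 'n) line_bundle" where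
  "bundle_power m t c d p = t c d p ^ m"

definition bundle_iso ::
  "('a, 'n::finite) chart set \<Rightarrow> ('a, 'n) line_bundle \<Rightarrow> ('a, 'n) line_bundle \<Rightarrow> bool" where
  "bundle_iso A t t' \<longleftrightarrow>
     (\<exists>h. (\<forall>c\<in>A. holo_fun_on (coord_rep c (h c)) (snd c ` fst c) \<and> (\<forall>p\<in>fst c. h c p \<noteq> 0)) \<and>
          (\<forall>c\<in>A. \<forall>d\<in>A. \<forall>p\<in>fst c \<inter> fst d. h c p * t c d p = t' c d p * h d p))"

text \<open>
  The value zero at irrelevant arguments makes the representation of a section unique, so that
  the dimension below is that of the space of sections.
\<close>

definition hol_sections ::
  "('a, 'n::finite) chart set \<Rightarrow> ('a, 'n) line_bundle \<Rightarrow> (('a, 'n) chart \<Rightarrow> 'a \<Rightarrow> complex) set" where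
  "hol_sections A t =
     {s. (\<forall>c\<in>A. holo_fun_on (coord_rep c (s c)) (snd c ` fst c)) \<and>
         (\<forall>c\<in>A. \<forall>d\<in>A. \<forall>p\<in>fst c \<inter> fst d. s c p = t c d p * s d p) \<and>
         (\<forall>c p. c \<notin> A \<or> p \<notin> fst c \<longrightarrow> s c p = 0)}"

definition section_scale ::
  "complex \<Rightarrow> (('a, 'n) chart \<Rightarrow> 'a \<Rightarrow> complex) \<Rightarrow> ('a, 'n) chart \<Rightarrow> 'a \<Rightarrow> complex" where
  "section_scale a s c p = a * s c p"

lemma vector_space_section_scale: "vector_space section_scale"
  by unfold_locales (auto simp: section_scale_def fun_eq_iff algebra_simps)

definition h0 :: "('a, 'n::finite) chart set \<Rightarrow> ('a, 'n) line_bundle \<Rightarrow> nat" where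
  "h0 A t = vector_space.dim section_scale (hol_sections A t)"

text \<open>
  The upper limit of \<open>log h\<^sup>0(m K) / log m\<close>, where the logarithm of zero is minus infinity.
  The space of sections is finite-dimensional as the manifold is compact. The index \<open>m \<le> 1\<close>,
  for which \<open>ln m\<close> vanishes, does not influence the upper limit.
\<close>

definition kodaira_dim :: "('a, 'n::finite) chart set \<Rightarrow> ereal" where
  "kodaira_dim A =
     limsup (\<lambda>m. let h = h0 A (bundle_power m canonical_bundle)
                 in if h = 0 then - \<infinity> else ereal (ln (real h) / ln (real m)))"

definition hol_torsion :: "('a, 'n::finite) chart set \<Rightarrow> ('a, 'n) line_bundle \<Rightarrow> bool" where
  "hol_torsion A t \<longleftrightarrow> (\<exists>m>0. bundle_iso A (bundle_power m t) trivial_bundle)"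

end

theory Submission
  imports Defs "HOL-Complex_Analysis.Cauchy_Integral_Formula"
begin

text \<open>
  Let \<open>\<sigma>\<close> be a section of \<open>m K\<^sub>M\<close>, and put \<open>Q = |\<sigma>|\<^sup>4 / (det g) ^ (2 m)\<close> and \<open>u = Q powr (1 / m)\<close>. The
  operator \<open>L e = \<Sum> \<partial>\<^sub>i \<partial>\<^sub>j' (e g\<^sup>i\<^sup>j)\<close>, with \<open>j'\<close> for the conjugate index, is the formal adjoint of the complex
  Laplacian, which annihilates constants; so \<open>L (u det g)\<close> has integral zero over \<open>M\<close>. Where \<open>\<sigma> \<noteq> 0\<close> it
  equals \<open>u det g (S + |\<alpha>|\<^sup>2)\<close>. Here \<open>S\<close> is the sum of the two scalar curvatures of the Chern
  connection, a positive average of holomorphic sectional curvatures, and \<open>\<alpha> = \<partial> log u + \<tau>\<close> with \<open>\<tau>\<close> the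
  torsion 1-form; the zeros of \<open>\<sigma>\<close> are handled by replacing \<open>Q\<close> by \<open>Q + \<epsilon>\<close>. Hence \<open>S = 0\<close> and \<open>\<alpha> = 0\<close>
  wherever \<open>\<sigma> \<noteq> 0\<close>. The equation \<open>\<alpha> = 0\<close> is a linear differential equation for \<open>\<sigma>\<close> along segments, so a
  nonzero section has no zeros at all. This makes \<open>K\<^sub>M\<close> torsion and leaves at most a one-dimensional
  space of sections, since a suitable linear combination of two sections has a zero. Finally \<open>S = 0\<close>
  forces all holomorphic sectional curvatures to vanish, and \<open>\<alpha> = 0\<close> says that \<open>u powr (1 / (n - 1)) g\<close>
  is balanced.
\<close>

section \<open>Calculus of \<open>k\<close> times differentiable functions\<close>

text \<open>The exponents in \<open>Q\<close> are forced by signs. The factor det g alone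
  contributes - \<open>scal\<close> to L, while log u contributes + 2 \<open>scal\<close>, because
  \<open>Q\<close> is the square of |\<sigma>|^2 / (det g) ^ m. The net + \<open>scal\<close> then
  meets \<open>scal_hat\<close> with weight one, and it is the sum of the two that is an average of
  holomorphic sectional curvatures. At the zeros of \<sigma> the power 1 / m need not be C^2, hence
  \<epsilon>. With t = Q / (Q + \<epsilon>), the regularised expression is the wanted one with
  weight t, plus L (det g) with weight 1 - t, plus a nonnegative term. After multiplication by u the
  middle term is at most a constant times \<epsilon> powr (1 / m), so it disappears in the limit.
  The integral over M is a sum of Euclidean integrals against a C^2 partition of unity. The equation
  \<alpha> = 0 is known only where \<sigma> is nonzero, so it is followed from a nonzero value up to
  a hypothetical first zero. Conversely, powers of a trivialisation of m K give sections at
  arbitrarily large indices.\<close>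

lemma frechet_derivative_cong_open:
  assumes "open S" "x \<in> S" "\<And>y. y \<in> S \<Longrightarrow> f y = g y"
  shows "frechet_derivative f (at x) = frechet_derivative g (at x)"
proof -
  have "(f has_derivative D) (at x) \<longleftrightarrow> (g has_derivative D) (at x)" for D
    using assms by (metis has_derivative_transform_within_open)
  then show ?thesis by (simp add: frechet_derivative_def)
qed

lemma differentiable_cong_open:
  assumes "open S" "x \<in> S" "\<And>y. y \<in> S \<Longrightarrow> f y = g y"
  shows "f differentiable at x \<longleftrightarrow> g differentiable at x"
  using assms unfolding differentiable_def
  by (metis has_derivative_transform_within_open)

lemma frechet_derivative_works':
  "f differentiable at x \<Longrightarrow> (f has_derivative (\<lambda>v. frechet_derivative f (at x) v)) (at x)"
  using frechet_derivative_works[of f "at x"] by simp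

lemma Ck_on_cong:
  assumes "open S" "\<And>x. x \<in> S \<Longrightarrow> f x = g x"
  shows "Ck_on k f S \<longleftrightarrow> Ck_on k g S"
  using assms(2)
proof (induction k arbitrary: f g)
  case 0
  then show ?case by (simp cong: continuous_on_cong)
next
  case (Suc k)
  have "Ck_on k (\<lambda>x. frechet_derivative f (at x) v) S \<longleftrightarrow> Ck_on k (\<lambda>x. frechet_derivative g (at x) v) S" for v
    by (rule Suc.IH) (metis Suc.prems assms(1) frechet_derivative_cong_open)
  moreover have "f differentiable at x \<longleftrightarrow> g differentiable at x" if "x \<in> S" for x
    using differentiable_cong_open[OF assms(1) that Suc.prems] .
  ultimately show ?case by auto
qed

lemma Ck_on_imp_continuous: "Ck_on k f S \<Longrightarrow> continuous_on S f"
  by (cases k)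
    (auto intro!: continuous_at_imp_continuous_on differentiable_imp_continuous_within)

lemma Ck_on_SucD: "Ck_on (Suc k) f S \<Longrightarrow> Ck_on k f S"
proof (induction k arbitrary: f)
  case 0
  then show ?case using Ck_on_imp_continuous by (metis Ck_on.simps(1))
next
  case (Suc k)
  then show ?case by (metis Ck_on.simps(2))
qed

lemma Ck_on_subset: "Ck_on k f S \<Longrightarrow> T \<subseteq> S \<Longrightarrow> Ck_on k f T"
proof (induction k arbitrary: f)
  case 0
  then show ?case using continuous_on_subset by auto
next
  case (Suc k)
  have "Ck_on k (\<lambda>x. frechet_derivative f (at x) v) T" for v
    using Suc.IH[of "\<lambda>x. frechet_derivative f (at x) v"] Suc.prems by simp
  then show ?case using Suc.prems by (simp add: subset_iff)
qed

lemma Ck_on_Un: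
  assumes "open S" "open T"
  shows "Ck_on k f S \<Longrightarrow> Ck_on k f T \<Longrightarrow> Ck_on k f (S \<union> T)"
proof (induction k arbitrary: f)
  case 0
  then show ?case using continuous_on_open_Un assms by auto
next
  case (Suc k)
  have "Ck_on k (\<lambda>x. frechet_derivative f (at x) v) (S \<union> T)" for v
    using Suc.IH[of "\<lambda>x. frechet_derivative f (at x) v"] Suc.prems by simp
  then show ?case using Suc.prems by auto
qed

lemma Ck_on_SucI:
  assumes "open S" "\<And>x. x \<in> S \<Longrightarrow> (f has_derivative f' x) (at x)" "\<And>v. Ck_on k (\<lambda>x. f' x v) S"
  shows "Ck_on (Suc k) f S"
proof -
  have "frechet_derivative f (at x) = f' x" if "x \<in> S" for x
    using frechet_derivative_at[OF assms(2)[OF that]] by simp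
  then have "Ck_on k (\<lambda>x. frechet_derivative f (at x) v) S" for v
    using Ck_on_cong[OF assms(1), of "\<lambda>x. frechet_derivative f (at x) v" "\<lambda>x. f' x v"] assms(3) by auto
  then show ?thesis using assms(2) by (auto simp: differentiable_def)
qed

lemma Ck_on_differentiable: "Ck_on (Suc k) f S \<Longrightarrow> x \<in> S \<Longrightarrow> f differentiable at x"
  by simp

lemma Ck_on_SucE:
  assumes "Ck_on (Suc k) f S"
  shows "x \<in> S \<Longrightarrow> (f has_derivative frechet_derivative f (at x)) (at x)"
    and "Ck_on k (\<lambda>x. frechet_derivative f (at x) v) S"
  using assms frechet_derivative_works by auto

lemma Ck_on_const [simp]: "open S \<Longrightarrow> Ck_on k (\<lambda>x. c) S"
proof (induction k arbitrary: c)
  case (Suc k)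
  then show ?case by (intro Ck_on_SucI[where f'="\<lambda>x v. 0"]) auto
qed auto

lemma Ck_on_bounded_linear:
  assumes "open S" "bounded_linear h" shows "Ck_on k h S"
proof (cases k)
  case 0
  then show ?thesis using assms by (simp add: linear_continuous_on)
next
  case (Suc j)
  show ?thesis unfolding Suc
    by (rule Ck_on_SucI[where f'="\<lambda>x. h"]) (use assms bounded_linear_imp_has_derivative in auto)
qed

lemma Ck_on_add:
  assumes "open S"
  shows "Ck_on k f S \<Longrightarrow> Ck_on k g S \<Longrightarrow> Ck_on k (\<lambda>x. f x + g x) S"
proof (induction k arbitrary: f g)
  case (Suc k)
  show ?case
    by (rule Ck_on_SucI[where f'="\<lambda>x v. frechet_derivative f (at x) v + frechet_derivative g (at x) v"])
       (intro assms has_derivative_add Ck_on_SucE(1)[OF Suc.prems(1)] Ck_on_SucE(1)[OF Suc.prems(2)]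
          Suc.IH Ck_on_SucE(2)[OF Suc.prems(1)] Ck_on_SucE(2)[OF Suc.prems(2)]; assumption)+
qed (auto intro: continuous_intros)

lemma Ck_on_sum:
  assumes "open S" "\<And>i. i \<in> I \<Longrightarrow> Ck_on k (f i) S"
  shows "Ck_on k (\<lambda>x. \<Sum>i\<in>I. f i x) S"
proof (cases "finite I")
  case True
  then show ?thesis using assms(2)
    by (induction I rule: finite_induct) (use assms(1) in \<open>auto intro: Ck_on_add\<close>)
qed (use assms(1) in auto)

lemma Ck_on_bilinear:
  assumes "open S" "bounded_bilinear h"
  shows "Ck_on k f S \<Longrightarrow> Ck_on k g S \<Longrightarrow> Ck_on k (\<lambda>x. h (f x) (g x)) S"
proof (induction k arbitrary: f g)
  case 0
  then show ?case using bounded_bilinear.continuous_on[OF assms(2)] by auto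
next
  case (Suc k)
  show ?case
  proof (rule Ck_on_SucI[OF assms(1)])
    fix x assume "x \<in> S"
    with Suc.prems show "((\<lambda>x. h (f x) (g x)) has_derivative (\<lambda>v. h (f x) (frechet_derivative g (at x) v)
          + h (frechet_derivative f (at x) v) (g x))) (at x)"
      by (intro bounded_bilinear.FDERIV[OF assms(2)] frechet_derivative_works') auto
  next
    fix v
    show "Ck_on k (\<lambda>x. h (f x) (frechet_derivative g (at x) v) + h (frechet_derivative f (at x) v) (g x)) S"
      using Suc.prems by (intro Ck_on_add[OF assms(1)] Suc.IH Ck_on_SucD[of k f] Ck_on_SucD[of k g]) auto
  qed
qed

lemma Ck_on_linear_compose:
  assumes "open S" "bounded_linear h"
  shows "Ck_on k f S \<Longrightarrow> Ck_on k (\<lambda>x. h (f x)) S"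
proof (induction k arbitrary: f)
  case 0
  then show ?case using bounded_linear.continuous_on[OF assms(2)] by auto
next
  case (Suc k)
  show ?case
    by (rule Ck_on_SucI[where f'="\<lambda>x v. h (frechet_derivative f (at x) v)"])
       (intro assms(1) bounded_linear.has_derivative[OF assms(2)] Ck_on_SucE(1)[OF Suc.prems]
          Suc.IH Ck_on_SucE(2)[OF Suc.prems]; assumption)+
qed

lemma Ck_on_mult:
  fixes f g :: "'e::real_normed_vector \<Rightarrow> 'b::real_normed_algebra"
  shows "open S \<Longrightarrow> Ck_on k f S \<Longrightarrow> Ck_on k g S \<Longrightarrow> Ck_on k (\<lambda>x. f x * g x) S"
  by (rule Ck_on_bilinear[OF _ bounded_bilinear_mult])

lemma Ck_on_scaleR:
  shows "open S \<Longrightarrow> Ck_on k f S \<Longrightarrow> Ck_on k g S \<Longrightarrow> Ck_on k (\<lambda>x. f x *\<^sub>R g x) S"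
  by (rule Ck_on_bilinear[OF _ bounded_bilinear_scaleR])

lemma Ck_on_uminus: "open S \<Longrightarrow> Ck_on k f S \<Longrightarrow> Ck_on k (\<lambda>x. - f x) S"
  by (rule Ck_on_linear_compose[OF _ bounded_linear_minus[OF bounded_linear_ident]])

lemma Ck_on_diff: "open S \<Longrightarrow> Ck_on k f S \<Longrightarrow> Ck_on k g S \<Longrightarrow> Ck_on k (\<lambda>x. f x - g x) S"
  using Ck_on_add[of S k f "\<lambda>x. - g x"] Ck_on_uminus[of S k g] by simp

lemma Ck_on_prod:
  fixes f :: "'i \<Rightarrow> 'e::real_normed_vector \<Rightarrow> 'b::{real_normed_algebra,comm_ring_1}"
  assumes "open S" "\<And>i. i \<in> I \<Longrightarrow> Ck_on k (f i) S"
  shows "Ck_on k (\<lambda>x. \<Prod>i\<in>I. f i x) S"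
proof (cases "finite I")
  case True
  then show ?thesis using assms(2)
    by (induction I rule: finite_induct) (use assms(1) in \<open>auto intro: Ck_on_mult\<close>)
qed (use assms(1) in auto)

lemma Ck_on_power:
  fixes f :: "'e::real_normed_vector \<Rightarrow> 'b::{real_normed_algebra,comm_ring_1}"
  shows "open S \<Longrightarrow> Ck_on k f S \<Longrightarrow> Ck_on k (\<lambda>x. f x ^ m) S"
  by (induction m) (auto intro: Ck_on_mult)

text \<open>\<open>Ck_on\<close> controls derivatives in fixed directions only, while the chain rule
  produces the direction \<open>frechet_derivative f (at x) v\<close>, which varies with x.
  Expanding it over \<open>Basis\<close> restores fixed directions; this is the reason for the
  euclidean middle space.\<close>

lemma Ck_on_compose:
  fixes f :: "'e::real_normed_vector \<Rightarrow> 'f::euclidean_space" and g :: "'f \<Rightarrow> 'g::real_normed_vector"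
  assumes "open S" "open T" "f ` S \<subseteq> T"
  shows "Ck_on k f S \<Longrightarrow> Ck_on k g T \<Longrightarrow> Ck_on k (\<lambda>x. g (f x)) S"
proof (induction k arbitrary: g)
  case 0
  then show ?case using assms(3) continuous_on_compose2 by auto
next
  case (Suc k)
  show ?case
  proof (rule Ck_on_SucI[OF assms(1)])
    fix x assume x: "x \<in> S"
    have "((\<lambda>x. g (f x)) has_derivative (\<lambda>v. frechet_derivative g (at (f x)) (frechet_derivative f (at x) v))) (at x)"
      by (rule has_derivative_compose[OF frechet_derivative_works' frechet_derivative_works'])
        (use Suc.prems x assms(3) in auto)
    moreover have "frechet_derivative g (at (f x)) (frechet_derivative f (at x) v)
        = (\<Sum>b\<in>Basis. (frechet_derivative f (at x) v \<bullet> b) *\<^sub>R frechet_derivative g (at (f x)) b)" for v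
    proof -
      have lin: "linear (frechet_derivative g (at (f x)))"
        using Suc.prems x assms(3) by (intro linear_frechet_derivative) auto
      have "frechet_derivative g (at (f x)) (frechet_derivative f (at x) v) =
         frechet_derivative g (at (f x)) (\<Sum>b\<in>Basis. (frechet_derivative f (at x) v \<bullet> b) *\<^sub>R b)"
        by (simp add: euclidean_representation)
      also have "\<dots> = (\<Sum>b\<in>Basis. (frechet_derivative f (at x) v \<bullet> b) *\<^sub>R frechet_derivative g (at (f x)) b)"
        by (simp add: linear_sum[OF lin] linear_cmul[OF lin])
      finally show ?thesis .
    qed
    ultimately show "((\<lambda>x. g (f x)) has_derivative (\<lambda>v. \<Sum>b\<in>Basis. (frechet_derivative f (at x) v \<bullet> b) *\<^sub>R frechet_derivative g (at (f x)) b)) (at x)"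
      by simp
  next
    fix v
    have "Ck_on k (\<lambda>x. frechet_derivative f (at x) v \<bullet> b) S" for b
      by (rule Ck_on_linear_compose[OF assms(1) bounded_linear_inner_left]) (use Suc.prems in auto)
    moreover have "Ck_on k (\<lambda>x. frechet_derivative g (at (f x)) b) S" for b
      by (rule Suc.IH) (use Suc.prems Ck_on_SucD in auto)
    ultimately show "Ck_on k (\<lambda>x. \<Sum>b\<in>Basis. (frechet_derivative f (at x) v \<bullet> b) *\<^sub>R frechet_derivative g (at (f x)) b) S"
      by (intro Ck_on_sum Ck_on_scaleR assms(1)) auto
  qed
qed

lemma Ck_on_field_derivI:
  fixes f :: "'b::{real_normed_field} \<Rightarrow> 'b"
  assumes "open S" "\<And>x. x \<in> S \<Longrightarrow> (f has_field_derivative f' x) (at x)" "Ck_on k f' S"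
  shows "Ck_on (Suc k) f S"
proof (rule Ck_on_SucI[OF assms(1)])
  fix x assume "x \<in> S"
  then show "(f has_derivative (\<lambda>v. f' x * v)) (at x)"
    using assms(2) by (simp add: has_field_derivative_def)
next
  fix v
  show "Ck_on k (\<lambda>x. f' x * v) S" by (rule Ck_on_mult[OF assms(1,3) Ck_on_const[OF assms(1)]])
qed

lemma Ck_on_inverse: "Ck_on k (inverse :: 'b \<Rightarrow> 'b::{real_normed_field}) (- {0})"
proof (induction k)
  case 0
  then show ?case by (auto intro!: continuous_intros)
next
  case (Suc k)
  have "Ck_on k (\<lambda>x::'b. - (inverse x * inverse x)) (-{0})"
    by (intro Ck_on_uminus Ck_on_mult Suc) auto
  then show ?case
    by (rule Ck_on_field_derivI[rotated 2])
       (auto simp: power2_eq_square intro!: derivative_eq_intros)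
qed

lemma Ck_on_ln: "Ck_on k ln {0::real<..}"
proof (cases k)
  case 0
  then show ?thesis by (auto intro!: continuous_intros)
next
  case (Suc j)
  have "Ck_on j (inverse::real\<Rightarrow>real) {0<..}" by (rule Ck_on_subset[OF Ck_on_inverse]) auto
  then show ?thesis unfolding Suc
    by (rule Ck_on_field_derivI[rotated 2]) (auto intro!: derivative_eq_intros simp: field_simps)
qed

lemma Ck_on_powr: "Ck_on k (\<lambda>x. x powr a) {0::real<..}"
proof (induction k arbitrary: a)
  case 0
  then show ?case by (auto intro!: continuous_intros)
next
  case (Suc k)
  have "Ck_on k (\<lambda>x. a * x powr (a - 1)) {0<..}" by (intro Ck_on_mult Ck_on_const Suc) auto
  then show ?case
    by (rule Ck_on_field_derivI[rotated 2])
       (auto intro!: has_real_derivative_powr)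
qed

lemma Ck_on_inverse_compose:
  fixes f :: "'e::real_normed_vector \<Rightarrow> 'b::{real_normed_field,euclidean_space}"
  assumes "open S" "\<And>x. x \<in> S \<Longrightarrow> f x \<noteq> 0" "Ck_on k f S"
  shows "Ck_on k (\<lambda>x. inverse (f x)) S"
  by (rule Ck_on_compose[OF assms(1) _ _ assms(3) Ck_on_inverse]) (use assms in auto)

lemma Ck_on_divide:
  fixes f :: "'e::real_normed_vector \<Rightarrow> 'b::{real_normed_field,euclidean_space}"
  assumes "open S" "\<And>x. x \<in> S \<Longrightarrow> f x \<noteq> 0" "Ck_on k f S" "Ck_on k g S"
  shows "Ck_on k (\<lambda>x. g x / f x) S"
  using Ck_on_mult[OF assms(1) assms(4) Ck_on_inverse_compose[OF assms(1-3)]] by (simp add: divide_inverse)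

lemma Ck_on_of_real:
  "open S \<Longrightarrow> Ck_on k f S \<Longrightarrow> Ck_on k (\<lambda>x. complex_of_real (f x)) S"
  by (rule Ck_on_linear_compose[OF _ bounded_linear_of_real])

lemma Ck_on_Re: "open S \<Longrightarrow> Ck_on k f S \<Longrightarrow> Ck_on k (\<lambda>x. Re (f x)) S"
  by (rule Ck_on_linear_compose[OF _ bounded_linear_Re])

lemma Ck_on_cnj: "open S \<Longrightarrow> Ck_on k f S \<Longrightarrow> Ck_on k (\<lambda>x. cnj (f x)) S"
  by (rule Ck_on_linear_compose[OF _ bounded_linear_cnj])

lemma Ck_on_vec:
  fixes f :: "'e::real_normed_vector \<Rightarrow> 'b::real_normed_vector^'n"
  assumes "open S" "\<And>i. Ck_on k (\<lambda>x. f x $ i) S"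
  shows "Ck_on k f S"
proof -
  have bl: "bounded_linear (axis i :: 'b \<Rightarrow> 'b^'n)" for i
  proof (rule bounded_linear_intro[where K=1])
    fix x :: 'b
    have "norm (axis i x :: 'b^'n) \<le> (\<Sum>j\<in>UNIV. norm (axis i x $ j))"
      unfolding norm_vec_def by (rule L2_set_le_sum) auto
    also have "\<dots> = norm x" by (simp add: axis_def if_distrib cong: if_cong)
    finally show "norm (axis i x :: 'b^'n) \<le> norm x * 1" by simp
  qed (auto simp: axis_def vec_eq_iff)
  have "f x = (\<Sum>i\<in>UNIV. axis i (f x $ i))" for x
    by (simp add: vec_eq_iff axis_def if_distrib sum.delta)
  then have "f = (\<lambda>x. \<Sum>i\<in>UNIV. axis i (f x $ i))" by blast
  moreover have "Ck_on k (\<lambda>x. \<Sum>i\<in>UNIV. axis i (f x $ i)) S"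
    by (intro Ck_on_sum Ck_on_linear_compose[OF assms(1) bl] assms)
  ultimately show ?thesis by simp
qed

lemma Ck_on_det:
  assumes "open S" "\<And>i j. Ck_on k (\<lambda>x. M x $ i $ j :: complex) S"
  shows "Ck_on k (\<lambda>x. det (M x)) S"
  unfolding det_def by (intro Ck_on_sum Ck_on_mult Ck_on_prod Ck_on_const assms)

section \<open>Holomorphic functions of several variables are smooth\<close>

lemma norm_vector_smult: "norm (c *s v) = norm c * norm (v :: complex^'n)"
  by (simp add: norm_vec_def norm_mult L2_set_right_distrib)

lemma holo_fun_onD:
  assumes "holo_fun_on f S" "z \<in> S"
  shows "(f has_derivative frechet_derivative f (at z)) (at z)"
    and "frechet_derivative f (at z) (a *s v) = a * frechet_derivative f (at z) v"
proof -
  obtain D where D: "(f has_derivative D) (at z)" "\<And>a v. D (a *s v) = a * D v"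
    using assms unfolding holo_fun_on_def by blast
  have "frechet_derivative f (at z) = D" using frechet_derivative_at[OF D(1)] by simp
  with D show "(f has_derivative frechet_derivative f (at z)) (at z)"
    and "frechet_derivative f (at z) (a *s v) = a * frechet_derivative f (at z) v" by auto
qed

lemma holo_fun_on_cong:
  assumes "open S" "\<And>x. x \<in> S \<Longrightarrow> f x = g x"
  shows "holo_fun_on f S \<longleftrightarrow> holo_fun_on g S"
proof -
  have "(f has_derivative D) (at z) \<longleftrightarrow> (g has_derivative D) (at z)" if "z \<in> S" for z D
    using assms that by (metis has_derivative_transform_within_open)
  then show ?thesis unfolding holo_fun_on_def by auto
qed

lemma holo_fun_on_continuous: "holo_fun_on f S \<Longrightarrow> continuous_on S f"
  by (meson continuous_at_imp_continuous_on holo_fun_onD(1) has_derivative_continuous)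

lemma linear_smult_left: "bounded_linear (\<lambda>c::complex. c *s (v::complex^'n))"
  by (rule bounded_linear_intro[where K="norm v"])
    (auto simp: norm_vector_smult vec_eq_iff algebra_simps)

text \<open>Cauchy's formula for the first derivative on the complex line through z in direction v,
  with the circle parametrised. The integrand contains f but no derivative of it, so regularity in z
  is gained by differentiating under the integral.\<close>

lemma frechet_derivative_Cauchy_integral:
  fixes f :: "complex^'n \<Rightarrow> complex"
  assumes f: "holo_fun_on f S" and S: "open S" and r: "r > 0"
    and disc: "\<And>c. norm c \<le> r \<Longrightarrow> z + c *s v \<in> S"
  shows "((\<lambda>t. f (z + (of_real r * exp (2 * of_real pi * \<i> * of_real t)) *s v) /
            (of_real r * exp (2 * of_real pi * \<i> * of_real t)))
          has_integral frechet_derivative f (at z) v) (cbox 0 1)"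
proof -
  define h where "h = (\<lambda>c. f (z + c *s v))"
  have der: "(h has_field_derivative frechet_derivative f (at (z + c *s v)) v) (at c)" if "norm c \<le> r" for c
  proof -
    have "((\<lambda>c. z + c *s v) has_derivative (\<lambda>x. x *s v)) (at c)"
      by (auto intro!: derivative_eq_intros bounded_linear_imp_has_derivative linear_smult_left)
    note has_derivative_compose[OF this holo_fun_onD(1)[OF f disc[OF that]]]
    then
    show ?thesis unfolding h_def has_field_derivative_def
      by (rule has_derivative_eq_rhs)
        (auto simp: fun_eq_iff holo_fun_onD(2)[OF f disc[OF that]])
  qed
  have hol: "h holomorphic_on cball 0 r"
    unfolding holomorphic_on_def field_differentiable_def
  proof (intro ballI exI)
    fix c :: complex assume "c \<in> cball 0 r"
    then show "(h has_field_derivative frechet_derivative f (at (z + c *s v)) v) (at c within cball 0 r)"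
      by (intro has_field_derivative_at_within[OF der]) simp
  qed
  have "((\<lambda>u. h u / (u - 0) ^ Suc 1) has_contour_integral 2 * of_real pi * \<i> / fact 1 * (deriv ^^ 1) h 0) (circlepath 0 r)"
    using Cauchy_has_contour_integral_higher_derivative_circlepath[of 0 r h 0 1]
      holomorphic_on_imp_continuous_on[OF hol] holomorphic_on_subset[OF hol ball_subset_cball] r by auto
  moreover have "deriv h 0 = frechet_derivative f (at z) v"
    using DERIV_imp_deriv[OF der[of 0]] r by simp
  ultimately have "((\<lambda>u. h u / u^2) has_contour_integral 2 * of_real pi * \<i> * frechet_derivative f (at z) v) (circlepath 0 r)"
    by (simp add: power2_eq_square)
  then have "((\<lambda>t. h (circlepath 0 r t) / (circlepath 0 r t)^2 * vector_derivative (circlepath 0 r) (at t within {0..1}))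
      has_integral 2 * of_real pi * \<i> * frechet_derivative f (at z) v) {0..1}"
    unfolding has_contour_integral_def .
  then have "((\<lambda>t. (1 / (2 * of_real pi * \<i>)) * (h (circlepath 0 r t) / (circlepath 0 r t)^2 * vector_derivative (circlepath 0 r) (at t within {0..1})))
      has_integral (1 / (2 * of_real pi * \<i>)) * (2 * of_real pi * \<i> * frechet_derivative f (at z) v)) {0..1}"
    by (rule has_integral_mult_right)
  then have "((\<lambda>t. (1 / (2 * of_real pi * \<i>)) * (h (circlepath 0 r t) / (circlepath 0 r t)^2 * vector_derivative (circlepath 0 r) (at t within {0..1})))
      has_integral frechet_derivative f (at z) v) {0..1}" by simp
  then show ?thesis unfolding cbox_interval
  proof (rule has_integral_eq[rotated])
    fix t :: real assume t: "t \<in> {0..1}"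
    show "(1 / (2 * of_real pi * \<i>)) * (h (circlepath 0 r t) / (circlepath 0 r t)^2 * vector_derivative (circlepath 0 r) (at t within {0..1})) =
       f (z + (of_real r * exp (2 * of_real pi * \<i> * of_real t)) *s v) /
            (of_real r * exp (2 * of_real pi * \<i> * of_real t))"
    proof -
      have vd: "vector_derivative (circlepath 0 r) (at t within {0..1}) = 2 * of_real pi * \<i> * of_real r * exp (2 * of_real pi * \<i> * of_real t)"
        using t vector_derivative_circlepath01[of t 0 r] by simp
      have cp: "circlepath 0 r t = of_real r * exp (2 * of_real pi * \<i> * of_real t)"
        by (simp add: circlepath)
      define E where "E = exp (2 * complex_of_real pi * \<i> * complex_of_real t)"
      have "E \<noteq> 0" unfolding E_def by simp
      then show ?thesis unfolding vd cp E_def[symmetric] h_def power2_eq_square using r by simp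
    qed
  qed
qed

text \<open>One radius serves all centres near z0, as integrals that depend on the centre
  require.\<close>

lemma holo_disc_exists:
  fixes z0 v :: "complex^'n"
  assumes "open S" "z0 \<in> S"
  obtains R r where "R > 0" "r > 0" "\<And>z c. z \<in> ball z0 R \<Longrightarrow> norm c \<le> r \<Longrightarrow> z + c *s v \<in> S"
proof -
  obtain e where e: "e > 0" "ball z0 e \<subseteq> S" using assms openE by blast
  define r where "r = e / (2 * (norm v + 1))"
  have r: "r > 0" unfolding r_def using e by (auto intro!: divide_pos_pos add_nonneg_pos)
  have "z + c *s v \<in> S" if "z \<in> ball z0 (e/2)" "norm c \<le> r" for z c
  proof -
    have "norm c * norm v \<le> r * (norm v + 1)" using that r by (intro mult_mono) auto
    also have "\<dots> = e / 2" unfolding r_def by (simp add: field_simps add_nonneg_eq_0_iff)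
    finally have "norm (c *s v) \<le> e/2" by (simp add: norm_vector_smult)
    moreover have "dist z0 (z + c *s v) \<le> dist z0 z + norm (c *s v)"
      using norm_triangle_ineq4[of "z0 - z" "c *s v"] by (simp add: dist_norm diff_diff_eq)
    ultimately have "dist z0 (z + c *s v) < e" using that by auto
    then show ?thesis using e by auto
  qed
  then show thesis using that[of "e/2" r] e r by auto
qed

text \<open>Continuity of the derivative is not part of \<open>holo_fun_on\<close>. It comes first
  because the Leibniz rule used for the next lemma asks for a continuous derivative of the
  integrand.\<close>

lemma holo_frechet_derivative_continuous:
  fixes f :: "complex^'n \<Rightarrow> complex"
  assumes f: "holo_fun_on f S" and S: "open S"
  shows "continuous_on S (\<lambda>z. frechet_derivative f (at z) v)"
proof (rule continuous_at_imp_continuous_on, rule ballI)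
  fix z0 assume "z0 \<in> S"
  then obtain R r where Rr: "R > 0" "r > 0" "\<And>z c. z \<in> ball z0 R \<Longrightarrow> norm c \<le> r \<Longrightarrow> z + c *s v \<in> S"
    using holo_disc_exists[OF S] by metis
  define e where "e = (\<lambda>t. of_real r * exp (2 * of_real pi * \<i> * of_real t) :: complex)"
  have e: "norm (e t) = r" "e t \<noteq> 0" for t
    using Rr(2) by (auto simp: e_def norm_mult norm_exp_eq_Re)
  have "continuous_on (ball z0 R \<times> cbox 0 1) (\<lambda>(z, t). f (z + e t *s v) / e t)"
    unfolding case_prod_beta
    by (intro continuous_intros continuous_on_compose2[OF holo_fun_on_continuous[OF f]]
        bounded_linear.continuous_on[OF linear_smult_left])
      (auto simp: e_def[symmetric] e Rr intro!: continuous_intros, auto simp: e_def intro!: continuous_intros)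
  then have "continuous_on (ball z0 R) (\<lambda>z. integral (cbox 0 1) (\<lambda>t. f (z + e t *s v) / e t))"
    by (rule integral_continuous_on_param)
  moreover have "integral (cbox 0 1) (\<lambda>t. f (z + e t *s v) / e t) = frechet_derivative f (at z) v" if "z \<in> ball z0 R" for z
    using frechet_derivative_Cauchy_integral[OF f S Rr(2), of z v] Rr(3)[OF that] unfolding e_def
    by (metis (no_types, lifting) integral_unique)
  ultimately have "continuous_on (ball z0 R) (\<lambda>z. frechet_derivative f (at z) v)"
    by (rule continuous_on_eq)
  then show "isCont (\<lambda>z. frechet_derivative f (at z) v) z0"
    by (rule continuous_on_interior) (use Rr(1) in simp)
qed

lemma holo_frechet_derivative_holo:
  fixes f :: "complex^'n \<Rightarrow> complex"
  assumes f: "holo_fun_on f S" and S: "open S"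
  shows "holo_fun_on (\<lambda>z. frechet_derivative f (at z) v) S"
  unfolding holo_fun_on_def
proof (rule ballI)
  fix z0 assume "z0 \<in> S"
  then obtain R r where Rr: "R > 0" "r > 0" "\<And>z c. z \<in> ball z0 R \<Longrightarrow> norm c \<le> r \<Longrightarrow> z + c *s v \<in> S"
    using holo_disc_exists[OF S] by metis
  define e where "e = (\<lambda>t. of_real r * exp (2 * of_real pi * \<i> * of_real t) :: complex)"
  have e: "norm (e t) = r" "e t \<noteq> 0" for t
    using Rr(2) by (auto simp: e_def norm_mult norm_exp_eq_Re)
  have e_cont: "continuous_on X e" for X
    unfolding e_def by (intro continuous_intros)
  have e_cont2: "continuous_on X (\<lambda>p. e (snd p))" for X :: "((complex^'n) \<times> real) set"
    by (intro continuous_on_compose2[OF e_cont[of UNIV]] continuous_intros) auto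
  define U where "U = ball z0 R"
  have US: "z + e t *s v \<in> S" if "z \<in> U" for z t
    using Rr(3)[of z "e t"] that e by (simp add: U_def)
  \<comment> \<open>The Leibniz rule takes the derivative of the integrand as a bounded linear
    function; in finite dimension its continuity can be tested on single vectors.\<close>
  define fx where "fx = (\<lambda>z t. Blinfun (\<lambda>w. frechet_derivative f (at (z + e t *s v)) w / e t))"
  have fx: "blinfun_apply (fx z t) = (\<lambda>w. frechet_derivative f (at (z + e t *s v)) w / e t)" if "z \<in> U" for z t
    unfolding fx_def
    by (intro bounded_linear_Blinfun_apply bounded_linear_divide[THEN bounded_linear_compose]
        has_derivative_bounded_linear[OF holo_fun_onD(1)[OF f US[OF that]]])
  have arg_cont: "continuous_on (U \<times> cbox 0 1) (\<lambda>p. fst p + e (snd p) *s v)"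
    by (intro continuous_intros bounded_linear.continuous_on[OF linear_smult_left] e_cont2)
  have fx_cont: "continuous_on (U \<times> cbox 0 1) (\<lambda>(z, t). fx z t)"
  proof (rule continuous_on_blinfun_componentwise)
    fix i :: "complex^'n"
    have "continuous_on (U \<times> cbox 0 1) (\<lambda>p. frechet_derivative f (at (fst p + e (snd p) *s v)) i / e (snd p))"
      by (intro continuous_intros continuous_on_compose2[OF holo_frechet_derivative_continuous[OF f S] arg_cont] e_cont2)
        (use US e in auto)
    moreover have "(case p of (z,t) \<Rightarrow> fx z t) i = frechet_derivative f (at (fst p + e (snd p) *s v)) i / e (snd p)"
      if "p \<in> U \<times> cbox 0 1" for p
      using fx that by auto
    ultimately show "continuous_on (U \<times> cbox 0 1) (\<lambda>p. (case p of (z,t) \<Rightarrow> fx z t) i)"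
      by (simp cong: continuous_on_cong)
  qed
  have z0: "z0 \<in> U" unfolding U_def using Rr by simp
  have "((\<lambda>z. integral (cbox 0 1) (\<lambda>t. f (z + e t *s v) / e t)) has_derivative integral (cbox 0 1) (fx z0)) (at z0 within U)"
  proof (rule leibniz_rule[OF _ _ fx_cont z0])
    fix z t assume z: "z \<in> U" and "t \<in> cbox 0 (1::real)"
    have 1: "((\<lambda>x. x + e t *s v) has_derivative (\<lambda>x. x)) (at z)"
      by (auto intro!: derivative_eq_intros)
    have "((\<lambda>z. f (z + e t *s v)) has_derivative (\<lambda>w. frechet_derivative f (at (z + e t *s v)) w)) (at z)"
      using has_derivative_compose[OF 1 holo_fun_onD(1)[OF f US[OF z]]] by simp
    from bounded_linear.has_derivative[OF bounded_linear_divide[of "e t"] this]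
    show "((\<lambda>z. f (z + e t *s v) / e t) has_derivative blinfun_apply (fx z t)) (at z within U)"
      unfolding fx[OF z] by (rule has_derivative_at_withinI)
  next
    fix z assume z: "z \<in> U"
    have "continuous_on (cbox 0 1) (\<lambda>t. f (z + e t *s v) / e t)"
      by (intro continuous_intros continuous_on_compose2[OF holo_fun_on_continuous[OF f]]
        bounded_linear.continuous_on[OF linear_smult_left] e_cont) (use e US[OF z] in auto)
    then show "(\<lambda>t. f (z + e t *s v) / e t) integrable_on cbox 0 1" by (rule integrable_continuous)
  qed (simp add: U_def)
  then have lhs: "((\<lambda>z. integral (cbox 0 1) (\<lambda>t. f (z + e t *s v) / e t)) has_derivative integral (cbox 0 1) (fx z0)) (at z0)"
    using z0 at_within_open[OF z0] unfolding U_def by simp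
  have eq: "integral (cbox 0 1) (\<lambda>t. f (z + e t *s v) / e t) = frechet_derivative f (at z) v" if "z \<in> U" for z
    using frechet_derivative_Cauchy_integral[OF f S Rr(2), of z v] Rr(3)[of z] that unfolding e_def U_def
    by (metis (no_types, lifting) integral_unique)
  have "open U" by (simp add: U_def)
  have "((\<lambda>z. frechet_derivative f (at z) v) has_derivative integral (cbox 0 1) (fx z0)) (at z0)"
    by (rule has_derivative_transform_within_open[OF lhs \<open>open U\<close> z0 eq])
  moreover have "integral (cbox 0 1) (fx z0) (a *s w) = a * integral (cbox 0 1) (fx z0) w" for a w
  proof -
    have "continuous_on (cbox 0 1) (\<lambda>t. (\<lambda>(z, t). fx z t) (z0, t))"
      by (rule continuous_on_compose2[OF fx_cont]) (use z0 in \<open>auto intro!: continuous_intros\<close>)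
    then have "continuous_on (cbox 0 1) (fx z0)" by simp
    then have int: "fx z0 integrable_on cbox 0 1" by (rule integrable_continuous)
    have "blinfun_apply (integral (cbox 0 1) (fx z0)) (a *s w) = integral (cbox 0 1) (\<lambda>t. a * fx z0 t w)"
      using blinfun_apply_integral[OF int] by (simp add: fx[OF z0] holo_fun_onD(2)[OF f US[OF z0]])
    also have "\<dots> = a * integral (cbox 0 1) (\<lambda>t. fx z0 t w)" by simp
    finally show ?thesis using blinfun_apply_integral[OF int] by simp
  qed
  ultimately show "\<exists>D. ((\<lambda>z. frechet_derivative f (at z) v) has_derivative D) (at z0) \<and> (\<forall>a w. D (a *s w) = a * D w)"
    by blast
qed

lemma holo_fun_on_Ck_on: 
  assumes "open S" shows "holo_fun_on f S \<Longrightarrow> Ck_on k f S"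
proof (induction k arbitrary: f)
  case 0
  then show ?case by (simp add: holo_fun_on_continuous)
next
  case (Suc k)
  show ?case
    by (rule Ck_on_SucI[OF assms holo_fun_onD(1)[OF Suc.prems]
          Suc.IH[OF holo_frechet_derivative_holo[OF Suc.prems assms]]])
qed

section \<open>Wirtinger derivatives\<close>

definition dir_op :: "complex \<Rightarrow> 'e \<Rightarrow> complex \<Rightarrow> 'e \<Rightarrow> ('e::real_normed_vector \<Rightarrow> complex) \<Rightarrow> 'e \<Rightarrow> complex" where
  "dir_op a x b y f z = a * frechet_derivative f (at z) x + b * frechet_derivative f (at z) y"

text \<open>Both Wirtinger operators are complex combinations of two directional derivatives. The
  product, quotient and determinant rules depend on nothing else, so they are proved once for
  both.\<close>

locale derivation =
  fixes \<delta> :: "('e::real_normed_vector \<Rightarrow> complex) \<Rightarrow> 'e \<Rightarrow> complex"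
  assumes dir_op_ex: "\<exists>a x b y. \<delta> = dir_op a x b y"
begin

text \<open>A linear functional \<Phi> of the derivative stands in for the operator, so that each
  rule follows from the corresponding \<open>has_derivative\<close> rule.\<close>

lemma has_derivativeE:
  obtains \<Phi> where "\<And>f D z. (f has_derivative D) (at z) \<Longrightarrow> \<delta> f z = \<Phi> D"
    and "\<And>D E. \<Phi> (\<lambda>v. D v + E v) = \<Phi> D + \<Phi> E" and "\<And>c D. \<Phi> (\<lambda>v. c * D v) = c * \<Phi> D"
proof -
  obtain a x b y where d: "\<delta> = dir_op a x b y" using dir_op_ex by blast
  show thesis
    by (rule that[of "\<lambda>D. a * D x + b * D y"])
      (auto simp: d dir_op_def algebra_simps dest: frechet_derivative_at[symmetric])
qed

lemma cong:
  assumes "open S" "z \<in> S" "\<And>y. y \<in> S \<Longrightarrow> f y = g y"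
  shows "\<delta> f z = \<delta> g z"
proof -
  obtain a x b y where d: "\<delta> = dir_op a x b y" using dir_op_ex by blast
  have "frechet_derivative f (at z) = frechet_derivative g (at z)"
    by (rule frechet_derivative_cong_open[OF assms])
  then show ?thesis unfolding d dir_op_def by simp
qed

lemma const [simp]: "\<delta> (\<lambda>y. c) z = 0"
proof -
  obtain a x b y where d: "\<delta> = dir_op a x b y" using dir_op_ex by blast
  show ?thesis unfolding d dir_op_def by simp
qed

lemma add:
  assumes "f differentiable at z" "g differentiable at z"
  shows "\<delta> (\<lambda>y. f y + g y) z = \<delta> f z + \<delta> g z"
proof -
  obtain \<Phi> where \<Phi>: "\<And>f D z. (f has_derivative D) (at z) \<Longrightarrow> \<delta> f z = \<Phi> D"
    "\<And>D E. \<Phi> (\<lambda>v. D v + E v) = \<Phi> D + \<Phi> E" by (rule has_derivativeE) (rule that; assumption)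
  note * = assms[THEN frechet_derivative_works']
  show ?thesis using \<Phi>(1)[OF has_derivative_add[OF *]] \<Phi>(1)[OF *(1)] \<Phi>(1)[OF *(2)] \<Phi>(2) by simp
qed

lemma mult:
  assumes "f differentiable at z" "g differentiable at z"
  shows "\<delta> (\<lambda>y. f y * g y) z = f z * \<delta> g z + \<delta> f z * g z"
proof -
  obtain \<Phi> where \<Phi>: "\<And>f D z. (f has_derivative D) (at z) \<Longrightarrow> \<delta> f z = \<Phi> D"
    "\<And>D E. \<Phi> (\<lambda>v. D v + E v) = \<Phi> D + \<Phi> E" "\<And>c D. \<Phi> (\<lambda>v. c * D v) = c * \<Phi> D" by (rule has_derivativeE) (rule that; assumption)
  note * = assms[THEN frechet_derivative_works']
  have "\<delta> (\<lambda>y. f y * g y) z = \<Phi> (\<lambda>v. f z * frechet_derivative g (at z) v + g z * frechet_derivative f (at z) v)"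
    using \<Phi>(1)[OF has_derivative_mult[OF *]] by (simp add: mult.commute)
  then show ?thesis using \<Phi>(1)[OF *(1)] \<Phi>(1)[OF *(2)] \<Phi>(2,3) by simp
qed

lemma cmult:
  assumes "f differentiable at z"
  shows "\<delta> (\<lambda>y. c * f y) z = c * \<delta> f z"
  using mult[of "\<lambda>y. c" z f] assms by simp

lemma uminus:
  assumes "f differentiable at z"
  shows "\<delta> (\<lambda>y. - f y) z = - \<delta> f z"
  using cmult[OF assms, of "-1"] by simp

lemma diff:
  assumes "f differentiable at z" "g differentiable at z"
  shows "\<delta> (\<lambda>y. f y - g y) z = \<delta> f z - \<delta> g z"
  using add[of f z "\<lambda>y. - g y"] uminus[of g z] assms by simp

lemma sum:
  assumes "\<And>i. i \<in> I \<Longrightarrow> f i differentiable at z"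
  shows "\<delta> (\<lambda>y. \<Sum>i\<in>I. f i y) z = (\<Sum>i\<in>I. \<delta> (f i) z)"
proof (cases "finite I")
  case True
  then show ?thesis using assms
    by (induction I rule: finite_induct) (simp_all add: add differentiable_sum)
qed simp

lemma prod:
  assumes "finite I" "\<And>i. i \<in> I \<Longrightarrow> f i differentiable at z"
  shows "(\<lambda>y. \<Prod>i\<in>I. f i y) differentiable at z \<and> 
    \<delta> (\<lambda>y. \<Prod>i\<in>I. f i y) z = (\<Sum>i\<in>I. \<delta> (f i) z * (\<Prod>j\<in>I - {i}. f j z))"
  using assms
proof (induction I rule: finite_induct)
  case empty
  then show ?case by simp
next
  case (insert k I)
  then have d: "f k differentiable at z" "(\<lambda>y. \<Prod>i\<in>I. f i y) differentiable at z" by auto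
  have "(\<Sum>i\<in>I. \<delta> (f i) z * (\<Prod>j\<in>insert k I - {i}. f j z)) = (\<Sum>i\<in>I. f k z * (\<delta> (f i) z * (\<Prod>j\<in>I - {i}. f j z)))"
  proof (rule sum.cong[OF refl])
    fix i assume "i \<in> I"
    then have "insert k I - {i} = insert k (I - {i})" using insert by auto
    then show "\<delta> (f i) z * (\<Prod>j\<in>insert k I - {i}. f j z) = f k z * (\<delta> (f i) z * (\<Prod>j\<in>I - {i}. f j z))"
      using insert by simp
  qed
  moreover have "insert k I - {k} = I" using insert by auto
  ultimately show ?case using insert d
    by (simp add: mult differentiable_mult sum_distrib_left[symmetric])
qed

lemma inverse:
  assumes "f differentiable at z" "f z \<noteq> 0"
  shows "\<delta> (\<lambda>y. inverse (f y)) z = - \<delta> f z / (f z)^2"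
proof -
  obtain \<Phi> where \<Phi>: "\<And>f D z. (f has_derivative D) (at z) \<Longrightarrow> \<delta> f z = \<Phi> D"
    "\<And>D E. \<Phi> (\<lambda>v. D v + E v) = \<Phi> D + \<Phi> E" "\<And>c D. \<Phi> (\<lambda>v. c * D v) = c * \<Phi> D" by (rule has_derivativeE) (rule that; assumption)
  note * = assms(1)[THEN frechet_derivative_works']
  have "(\<lambda>v. - (inverse (f z) * frechet_derivative f (at z) v * inverse (f z)))
     = (\<lambda>v. (- inverse (f z) * inverse (f z)) * frechet_derivative f (at z) v)" by (simp add: fun_eq_iff)
  then have "\<delta> (\<lambda>y. inverse (f y)) z = \<Phi> (\<lambda>v. (- inverse (f z) * inverse (f z)) * frechet_derivative f (at z) v)"
    using \<Phi>(1)[OF Deriv.has_derivative_inverse[OF assms(2) *]] by simp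
  then show ?thesis using \<Phi>(1)[OF *(1)] unfolding \<Phi>(3) by (simp add: power2_eq_square field_simps)
qed

lemma real_compose:
  assumes q: "q differentiable at z" and h: "(h has_real_derivative h') (at (q z))"
  shows "\<delta> (\<lambda>y. of_real (h (q y))) z = of_real h' * \<delta> (\<lambda>y. of_real (q y)) z"
proof -
  obtain \<Phi> where \<Phi>: "\<And>f D z. (f has_derivative D) (at z) \<Longrightarrow> \<delta> f z = \<Phi> D"
    "\<And>c D. \<Phi> (\<lambda>v. c * D v) = c * \<Phi> D" by (rule has_derivativeE) (rule that; assumption)
  note * = q[THEN frechet_derivative_works']
  have "((\<lambda>y. h (q y)) has_derivative (\<lambda>v. h' * frechet_derivative q (at z) v)) (at z)"
    using has_derivative_compose[OF *(1) h[unfolded has_field_derivative_def]] .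
  from bounded_linear.has_derivative[OF bounded_linear_of_real this]
  have "((\<lambda>y. complex_of_real (h (q y))) has_derivative (\<lambda>v. of_real h' * of_real (frechet_derivative q (at z) v))) (at z)"
    by simp
  from \<Phi>(1)[OF this] \<Phi>(1)[OF bounded_linear.has_derivative[OF bounded_linear_of_real *]]
  show ?thesis unfolding \<Phi>(2) by simp
qed

lemma Ck:
  assumes "open S" "Ck_on (Suc k) f S"
  shows "Ck_on k (\<delta> f) S"
proof -
  obtain a x b y where d: "\<delta> = dir_op a x b y" using dir_op_ex by blast
  show ?thesis unfolding d dir_op_def
    by (intro Ck_on_add Ck_on_mult Ck_on_const assms(1) Ck_on_SucE(2)[OF assms(2)])
qed

end

lemma derivation_d_z: "derivation (d_z i)"
proof
  show "\<exists>a x b y. d_z i = dir_op a x b y"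
    by (rule exI[of _ "1/2"], rule exI[of _ "axis i 1"], rule exI[of _ "-\<i>/2"], rule exI[of _ "axis i \<i>"])
      (auto simp: fun_eq_iff d_z_def dir_op_def field_simps)
qed

lemma derivation_d_zbar: "derivation (d_zbar i)"
proof
  show "\<exists>a x b y. d_zbar i = dir_op a x b y"
    by (rule exI[of _ "1/2"], rule exI[of _ "axis i 1"], rule exI[of _ "\<i>/2"], rule exI[of _ "axis i \<i>"])
      (auto simp: fun_eq_iff d_zbar_def dir_op_def field_simps)
qed

interpretation dz: derivation "d_z i" for i by (rule derivation_d_z)
interpretation dzb: derivation "d_zbar i" for i by (rule derivation_d_zbar)

lemma frechet_derivative_cnj:
  assumes "f differentiable at z"
  shows "frechet_derivative (\<lambda>y. cnj (f y)) (at z) v = cnj (frechet_derivative f (at z) v)"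
  using frechet_derivative_at[OF bounded_linear.has_derivative[OF bounded_linear_cnj frechet_derivative_works'[OF assms]]]
  by (metis (no_types))

lemma d_z_cnj: "f differentiable at z \<Longrightarrow> d_z i (\<lambda>y. cnj (f y)) z = cnj (d_zbar i f z)"
  by (simp add: d_z_def d_zbar_def frechet_derivative_cnj)

lemma d_zbar_cnj: "f differentiable at z \<Longrightarrow> d_zbar i (\<lambda>y. cnj (f y)) z = cnj (d_z i f z)"
  by (simp add: d_z_def d_zbar_def frechet_derivative_cnj)

lemma axis_ii: "axis i \<i> = \<i> *s (axis i 1 :: complex^'n)"
  by (simp add: vec_eq_iff axis_def)

lemma frechet_derivative_wirtinger:
  fixes f :: "complex^'n \<Rightarrow> complex"
  assumes "f differentiable at z"
  shows "frechet_derivative f (at z) v = (\<Sum>i\<in>UNIV. v $ i * d_z i f z + cnj (v $ i) * d_zbar i f z)"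
proof -
  let ?D = "frechet_derivative f (at z)"
  have lin: "linear ?D" using assms by (rule linear_frechet_derivative)
  have "v = (\<Sum>i\<in>UNIV. Re (v $ i) *\<^sub>R axis i 1 + Im (v $ i) *\<^sub>R axis i \<i>)"
    by (simp add: vec_eq_iff axis_def sum.distrib if_distrib complex_eq_iff cong: if_cong)
  then have "?D v = ?D (\<Sum>i\<in>UNIV. Re (v $ i) *\<^sub>R axis i 1 + Im (v $ i) *\<^sub>R axis i \<i>)" by simp
  also have "\<dots> = (\<Sum>i\<in>UNIV. of_real (Re (v $ i)) * ?D (axis i 1) + of_real (Im (v $ i)) * ?D (axis i \<i>))"
    by (simp add: linear_sum[OF lin] linear_add[OF lin] linear_cmul[OF lin] scaleR_conv_of_real[where 'a=complex])
  also have "\<dots> = (\<Sum>i\<in>UNIV. v $ i * d_z i f z + cnj (v $ i) * d_zbar i f z)"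
  proof (rule sum.cong[OF refl])
    fix i
    show "of_real (Re (v $ i)) * ?D (axis i 1) + of_real (Im (v $ i)) * ?D (axis i \<i>) = v $ i * d_z i f z + cnj (v $ i) * d_zbar i f z"
      by (simp add: complex_eq_iff d_z_def d_zbar_def field_simps)
  qed
  finally show ?thesis .
qed

lemma holo_frechet_axis_ii:
  assumes "holo_fun_on f S" "z \<in> S"
  shows "frechet_derivative f (at z) (axis i \<i>) = \<i> * frechet_derivative f (at z) (axis i 1)"
  unfolding axis_ii holo_fun_onD(2)[OF assms] ..

lemma d_zbar_holo:
  assumes "holo_fun_on f S" "z \<in> S"
  shows "d_zbar i f z = 0"
  unfolding d_zbar_def holo_frechet_axis_ii[OF assms] by simp

lemma d_z_holo:
  assumes "holo_fun_on f S" "z \<in> S"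
  shows "d_z i f z = frechet_derivative f (at z) (axis i 1)"
  unfolding d_z_def holo_frechet_axis_ii[OF assms] by simp

lemma holo_d_z:
  assumes "open S" "holo_fun_on f S"
  shows "holo_fun_on (d_z i f) S"
  using holo_fun_on_cong[OF assms(1), of "d_z i f" "\<lambda>z. frechet_derivative f (at z) (axis i 1)"]
    d_z_holo[OF assms(2)] holo_frechet_derivative_holo[OF assms(2,1)] by blast

lemma holo_fun_on_differentiable: "holo_fun_on f S \<Longrightarrow> z \<in> S \<Longrightarrow> f differentiable at z"
  using holo_fun_onD(1) differentiableI by blast

text \<open>The components of w have vanishing \<open>d_zbar\<close> derivatives, so the mixed terms
  of the chain rule drop out and the two types of derivative stay separate.\<close>

lemma wirtinger_chain_holo:
  fixes f :: "complex^'n \<Rightarrow> complex" and w :: "complex^'m \<Rightarrow> complex^'n"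
  assumes f: "f differentiable at (w z)" and w: "\<And>k. holo_fun_on (\<lambda>y. w y $ k) S" "z \<in> S"
  shows "d_z i (\<lambda>y. f (w y)) z = (\<Sum>k\<in>UNIV. d_z k f (w z) * d_z i (\<lambda>y. w y $ k) z)"
    and "d_zbar i (\<lambda>y. f (w y)) z = (\<Sum>k\<in>UNIV. d_zbar k f (w z) * cnj (d_z i (\<lambda>y. w y $ k) z))"
    and "(\<lambda>y. f (w y)) differentiable at z"
proof -
  define W where "W = (\<lambda>v. \<chi> k. frechet_derivative (\<lambda>y. w y $ k) (at z) v)"
  have W: "(w has_derivative W) (at z)"
    unfolding W_def
    by (rule has_derivative_componentwise_within[THEN iffD2])
      (auto simp: Basis_vec_def inner_axis' inner_axis intro!: has_derivative_inner_left holo_fun_onD(1)[OF w])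
  have D: "((\<lambda>y. f (w y)) has_derivative (\<lambda>v. frechet_derivative f (at (w z)) (W v))) (at z)"
    by (rule has_derivative_compose[OF W frechet_derivative_works'[OF f]])
  then show "(\<lambda>y. f (w y)) differentiable at z" by (rule differentiableI)
  have fd: "frechet_derivative (\<lambda>y. f (w y)) (at z) v = frechet_derivative f (at (w z)) (W v)" for v
    using frechet_derivative_at[OF D] by (metis (no_types))
  have W1: "W (axis i 1) $ k = d_z i (\<lambda>y. w y $ k) z" for k
    unfolding W_def d_z_holo[OF w] by simp
  have W2: "W (axis i \<i>) $ k = \<i> * d_z i (\<lambda>y. w y $ k) z" for k
    unfolding W_def d_z_holo[OF w] using holo_frechet_axis_ii[OF w] by simp
  show "d_z i (\<lambda>y. f (w y)) z = (\<Sum>k\<in>UNIV. d_z k f (w z) * d_z i (\<lambda>y. w y $ k) z)"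
    unfolding d_z_def[of i "\<lambda>y. f (w y)"] fd frechet_derivative_wirtinger[OF f] W1 W2
    by (simp add: sum_distrib_left sum_subtractf[symmetric] sum_divide_distrib field_simps flip: sum.distrib)
  show "d_zbar i (\<lambda>y. f (w y)) z = (\<Sum>k\<in>UNIV. d_zbar k f (w z) * cnj (d_z i (\<lambda>y. w y $ k) z))"
    unfolding d_zbar_def[of i "\<lambda>y. f (w y)"] fd frechet_derivative_wirtinger[OF f] W1 W2
    by (simp add: sum_distrib_left sum_subtractf[symmetric] sum_divide_distrib field_simps flip: sum.distrib)
qed

section \<open>Derivatives of matrix-valued functions\<close>

definition mat_op :: "(('e \<Rightarrow> complex) \<Rightarrow> 'e \<Rightarrow> complex) \<Rightarrow> ('e \<Rightarrow> complex^'n^'m) \<Rightarrow> 'e \<Rightarrow> complex^'n^'m" where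
  "mat_op \<delta> M z = (\<chi> i j. \<delta> (\<lambda>y. M y $ i $ j) z)"

definition mat_differentiable :: "('e::real_normed_vector \<Rightarrow> complex^'n^'m) \<Rightarrow> 'e \<Rightarrow> bool" where
  "mat_differentiable M z \<longleftrightarrow> (\<forall>i j. (\<lambda>y. M y $ i $ j) differentiable at z)"

lemma mat_differentiable_mult:
  "mat_differentiable M z \<Longrightarrow> mat_differentiable N z \<Longrightarrow> mat_differentiable (\<lambda>y. M y ** N y) z"
  unfolding mat_differentiable_def matrix_matrix_mult_def by (auto intro!: differentiable_sum differentiable_mult)

lemma mat_add_mult: "(A + B) ** C = A ** C + B ** (C :: complex^'n^'m)"
  by (simp add: matrix_matrix_mult_def vec_eq_iff sum.distrib distrib_right)

context derivation
begin

lemma mat_mult: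
  fixes M :: "'e \<Rightarrow> complex^'n^'m" and N :: "'e \<Rightarrow> complex^'k^'n"
  assumes "mat_differentiable M z" "mat_differentiable N z"
  shows "mat_op \<delta> (\<lambda>y. M y ** N y) z = mat_op \<delta> M z ** N z + M z ** mat_op \<delta> N z"
proof -
  have "\<delta> (\<lambda>y. \<Sum>k\<in>UNIV. M y $ i $ k * N y $ k $ j) z
     = (\<Sum>k\<in>UNIV. \<delta> (\<lambda>y. M y $ i $ k) z * N z $ k $ j) + (\<Sum>k\<in>UNIV. M z $ i $ k * \<delta> (\<lambda>y. N y $ k $ j) z)" for i j
  proof -
    have d: "(\<lambda>y. M y $ i $ k) differentiable at z" "(\<lambda>y. N y $ k $ j) differentiable at z" for k
      using assms by (auto simp: mat_differentiable_def)
    then show ?thesis by (simp add: sum mult sum.distrib add.commute)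
  qed
  then show ?thesis
    unfolding mat_op_def matrix_matrix_mult_def by (simp add: vec_eq_iff)
qed

lemma mat_cong:
  assumes "open S" "z \<in> S" "\<And>y. y \<in> S \<Longrightarrow> M y = N y"
  shows "mat_op \<delta> M z = mat_op \<delta> N z"
proof -
  have "\<delta> (\<lambda>y. M y $ i $ j) z = \<delta> (\<lambda>y. N y $ i $ j) z" for i j
    by (rule cong[OF assms(1,2)]) (simp add: assms(3))
  then show ?thesis unfolding mat_op_def by simp
qed

lemma mat_inverse:
  fixes G K :: "'e \<Rightarrow> complex^'n^'n"
  assumes "mat_differentiable G z" "mat_differentiable K z"
    and S: "open S" "z \<in> S" "\<And>y. y \<in> S \<Longrightarrow> K y ** G y = mat 1"
  shows "mat_op \<delta> K z = - (K z ** mat_op \<delta> G z ** K z)"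
proof -
  have GK: "G z ** K z = mat 1" using S matrix_left_right_inverse by blast
  have "mat_op \<delta> K z ** G z + K z ** mat_op \<delta> G z = mat_op \<delta> (\<lambda>y. mat 1 :: complex^'n^'n) z"
    using mat_mult[OF assms(2,1)] mat_cong[OF S] by simp
  also have "\<dots> = 0" by (simp add: mat_op_def vec_eq_iff)
  finally have "(mat_op \<delta> K z ** G z + K z ** mat_op \<delta> G z) ** K z = 0"
    by (simp add: vec_eq_iff matrix_matrix_mult_def)
  then have "mat_op \<delta> K z ** (G z ** K z) + K z ** mat_op \<delta> G z ** K z = 0"
    by (simp add: matrix_mul_assoc mat_add_mult)
  then show ?thesis unfolding GK by (simp add: eq_neg_iff_add_eq_0)
qed

text \<open>Jacobi's formula. The product rule differentiates one row at a time. Row i of X =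
  \<open>?B ** G z\<close> is a combination of the rows of G with coefficients from row i of
  \<open>?B\<close>, so by Cramer's lemma the i-th determinant is
  \<open>?B $ i $ i * det (G z)\<close>.\<close>

lemma det:
  fixes G K :: "'e \<Rightarrow> complex^'n^'n"
  assumes G: "mat_differentiable G z" and K: "K z ** G z = mat 1"
  shows "\<delta> (\<lambda>y. det (G y)) z = det (G z) * trace (K z ** mat_op \<delta> G z)"
proof -
  have d: "(\<lambda>y. G y $ i $ j) differentiable at z" for i j
    using G by (simp add: mat_differentiable_def)
  let ?X = "mat_op \<delta> G z"
  let ?B = "?X ** K z"
  have X: "?X = ?B ** G z" by (simp add: K flip: matrix_mul_assoc)
  have dp: "(\<lambda>y. \<Prod>i\<in>UNIV. G y $ i $ p i) differentiable at z" for p :: "'n \<Rightarrow> 'n"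
    using prod[of UNIV "\<lambda>i y. G y $ i $ p i" z] d by simp
  have "\<delta> (\<lambda>y. det (G y)) z = (\<Sum>p | p permutes UNIV. of_int (sign p) * \<delta> (\<lambda>y. \<Prod>i\<in>UNIV. G y $ i $ p i) z)"
    unfolding det_def by (subst sum) (auto intro!: differentiable_mult dp simp: cmult[OF dp])
  also have "\<dots> = (\<Sum>p | p permutes UNIV. of_int (sign p) * (\<Sum>i\<in>UNIV. ?X $ i $ p i * (\<Prod>j\<in>UNIV - {i}. G z $ j $ p j)))"
  proof (rule sum.cong[OF refl])
    fix p :: "'n \<Rightarrow> 'n"
    have "\<delta> (\<lambda>y. \<Prod>i\<in>UNIV. G y $ i $ p i) z = (\<Sum>i\<in>UNIV. \<delta> (\<lambda>y. G y $ i $ p i) z * (\<Prod>j\<in>UNIV - {i}. G z $ j $ p j))"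
      by (rule conjunct2[OF prod[of UNIV "\<lambda>i y. G y $ i $ p i" z]]) (use d in auto)
    then show "of_int (sign p) * \<delta> (\<lambda>y. \<Prod>i\<in>UNIV. G y $ i $ p i) z
        = of_int (sign p) * (\<Sum>i\<in>UNIV. ?X $ i $ p i * (\<Prod>j\<in>UNIV - {i}. G z $ j $ p j))"
      unfolding mat_op_def by simp
  qed
  also have "\<dots> = (\<Sum>i\<in>UNIV. \<Sum>p | p permutes UNIV. of_int (sign p) * (?X $ i $ p i * (\<Prod>j\<in>UNIV - {i}. G z $ j $ p j)))"
    unfolding sum_distrib_left by (rule sum.swap)
  also have "\<dots> = (\<Sum>i\<in>UNIV. det (\<chi> r. if r = i then row i ?X else row r (G z)))"
  proof (rule sum.cong[OF refl])
    fix i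
    have "?X $ i $ p i * (\<Prod>j\<in>UNIV - {i}. G z $ j $ p j) = (\<Prod>r\<in>UNIV. (\<chi> r. if r = i then row i ?X else row r (G z)) $ r $ p r)" for p
    proof -
      let ?f = "\<lambda>r. (\<chi> r. if r = i then row i ?X else row r (G z)) $ r $ p r"
      have "(\<Prod>r\<in>UNIV. ?f r) = ?f i * (\<Prod>r\<in>UNIV - {i}. ?f r)"
        by (rule prod.remove) auto
      also have "(\<Prod>r\<in>UNIV - {i}. ?f r) = (\<Prod>r\<in>UNIV - {i}. G z $ r $ p r)"
        by (rule prod.cong) (auto simp: row_def)
      finally show ?thesis by (simp add: row_def)
    qed
    then show "(\<Sum>p | p permutes UNIV. of_int (sign p) * (?X $ i $ p i * (\<Prod>j\<in>UNIV - {i}. G z $ j $ p j))) =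
        det (\<chi> r. if r = i then row i ?X else row r (G z))" unfolding det_def by simp
  qed
  also have "\<dots> = (\<Sum>i\<in>UNIV. ?B $ i $ i * det (G z))"
  proof (rule sum.cong[OF refl])
    fix i
    have rX: "row i ?X = (\<Sum>j\<in>UNIV. (row i ?B) $ j *s row j (G z))"
      by (subst X) (simp add: row_def vec_eq_iff matrix_matrix_mult_def)
    have cr: "det (\<chi> r. if r = i then u else row r (G z)) = ?B $ i $ i * det (G z)"
      if "u = (\<Sum>j\<in>UNIV. (row i ?B) $ j *s row j (G z))" for u
    proof -
      have "(row i ?B) $ i = ?B $ i $ i" by (simp add: row_def)
      then show ?thesis using cramer_lemma_transpose[of i "row i ?B" "G z", folded that] by (simp only:)
    qed
    show "det (\<chi> r. if r = i then row i ?X else row r (G z)) = ?B $ i $ i * det (G z)"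
      by (rule cr[OF rX])
  qed
  also have "\<dots> = det (G z) * trace ?B"
    unfolding trace_def sum_distrib_left by (rule sum.cong[OF refl]) (rule mult.commute)
  also have "trace ?B = trace (K z ** ?X)" by (rule trace_mul_sym)
  finally show ?thesis .
qed

end

section \<open>The Chern curvature in a chart\<close>

lemma mat_minus_mult: "(- A) ** C = - (A ** (C :: complex^'n^'m))"
  by (simp add: matrix_matrix_mult_def vec_eq_iff sum_negf)

lemma mat_mult_minus: "A ** (- C) = - (A ** (C :: complex^'n^'m))"
  by (simp add: matrix_matrix_mult_def vec_eq_iff sum_negf)

lemma mat_diff_mult: "(A - B) ** C = A ** C - B ** (C :: complex^'n^'m)"
  by (simp add: matrix_matrix_mult_def vec_eq_iff sum_subtractf algebra_simps)

lemma mat_mult_diff: "C ** (A - B) = C ** A - C ** (B :: complex^'n^'m)"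
  by (simp add: matrix_matrix_mult_def vec_eq_iff sum_subtractf algebra_simps)

lemma cnj_det: "det (\<chi> i j. cnj (M $ i $ j)) = cnj (det (M :: complex^'n^'n))"
  by (simp add: det_def)

lemma trace_uminus: "trace (- A) = - trace (A :: complex^'n^'n)"
  by (simp add: trace_def sum_negf)

context derivation
begin

lemma trace:
  assumes "mat_differentiable M z"
  shows "\<delta> (\<lambda>y. trace (M y)) z = trace (mat_op \<delta> M z)"
  using assms unfolding trace_def mat_differentiable_def by (simp add: sum mat_op_def)

lemma mat_uminus:
  assumes "mat_differentiable M z"
  shows "mat_op \<delta> (\<lambda>y. - M y) z = - mat_op \<delta> M z"
  using assms unfolding mat_differentiable_def by (simp add: vec_eq_iff mat_op_def uminus)

end

section \<open>Positive definite Hermitian matrices\<close>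

definition herm_form :: "complex^'n^'n \<Rightarrow> complex^'n \<Rightarrow> complex^'n \<Rightarrow> complex" where
  "herm_form M x y = (\<Sum>i\<in>UNIV. \<Sum>j\<in>UNIV. M $ i $ j * x $ i * cnj (y $ j))"

definition pos_def :: "complex^'n^'n \<Rightarrow> bool" where
  "pos_def M \<longleftrightarrow> (\<forall>i j. M $ j $ i = cnj (M $ i $ j)) \<and> (\<forall>v. v \<noteq> 0 \<longrightarrow> Re (herm_form M v v) > 0)"

lemma matrix_inv_works:
  assumes "invertible M"
  shows "M ** matrix_inv M = mat 1" "matrix_inv M ** M = mat 1"
  using someI_ex[OF assms[unfolded invertible_def]] unfolding matrix_inv_def by auto

lemma pos_def_sym: "pos_def M \<Longrightarrow> cnj (M $ i $ j) = M $ j $ i"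
  unfolding pos_def_def by metis

lemma herm_form_left: "herm_form M x y = (\<Sum>j\<in>UNIV. (transpose M *v x) $ j * cnj (y $ j))"
  unfolding herm_form_def by (subst sum.swap) (simp add: matrix_vector_mult_def transpose_def sum_distrib_right)

lemma pos_def_det_nonzero:
  assumes "pos_def (M :: complex^'n^'n)" shows "det M \<noteq> 0"
proof -
  have "x = 0" if "transpose M *v x = 0" for x
  proof (rule ccontr)
    assume "x \<noteq> 0"
    then have "Re (herm_form M x x) > 0" using assms by (simp add: pos_def_def)
    then show False unfolding herm_form_left that by simp
  qed
  then have "\<exists>B. B ** transpose M = mat 1"
    unfolding matrix_left_invertible_ker by blast
  then have "invertible (transpose M)" by (simp add: invertible_left_inverse)
  then show ?thesis unfolding invertible_det_nz by (simp add: det_transpose)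
qed

lemma pos_def_det_real:
  assumes "pos_def (M :: complex^'n^'n)" shows "det M \<in> \<real>"
proof -
  have "transpose M = (\<chi> i j. cnj (M $ i $ j))"
    by (simp add: pos_def_sym[OF assms] transpose_def)
  then have "det (transpose M) = cnj (det M)" by (simp only: cnj_det)
  then show ?thesis by (simp add: Reals_cnj_iff det_transpose)
qed

lemma herm_form_scale_add: "herm_form (\<chi> i j. of_real a * M $ i $ j + of_real b * N $ i $ j) x y
   = of_real a * herm_form M x y + of_real b * herm_form N x y"
  by (simp add: herm_form_def sum_distrib_left sum.distrib algebra_simps)

lemma pos_def_mat_1: "pos_def (mat 1 :: complex^'n^'n)"
proof -
  have "Re (herm_form (mat 1 :: complex^'n^'n) v v) = (\<Sum>j\<in>UNIV. (norm (v $ j))^2)" for v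
    unfolding herm_form_left by (simp add: transpose_mat cmod_power2 flip: power2_eq_square)
  moreover have "(\<Sum>j\<in>UNIV. (norm (v $ j))^2) > 0" if v: "v \<noteq> 0" for v :: "complex^'n"
  proof -
    obtain j where "v $ j \<noteq> 0" using v by (auto simp: vec_eq_iff)
    then show ?thesis by (intro sum_pos2[of _ j]) auto
  qed
  ultimately show ?thesis unfolding pos_def_def by (auto simp: mat_def)
qed

text \<open>On the segment from the identity the determinant is real and never zero.\<close>

lemma pos_def_det_pos:
  assumes "pos_def (M :: complex^'n^'n)" shows "Re (det M) > 0"
proof -
  define N where "N = (\<lambda>t::real. \<chi> i j. of_real t * M $ i $ j + of_real (1 - t) * (mat 1 :: complex^'n^'n) $ i $ j)"
  have N: "pos_def (N t)" if t: "0 \<le> t" "t \<le> 1" for t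
    unfolding pos_def_def
  proof (intro conjI allI impI)
    fix i j show "N t $ j $ i = cnj (N t $ i $ j)"
      by (simp add: N_def pos_def_sym[OF assms] mat_def)
  next
    fix v :: "complex^'n" assume "v \<noteq> 0"
    then have "Re (herm_form M v v) > 0" "Re (herm_form (mat 1) v v) > 0"
      using assms pos_def_mat_1 by (auto simp: pos_def_def)
    then have "t * Re (herm_form M v v) + (1 - t) * Re (herm_form (mat 1) v v) > 0"
      using t by (cases "t = 0") (auto intro!: add_pos_nonneg mult_pos_pos)
    then show "Re (herm_form (N t) v v) > 0"
      unfolding N_def herm_form_scale_add by simp
  qed
  have cont: "continuous_on {0..1} (\<lambda>t. Re (det (N t)))"
    unfolding det_def N_def by (auto intro!: continuous_intros)
  have ne: "Re (det (N t)) \<noteq> 0" if "0 \<le> t" "t \<le> 1" for t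
    using pos_def_det_nonzero[OF N[OF that]] pos_def_det_real[OF N[OF that]]
    by (auto simp: complex_is_Real_iff complex_eq_iff)
  have 0: "N 0 = mat 1" and 1: "N 1 = M" by (auto simp: N_def vec_eq_iff)
  show ?thesis
  proof (rule ccontr)
    assume "\<not> ?thesis"
    then have "Re (det (N 1)) \<le> 0" "0 \<le> Re (det (N 0))" by (auto simp: 0 1)
    then obtain t where "0 \<le> t" "t \<le> 1" "Re (det (N t)) = 0"
      using IVT2'[of "\<lambda>t. Re (det (N t))" 1 0 0] cont by auto
    then show False using ne by blast
  qed
qed

lemma pos_def_inverse:
  assumes M: "pos_def (M :: complex^'n^'n)"
  shows "matrix_inv M ** M = mat 1" "M ** matrix_inv M = mat 1"
    "matrix_inv M $ j $ i = cnj (matrix_inv M $ i $ j)"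
    "x \<noteq> 0 \<Longrightarrow> Re (\<Sum>i\<in>UNIV. \<Sum>j\<in>UNIV. matrix_inv M $ j $ i * x $ i * cnj (x $ j)) > 0"
proof -
  have inv: "invertible M" using pos_def_det_nonzero[OF M] by (simp add: invertible_det_nz)
  show KM: "matrix_inv M ** M = mat 1" and MK: "M ** matrix_inv M = mat 1"
    using matrix_inv_works[OF inv] by auto
  define C where "C = (\<chi> i j. cnj (matrix_inv M $ j $ i))"
  have "C ** M = mat 1"
  proof -
    have "(C ** M) $ i $ j = (mat 1 :: complex^'n^'n) $ i $ j" for i j
    proof -
      have "(C ** M) $ i $ j = cnj ((M ** matrix_inv M) $ j $ i)"
        by (simp add: matrix_matrix_mult_def C_def pos_def_sym[OF M] mult.commute)
      then show ?thesis unfolding MK by (auto simp: mat_def)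
    qed
    then show ?thesis by (simp add: vec_eq_iff)
  qed
  then have "C = matrix_inv M" using MK by (metis matrix_mul_assoc matrix_mul_lid matrix_mul_rid)
  then have C: "matrix_inv M $ j $ i = C $ j $ i" for i j by simp
  show "matrix_inv M $ j $ i = cnj (matrix_inv M $ i $ j)" for i j
    by (subst C) (simp add: C_def)
  assume x: "x \<noteq> 0"
  \<comment> \<open>As x = \<open>M *v c\<close>, the form of the inverse at x is the form of M at
    the conjugate of c.\<close>
  define c where "c = matrix_inv M *v x"
  define v where "v = (\<chi> i. cnj (c $ i))"
  have xc: "x = M *v c" unfolding c_def matrix_vector_mul_assoc MK by simp
  have "v \<noteq> 0"
  proof
    assume "v = 0"
    then have "c = 0" by (simp add: v_def vec_eq_iff)
    then show False using x xc by simp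
  qed
  then have "Re (herm_form M v v) > 0" using M by (simp add: pos_def_def)
  moreover have "(\<Sum>i\<in>UNIV. \<Sum>j\<in>UNIV. matrix_inv M $ j $ i * x $ i * cnj (x $ j)) = (\<Sum>j\<in>UNIV. c $ j * cnj (x $ j))"
    unfolding c_def by (subst sum.swap) (simp add: matrix_vector_mult_def sum_distrib_right)
  moreover have "(\<Sum>j\<in>UNIV. c $ j * cnj (x $ j)) = herm_form M v v"
  proof -
    have "(\<Sum>j\<in>UNIV. c $ j * cnj (x $ j)) = (\<Sum>j\<in>UNIV. \<Sum>l\<in>UNIV. M $ l $ j * v $ l * cnj (v $ j))"
      unfolding xc
      by (simp add: matrix_vector_mult_def v_def sum_distrib_left pos_def_sym[OF M] algebra_simps)
    also have "\<dots> = herm_form M v v" unfolding herm_form_def by (rule sum.swap)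
    finally show ?thesis .
  qed
  ultimately show "Re (\<Sum>i\<in>UNIV. \<Sum>j\<in>UNIV. matrix_inv M $ j $ i * x $ i * cnj (x $ j)) > 0" by simp
qed

text \<open>Cramer's rule for a single entry. It exhibits the inverse metric as a quotient of
  polynomials in the metric, from which its smoothness is read off.\<close>

lemma matrix_inv_entry:
  assumes "det (M :: complex^'n^'n) \<noteq> 0"
  shows "matrix_inv M $ k $ j = det (\<chi> i l. if l = k then mat 1 $ i $ j else M $ i $ l) / det M"
proof -
  have "invertible M" using assms by (simp add: invertible_det_nz)
  then have "M ** matrix_inv M = mat 1" by (rule matrix_inv_works)
  then have "M *v column j (matrix_inv M) = (\<chi> i. mat 1 $ i $ j)"
    by (simp add: vec_eq_iff matrix_vector_mult_def matrix_matrix_mult_def column_def)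
  then have c: "column j (matrix_inv M) = (\<chi> k. det (\<chi> i l. if l = k then (\<chi> i. mat 1 $ i $ j) $ i else M $ i $ l) / det M)"
    using cramer[OF assms] by blast
  have "column j (matrix_inv M) $ k = det (\<chi> i l. if l = k then mat 1 $ i $ j else M $ i $ l) / det M"
    unfolding c vec_lambda_beta ..
  then show ?thesis unfolding column_def vec_lambda_beta .
qed

text \<open>The metric as a matrix function over the image of one chart. The curvature identities
  are local and are proved at this level, before any manifold appears.\<close>

locale hermitian_coords =
  fixes G :: "complex^'n \<Rightarrow> complex^'n^'n" and U :: "(complex^'n) set"
  assumes open_U: "open U"
    and smooth_G: "Ck_on k (\<lambda>z. G z $ i $ j) U"
    and pos_G: "z \<in> U \<Longrightarrow> pos_def (G z)"
begin

text \<open>As \<open>K\<close> is the inverse and not its transpose, \<open>K z $ j $ i\<close> is the component \<open>g\<^sup>i\<^sup>j\<close> (\<open>j\<close> conjugate) of the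
  inverse metric, and \<open>R i j z $ k $ l\<close> the component \<open>i\<close>, \<open>j\<close>-bar, \<open>k\<close>, \<open>l\<close>-bar of the curvature. The two scalar
  curvatures contract \<open>(i, j), (k, l)\<close> and \<open>(i, l), (k, j)\<close>; \<open>tor\<close> is the divergence of the
  inverse metric, which differs from the trace of the torsion by the gradient of \<open>log det G\<close>.\<close>

definition "K z = matrix_inv (G z)"
definition "D z = det (G z)"
definition "X i z = mat_op (d_z i) G z"
definition "Y j z = mat_op (d_zbar j) G z"
definition "R i j z = X i z ** K z ** Y j z - mat_op (d_z i) (Y j) z"
definition "scal z = (\<Sum>i\<in>UNIV. \<Sum>j\<in>UNIV. K z $ j $ i * trace (K z ** R i j z))"
definition "scal_hat z = (\<Sum>i\<in>UNIV. \<Sum>j\<in>UNIV. (K z ** R i j z ** K z) $ j $ i)"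
definition "tor z = (\<chi> q. \<Sum>i\<in>UNIV. mat_op (d_z i) K z $ q $ i)"
definition "tor_bar z = (\<chi> p. \<Sum>j\<in>UNIV. mat_op (d_zbar j) K z $ j $ p)"
definition "qf z a b = (\<Sum>i\<in>UNIV. \<Sum>j\<in>UNIV. K z $ j $ i * a $ i * b $ j)"

lemma smooth_D: "Ck_on k D U"
  unfolding D_def by (rule Ck_on_det[OF open_U smooth_G])

lemma D_nz: "z \<in> U \<Longrightarrow> D z \<noteq> 0"
  unfolding D_def by (rule pos_def_det_nonzero[OF pos_G])

lemma D_pos: "z \<in> U \<Longrightarrow> Re (D z) > 0"
  unfolding D_def by (rule pos_def_det_pos[OF pos_G])

lemma D_real: "z \<in> U \<Longrightarrow> D z = of_real (Re (D z))"
  unfolding D_def using pos_def_det_real[OF pos_G] by (metis of_real_Re)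

lemma K_G: "z \<in> U \<Longrightarrow> K z ** G z = mat 1" and G_K: "z \<in> U \<Longrightarrow> G z ** K z = mat 1"
  unfolding K_def by (simp_all add: pos_def_inverse pos_G)

lemma smooth_K: "Ck_on k (\<lambda>z. K z $ i $ j) U"
proof -
  have "Ck_on k (\<lambda>z. if l = i then a else G z $ r $ l) U" for l r a
    by (cases "l = i") (simp_all add: open_U smooth_G)
  then have ck: "Ck_on k (\<lambda>z. det (\<chi> r l. if l = i then mat 1 $ r $ j else G z $ r $ l) / D z) U"
    by (intro Ck_on_divide open_U D_nz smooth_D Ck_on_det) simp_all
  have eq: "det (\<chi> r l. if l = i then mat 1 $ r $ j else G z $ r $ l) / D z = K z $ i $ j" if "z \<in> U" for z
    unfolding K_def D_def by (rule matrix_inv_entry[OF pos_def_det_nonzero[OF pos_G[OF that]], symmetric])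
  show ?thesis by (rule iffD1[OF Ck_on_cong[OF open_U eq] ck])
qed

lemma mat_diff_G: "z \<in> U \<Longrightarrow> mat_differentiable G z"
  unfolding mat_differentiable_def by (intro allI Ck_on_differentiable[OF smooth_G])

lemma mat_diff_K: "z \<in> U \<Longrightarrow> mat_differentiable K z"
  unfolding mat_differentiable_def by (intro allI Ck_on_differentiable[OF smooth_K])

lemma smooth_Y: "Ck_on k (\<lambda>z. Y j z $ p $ q) U"
  unfolding Y_def mat_op_def by (simp add: dzb.Ck[OF open_U smooth_G])

lemma smooth_X: "Ck_on k (\<lambda>z. X j z $ p $ q) U"
  unfolding X_def mat_op_def by (simp add: dz.Ck[OF open_U smooth_G])

lemma mat_diff_Y: "z \<in> U \<Longrightarrow> mat_differentiable (Y j) z"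
  unfolding mat_differentiable_def by (intro allI Ck_on_differentiable[OF smooth_Y])

lemma d_z_K: "z \<in> U \<Longrightarrow> mat_op (d_z i) K z = - (K z ** X i z ** K z)"
  unfolding X_def by (rule dz.mat_inverse[OF mat_diff_G mat_diff_K open_U]) (auto simp: K_G)

lemma d_zbar_K: "z \<in> U \<Longrightarrow> mat_op (d_zbar j) K z = - (K z ** Y j z ** K z)"
  unfolding Y_def by (rule dzb.mat_inverse[OF mat_diff_G mat_diff_K open_U]) (auto simp: K_G)

lemma d_z_D: "z \<in> U \<Longrightarrow> d_z i D z = D z * trace (K z ** X i z)"
  unfolding D_def X_def by (rule dz.det[OF mat_diff_G K_G])

lemma d_zbar_D: "z \<in> U \<Longrightarrow> d_zbar j D z = D z * trace (K z ** Y j z)"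
  unfolding D_def Y_def by (rule dzb.det[OF mat_diff_G K_G])

text \<open>\<open>trace (K ** Y j)\<close> is the \<open>d_zbar j\<close> derivative of log det G,
  so this is the expression of the first Ricci form as minus the complex Hessian of log det
  G.\<close>

lemma d_z_trace:
  assumes z: "z \<in> U"
  shows "d_z i (\<lambda>y. trace (K y ** Y j y)) z = - trace (K z ** R i j z)"
proof -
  have "d_z i (\<lambda>y. trace (K y ** Y j y)) z = trace (mat_op (d_z i) K z ** Y j z + K z ** mat_op (d_z i) (Y j) z)"
    by (simp add: dz.trace dz.mat_mult mat_differentiable_mult mat_diff_K mat_diff_Y z)
  also have "mat_op (d_z i) K z ** Y j z + K z ** mat_op (d_z i) (Y j) z = - (K z ** R i j z)"
    unfolding d_z_K[OF z] R_def by (simp add: mat_minus_mult mat_mult_diff matrix_mul_assoc)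
  finally show ?thesis by (simp only: trace_uminus)
qed

text \<open>Differentiating the inverse twice yields the curvature with two indices raised, up to
  one product of first derivatives of K; that product is the source of the torsion square.\<close>

lemma d_z_d_zbar_K:
  assumes z: "z \<in> U"
  shows "mat_op (d_z i) (\<lambda>y. mat_op (d_zbar j) K y) z
    = K z ** R i j z ** K z + mat_op (d_zbar j) K z ** G z ** mat_op (d_z i) K z"
proof -
  have KY: "mat_differentiable (\<lambda>y. K y ** Y j y) z"
    by (simp add: mat_differentiable_mult mat_diff_K mat_diff_Y z)
  have "mat_op (d_z i) (\<lambda>y. mat_op (d_zbar j) K y) z = mat_op (d_z i) (\<lambda>y. - (K y ** Y j y ** K y)) z"
    by (rule dz.mat_cong[OF open_U z d_zbar_K])
  also have "\<dots> = - ((mat_op (d_z i) K z ** Y j z + K z ** mat_op (d_z i) (Y j) z) ** K z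
      + K z ** Y j z ** mat_op (d_z i) K z)"
    by (simp only: dz.mat_uminus[OF mat_differentiable_mult[OF KY mat_diff_K[OF z]]]
        dz.mat_mult[OF KY mat_diff_K[OF z]] dz.mat_mult[OF mat_diff_K[OF z] mat_diff_Y[OF z]])
  also have "\<dots> = K z ** X i z ** K z ** Y j z ** K z - K z ** mat_op (d_z i) (Y j) z ** K z
      + K z ** Y j z ** K z ** X i z ** K z"
    unfolding d_z_K[OF z]
    by (simp add: mat_add_mult mat_diff_mult mat_minus_mult mat_mult_minus matrix_mul_assoc)
  also have "K z ** Y j z ** K z ** X i z ** K z = mat_op (d_zbar j) K z ** G z ** mat_op (d_z i) K z"
  proof -
    have "mat_op (d_zbar j) K z ** G z ** mat_op (d_z i) K z = K z ** Y j z ** (K z ** G z) ** K z ** X i z ** K z"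
      unfolding d_z_K[OF z] d_zbar_K[OF z] by (simp add: mat_minus_mult mat_mult_minus matrix_mul_assoc)
    then show ?thesis unfolding K_G[OF z] by simp
  qed
  also have "K z ** X i z ** K z ** Y j z ** K z - K z ** mat_op (d_z i) (Y j) z ** K z = K z ** R i j z ** K z"
    unfolding R_def by (simp add: mat_mult_diff mat_diff_mult matrix_mul_assoc)
  finally show ?thesis .
qed

text \<open>In the product term the index j occurs only in the first factor and i only in the last,
  so each factor can be summed separately to a divergence.\<close>

lemma sum_d_z_d_zbar_K:
  assumes z: "z \<in> U"
  shows "(\<Sum>i\<in>UNIV. \<Sum>j\<in>UNIV. d_z i (d_zbar j (\<lambda>y. K y $ j $ i)) z)
    = scal_hat z + (\<Sum>p\<in>UNIV. \<Sum>q\<in>UNIV. tor_bar z $ p * G z $ p $ q * tor z $ q)"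
proof -
  have "d_z i (d_zbar j (\<lambda>y. K y $ j $ i)) z = mat_op (d_z i) (\<lambda>y. mat_op (d_zbar j) K y) z $ j $ i" for i j
    by (simp add: mat_op_def)
  then have e: "d_z i (d_zbar j (\<lambda>y. K y $ j $ i)) z = (K z ** R i j z ** K z) $ j $ i
      + (mat_op (d_zbar j) K z ** G z ** mat_op (d_z i) K z) $ j $ i" for i j
    unfolding d_z_d_zbar_K[OF z] by simp
  have "(\<Sum>i\<in>UNIV. \<Sum>j\<in>UNIV. (mat_op (d_zbar j) K z ** G z ** mat_op (d_z i) K z) $ j $ i)
     = (\<Sum>i\<in>UNIV. \<Sum>j\<in>UNIV. \<Sum>q\<in>UNIV. \<Sum>p\<in>UNIV. mat_op (d_zbar j) K z $ j $ p * G z $ p $ q * mat_op (d_z i) K z $ q $ i)"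
    by (simp add: matrix_matrix_mult_def sum_distrib_right)
  also have "\<dots> = (\<Sum>i\<in>UNIV. \<Sum>q\<in>UNIV. \<Sum>j\<in>UNIV. \<Sum>p\<in>UNIV. mat_op (d_zbar j) K z $ j $ p * G z $ p $ q * mat_op (d_z i) K z $ q $ i)"
    by (rule sum.cong[OF refl]) (rule sum.swap)
  also have "\<dots> = (\<Sum>i\<in>UNIV. \<Sum>q\<in>UNIV. \<Sum>p\<in>UNIV. tor_bar z $ p * G z $ p $ q * mat_op (d_z i) K z $ q $ i)"
    unfolding tor_bar_def vec_lambda_beta sum_distrib_right
    by (intro sum.cong refl sum.swap)
  also have "\<dots> = (\<Sum>q\<in>UNIV. \<Sum>i\<in>UNIV. \<Sum>p\<in>UNIV. tor_bar z $ p * G z $ p $ q * mat_op (d_z i) K z $ q $ i)"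
    by (rule sum.swap)
  also have "\<dots> = (\<Sum>q\<in>UNIV. \<Sum>p\<in>UNIV. tor_bar z $ p * G z $ p $ q * tor z $ q)"
    unfolding tor_def vec_lambda_beta sum_distrib_left
    by (intro sum.cong refl sum.swap)
  also have "\<dots> = (\<Sum>p\<in>UNIV. \<Sum>q\<in>UNIV. tor_bar z $ p * G z $ p $ q * tor z $ q)"
    by (rule sum.swap)
  finally show ?thesis unfolding e scal_hat_def by (simp add: sum.distrib)
qed

lemma qf_alt: "qf z a b = (\<Sum>j\<in>UNIV. (K z *v a) $ j * b $ j)"
  unfolding qf_def by (subst sum.swap) (simp add: matrix_vector_mult_def sum_distrib_right)

lemma qf_alt2: "qf z a b = (\<Sum>i\<in>UNIV. a $ i * (b v* K z) $ i)"
  unfolding qf_def by (simp add: vector_matrix_mult_def sum_distrib_left mult_ac)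

lemma qf_add: "qf z (a + a') b = qf z a b + qf z a' b" "qf z a (b + b') = qf z a b + qf z a b'"
  by (simp_all add: qf_def algebra_simps sum.distrib)

lemma qf_scale: "qf z (c *s a) b = c * qf z a b" "qf z a (c *s b) = c * qf z a b"
  by (simp_all add: qf_def algebra_simps sum_distrib_left)

lemma qf_tor:
  assumes z: "z \<in> U"
  shows "qf z (G z *v t) b = (\<Sum>j\<in>UNIV. t $ j * b $ j)" "qf z a (t v* G z) = (\<Sum>i\<in>UNIV. a $ i * t $ i)"
proof -
  show "qf z (G z *v t) b = (\<Sum>j\<in>UNIV. t $ j * b $ j)"
    unfolding qf_alt matrix_vector_mul_assoc K_G[OF z] by simp
  show "qf z a (t v* G z) = (\<Sum>i\<in>UNIV. a $ i * t $ i)"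
    unfolding qf_alt2 vector_matrix_mul_assoc G_K[OF z] by simp
qed

text \<open>The formal adjoint of the complex Laplacian, applied to a function with prescribed
  logarithmic derivatives \<open>a\<close> and \<open>b\<close>: the second derivatives of the inverse metric supply the
  trace \<open>scal_hat\<close> of the curvature and complete a square.\<close>

lemma adjoint_laplacian_log:
  assumes V: "open V" "V \<subseteq> U" "z \<in> V"
    and e: "\<And>y. y \<in> V \<Longrightarrow> e differentiable at y"
    and eb: "\<And>j y. y \<in> V \<Longrightarrow> d_zbar j e y = e y * b j y"
    and ea: "\<And>i. d_z i e z = e z * a $ i"
    and bd: "\<And>j. b j differentiable at z"
  shows "(\<Sum>i\<in>UNIV. \<Sum>j\<in>UNIV. d_z i (d_zbar j (\<lambda>y. e y * K y $ j $ i)) z) =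
    e z * ((\<Sum>i\<in>UNIV. \<Sum>j\<in>UNIV. K z $ j $ i * d_z i (b j) z) + scal_hat z
       + qf z (a + G z *v tor z) ((\<chi> j. b j z) + tor_bar z v* G z))"
proof -
  have zU: "z \<in> U" using V by auto
  have dK: "(\<lambda>y. K y $ p $ q) differentiable at y" if "y \<in> U" for p q y
    using mat_diff_K[OF that] by (simp add: mat_differentiable_def)
  have dK2: "d_zbar j (\<lambda>y. K y $ p $ q) differentiable at z" for j p q
    using dzb.Ck[OF open_U smooth_K, of 1 j p q] zU Ck_on_differentiable by (metis One_nat_def)
  have "d_z i (d_zbar j (\<lambda>y. e y * K y $ j $ i)) z = 
     e z * (K z $ j $ i * d_z i (b j) z + d_z i (d_zbar j (\<lambda>y. K y $ j $ i)) z
        + a $ i * (b j z * K z $ j $ i) + a $ i * d_zbar j (\<lambda>y. K y $ j $ i) z + b j z * d_z i (\<lambda>y. K y $ j $ i) z)" for i j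
  proof -
    have "d_zbar j (\<lambda>y. e y * K y $ j $ i) y = e y * (b j y * K y $ j $ i + d_zbar j (\<lambda>y. K y $ j $ i) y)" if "y \<in> V" for y
      using dzb.mult[OF e[OF that] dK, of j j i] that V eb[OF that] by (auto simp: algebra_simps)
    then have "d_z i (d_zbar j (\<lambda>y. e y * K y $ j $ i)) z = d_z i (\<lambda>y. e y * (b j y * K y $ j $ i + d_zbar j (\<lambda>y. K y $ j $ i) y)) z"
      by (rule dz.cong[OF V(1,3)])
    also have "\<dots> = e z * ((b j z * d_z i (\<lambda>y. K y $ j $ i) z + d_z i (b j) z * K z $ j $ i) + d_z i (d_zbar j (\<lambda>y. K y $ j $ i)) z)
        + e z * a $ i * (b j z * K z $ j $ i + d_zbar j (\<lambda>y. K y $ j $ i) z)"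
      using e[OF V(3)] bd dK[OF zU] dK2
      by (simp add: dz.mult dz.add ea differentiable_mult differentiable_add)
    finally show ?thesis by (simp add: algebra_simps)
  qed
  then have "(\<Sum>i\<in>UNIV. \<Sum>j\<in>UNIV. d_z i (d_zbar j (\<lambda>y. e y * K y $ j $ i)) z) =
     e z * ((\<Sum>i\<in>UNIV. \<Sum>j\<in>UNIV. K z $ j $ i * d_z i (b j) z) + (\<Sum>i\<in>UNIV. \<Sum>j\<in>UNIV. d_z i (d_zbar j (\<lambda>y. K y $ j $ i)) z)
       + (\<Sum>i\<in>UNIV. \<Sum>j\<in>UNIV. a $ i * (b j z * K z $ j $ i))
       + (\<Sum>i\<in>UNIV. \<Sum>j\<in>UNIV. a $ i * d_zbar j (\<lambda>y. K y $ j $ i) z) 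
       + (\<Sum>i\<in>UNIV. \<Sum>j\<in>UNIV. b j z * d_z i (\<lambda>y. K y $ j $ i) z))"
    by (simp add: sum_distrib_left[symmetric] sum.distrib)
  also have "(\<Sum>i\<in>UNIV. \<Sum>j\<in>UNIV. a $ i * (b j z * K z $ j $ i)) = qf z a (\<chi> j. b j z)"
    unfolding qf_def by (simp add: mult_ac)
  also have "(\<Sum>i\<in>UNIV. \<Sum>j\<in>UNIV. a $ i * d_zbar j (\<lambda>y. K y $ j $ i) z) = (\<Sum>i\<in>UNIV. a $ i * tor_bar z $ i)"
    by (simp add: tor_bar_def mat_op_def sum_distrib_left)
  also have "(\<Sum>i\<in>UNIV. \<Sum>j\<in>UNIV. b j z * d_z i (\<lambda>y. K y $ j $ i) z) = (\<Sum>j\<in>UNIV. b j z * tor z $ j)"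
    by (subst sum.swap) (simp add: tor_def mat_op_def sum_distrib_left)
  \<comment> \<open>With both divergences lowered by G, their product becomes a value of
    \<open>qf\<close>: the missing corner in the expansion of \<open>qf\<close> at two sums.\<close>
  also have "(\<Sum>i\<in>UNIV. \<Sum>j\<in>UNIV. d_z i (d_zbar j (\<lambda>y. K y $ j $ i)) z) 
      = scal_hat z + qf z (G z *v tor z) (tor_bar z v* G z)"
  proof -
    have "(\<Sum>p\<in>UNIV. \<Sum>q\<in>UNIV. tor_bar z $ p * G z $ p $ q * tor z $ q) = qf z (G z *v tor z) (tor_bar z v* G z)"
      unfolding qf_tor(1)[OF zU]
      by (subst sum.swap) (simp add: vector_matrix_mult_def sum_distrib_left mult_ac)
    then show ?thesis using sum_d_z_d_zbar_K[OF zU] by simp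
  qed
  finally show ?thesis
    by (simp add: qf_add qf_tor[OF zU] algebra_simps)
qed

end

section \<open>The differential inequality for a pluricanonical section\<close>

text \<open>\<open>qf\<close> is complex bilinear, so the Hermitian square of a covector a is
  written \<open>qf z a (cnjv a)\<close>.\<close>

definition cnjv :: "complex^'n \<Rightarrow> complex^'n" where
  "cnjv v = (\<chi> i. cnj (v $ i))"

lemma cnjv_simps: "cnjv (a + b) = cnjv a + cnjv b" "cnjv (c *s a) = cnj c *s cnjv a" "cnjv (cnjv a) = a"
  by (simp_all add: cnjv_def vec_eq_iff)

lemma (in derivation) power:
  assumes "f differentiable at z"
  shows "\<delta> (\<lambda>y. f y ^ n) z = of_nat n * f z ^ (n - 1) * \<delta> f z"
proof (induction n)
  case 0
  then show ?case by simp
next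
  case (Suc n)
  have d: "(\<lambda>y. f y ^ n) differentiable at z" by (intro differentiable_power assms)
  have "\<delta> (\<lambda>y. f y ^ Suc n) z = f z * (of_nat n * f z ^ (n - 1) * \<delta> f z) + \<delta> f z * f z ^ n"
    by (simp only: power_Suc mult[OF assms d] Suc.IH)
  also have "\<dots> = of_nat (Suc n) * f z ^ (Suc n - 1) * \<delta> f z"
    by (cases n) (simp_all add: algebra_simps)
  finally show ?case .
qed

context hermitian_coords
begin

text \<open>The gradient of log det G. In \<open>na + tor_low\<close> the p-th component is the
  contraction of d_p g_{kl} - d_k g_{pl} over k and the conjugate index l, that is, the trace of the
  Chern torsion.\<close>

definition "na z = (\<chi> i. trace (K z ** X i z))"
definition "tor_low z = G z *v tor z"

lemma K_herm: "z \<in> U \<Longrightarrow> cnj (K z $ i $ j) = K z $ j $ i"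
  unfolding K_def using pos_def_inverse(3)[OF pos_G, of z j i] by simp

lemma differentiable_D: "z \<in> U \<Longrightarrow> D differentiable at z"
  using Ck_on_differentiable[OF smooth_D] .

lemma differentiable_K: "z \<in> U \<Longrightarrow> (\<lambda>y. K y $ i $ j) differentiable at z"
  using Ck_on_differentiable[OF smooth_K] .

lemma d_z_real:
  assumes "z \<in> U" "e differentiable at z" "\<And>y. y \<in> U \<Longrightarrow> cnj (e y) = e y"
  shows "d_z i e z = cnj (d_zbar i e z)"
proof -
  have "d_z i e z = d_z i (\<lambda>y. cnj (e y)) z"
    by (rule dz.cong[OF open_U assms(1)]) (simp add: assms(3))
  then show ?thesis by (simp add: d_z_cnj[OF assms(2)])
qed

lemma D_cnj: "z \<in> U \<Longrightarrow> cnj (D z) = D z"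
  using D_real by (metis complex_cnj_complex_of_real)

lemma trace_KY: "z \<in> U \<Longrightarrow> trace (K z ** Y j z) = cnj (na z $ j)"
proof -
  assume z: "z \<in> U"
  have "D z * (na z $ j) = cnj (D z * trace (K z ** Y j z))"
    using d_z_real[OF z differentiable_D[OF z] D_cnj, of j] by (simp add: d_z_D[OF z] d_zbar_D[OF z] na_def)
  then have "D z * (na z $ j) = D z * cnj (trace (K z ** Y j z))" by (simp add: D_cnj[OF z])
  then show ?thesis using D_nz[OF z] by simp
qed

lemma tor_bar_cnj:
  assumes z: "z \<in> U"
  shows "tor_bar z = cnjv (tor z)"
proof -
  have "d_zbar j (\<lambda>y. K y $ j $ p) z = cnj (d_z j (\<lambda>y. K y $ p $ j) z)" for j p
  proof -
    have "d_zbar j (\<lambda>y. K y $ j $ p) z = d_zbar j (\<lambda>y. cnj (K y $ p $ j)) z"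
      by (rule dzb.cong[OF open_U z]) (simp add: K_herm)
    then show ?thesis by (simp add: d_zbar_cnj[OF differentiable_K[OF z]])
  qed
  then show ?thesis by (simp add: tor_bar_def tor_def cnjv_def mat_op_def)
qed

lemma tor_bar_low:
  assumes z: "z \<in> U"
  shows "tor_bar z v* G z = cnjv (tor_low z)"
  unfolding tor_bar_cnj[OF z] tor_low_def cnjv_def vec_eq_iff
  by (simp add: vector_matrix_mult_def matrix_vector_mult_def pos_def_sym[OF pos_G[OF z]] mult.commute)

lemma qf_pos: "z \<in> U \<Longrightarrow> a \<noteq> 0 \<Longrightarrow> Re (qf z a (cnjv a)) > 0"
  unfolding qf_def K_def cnjv_def using pos_def_inverse(4)[OF pos_G] by simp

lemma qf_nonneg: "z \<in> U \<Longrightarrow> Re (qf z a (cnjv a)) \<ge> 0"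
proof (cases "a = 0")
  case True
  then show ?thesis by (simp add: qf_def)
qed (use qf_pos in force)

lemma smooth_trace: "Ck_on k (\<lambda>z. trace (K z ** Y j z)) U"
  unfolding trace_def matrix_matrix_mult_def
  by (simp, intro Ck_on_sum Ck_on_mult open_U smooth_K smooth_Y)

text \<open>The volume density det G is carried by the argument e, since all integrals are taken
  against Lebesgue measure in coordinates.\<close>

definition adj_lap :: "(complex^'n \<Rightarrow> complex) \<Rightarrow> complex^'n \<Rightarrow> complex" where
  "adj_lap e z = (\<Sum>i\<in>UNIV. \<Sum>j\<in>UNIV. d_z i (d_zbar j (\<lambda>y. e y * K y $ j $ i)) z)"

lemma sum_K_trace: "(\<Sum>i\<in>UNIV. \<Sum>j\<in>UNIV. K z $ j $ i * - trace (K z ** R i j z)) = - scal z"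
  by (simp add: scal_def sum_negf)

text \<open>Here \<open>scal\<close> has the wrong sign, as log det G is differentiated without the
  help of a section. This quantity is the error term of the regularisation.\<close>

lemma adj_lap_D:
  assumes z: "z \<in> U"
  shows "adj_lap D z = D z * (- scal z + scal_hat z + qf z (na z + tor_low z) (cnjv (na z + tor_low z)))"
proof -
  have *: "(\<chi> j. trace (K z ** Y j z)) = cnjv (na z)"
    by (simp add: trace_KY[OF z] cnjv_def)
  have "adj_lap D z = D z * ((\<Sum>i\<in>UNIV. \<Sum>j\<in>UNIV. K z $ j $ i * d_z i (\<lambda>y. trace (K y ** Y j y)) z) + scal_hat z
       + qf z (na z + G z *v tor z) ((\<chi> j. trace (K z ** Y j z)) + tor_bar z v* G z))"
    unfolding adj_lap_def
    by (rule adjoint_laplacian_log[OF open_U order_refl z differentiable_D d_zbar_D])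
      (auto simp: d_z_D[OF z] na_def intro: Ck_on_differentiable[OF smooth_trace z])
  then show ?thesis
    unfolding d_z_trace[OF z] * tor_bar_low[OF z] sum_K_trace cnjv_simps
    by (simp add: tor_low_def)
qed

end

locale section_coords = hermitian_coords G U
  for G :: "complex^'n \<Rightarrow> complex^'n^'n" and U +
  fixes f :: "complex^'n \<Rightarrow> complex" and m :: nat
  assumes f: "holo_fun_on f U" and m: "m > 0"
begin

definition "Q z = (norm (f z)) ^ 4 / (Re (D z)) ^ (2 * m)"
definition "u \<epsilon> z = (Q z + \<epsilon>) powr (1 / m)"
text \<open>The cofactor of f^2 in the \<open>d_zbar j\<close> derivative of Q. Keeping f^2 as a
  factor, instead of dividing by f, keeps every expression smooth across the zeros of f.\<close>

definition "H j z = (2 * cnj (f z) * cnj (d_z j f z) - 2 * of_nat m * trace (K z ** Y j z) * cnj (f z) ^ 2)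
    * inverse (D z ^ (2 * m))"
text \<open>The logarithmic \<open>d_zbar j\<close> derivative of \<open>e \<epsilon>\<close>, the
  product of \<open>u \<epsilon>\<close> and the volume density.\<close>

definition "b \<epsilon> j z = of_real (1 / m) * inverse (of_real (Q z + \<epsilon>)) * (f z ^ 2 * H j z) + trace (K z ** Y j z)"

lemma Q_nonneg: "z \<in> U \<Longrightarrow> Q z \<ge> 0"
  unfolding Q_def using D_pos by (intro divide_nonneg_nonneg zero_le_power) (auto intro: less_imp_le)

lemma Q_complex: "z \<in> U \<Longrightarrow> of_real (Q z) = f z ^ 2 * cnj (f z) ^ 2 * inverse (D z ^ (2 * m))"
proof -
  assume z: "z \<in> U"
  have "complex_of_real ((norm (f z)) ^ 4) = (of_real ((norm (f z))^2))^2" by (simp flip: of_real_power)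
  also have "\<dots> = f z ^ 2 * cnj (f z) ^ 2"
    by (simp only: complex_norm_square power_mult_distrib)
  finally have "complex_of_real ((norm (f z)) ^ 4) = f z ^ 2 * cnj (f z) ^ 2" .
  moreover have "complex_of_real (Re (D z)) = D z" using D_real[OF z] by simp
  ultimately show ?thesis unfolding Q_def of_real_divide of_real_power by (simp add: divide_inverse)
qed

lemma smooth_f: "Ck_on k f U" using holo_fun_on_Ck_on[OF open_U f] .
lemma smooth_df: "Ck_on k (d_z j f) U" using holo_fun_on_Ck_on[OF open_U holo_d_z[OF open_U f]] .

lemma smooth_Q: "Ck_on k Q U"
proof -
  have "Ck_on k (\<lambda>z. Re (f z ^ 2 * cnj (f z) ^ 2 * inverse (D z ^ (2 * m)))) U"
    by (intro Ck_on_Re Ck_on_mult Ck_on_power Ck_on_cnj Ck_on_inverse_compose smooth_f smooth_D open_U) (simp add: D_nz)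
  moreover have "Re (f z ^ 2 * cnj (f z) ^ 2 * inverse (D z ^ (2 * m))) = Q z" if "z \<in> U" for z
    using Q_complex[OF that] by (metis Re_complex_of_real)
  ultimately show ?thesis using Ck_on_cong[OF open_U, of "\<lambda>z. Re (f z ^ 2 * cnj (f z) ^ 2 * inverse (D z ^ (2 * m)))" Q] by simp
qed

lemma smooth_H: "Ck_on k (H j) U"
  unfolding H_def
  by (intro Ck_on_mult Ck_on_diff Ck_on_power Ck_on_cnj Ck_on_const Ck_on_inverse_compose smooth_trace smooth_f smooth_df smooth_D open_U)
    (simp add: D_nz)

lemma smooth_u: "\<epsilon> > 0 \<Longrightarrow> Ck_on k (u \<epsilon>) U"
  unfolding u_def
  by (rule Ck_on_compose[OF open_U _ _ _ Ck_on_powr, where f="\<lambda>z. Q z + \<epsilon>"])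
    (auto intro!: Ck_on_add Ck_on_const smooth_Q open_U add_nonneg_pos Q_nonneg)

lemma smooth_b: "\<epsilon> > 0 \<Longrightarrow> Ck_on k (b \<epsilon> j) U"
proof -
  assume e: "\<epsilon> > 0"
  have "complex_of_real (Q z + \<epsilon>) \<noteq> 0" if "z \<in> U" for z
    using Q_nonneg[OF that] e by (simp only: of_real_eq_0_iff)
  then show ?thesis
    unfolding b_def
    by (intro Ck_on_add Ck_on_mult Ck_on_const Ck_on_power Ck_on_inverse_compose Ck_on_of_real
        smooth_trace smooth_f smooth_Q smooth_H open_U) auto
qed

lemma differentiable_f: "z \<in> U \<Longrightarrow> f differentiable at z"
  using Ck_on_differentiable[OF smooth_f] .

lemma d_zbar_Q:
  assumes z: "z \<in> U"
  shows "d_zbar j (\<lambda>y. of_real (Q y)) z = f z ^ 2 * H j z"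
proof -
  have df: "f differentiable at z" "(\<lambda>y. cnj (f y)) differentiable at z" "(\<lambda>y. D y ^ (2 * m)) differentiable at z"
    using Ck_on_differentiable[OF smooth_f z] Ck_on_differentiable[OF Ck_on_cnj[OF open_U smooth_f] z]
      differentiable_D[OF z] by (auto intro: differentiable_power)
  have Dm: "D z ^ (2 * m) \<noteq> 0" using D_nz[OF z] by simp
  have di: "(\<lambda>y. inverse (D y ^ (2 * m))) differentiable at z"
    using Ck_on_differentiable[OF Ck_on_inverse_compose[OF open_U _ Ck_on_power[OF open_U smooth_D]] z] D_nz by simp
  have 1: "d_zbar j (\<lambda>y. f y ^ 2) z = 0"
    by (simp add: dzb.power[OF df(1)] d_zbar_holo[OF f z])
  have 2: "d_zbar j (\<lambda>y. cnj (f y) ^ 2) z = 2 * cnj (f z) * cnj (d_z j f z)"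
    by (simp add: dzb.power[OF df(2)] d_zbar_cnj[OF df(1)])
  have 3: "d_zbar j (\<lambda>y. inverse (D y ^ (2 * m))) z = - 2 * of_nat m * trace (K z ** Y j z) * inverse (D z ^ (2 * m))"
  proof -
    have "D z ^ (2 * m) = D z ^ (2 * m - 1) * D z" using m by (metis power_minus_mult nat_0_less_mult_iff zero_less_numeral)
    then show ?thesis
      using D_nz[OF z] unfolding dzb.inverse[OF df(3) Dm] dzb.power[OF differentiable_D[OF z]] d_zbar_D[OF z]
      by (simp add: power2_eq_square field_simps)
  qed
  have "d_zbar j (\<lambda>y. of_real (Q y)) z = d_zbar j (\<lambda>y. f y ^ 2 * (cnj (f y) ^ 2 * inverse (D y ^ (2 * m)))) z"
    by (rule dzb.cong[OF open_U z]) (simp add: Q_complex mult.assoc)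
  also have "\<dots> = f z ^ 2 * (cnj (f z) ^ 2 * (- 2 * of_nat m * trace (K z ** Y j z) * inverse (D z ^ (2 * m)))
        + 2 * cnj (f z) * cnj (d_z j f z) * inverse (D z ^ (2 * m)))"
    using df di by (simp add: dzb.mult differentiable_mult differentiable_power 1 2 3)
  finally show ?thesis by (simp add: H_def algebra_simps)
qed

lemma differentiable_Q: "z \<in> U \<Longrightarrow> Q differentiable at z"
  using Ck_on_differentiable[OF smooth_Q] .

lemma d_zbar_u:
  assumes e: "\<epsilon> > 0" and z: "z \<in> U"
  shows "d_zbar j (\<lambda>y. of_real (u \<epsilon> y)) z = of_real (u \<epsilon> z) * (of_real (1 / m) * inverse (of_real (Q z + \<epsilon>)) * (f z ^ 2 * H j z))"
proof -
  have p: "Q z + \<epsilon> > 0" using Q_nonneg[OF z] e by simp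
  have "((\<lambda>t. (t + \<epsilon>) powr (1 / m)) has_real_derivative (1 / m) * (Q z + \<epsilon>) powr (1 / m - 1)) (at (Q z))"
    using p by (auto intro!: derivative_eq_intros)
  then have "d_zbar j (\<lambda>y. of_real (u \<epsilon> y)) z = of_real ((1 / m) * (Q z + \<epsilon>) powr (1 / m - 1)) * d_zbar j (\<lambda>y. of_real (Q y)) z"
    unfolding u_def by (rule dzb.real_compose[OF differentiable_Q[OF z]])
  moreover have "(Q z + \<epsilon>) powr (1 / m - 1) = u \<epsilon> z * inverse (Q z + \<epsilon>)"
    using p by (simp add: u_def powr_diff divide_inverse)
  ultimately show ?thesis unfolding d_zbar_Q[OF z] by (simp add: mult_ac)
qed

definition "e \<epsilon> z = of_real (u \<epsilon> z) * D z"

lemma differentiable_e: "\<epsilon> > 0 \<Longrightarrow> z \<in> U \<Longrightarrow> e \<epsilon> differentiable at z"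
  unfolding e_def
  using Ck_on_differentiable[OF Ck_on_mult[OF open_U Ck_on_of_real[OF open_U smooth_u] smooth_D]] .

lemma d_zbar_e:
  assumes "\<epsilon> > 0" "z \<in> U"
  shows "d_zbar j (e \<epsilon>) z = e \<epsilon> z * b \<epsilon> j z"
proof -
  have "(\<lambda>y. complex_of_real (u \<epsilon> y)) differentiable at z"
    using Ck_on_differentiable[OF Ck_on_of_real[OF open_U smooth_u]] assms by blast
  then show ?thesis
    unfolding e_def using assms by (simp add: dzb.mult differentiable_D d_zbar_u d_zbar_D b_def algebra_simps)
qed

lemma d_z_e:
  assumes "\<epsilon> > 0" "z \<in> U"
  shows "d_z j (e \<epsilon>) z = e \<epsilon> z * cnjv (\<chi> j. b \<epsilon> j z) $ j"
proof -
  have "cnj (e \<epsilon> y) = e \<epsilon> y" if "y \<in> U" for y using D_cnj[OF that] by (simp add: e_def)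
  then show ?thesis
    using d_z_real[OF assms(2) differentiable_e[OF assms]] d_zbar_e[OF assms] assms(2) by (simp add: cnjv_def)
qed

lemma adj_lap_e:
  assumes "\<epsilon> > 0" and z: "z \<in> U"
  shows "adj_lap (e \<epsilon>) z = e \<epsilon> z * ((\<Sum>i\<in>UNIV. \<Sum>j\<in>UNIV. K z $ j $ i * d_z i (b \<epsilon> j) z) + scal_hat z
       + qf z (cnjv (\<chi> j. b \<epsilon> j z) + tor_low z) (cnjv (cnjv (\<chi> j. b \<epsilon> j z) + tor_low z)))"
  using adjoint_laplacian_log[OF open_U order_refl z differentiable_e[OF assms(1)] d_zbar_e[OF assms(1)] d_z_e[OF assms]
      Ck_on_differentiable[OF smooth_b[OF assms(1)] z]]
  unfolding adj_lap_def cnjv_simps tor_bar_low[OF z] tor_low_def .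

text \<open>The logarithmic derivatives of \<open>e \<epsilon>\<close> and of D differ by f^2 times
  a differentiable function. At a zero of f this difference vanishes together with its first
  derivatives.\<close>

lemma adj_lap_e_zero:
  assumes e: "\<epsilon> > 0" and z: "z \<in> U" and fz: "f z = 0"
  shows "adj_lap (e \<epsilon>) z = of_real (u \<epsilon> z) * adj_lap D z"
proof -
  have bz: "(\<chi> j. b \<epsilon> j z) = cnjv (na z)" by (simp add: b_def fz trace_KY[OF z] cnjv_def)
  have db: "d_z i (b \<epsilon> j) z = d_z i (\<lambda>y. trace (K y ** Y j y)) z" for i j
  proof -
    define C where "C = (\<lambda>y. of_real (1 / m) * inverse (complex_of_real (Q y + \<epsilon>)) * H j y)"
    have ne: "complex_of_real (Q y + \<epsilon>) \<noteq> 0" if "y \<in> U" for y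
      using Q_nonneg[OF that] e by (simp only: of_real_eq_0_iff)
    have C: "C differentiable at z"
      unfolding C_def
      by (rule Ck_on_differentiable[OF _ z], intro Ck_on_mult Ck_on_const Ck_on_inverse_compose Ck_on_of_real Ck_on_add
        smooth_Q smooth_H open_U) (use ne in auto)
    have "b \<epsilon> j = (\<lambda>y. f y * (f y * C y) + trace (K y ** Y j y))"
      by (simp add: fun_eq_iff b_def C_def power2_eq_square mult_ac)
    then show ?thesis
      using C differentiable_f[OF z] Ck_on_differentiable[OF smooth_trace z]
      by (simp add: dz.add dz.mult differentiable_mult fz)
  qed
  show ?thesis
    unfolding adj_lap_e[OF e z] adj_lap_D[OF z] bz cnjv_simps(3) db d_z_trace[OF z] sum_K_trace
    by (simp add: e_def)
qed

text \<open>\<open>p\<close> is the gradient of log u for \<epsilon> = 0, and for positive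
  \<epsilon> it is multiplied by the weight t. Differentiating the weight adds m t (1 - t) |p|^2,
  while the convexity defect of the square norm at t p + (\<open>na\<close> +
  \<open>tor_low\<close>) takes away t (1 - t) |p|^2. The remaining multiple of |p|^2 is nonnegative
  because m is at least 1.\<close>

lemma adj_lap_e_nonzero:
  assumes e: "\<epsilon> > 0" and z: "z \<in> U" and fz: "f z \<noteq> 0"
  defines "t \<equiv> Q z / (Q z + \<epsilon>)"
    and "p \<equiv> (\<chi> j. 2 / of_nat m * (d_z j f z / f z)) - 2 *s na z"
  shows "adj_lap (e \<epsilon>) z = of_real (u \<epsilon> z) * (
     of_real t * D z * (scal z + scal_hat z + qf z (p + (na z + tor_low z)) (cnjv (p + (na z + tor_low z))))
     + of_real (1 - t) * adj_lap D z
     + of_real ((real m - 1) * t * (1 - t)) * D z * qf z p (cnjv p))"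
proof -
  \<comment> \<open>An open neighbourhood of z on which division by f is allowed.\<close>
  define V where "V = f -` (- {0}) \<inter> U"
  have V: "open V" "V \<subseteq> U" "z \<in> V"
    using continuous_on_open_vimage[OF open_U, THEN iffD1, OF holo_fun_on_continuous[OF f]] z fz
    unfolding V_def by auto
  \<comment> \<open>On V this is the \<open>d_zbar j\<close> derivative of log Q; \<open>tc\<close>
    below is the weight t as a function of the point.\<close>
  define xb where "xb = (\<lambda>j y. 2 * cnj (d_z j f y * inverse (f y)) - 2 * of_nat m * trace (K y ** Y j y))"
  define tc where "tc = (\<lambda>y. of_real (Q y) * inverse (complex_of_real (Q y + \<epsilon>)))"
  have ne: "complex_of_real (Q y + \<epsilon>) \<noteq> 0" if "y \<in> U" for y
    using Q_nonneg[OF that] e by (simp only: of_real_eq_0_iff)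
  have QH: "f y ^ 2 * H j y = of_real (Q y) * xb j y" if "y \<in> V" for j y
  proof -
    have "y \<in> U" "f y \<noteq> 0" using that by (auto simp: V_def)
    have "2 * a * c - 2 * n * T * a\<^sup>2 = a\<^sup>2 * (2 * (c * inverse a) - 2 * n * T)" if "a \<noteq> 0" for a c n T :: complex
      using that by (simp add: field_simps power2_eq_square)
    from this[of "cnj (f y)" "cnj (d_z j f y)" "of_nat m" "trace (K y ** Y j y)"]
    show ?thesis unfolding Q_complex[OF \<open>y \<in> U\<close>] H_def xb_def
      using \<open>f y \<noteq> 0\<close> by (simp add: mult_ac)
  qed
  have bV: "b \<epsilon> j y = of_real (1 / m) * (tc y * xb j y) + trace (K y ** Y j y)" if "y \<in> V" for j y
    unfolding b_def QH[OF that] tc_def by (simp add: mult_ac)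
  have tcz: "tc z = of_real t" by (simp add: tc_def t_def divide_inverse)
  have dQ: "(\<lambda>y. complex_of_real (Q y)) differentiable at z"
    using Ck_on_differentiable[OF Ck_on_of_real[OF open_U smooth_Q] z] .
  have dQe: "(\<lambda>y. complex_of_real (Q y + \<epsilon>)) differentiable at z"
    by (rule Ck_on_differentiable[OF _ z], intro Ck_on_of_real Ck_on_add Ck_on_const smooth_Q open_U)
  have dQi: "(\<lambda>y. inverse (complex_of_real (Q y + \<epsilon>))) differentiable at z"
    by (rule Ck_on_differentiable[OF _ z], intro Ck_on_inverse_compose Ck_on_of_real Ck_on_add Ck_on_const smooth_Q open_U ne)
  have dtc: "tc differentiable at z" unfolding tc_def by (intro differentiable_mult dQ dQi)
  have dh: "(\<lambda>y. d_z j f y * inverse (f y)) differentiable at z" for j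
    by (intro differentiable_mult Ck_on_differentiable[OF smooth_df z] 
        Ck_on_differentiable[OF Ck_on_inverse_compose[OF V(1) _ Ck_on_subset[OF smooth_f V(2)]] V(3)])
      (auto simp: V_def)
  have dhc: "(\<lambda>y. cnj (d_z j f y * inverse (f y))) differentiable at z" for j
    by (rule differentiableI[OF bounded_linear.has_derivative[OF bounded_linear_cnj frechet_derivative_works'[OF dh]]])
  have dtr: "(\<lambda>y. trace (K y ** Y j y)) differentiable at z" for j
    using Ck_on_differentiable[OF smooth_trace z] .
  have dxb: "xb j differentiable at z" for j
    unfolding xb_def by (intro differentiable_diff differentiable_mult differentiable_const dhc dtr)
  \<comment> \<open>The conjugate of the logarithmic derivative of f is antiholomorphic and is
    killed by \<open>d_z\<close>; only the log det G in log Q contributes curvature.\<close>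
  have d_xb: "d_z i (xb j) z = 2 * of_nat m * trace (K z ** R i j z)" for i j
  proof -
    have "d_zbar i (\<lambda>y. d_z j f y * inverse (f y)) z = 0"
    proof -
      have "(\<lambda>y. inverse (f y)) differentiable at z"
        by (intro Ck_on_differentiable[OF Ck_on_inverse_compose[OF V(1) _ Ck_on_subset[OF smooth_f V(2)]] V(3)])
          (auto simp: V_def)
      then show ?thesis
        using Ck_on_differentiable[OF smooth_df z, of j]
        by (simp add: dzb.mult dzb.inverse[OF differentiable_f[OF z] fz] d_zbar_holo[OF f z] d_zbar_holo[OF holo_d_z[OF open_U f] z])
    qed
    then have "d_z i (\<lambda>y. cnj (d_z j f y * inverse (f y))) z = 0" unfolding d_z_cnj[OF dh] by simp
    then show ?thesis unfolding xb_def
      by (simp add: dz.diff dz.cmult dhc dtr differentiable_mult d_z_trace[OF z] del: complex_cnj_mult)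
  qed
  define x where "x = cnjv (\<chi> j. xb j z)"
  have xp: "x = of_nat m *s p"
    using m unfolding x_def p_def cnjv_def xb_def
    by (simp add: vec_eq_iff trace_KY[OF z] field_simps)
  have d_Q: "d_z i (\<lambda>y. of_real (Q y)) z = of_real (Q z) * x $ i" for i
  proof -
    have "d_z i (\<lambda>y. of_real (Q y)) z = cnj (d_zbar i (\<lambda>y. of_real (Q y)) z)"
      by (rule d_z_real[OF z dQ]) simp
    then show ?thesis unfolding d_zbar_Q[OF z] QH[OF V(3)] by (simp add: x_def cnjv_def)
  qed
  have d_tc: "d_z i tc z = of_real (t * (1 - t)) * x $ i" for i
  proof -
    have "d_z i (\<lambda>y. complex_of_real (Q y + \<epsilon>)) z = of_real (Q z) * x $ i"
      using dz.add[OF dQ, of "\<lambda>y. of_real \<epsilon>"] by (simp add: d_Q)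
    then have "d_z i tc z = of_real (Q z) * (- (of_real (Q z) * x $ i) / (of_real (Q z + \<epsilon>))^2) + of_real (Q z) * x $ i * inverse (of_real (Q z + \<epsilon>))"
      unfolding tc_def by (simp only: dz.mult[OF dQ dQi] dz.inverse[OF dQe ne[OF z]] d_Q)
    also have "\<dots> = of_real (Q z / (Q z + \<epsilon>) - (Q z / (Q z + \<epsilon>)) ^ 2) * x $ i"
    proof -
      have "q * (- (q * w) / E\<^sup>2) + q * w * inverse E = (q / E - (q / E)\<^sup>2) * w" for q w E :: complex
        by (simp add: divide_inverse power2_eq_square algebra_simps)
      then show ?thesis by (simp only: of_real_diff of_real_divide of_real_power)
    qed
    also have "Q z / (Q z + \<epsilon>) - (Q z / (Q z + \<epsilon>)) ^ 2 = t * (1 - t)"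
      by (simp add: t_def power2_eq_square algebra_simps)
    finally show ?thesis .
  qed
  have d_b: "d_z i (b \<epsilon> j) z = of_real (1 / m * (t * (1 - t))) * (x $ i * xb j z) + of_real (2 * t) * trace (K z ** R i j z) - trace (K z ** R i j z)" for i j
  proof -
    have "d_z i (b \<epsilon> j) z = d_z i (\<lambda>y. of_real (1 / m) * (tc y * xb j y) + trace (K y ** Y j y)) z"
      by (rule dz.cong[OF V(1,3) bV])
    also have "\<dots> = of_real (1 / m) * (tc z * (2 * of_nat m * trace (K z ** R i j z)) + of_real (t * (1 - t)) * x $ i * xb j z) - trace (K z ** R i j z)"
    proof -
      have "d_z i (\<lambda>y. c * (tc y * xb j y) + trace (K y ** Y j y)) z
        = c * (tc z * (2 * of_nat m * trace (K z ** R i j z)) + of_real (t * (1 - t)) * x $ i * xb j z) - trace (K z ** R i j z)" for c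
        using dtc dxb dtr by (simp add: dz.add dz.cmult dz.mult differentiable_mult d_xb d_tc d_z_trace[OF z])
      then show ?thesis .
    qed
    finally show ?thesis unfolding tcz using m by (simp add: field_simps)
  qed
  have "(\<Sum>i\<in>UNIV. \<Sum>j\<in>UNIV. K z $ j $ i * d_z i (b \<epsilon> j) z)
     = of_real (1 / m * (t * (1 - t))) * qf z x (cnjv x) + of_real (2 * t) * scal z - scal z"
    unfolding d_b qf_def scal_def x_def
    by (simp add: cnjv_def algebra_simps sum.distrib sum_subtractf sum_distrib_left)
  also have "qf z x (cnjv x) = of_nat (m^2) * qf z p (cnjv p)"
    unfolding xp cnjv_simps qf_scale by (simp add: power2_eq_square)
  also have "of_real (1 / m * (t * (1 - t))) * (of_nat (m^2) * qf z p (cnjv p)) = of_real (m * (t * (1 - t))) * qf z p (cnjv p)"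
    using m by (simp add: power2_eq_square)
  finally have S: "(\<Sum>i\<in>UNIV. \<Sum>j\<in>UNIV. K z $ j $ i * d_z i (b \<epsilon> j) z)
     = of_real (m * (t * (1 - t))) * qf z p (cnjv p) + of_real (2 * t) * scal z - scal z" .
  have "cnjv (\<chi> j. b \<epsilon> j z) = of_real t *s p + na z"
  proof -
    have bv: "(\<chi> j. b \<epsilon> j z) = of_real (t / m) *s cnjv x + cnjv (na z)"
      by (simp add: vec_eq_iff bV[OF V(3)] tcz x_def cnjv_simps trace_KY[OF z] cnjv_def)
    show ?thesis unfolding bv xp cnjv_simps using m by (simp add: vec_eq_iff)
  qed
  then have bz: "cnjv (\<chi> j. b \<epsilon> j z) + tor_low z = of_real t *s p + (na z + tor_low z)" by simp
  show ?thesis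
    unfolding adj_lap_e[OF e z] S bz adj_lap_D[OF z] cnjv_simps qf_add qf_scale e_def
    by (simp add: algebra_simps)
qed

end

section \<open>The exterior derivative of a power of the fundamental form\<close>

text \<open>Alternation without a factorial: with the normalisation of \<open>wedge\<close>, a wedge
  product of two alternations is again an alternation, with no numerical factor
  (\<open>wedge_alt\<close>).\<close>

definition alt :: "nat \<Rightarrow> ((nat \<Rightarrow> 'b) \<Rightarrow> complex) \<Rightarrow> (nat \<Rightarrow> 'b) \<Rightarrow> complex" where
  "alt N F v = (\<Sum>\<sigma> | \<sigma> permutes {..<N}. of_int (sign \<sigma>) * F (\<lambda>i. v (\<sigma> i)))"

lemma sign_square: "of_int (sign q) * of_int (sign q) = (1 :: complex)"
  by (metis of_int_1 of_int_mult sign_idempotent)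

lemma alt_permute:
  assumes q: "q permutes {..<N}"
  shows "alt N (\<lambda>w. F (\<lambda>i. w (q i))) v = of_int (sign q) * alt N F v"
proof -
  have "alt N F v = (\<Sum>\<sigma> | \<sigma> permutes {..<N}. of_int (sign (\<sigma> \<circ> q)) * F (\<lambda>i. v ((\<sigma> \<circ> q) i)))"
    unfolding alt_def by (rule sum_permutations_compose_right[OF q])
  also have "\<dots> = (\<Sum>\<sigma> | \<sigma> permutes {..<N}. of_int (sign q) * (of_int (sign \<sigma>) * F (\<lambda>i. v (\<sigma> (q i)))))"
  proof (rule sum.cong[OF refl])
    fix \<sigma> assume "\<sigma> \<in> {\<sigma>. \<sigma> permutes {..<N}}"
    then have "sign (\<sigma> \<circ> q) = sign \<sigma> * sign q"
      using q by (intro sign_compose) (auto intro: permutation_permutes[THEN iffD2])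
    then show "of_int (sign (\<sigma> \<circ> q)) * F (\<lambda>i. v ((\<sigma> \<circ> q) i)) = of_int (sign q) * (of_int (sign \<sigma>) * F (\<lambda>i. v (\<sigma> (q i))))"
      by simp
  qed
  also have "\<dots> = of_int (sign q) * alt N (\<lambda>w. F (\<lambda>i. w (q i))) v"
    unfolding alt_def by (simp add: sum_distrib_left)
  finally show ?thesis by (simp add: sign_square flip: mult.assoc)
qed

lemma alt_sum: "alt N (\<lambda>w. \<Sum>p\<in>P. F p w) v = (\<Sum>p\<in>P. alt N (F p) v)"
  unfolding alt_def sum_distrib_left by (rule sum.swap)

lemma alt_cmult: "alt N (\<lambda>w. c * F w) v = c * alt N F v"
  unfolding alt_def sum_distrib_left by (simp add: mult_ac)

lemma alt_add: "alt N (\<lambda>w. F w + H w) v = alt N F v + alt N H v"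
  unfolding alt_def by (simp add: distrib_left sum.distrib)

lemma map_permutation_shift:
  fixes p q :: nat
  assumes \<pi>: "\<pi> permutes {..<q}"
  shows "map_permutation {..<q} ((+) p) \<pi> permutes {p..<p+q}"
    and "sign (map_permutation {..<q} ((+) p) \<pi>) = sign \<pi>"
    and "i < q \<Longrightarrow> map_permutation {..<q} ((+) p) \<pi> (p + i) = p + \<pi> i"
proof -
  have inj: "inj_on ((+) p) {..<q}" by (auto simp: inj_on_def)
  have "(+) p ` {..<q} = {p..<p+q}" by (simp add: lessThan_atLeast0 add.commute)
  then show "map_permutation {..<q} ((+) p) \<pi> permutes {p..<p+q}"
    using inj by (intro map_permutation_permutes \<pi>) (simp add: bij_betw_def)
  show "sign (map_permutation {..<q} ((+) p) \<pi>) = sign \<pi>"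
    by (rule sign_map_permutation[OF inj \<pi>]) simp
  show "i < q \<Longrightarrow> map_permutation {..<q} ((+) p) \<pi> (p + i) = p + \<pi> i"
    by (rule map_permutation_apply[OF inj]) simp
qed

text \<open>A permutation of each block combines to one permutation of all p + q slots, over which
  the outer sum is reindexed. All fact p * fact q pairs contribute equally and cancel the
  denominator of \<open>wedge\<close>. As forms take infinite sequences, the hypotheses have to say
  that F and H read only the slots of their own block.\<close>

lemma wedge_alt:
  assumes F: "\<And>w w'. (\<And>i. i < p \<Longrightarrow> w i = w' i) \<Longrightarrow> F w = F w'"
    and H: "\<And>w w'. (\<And>i. i < q \<Longrightarrow> w i = w' i) \<Longrightarrow> H w = H w'"
  shows "wedge p q (alt p F) (alt q H) v = alt (p + q) (\<lambda>w. F w * H (\<lambda>i. w (p + i))) v"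
proof -
  let ?E = "\<lambda>w. F w * H (\<lambda>i. w (p + i))"
  let ?S = "\<lambda>n. {\<sigma>. \<sigma> permutes {..<n::nat}}"
  have key: "(\<Sum>\<sigma>\<in>?S (p+q). of_int (sign \<sigma>) * (of_int (sign \<tau>) * F (\<lambda>i. v (\<sigma> (\<tau> i)))) * (of_int (sign \<pi>) * H (\<lambda>i. v (\<sigma> (p + \<pi> i)))))
       = alt (p + q) ?E v" if \<tau>: "\<tau> \<in> ?S p" and \<pi>: "\<pi> \<in> ?S q" for \<tau> \<pi>
  proof -
    define \<rho> where "\<rho> = \<tau> \<circ> map_permutation {..<q} ((+) p) \<pi>"
    note m = map_permutation_shift[where \<pi>=\<pi> and q=q and p=p]
    have t: "\<tau> permutes {..<p+q}" using \<tau> permutes_subset[of \<tau> "{..<p}" "{..<p+q}"] by auto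
    have m': "map_permutation {..<q} ((+) p) \<pi> permutes {..<p+q}"
      by (rule permutes_subset[OF m(1)]) (use \<pi> in auto)
    have \<rho>: "\<rho> permutes {..<p+q}" unfolding \<rho>_def by (rule permutes_compose[OF m' t])
    have "sign \<rho> = sign \<tau> * sign \<pi>"
      unfolding \<rho>_def using m(2) \<pi> t m' by (subst sign_compose) (auto intro: permutation_permutes[THEN iffD2])
    moreover have "F (\<lambda>i. v (\<sigma> (\<rho> i))) = F (\<lambda>i. v (\<sigma> (\<tau> i)))" for \<sigma>
    proof (rule F)
      fix i assume "i < p"
      then have "map_permutation {..<q} ((+) p) \<pi> i = i" using \<pi> permutes_not_in[OF m(1), of i] by auto
      then show "v (\<sigma> (\<rho> i)) = v (\<sigma> (\<tau> i))" by (simp add: \<rho>_def)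
    qed
    moreover have "H (\<lambda>i. v (\<sigma> (\<rho> (p + i)))) = H (\<lambda>i. v (\<sigma> (p + \<pi> i)))" for \<sigma>
    proof (rule H)
      fix i assume i: "i < q"
      have "\<tau> (p + \<pi> i) = p + \<pi> i" using \<tau> by (auto intro: permutes_not_in)
      then show "v (\<sigma> (\<rho> (p + i))) = v (\<sigma> (p + \<pi> i))" using m(3)[OF _ i] \<pi> by (simp add: \<rho>_def)
    qed
    ultimately have "(\<Sum>\<sigma>\<in>?S (p+q). of_int (sign \<sigma>) * (of_int (sign \<tau>) * F (\<lambda>i. v (\<sigma> (\<tau> i)))) * (of_int (sign \<pi>) * H (\<lambda>i. v (\<sigma> (p + \<pi> i)))))
       = of_int (sign \<rho>) * alt (p + q) (\<lambda>w. ?E (\<lambda>i. w (\<rho> i))) v"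
      unfolding alt_def sum_distrib_left by (simp add: mult_ac)
    also have "\<dots> = alt (p + q) ?E v"
      unfolding alt_permute[OF \<rho>, of ?E] by (simp add: sign_square flip: mult.assoc)
    finally show ?thesis .
  qed
  have "(\<Sum>\<sigma>\<in>?S (p+q). of_int (sign \<sigma>) * alt p F (\<lambda>i. v (\<sigma> i)) * alt q H (\<lambda>i. v (\<sigma> (p + i))))
     = (\<Sum>\<sigma>\<in>?S (p+q). \<Sum>\<tau>\<in>?S p. \<Sum>\<pi>\<in>?S q.
         of_int (sign \<sigma>) * (of_int (sign \<tau>) * F (\<lambda>i. v (\<sigma> (\<tau> i)))) * (of_int (sign \<pi>) * H (\<lambda>i. v (\<sigma> (p + \<pi> i)))))"
    unfolding alt_def sum_distrib_left sum_distrib_right by (rule sum.cong[OF refl], rule sum.swap)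
  also have "\<dots> = (\<Sum>\<tau>\<in>?S p. \<Sum>\<sigma>\<in>?S (p+q). \<Sum>\<pi>\<in>?S q.
         of_int (sign \<sigma>) * (of_int (sign \<tau>) * F (\<lambda>i. v (\<sigma> (\<tau> i)))) * (of_int (sign \<pi>) * H (\<lambda>i. v (\<sigma> (p + \<pi> i)))))"
    by (rule sum.swap)
  also have "\<dots> = (\<Sum>\<tau>\<in>?S p. \<Sum>\<pi>\<in>?S q. \<Sum>\<sigma>\<in>?S (p+q).
         of_int (sign \<sigma>) * (of_int (sign \<tau>) * F (\<lambda>i. v (\<sigma> (\<tau> i)))) * (of_int (sign \<pi>) * H (\<lambda>i. v (\<sigma> (p + \<pi> i)))))"
    by (rule sum.cong[OF refl]) (rule sum.swap)
  also have "\<dots> = (\<Sum>\<tau>\<in>?S p. \<Sum>\<pi>\<in>?S q. alt (p + q) ?E v)"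
    by (intro sum.cong refl key)
  also have "\<dots> = fact p * fact q * alt (p + q) ?E v"
    by (simp add: card_permutations)
  finally show ?thesis unfolding wedge_def by simp
qed

lemma wedge_scale: "wedge p q (\<lambda>v. a * \<alpha> v) (\<lambda>v. b * \<beta> v) v = a * b * wedge p q \<alpha> \<beta> v"
  unfolding wedge_def by (simp add: sum_distrib_left sum_divide_distrib mult_ac)

definition pair_monomial :: "nat \<Rightarrow> ('b \<Rightarrow> 'b \<Rightarrow> complex) \<Rightarrow> (nat \<Rightarrow> 'b) \<Rightarrow> complex" where
  "pair_monomial k h w = (\<Prod>a<k. h (w (2 * a)) (w (2 * a + 1)))"

lemma fundamental_form_alt: "fundamental_form M v = \<i> * alt 2 (pair_monomial 1 (herm_form M)) v"
proof -
  have "wedge 1 1 (dz_form i) (dzbar_form j) v = (\<Sum>\<sigma> | \<sigma> permutes {..<2}. of_int (sign \<sigma>) * (v (\<sigma> 0) $ i * cnj (v (\<sigma> 1) $ j)))" for i j :: 'a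
    unfolding wedge_def dz_form_def dzbar_form_def by (simp add: mult.assoc numeral_2_eq_2)
  then have "(\<Sum>i\<in>UNIV. \<Sum>j\<in>UNIV. M $ i $ j * wedge 1 1 (dz_form i) (dzbar_form j) v)
    = (\<Sum>i\<in>UNIV. \<Sum>j\<in>UNIV. \<Sum>\<sigma> | \<sigma> permutes {..<2}. of_int (sign \<sigma>) * (M $ i $ j * v (\<sigma> 0) $ i * cnj (v (\<sigma> 1) $ j)))"
    by (simp add: sum_distrib_left mult_ac)
  also have "\<dots> = (\<Sum>i\<in>UNIV. \<Sum>\<sigma> | \<sigma> permutes {..<2}. \<Sum>j\<in>UNIV. of_int (sign \<sigma>) * (M $ i $ j * v (\<sigma> 0) $ i * cnj (v (\<sigma> 1) $ j)))"
    by (rule sum.cong[OF refl]) (rule sum.swap)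
  also have "\<dots> = (\<Sum>\<sigma> | \<sigma> permutes {..<2}. \<Sum>i\<in>UNIV. \<Sum>j\<in>UNIV. of_int (sign \<sigma>) * (M $ i $ j * v (\<sigma> 0) $ i * cnj (v (\<sigma> 1) $ j)))"
    by (rule sum.swap)
  also have "\<dots> = alt 2 (pair_monomial 1 (herm_form M)) v"
    unfolding alt_def pair_monomial_def herm_form_def by (simp add: sum_distrib_left)
  finally show ?thesis unfolding fundamental_form_def by simp
qed

text \<open>The power is the alternation of a single product with consecutive slots paired, so that
  a derivative has to be taken only of one product of values of the metric.\<close>

lemma wedge_power_alt:
  "wedge_power2 (fundamental_form M) k = (\<lambda>v. \<i> ^ k * alt (2 * k) (pair_monomial k (herm_form M)) v)"
proof (induction k)
  case 0
  have "{\<sigma>. \<sigma> permutes {..<0::nat}} = {id}" by auto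
  then show ?case by (simp add: alt_def pair_monomial_def fun_eq_iff)
next
  case (Suc k)
  have ff: "fundamental_form M = (\<lambda>v. \<i> * alt 2 (pair_monomial 1 (herm_form M)) v)"
    by (rule ext) (rule fundamental_form_alt)
  have "wedge_power2 (fundamental_form M) (Suc k) v = \<i> ^ Suc k * alt (2 * Suc k) (pair_monomial (Suc k) (herm_form M)) v" for v
  proof -
    have "wedge_power2 (fundamental_form M) (Suc k) v = wedge 2 (2 * k) (\<lambda>v. \<i> * alt 2 (pair_monomial 1 (herm_form M)) v)
       (\<lambda>v. \<i> ^ k * alt (2 * k) (pair_monomial k (herm_form M)) v) v"
      by (simp only: wedge_power2.simps(2) Suc.IH ff[symmetric])
    also have "\<dots> = \<i> * \<i> ^ k * alt (2 + 2 * k) (\<lambda>w. pair_monomial 1 (herm_form M) w * pair_monomial k (herm_form M) (\<lambda>i. w (2 + i))) v"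
      unfolding wedge_scale by (subst wedge_alt) (auto simp: pair_monomial_def intro!: prod.cong)
    also have "(\<lambda>w. pair_monomial 1 (herm_form M) w * pair_monomial k (herm_form M) (\<lambda>i. w (2 + i))) = pair_monomial (Suc k) (herm_form M)"
      by (simp add: pair_monomial_def fun_eq_iff prod.lessThan_Suc_shift del: prod.lessThan_Suc)
    finally show ?thesis by simp
  qed
  then show ?case by (rule ext)
qed

text \<open>The cycle that brings slot i to the front. Its sign is the sign of the i-th summand of
  \<open>ext_deriv\<close>.\<close>

definition front_cycle :: "nat \<Rightarrow> nat \<Rightarrow> nat" where
  "front_cycle i j = (if j = 0 then i else if j \<le> i then j - 1 else j)"

lemma front_cycle_permutes_sign:
  "i \<le> N \<Longrightarrow> front_cycle i permutes {..<Suc N} \<and> sign (front_cycle i) = (- 1) ^ i"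
proof (induction i)
  case 0
  have "front_cycle 0 = id" by (auto simp: front_cycle_def fun_eq_iff)
  then show ?case by (simp only: permutes_id sign_id power_0 simp_thms)
next
  case (Suc i)
  have eq: "front_cycle (Suc i) = Transposition.transpose i (Suc i) \<circ> front_cycle i"
    by (auto simp: front_cycle_def fun_eq_iff Transposition.transpose_def)
  have t: "Transposition.transpose i (Suc i) permutes {..<Suc N}"
    using Suc.prems by (intro permutes_swap_id) auto
  have IH: "front_cycle i permutes {..<Suc N}" "sign (front_cycle i) = (- 1) ^ i" using Suc by auto
  have p: "front_cycle (Suc i) permutes {..<Suc N}"
    unfolding eq by (rule permutes_compose[OF IH(1) t])
  have "sign (front_cycle (Suc i)) = sign (Transposition.transpose i (Suc i)) * sign (front_cycle i)"
    unfolding eq using t IH by (intro sign_compose) (auto intro: permutation_permutes[THEN iffD2])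
  then show ?case using p IH(2) by (simp add: sign_swap_id)
qed

text \<open>Every permutation of N + 1 slots is a front cycle after a permutation fixing 0, in
  exactly one way. Hence the exterior derivative of an alternation is the alternation of the
  derivative, with slot 0 as its direction.\<close>

lemma alt_Suc:
  "(\<Sum>i\<le>N. (- 1) ^ i * alt N (\<lambda>w. Y (case_nat (v i) w)) (\<lambda>j. if j < i then v j else v (Suc j))) = alt (Suc N) Y v"
proof -
  let ?m = "\<lambda>\<pi>. map_permutation {..<N} ((+) 1) \<pi>"
  let ?g = "\<lambda>(i, \<pi>). front_cycle i \<circ> ?m \<pi>"
  let ?D = "{..N} \<times> {\<pi>. \<pi> permutes {..<N}}"
  have fin: "finite ?D" by (simp add: finite_permutations)
  have m0: "?m \<pi> 0 = 0" "?m \<pi> permutes {..<Suc N}" "sign (?m \<pi>) = sign \<pi>" "j < N \<Longrightarrow> ?m \<pi> (Suc j) = Suc (\<pi> j)"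
    if "\<pi> permutes {..<N}" for \<pi> j
  proof -
    note m = map_permutation_shift[OF that, where p=1]
    show "?m \<pi> 0 = 0" using permutes_not_in[OF m(1), of 0] by simp
    show "?m \<pi> permutes {..<Suc N}" by (rule permutes_subset[OF m(1)]) auto
    show "sign (?m \<pi>) = sign \<pi>" by (rule m(2))
    show "j < N \<Longrightarrow> ?m \<pi> (Suc j) = Suc (\<pi> j)" using m(3)[of j] by simp
  qed
  have inj: "inj_on ?g ?D"
  proof (rule inj_onI)
    fix x y assume xy: "x \<in> ?D" "y \<in> ?D" "?g x = ?g y"
    obtain i \<pi> i' \<pi>' where xy': "x = (i, \<pi>)" "y = (i', \<pi>')" by (cases x, cases y)
    have *: "i \<le> N" "i' \<le> N" "\<pi> permutes {..<N}" "\<pi>' permutes {..<N}"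
      and eq: "front_cycle i \<circ> ?m \<pi> = front_cycle i' \<circ> ?m \<pi>'"
      using xy by (simp_all add: xy')
    have "i = i'" using fun_cong[OF eq, of 0] m0(1)[OF *(3)] m0(1)[OF *(4)] by (simp add: front_cycle_def)
    moreover have "inj (front_cycle i)" using front_cycle_permutes_sign[OF *(1)] permutes_inj by blast
    ultimately have "?m \<pi> = ?m \<pi>'" using eq by (metis fun.inj_map_strong inj_eq fun_eq_iff comp_apply)
    then have "\<pi> j = \<pi>' j" for j
      using m0(4)[OF *(3), of j] m0(4)[OF *(4), of j] permutes_not_in[OF *(3), of j] permutes_not_in[OF *(4), of j]
      by (cases "j < N") auto
    then show "x = y" using \<open>i = i'\<close> by (auto simp: xy')
  qed
  have sub: "?g ` ?D \<subseteq> {\<sigma>. \<sigma> permutes {..<Suc N}}"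
    using front_cycle_permutes_sign m0(2) by (auto intro!: permutes_compose)
  \<comment> \<open>Injectivity and (N + 1) * N! = (N + 1)! give surjectivity.\<close>
  have "card (?g ` ?D) = card {\<sigma>. \<sigma> permutes {..<Suc N}}"
    unfolding card_image[OF inj] card_cartesian_product
    by (simp add: card_permutations[OF refl])
  then have im: "?g ` ?D = {\<sigma>. \<sigma> permutes {..<Suc N}}"
    by (intro card_subset_eq sub) (simp add: finite_permutations)
  have "alt (Suc N) Y v = (\<Sum>x\<in>?D. of_int (sign (?g x)) * Y (\<lambda>j. v (?g x j)))"
    unfolding alt_def im[symmetric] by (subst sum.reindex[OF inj]) simp
  also have "\<dots> = (\<Sum>(i,\<pi>)\<in>?D. (-1)^i * (of_int (sign \<pi>) * Y (\<lambda>j. case_nat (v i) (\<lambda>j. if \<pi> j < i then v (\<pi> j) else v (Suc (\<pi> j))) j)))"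
  proof (rule sum.cong[OF refl])
    fix x assume x: "x \<in> ?D"
    obtain i \<pi> where x': "x = (i, \<pi>)" by (cases x)
    have *: "i \<in> {..N}" "\<pi> permutes {..<N}" using x by (simp_all add: x')
    have "sign (front_cycle i \<circ> ?m \<pi>) = (-1)^i * sign \<pi>"
      using front_cycle_permutes_sign[of i N] * m0(2,3)[OF *(2)]
      by (subst sign_compose) (auto intro: permutation_permutes[THEN iffD2])
    moreover have "v ((front_cycle i \<circ> ?m \<pi>) j) = case_nat (v i) (\<lambda>j. if \<pi> j < i then v (\<pi> j) else v (Suc (\<pi> j))) j" for j
    proof (cases j)
      case 0
      then show ?thesis using m0(1)[OF *(2)] by (simp add: front_cycle_def)
    next
      case (Suc l)
      have "?m \<pi> (Suc l) = Suc (\<pi> l)"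
      proof (cases "l < N")
        case False
        then show ?thesis
          using permutes_not_in[OF m0(2)[OF *(2)], of "Suc l"] permutes_not_in[OF *(2), of l] by simp
      qed (rule m0(4)[OF *(2)])
      then show ?thesis using Suc by (auto simp: front_cycle_def)
    qed
    ultimately show "of_int (sign (?g x)) * Y (\<lambda>j. v (?g x j)) = (case x of (i,\<pi>) \<Rightarrow>
        (-1)^i * (of_int (sign \<pi>) * Y (\<lambda>j. case_nat (v i) (\<lambda>j. if \<pi> j < i then v (\<pi> j) else v (Suc (\<pi> j))) j)))"
      by (simp add: x')
  qed
  also have "\<dots> = (\<Sum>i\<le>N. \<Sum>\<pi> | \<pi> permutes {..<N}. (-1)^i * (of_int (sign \<pi>) * Y (\<lambda>j. case_nat (v i) (\<lambda>j. if \<pi> j < i then v (\<pi> j) else v (Suc (\<pi> j))) j)))"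
    by (rule sum.cartesian_product[symmetric])
  finally show ?thesis unfolding alt_def by (simp add: sum_distrib_left)
qed

section \<open>Cofactors produced by alternation\<close>

lemma det_row_expand:
  fixes M :: "complex^'n^'n"
  shows "det (\<chi> s. if s = k then x else c s) = (\<Sum>j\<in>UNIV. x $ j * det (\<chi> s. if s = k then axis j 1 else c s))"
proof -
  have "x = (\<Sum>j\<in>UNIV. x $ j *s axis j 1)" by (simp add: basis_expansion)
  then have "det (\<chi> s. if s = k then x else c s) = det (\<chi> s. if s = k then (\<Sum>j\<in>UNIV. x $ j *s axis j 1) else c s)"
    by (rule arg_cong[where f="\<lambda>x. det (\<chi> s. if s = k then x else c s)"])
  also have "\<dots> = (\<Sum>j\<in>UNIV. det (\<chi> s. if s = k then x $ j *s axis j 1 else c s))"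
    by (rule det_linear_row_sum) simp
  also have "\<dots> = (\<Sum>j\<in>UNIV. x $ j * det (\<chi> s. if s = k then axis j 1 else c s))"
    by (intro sum.cong refl det_row_mul)
  finally show ?thesis .
qed

text \<open>c selects n slots: \<open>c k\<close> holds the direction of differentiation, every
  other \<open>c s\<close> an argument paired with \<open>\<rho> s v* M\<close>, where \<rho> reads
  only the remaining slots. Alternating over the selected slots alone turns the product into a
  determinant, which is a combination with constant coefficients of the entries of det M * K. Their
  divergence is zero by hypothesis. The two halves of an exterior derivative, with
  \<open>d_z\<close> and \<open>d_zbar\<close>, are both of this shape.\<close>

lemma alt_vanish:
  fixes \<delta> :: "'n::finite \<Rightarrow> ('e::real_normed_vector \<Rightarrow> complex) \<Rightarrow> 'e \<Rightarrow> complex"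
    and M K :: "'e \<Rightarrow> complex^'n^'n" and c :: "'n \<Rightarrow> nat" and \<phi> :: "'b \<Rightarrow> 'n \<Rightarrow> complex"
    and \<rho> :: "'n \<Rightarrow> (nat \<Rightarrow> 'b) \<Rightarrow> complex^'n"
  assumes der: "\<And>m. derivation (\<delta> m)"
    and S: "open S" "z \<in> S" "\<And>y. y \<in> S \<Longrightarrow> K y ** M y = mat 1"
    and M: "mat_differentiable M z"
    and dK: "\<And>m j. (\<lambda>y. det (M y) * K y $ m $ j) differentiable at z"
    and div: "\<And>j. (\<Sum>m\<in>UNIV. \<delta> m (\<lambda>y. det (M y) * K y $ m $ j) z) = 0"
    and c: "inj c" "range c \<subseteq> {..<N}"
    and \<rho>: "\<And>s w w'. (\<And>i. i \<notin> range c \<Longrightarrow> w i = w' i) \<Longrightarrow> \<rho> s w = \<rho> s w'"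
  shows "alt N (\<lambda>w. \<Sum>m\<in>UNIV. \<phi> (w (c k)) m *
    \<delta> m (\<lambda>y. \<Prod>s\<in>UNIV - {k}. \<Sum>i\<in>UNIV. (\<rho> s w v* M y) $ i * \<phi> (w (c s)) i) z) v = 0"
    (is "alt N ?Y v = 0")
proof -
  let ?t = "\<lambda>p. map_permutation UNIV c p"
  let ?P = "{p. p permutes (UNIV :: 'n set)}"
  have t: "?t p permutes {..<N}" "sign (?t p) = sign p" "?t p (c s) = c (p s)" "i \<notin> range c \<Longrightarrow> ?t p i = i"
    if p: "p permutes UNIV" for p s i
  proof -
    have *: "?t p permutes range c"
      by (rule map_permutation_permutes[OF _ p]) (use c(1) in \<open>simp add: bij_betw_def\<close>)
    then show "?t p permutes {..<N}" by (rule permutes_subset[OF _ c(2)])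
    show "sign (?t p) = sign p" by (rule sign_map_permutation[OF c(1) p]) simp
    show "?t p (c s) = c (p s)" by (rule map_permutation_apply[OF c(1)]) simp
    show "i \<notin> range c \<Longrightarrow> ?t p i = i" by (rule permutes_not_in[OF *])
  qed
  have step: "(\<Sum>p\<in>?P. of_int (sign p) * ?Y (\<lambda>i. w (?t p i))) = 0" for w
  proof -
    define W where "W = (\<chi> s i. \<phi> (w (c s)) i)"
    define F where "F = (\<lambda>p y. \<Prod>s\<in>UNIV - {k}. \<Sum>i\<in>UNIV. (\<rho> s w v* M y) $ i * W $ p s $ i)"
    define cd where "cd = (\<lambda>j. det (\<chi> s. if s = k then axis j 1 else \<rho> s w))"
    have dF: "F p differentiable at z" for p
    proof -
      interpret derivation "\<delta> k" by (rule der)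
      have "(\<lambda>y. \<Sum>i\<in>UNIV. (\<rho> s w v* M y) $ i * W $ p s $ i) differentiable at z" for s
        using M unfolding vector_matrix_mult_def mat_differentiable_def
        by (auto intro!: differentiable_sum differentiable_mult)
      then show ?thesis unfolding F_def
        by (intro conjunct1[OF prod]) auto
    qed
    have Y: "?Y (\<lambda>i. w (?t p i)) = (\<Sum>m\<in>UNIV. W $ p k $ m * \<delta> m (F p) z)" if p: "p permutes UNIV" for p
    proof -
      have "\<rho> s (\<lambda>i. w (?t p i)) = \<rho> s w" for s by (rule \<rho>) (simp add: t(4)[OF p])
      then show ?thesis by (simp add: t(3)[OF p] F_def W_def)
    qed
    have detF: "(\<Sum>p\<in>?P. of_int (sign p) * W $ p k $ m * F p y) = (\<Sum>j\<in>UNIV. (cd j * det W) * (det (M y) * K y $ m $ j))"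
      if y: "y \<in> S" for y m
    proof -
      define N' where "N' = (\<chi> s. if s = k then axis m 1 else \<rho> s w v* M y)"
      have "(\<Sum>p\<in>?P. of_int (sign p) * W $ p k $ m * F p y) = det (N' ** transpose W)"
        unfolding det_def
      proof (rule sum.cong[OF refl])
        fix p
        have "(\<Prod>s\<in>UNIV. (N' ** transpose W) $ s $ p s) = (N' ** transpose W) $ k $ p k * (\<Prod>s\<in>UNIV - {k}. (N' ** transpose W) $ s $ p s)"
          by (rule prod.remove) auto
        also have "(N' ** transpose W) $ k $ p k = W $ p k $ m"
          by (simp add: N'_def matrix_matrix_mult_def transpose_def axis_def if_distrib[of "\<lambda>x. x * _"] cong: if_cong)
        also have "(\<Prod>s\<in>UNIV - {k}. (N' ** transpose W) $ s $ p s) = F p y"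
          unfolding F_def by (rule prod.cong) (auto simp: N'_def matrix_matrix_mult_def transpose_def)
        finally show "of_int (sign p) * W $ p k $ m * F p y = of_int (sign p) * (\<Prod>s\<in>UNIV. (N' ** transpose W) $ s $ p s)"
          by simp
      qed
      also have "\<dots> = det N' * det W" by (simp add: det_mul det_transpose)
      \<comment> \<open>The unit row m is row m of K times M. So M splits off and leaves a
        determinant linear in row m of K, whose coefficients \<open>cd j\<close> do not depend on
        y.\<close>
      also have "N' = (\<chi> s. if s = k then K y $ m else \<rho> s w) ** M y"
      proof -
        have "K y $ m v* M y = axis m 1"
          using S(3)[OF y] unfolding vec_eq_iff
          by (auto simp: vector_matrix_mult_def matrix_matrix_mult_def mat_def axis_def mult.commute)
        moreover have "(A ** M y) $ s = A $ s v* M y" for A :: "complex^'n^'n" and s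
          by (simp add: vec_eq_iff vector_matrix_mult_def matrix_matrix_mult_def mult.commute)
        ultimately show ?thesis unfolding N'_def by (simp add: vec_eq_iff[where 'b='n])
      qed
      also have "det \<dots> = (\<Sum>j\<in>UNIV. K y $ m $ j * cd j) * det (M y)"
        unfolding det_mul det_row_expand[of k "K y $ m"] cd_def ..
      finally show ?thesis by (simp add: sum_distrib_left sum_distrib_right mult_ac)
    qed
    have "(\<Sum>p\<in>?P. of_int (sign p) * ?Y (\<lambda>i. w (?t p i))) = (\<Sum>p\<in>?P. \<Sum>m\<in>UNIV. of_int (sign p) * W $ p k $ m * \<delta> m (F p) z)"
      by (rule sum.cong[OF refl]) (subst Y, auto simp: sum_distrib_left mult.assoc)
    also have "\<dots> = (\<Sum>m\<in>UNIV. \<Sum>p\<in>?P. of_int (sign p) * W $ p k $ m * \<delta> m (F p) z)" by (rule sum.swap)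
    also have "\<dots> = (\<Sum>m\<in>UNIV. \<Sum>j\<in>UNIV. (cd j * det W) * \<delta> m (\<lambda>y. det (M y) * K y $ m $ j) z)"
    proof (rule sum.cong[OF refl])
      fix m
      interpret derivation "\<delta> m" by (rule der)
      have "(\<Sum>p\<in>?P. of_int (sign p) * W $ p k $ m * \<delta> m (F p) z) = \<delta> m (\<lambda>y. \<Sum>p\<in>?P. of_int (sign p) * W $ p k $ m * F p y) z"
        by (subst sum) (auto intro!: differentiable_mult dF simp: cmult[OF dF])
      also have "\<dots> = \<delta> m (\<lambda>y. \<Sum>j\<in>UNIV. (cd j * det W) * (det (M y) * K y $ m $ j)) z"
        by (rule cong[OF S(1,2) detF])
      also have "\<dots> = (\<Sum>j\<in>UNIV. (cd j * det W) * \<delta> m (\<lambda>y. det (M y) * K y $ m $ j) z)"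
      proof -
        have d: "(\<lambda>y. (cd j * det W) * (det (M y) * K y $ m $ j)) differentiable at z" for j
          by (intro differentiable_mult differentiable_const dK)
        show ?thesis by (simp only: sum[OF d] cmult[OF dK])
      qed
      finally show "(\<Sum>p\<in>?P. of_int (sign p) * W $ p k $ m * \<delta> m (F p) z) = (\<Sum>j\<in>UNIV. (cd j * det W) * \<delta> m (\<lambda>y. det (M y) * K y $ m $ j) z)" .
    qed
    also have "\<dots> = (\<Sum>j\<in>UNIV. \<Sum>m\<in>UNIV. (cd j * det W) * \<delta> m (\<lambda>y. det (M y) * K y $ m $ j) z)" by (rule sum.swap)
    also have "\<dots> = 0" by (simp add: div flip: sum_distrib_left)
    finally show ?thesis .
  qed
  \<comment> \<open>Permuting the selected slots changes the alternation only by a sign, so it may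
    be replaced by a signed average over these permutations, which vanishes by
    \<open>step\<close>.\<close>
  have "of_nat (card ?P) * alt N ?Y v = (\<Sum>p\<in>?P. of_int (sign p) * (of_int (sign p) * alt N ?Y v))"
    by (simp add: sign_square flip: mult.assoc)
  also have "\<dots> = (\<Sum>p\<in>?P. of_int (sign p) * alt N (\<lambda>w. ?Y (\<lambda>i. w (?t p i))) v)"
  proof (rule sum.cong[OF refl])
    fix p assume "p \<in> ?P"
    then have p: "p permutes UNIV" by simp
    show "of_int (sign p) * (of_int (sign p) * alt N ?Y v) = of_int (sign p) * alt N (\<lambda>w. ?Y (\<lambda>i. w (?t p i))) v"
      using alt_permute[OF t(1)[OF p], of ?Y v] unfolding t(2)[OF p] by simp
  qed
  also have "\<dots> = alt N (\<lambda>w. \<Sum>p\<in>?P. of_int (sign p) * ?Y (\<lambda>i. w (?t p i))) v"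
    unfolding alt_sum alt_cmult ..
  also have "\<dots> = 0" unfolding step by (simp add: alt_def)
  finally show ?thesis by (simp add: card_permutations[OF refl])
qed

text \<open>A value of the Hermitian form as a row times a matrix, paired with either argument: the
  two shapes in which \<open>alt_vanish\<close> is applied.\<close>

lemma herm_form_vector_matrix:
  "herm_form M x y = (\<Sum>i\<in>UNIV. ((\<chi> j. cnj (y $ j)) v* transpose M) $ i * x $ i)"
  "herm_form M x y = (\<Sum>j\<in>UNIV. (x v* M) $ j * cnj (y $ j))"
proof -
  show "herm_form M x y = (\<Sum>i\<in>UNIV. ((\<chi> j. cnj (y $ j)) v* transpose M) $ i * x $ i)"
    unfolding herm_form_def by (simp add: vector_matrix_mult_def transpose_def sum_distrib_left sum_distrib_right mult_ac)
  show "herm_form M x y = (\<Sum>j\<in>UNIV. (x v* M) $ j * cnj (y $ j))"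
    unfolding herm_form_def by (subst sum.swap) (simp add: vector_matrix_mult_def sum_distrib_left sum_distrib_right mult_ac)
qed

text \<open>The coefficients of the \<open>(n-1)\<close>-st power of the fundamental form are the cofactors
  of the metric, so closedness follows once the rows of the adjugate are divergence free.\<close>

lemma ext_deriv_power_eq_0:
  fixes G K :: "complex^'n \<Rightarrow> complex^'n^'n"
  assumes S: "open S" "z \<in> S" "\<And>y. y \<in> S \<Longrightarrow> K y ** G y = mat 1"
    and G: "mat_differentiable G z" and K: "mat_differentiable K z" and D: "(\<lambda>y. det (G y)) differentiable at z"
    and div: "\<And>j. (\<Sum>m\<in>UNIV. d_z m (\<lambda>y. det (G y) * K y $ j $ m) z) = 0"
    and divbar: "\<And>j. (\<Sum>m\<in>UNIV. d_zbar m (\<lambda>y. det (G y) * K y $ m $ j) z) = 0"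
    and card: "CARD('n) = Suc k"
  shows "ext_deriv (2 * k) (\<lambda>y. wedge_power2 (fundamental_form (G y)) k) z v = 0"
proof -
  \<comment> \<open>One index is set aside for slot 0, the direction of the derivative. The others
    are numbered by e, and s owns the slots 2 e s + 1 and 2 e s + 2, the pair with number e s moved
    up by one.\<close>
  define o' :: 'n where "o' = undefined"
  have "card (UNIV - {o'}) = card {..<k}" using card by (simp add: card_Diff_singleton)
  then obtain e where e: "bij_betw e (UNIV - {o'}) {..<k}"
    using finite_same_card_bij[of "UNIV - {o'}" "{..<k}"] by auto
  have e_lt: "e s < k" if "s \<noteq> o'" for s using e that by (auto simp: bij_betw_def)
  have e_inj: "e s = e s' \<longleftrightarrow> s = s'" if "s \<noteq> o'" "s' \<noteq> o'" for s s'
    using e that by (auto simp: bij_betw_def inj_on_def)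
  define F where "F = (\<lambda>w y. pair_monomial k (herm_form (G y)) (\<lambda>j. w (Suc j)))"
  have F: "F w y = (\<Prod>s\<in>UNIV - {o'}. herm_form (G y) (w (2 * e s + 1)) (w (2 * e s + 2)))" for w y
    unfolding F_def pair_monomial_def by (subst prod.reindex_bij_betw[OF e, symmetric]) simp
  have dG: "(\<lambda>y. G y $ i $ j) differentiable at z" for i j using G by (simp add: mat_differentiable_def)
  have dH: "(\<lambda>y. herm_form (G y) x x') differentiable at z" for x x'
    unfolding herm_form_def by (intro differentiable_sum differentiable_mult differentiable_const dG finite ballI)
  have dpm: "(\<lambda>y. pair_monomial k (herm_form (G y)) w) differentiable at z" for w
    unfolding pair_monomial_def by (rule conjunct1[OF dz.prod]) (auto simp: dH)
  define Y where "Y = (\<lambda>w. frechet_derivative (F w) (at z) (w 0))"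
  have dF: "F w differentiable at z" for w unfolding F_def by (rule dpm)
  have "ext_deriv (2 * k) (\<lambda>y. wedge_power2 (fundamental_form (G y)) k) z v
     = (\<Sum>i\<le>2 * k. (- 1) ^ i * (\<i> ^ k * alt (2 * k) (\<lambda>w. Y (case_nat (v i) w)) (\<lambda>j. if j < i then v j else v (Suc j))))"
    unfolding ext_deriv_def
  proof (rule sum.cong[OF refl])
    fix i
    let ?v = "\<lambda>j. if j < i then v j else v (Suc j)"
    have "((\<lambda>y. wedge_power2 (fundamental_form (G y)) k ?v) has_derivative
       (\<lambda>x. \<i> ^ k * (\<Sum>\<sigma> | \<sigma> permutes {..<2 * k}. of_int (sign \<sigma>) * frechet_derivative (\<lambda>y. pair_monomial k (herm_form (G y)) (\<lambda>i. ?v (\<sigma> i))) (at z) x))) (at z)"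
      unfolding wedge_power_alt alt_def
      by (intro has_derivative_mult_right has_derivative_sum frechet_derivative_works' dpm)
    from frechet_derivative_at[OF this, symmetric]
    have "frechet_derivative (\<lambda>y. wedge_power2 (fundamental_form (G y)) k ?v) (at z) (v i)
      = \<i> ^ k * (\<Sum>\<sigma> | \<sigma> permutes {..<2 * k}. of_int (sign \<sigma>) * frechet_derivative (\<lambda>y. pair_monomial k (herm_form (G y)) (\<lambda>i. ?v (\<sigma> i))) (at z) (v i))"
      by (simp only:)
    then show "(- 1) ^ i * frechet_derivative (\<lambda>y. wedge_power2 (fundamental_form (G y)) k ?v) (at z) (v i)
      = (- 1) ^ i * (\<i> ^ k * alt (2 * k) (\<lambda>w. Y (case_nat (v i) w)) ?v)"
      by (simp only: alt_def Y_def F_def nat.case)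
  qed
  also have "\<dots> = \<i> ^ k * (\<Sum>i\<le>2 * k. (- 1) ^ i * alt (2 * k) (\<lambda>w. Y (case_nat (v i) w)) (\<lambda>j. if j < i then v j else v (Suc j)))"
    by (simp add: sum_distrib_left mult_ac)
  also have "\<dots> = \<i> ^ k * alt (Suc (2 * k)) Y v" unfolding alt_Suc ..
  also have "Y = (\<lambda>w. (\<Sum>m\<in>UNIV. w 0 $ m * d_z m (F w) z) + (\<Sum>m\<in>UNIV. cnj (w 0 $ m) * d_zbar m (F w) z))"
    unfolding Y_def by (simp add: frechet_derivative_wirtinger[OF dF] sum.distrib)
  also have "alt (Suc (2 * k)) \<dots> v = 0"
  proof -
    \<comment> \<open>Besides slot 0, c takes the first arguments of all Hermitian forms, in which
      they are linear, and c' the second arguments, in which they are conjugate linear.\<close>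
    define c where "c = (\<lambda>s. if s = o' then 0 else 2 * e s + 1)"
    define c' where "c' = (\<lambda>s. if s = o' then 0 else 2 * e s + 2)"
    have c: "inj c" and c': "inj c'"
      by (rule injI; auto simp: c_def c'_def e_inj split: if_splits)+
    have lt: "c s < Suc (2 * k)" "c' s < Suc (2 * k)" for s
      using e_lt[of s] by (auto simp: c_def c'_def)
    then have rc: "range c \<subseteq> {..<Suc (2 * k)}" "range c' \<subseteq> {..<Suc (2 * k)}"
      by (auto simp: image_subset_iff)
    have parity: "2 * a + 2 \<noteq> 2 * b + (1::nat)" for a b by presburger
    have nc: "2 * e s + 2 \<notin> range c" for s
    proof
      assume "2 * e s + 2 \<in> range c"
      then obtain x where "2 * e s + 2 = c x" by blast
      then show False using parity[of "e s" "e x"] by (simp add: c_def split: if_splits)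
    qed
    have nc': "2 * e s + 1 \<notin> range c'" for s
    proof
      assume "2 * e s + 1 \<in> range c'"
      then obtain x where "2 * e s + 1 = c' x" by blast
      then show False using parity[of "e x" "e s"] by (simp add: c'_def split: if_splits)
    qed
    have dT: "mat_differentiable (\<lambda>y. transpose (G y)) z" using G by (simp add: mat_differentiable_def transpose_def)
    have dK: "(\<lambda>y. det (G y) * K y $ i $ j) differentiable at z" for i j
      using K D by (simp add: mat_differentiable_def)
    \<comment> \<open>In the \<open>d_z\<close> half the permuted slots are first arguments. The
      conjugated second arguments then serve as rows, which transposes G and K; the
      \<open>d_zbar\<close> half is without transposition.\<close>
    have "alt (Suc (2 * k)) (\<lambda>w. \<Sum>m\<in>UNIV. w (c o') $ m *
      d_z m (\<lambda>y. \<Prod>s\<in>UNIV - {o'}. \<Sum>i\<in>UNIV. ((if s = o' then 0 else (\<chi> j. cnj (w (2 * e s + 2) $ j))) v* transpose (G y)) $ i * w (c s) $ i) z) v = 0"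
    proof (rule alt_vanish[where K="\<lambda>y. transpose (K y)" and \<phi>="\<lambda>x m. x $ m" and c=c and S=S and z=z, OF derivation_d_z S(1,2)])
      show "transpose (K y) ** transpose (G y) = mat 1" if "y \<in> S" for y
        using S(3)[OF that] by (metis matrix_left_right_inverse matrix_transpose_mul transpose_mat)
      show "(\<lambda>y. det (transpose (G y)) * transpose (K y) $ m $ j) differentiable at z" for m j
        using dK[of j m] by (simp add: det_transpose) (simp add: transpose_def)
      show "(\<Sum>m\<in>UNIV. d_z m (\<lambda>y. det (transpose (G y)) * transpose (K y) $ m $ j) z) = 0" for j
        using div[of j] by (simp add: det_transpose) (simp add: transpose_def)
    next
      fix s and w w' :: "nat \<Rightarrow> complex^'n" assume w: "\<And>i. i \<notin> range c \<Longrightarrow> w i = w' i"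
      show "(if s = o' then 0 else (\<chi> j. cnj (w (2 * e s + 2) $ j))) = (if s = o' then 0 else (\<chi> j. cnj (w' (2 * e s + 2) $ j)))"
        using w[OF nc[of s]] by auto
    qed (use c rc dT in auto)
    moreover have "(\<lambda>y. \<Prod>s\<in>UNIV - {o'}. \<Sum>i\<in>UNIV. ((if s = o' then 0 else (\<chi> j. cnj (w (2 * e s + 2) $ j))) v* transpose (G y)) $ i * w (c s) $ i) = F w" for w
      unfolding F herm_form_vector_matrix(1) by (auto simp: c_def fun_eq_iff intro!: prod.cong)
    ultimately have 1: "alt (Suc (2 * k)) (\<lambda>w. \<Sum>m\<in>UNIV. w 0 $ m * d_z m (F w) z) v = 0"
      by (simp add: c_def)
    have "alt (Suc (2 * k)) (\<lambda>w. \<Sum>m\<in>UNIV. cnj (w (c' o') $ m) *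
      d_zbar m (\<lambda>y. \<Prod>s\<in>UNIV - {o'}. \<Sum>i\<in>UNIV. ((if s = o' then 0 else w (2 * e s + 1)) v* G y) $ i * cnj (w (c' s) $ i)) z) v = 0"
    proof (rule alt_vanish[where K=K and \<phi>="\<lambda>x m. cnj (x $ m)" and c=c' and S=S and z=z, OF derivation_d_zbar S])
      fix s and w w' :: "nat \<Rightarrow> complex^'n" assume w: "\<And>i. i \<notin> range c' \<Longrightarrow> w i = w' i"
      show "(if s = o' then 0 else w (2 * e s + 1)) = (if s = o' then 0 else w' (2 * e s + 1))"
        using w[OF nc'[of s]] by auto
    qed (use c' rc dK divbar G in auto)
    moreover have "(\<lambda>y. \<Prod>s\<in>UNIV - {o'}. \<Sum>i\<in>UNIV. ((if s = o' then 0 else w (2 * e s + 1)) v* G y) $ i * cnj (w (c' s) $ i)) = F w" for w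
      unfolding F herm_form_vector_matrix(2) by (auto simp: c'_def fun_eq_iff intro!: prod.cong)
    ultimately have 2: "alt (Suc (2 * k)) (\<lambda>w. \<Sum>m\<in>UNIV. cnj (w 0 $ m) * d_zbar m (F w) z) v = 0"
      by (simp add: c'_def)
    show ?thesis unfolding alt_add 1 2 by simp
  qed
  finally show ?thesis by simp
qed

section \<open>The two traces of a curvature tensor as an average of holomorphic sectional curvatures\<close>

definition quad_form :: "('n \<Rightarrow> 'n \<Rightarrow> 'n \<Rightarrow> 'n \<Rightarrow> complex) \<Rightarrow> complex^'n \<Rightarrow> complex^'n \<Rightarrow> complex^'n \<Rightarrow> complex^'n::finite \<Rightarrow> complex" where
  "quad_form T x y z w = (\<Sum>i\<in>UNIV. \<Sum>j\<in>UNIV. \<Sum>k\<in>UNIV. \<Sum>l\<in>UNIV. T i j k l * x $ i * cnj (y $ j) * z $ k * cnj (w $ l))"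

lemma quad_form_add:
  "quad_form T (x + x') y z w = quad_form T x y z w + quad_form T x' y z w"
  "quad_form T x (y + y') z w = quad_form T x y z w + quad_form T x y' z w"
  "quad_form T x y (z + z') w = quad_form T x y z w + quad_form T x y z' w"
  "quad_form T x y z (w + w') = quad_form T x y z w + quad_form T x y z w'"
  unfolding quad_form_def by (simp_all add: algebra_simps sum.distrib)

lemma quad_form_scale:
  "quad_form T (c *s x) y z w = c * quad_form T x y z w"
  "quad_form T x (c *s y) z w = cnj c * quad_form T x y z w"
  "quad_form T x y (c *s z) w = c * quad_form T x y z w"
  "quad_form T x y z (c *s w) = cnj c * quad_form T x y z w"
  unfolding quad_form_def by (simp_all add: sum_distrib_left mult_ac)

definition mixed :: "('n \<Rightarrow> 'n \<Rightarrow> 'n \<Rightarrow> 'n \<Rightarrow> complex) \<Rightarrow> complex^'n \<Rightarrow> complex^'n::finite \<Rightarrow> complex" where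
  "mixed T v e = quad_form T v v e e + quad_form T e e v v + quad_form T v e e v + quad_form T e v v e"

text \<open>The mean of the diagonal values of \<open>quad_form T\<close> at v + \<Sum> \<theta>_a E
  a, over independent fourth roots of unity \<theta>_a. Only terms in which each \<theta>_a meets
  its own conjugate survive, and the mean of the square of \<theta>_a is zero. The final sum removes
  the terms with four equal indices, which the double sum counts twice.\<close>

definition frame_avg :: "('n \<Rightarrow> 'n \<Rightarrow> 'n \<Rightarrow> 'n \<Rightarrow> complex) \<Rightarrow> (nat \<Rightarrow> complex^'n::finite) \<Rightarrow> nat \<Rightarrow> complex^'n \<Rightarrow> complex" where
  "frame_avg T E N v = quad_form T v v v v + (\<Sum>a<N. mixed T v (E a))
     + (\<Sum>a<N. \<Sum>c<N. quad_form T (E a) (E a) (E c) (E c) + quad_form T (E a) (E c) (E c) (E a))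
     - (\<Sum>a<N. quad_form T (E a) (E a) (E a) (E a))"

lemma mixed_avg:
  "mixed T (v + e) x + mixed T (v + \<i> *s e) x + mixed T (v + (-1) *s e) x + mixed T (v + (-\<i>) *s e) x
    = 4 * (mixed T v x + mixed T e x)"
  unfolding mixed_def quad_form_add quad_form_scale by (simp add: algebra_simps)

lemma quad_form_avg:
  "quad_form T (v + e) (v + e) (v + e) (v + e)
   + quad_form T (v + \<i> *s e) (v + \<i> *s e) (v + \<i> *s e) (v + \<i> *s e)
   + quad_form T (v + (-1) *s e) (v + (-1) *s e) (v + (-1) *s e) (v + (-1) *s e)
   + quad_form T (v + (-\<i>) *s e) (v + (-\<i>) *s e) (v + (-\<i>) *s e) (v + (-\<i>) *s e)
    = 4 * (quad_form T v v v v + quad_form T e e e e + mixed T v e)"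
  unfolding mixed_def quad_form_add quad_form_scale by (simp add: algebra_simps)

text \<open>The mean over one further root of unity. Unfolded down to N = 0 it presents
  \<open>frame_avg\<close> as a mean of diagonal values, whence its sign.\<close>

lemma frame_avg_Suc:
  "4 * frame_avg T E (Suc N) v = frame_avg T E N (v + E N) + frame_avg T E N (v + \<i> *s E N)
     + frame_avg T E N (v + (-1) *s E N) + frame_avg T E N (v + (-\<i>) *s E N)"
proof -
  let ?e = "E N"
  let ?H = "\<lambda>v. quad_form T v v v v"
  let ?R = "(\<Sum>a<N. \<Sum>c<N. quad_form T (E a) (E a) (E c) (E c) + quad_form T (E a) (E c) (E c) (E a))
     - (\<Sum>a<N. ?H (E a))"
  have "(\<Sum>a<N. mixed T (v + ?e) (E a)) + (\<Sum>a<N. mixed T (v + \<i> *s ?e) (E a)) + (\<Sum>a<N. mixed T (v + (-1) *s ?e) (E a)) + (\<Sum>a<N. mixed T (v + (-\<i>) *s ?e) (E a))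
     = 4 * ((\<Sum>a<N. mixed T v (E a)) + (\<Sum>a<N. mixed T ?e (E a)))"
    unfolding sum.distrib[symmetric] mixed_avg sum_distrib_left[symmetric] ..
  with quad_form_avg[of T v ?e]
  have "frame_avg T E N (v + E N) + frame_avg T E N (v + \<i> *s E N)
     + frame_avg T E N (v + (-1) *s E N) + frame_avg T E N (v + (-\<i>) *s E N)
     = 4 * (?H v + ?H ?e + mixed T v ?e + (\<Sum>a<N. mixed T v (E a)) + (\<Sum>a<N. mixed T ?e (E a)) + ?R)"
    unfolding frame_avg_def by (simp only: algebra_simps) algebra
  also have "(\<Sum>a<N. mixed T ?e (E a)) = (\<Sum>a<N. quad_form T (E a) (E a) ?e ?e + quad_form T (E a) ?e ?e (E a))
      + (\<Sum>c<N. quad_form T ?e ?e (E c) (E c) + quad_form T ?e (E c) (E c) ?e)"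
    unfolding mixed_def sum.distrib[symmetric] by (simp add: algebra_simps)
  finally show ?thesis unfolding frame_avg_def
    by (simp add: sum.distrib algebra_simps)
qed

lemma frame_avg_nonneg:
  assumes "\<And>v. quad_form T v v v v \<in> \<real>\<^sub>\<ge>\<^sub>0"
  shows "frame_avg T E N v \<in> \<real>\<^sub>\<ge>\<^sub>0"
proof (induction N arbitrary: v)
  case 0
  then show ?case using assms by (simp add: frame_avg_def)
next
  case (Suc N)
  have "4 * frame_avg T E (Suc N) v \<in> \<real>\<^sub>\<ge>\<^sub>0"
    unfolding frame_avg_Suc by (intro nonneg_Reals_add_I Suc.IH)
  then show ?case by (simp add: complex_nonneg_Reals_iff)
qed

text \<open>The vectors may be dependent and N may exceed the dimension, which leaves room for
  prescribing the direction of one of them.\<close>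

definition frame_of :: "complex^'n^'n::finite \<Rightarrow> (nat \<Rightarrow> complex^'n) \<Rightarrow> nat \<Rightarrow> bool" where
  "frame_of M E N \<longleftrightarrow> (\<forall>i j. M $ i $ j = (\<Sum>a<N. cnj (E a $ i) * E a $ j))"

definition two_traces :: "complex^'n^'n::finite \<Rightarrow> ('n \<Rightarrow> 'n \<Rightarrow> 'n \<Rightarrow> 'n \<Rightarrow> complex) \<Rightarrow> complex" where
  "two_traces M T = (\<Sum>i\<in>UNIV. \<Sum>j\<in>UNIV. \<Sum>k\<in>UNIV. \<Sum>l\<in>UNIV.
     (M $ j $ i * M $ l $ k + M $ l $ i * M $ j $ k) * T i j k l)"

text \<open>At v = 0 the mean yields both contractions minus the diagonal values at the frame
  vectors. Put back as a separate nonnegative sum, these values are what a vanishing trace will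
  control.\<close>

lemma two_traces_frame:
  assumes E: "frame_of M E N"
  shows "two_traces M T = frame_avg T E N 0 + (\<Sum>a<N. quad_form T (E a) (E a) (E a) (E a))"
proof -
  have "(M $ j $ i * M $ l $ k + M $ l $ i * M $ j $ k) * T i j k l
    = (\<Sum>a<N. \<Sum>c<N. T i j k l * E a $ i * cnj (E a $ j) * E c $ k * cnj (E c $ l)
         + T i j k l * E a $ i * cnj (E c $ j) * E c $ k * cnj (E a $ l))" for i j k l
  proof -
    have M: "M $ i $ j = (\<Sum>a<N. cnj (E a $ i) * E a $ j)" for i j using E by (simp add: frame_of_def)
    show ?thesis unfolding M sum_product distrib_right sum_distrib_right sum.distrib
      by (simp add: sum_distrib_left mult_ac)
  qed
  then have "two_traces M T = (\<Sum>a<N. \<Sum>c<N. \<Sum>i\<in>UNIV. \<Sum>j\<in>UNIV. \<Sum>k\<in>UNIV. \<Sum>l\<in>UNIV.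
     T i j k l * E a $ i * cnj (E a $ j) * E c $ k * cnj (E c $ l)
         + T i j k l * E a $ i * cnj (E c $ j) * E c $ k * cnj (E a $ l))"
    unfolding two_traces_def by (simp only: sum.swap[where A=UNIV and B="{..<N}"])
  also have "\<dots> = (\<Sum>a<N. \<Sum>c<N. quad_form T (E a) (E a) (E c) (E c) + quad_form T (E a) (E c) (E c) (E a))"
    unfolding quad_form_def sum.distrib ..
  also have "\<dots> = frame_avg T E N 0 + (\<Sum>a<N. quad_form T (E a) (E a) (E a) (E a))"
    by (simp add: frame_avg_def mixed_def quad_form_def)
  finally show ?thesis .
qed

section \<open>Frames of a positive definite matrix\<close>

lemma herm_form_diff_scale:
  "herm_form M (x - c *s w) (x - c *s w) = herm_form M x x - c * herm_form M w x - cnj c * herm_form M x w + c * cnj c * herm_form M w w"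
  unfolding herm_form_def by (simp add: algebra_simps sum.distrib sum_subtractf sum_distrib_left)

lemma herm_form_cnj:
  assumes "\<And>i j. M $ j $ i = cnj (M $ i $ j)"
  shows "cnj (herm_form M x y) = herm_form M y x"
proof -
  have "cnj (herm_form M x y) = (\<Sum>i\<in>UNIV. \<Sum>j\<in>UNIV. cnj (M $ i $ j) * cnj (x $ i) * y $ j)"
    by (simp add: herm_form_def)
  also have "\<dots> = (\<Sum>i\<in>UNIV. \<Sum>j\<in>UNIV. M $ j $ i * y $ j * cnj (x $ i))"
    unfolding assms[symmetric] by (simp add: mult_ac)
  also have "\<dots> = herm_form M y x" unfolding herm_form_def by (rule sum.swap)
  finally show ?thesis .
qed

lemma herm_form_axis:
  "herm_form M x (axis k 1) = (\<Sum>i\<in>UNIV. M $ i $ k * x $ i)" "herm_form M (axis k 1) y = (\<Sum>j\<in>UNIV. M $ k $ j * cnj (y $ j))"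
proof -
  have 1: "(\<Sum>j\<in>UNIV. f j * cnj (axis k 1 $ j)) = f k" for f :: "'a \<Rightarrow> complex"
    by (simp add: axis_def if_distrib[of cnj] if_distrib[of "\<lambda>x. _ * x"] cong: if_cong)
  show "herm_form M x (axis k 1) = (\<Sum>i\<in>UNIV. M $ i $ k * x $ i)"
    unfolding herm_form_def 1 ..
  have 2: "(\<Sum>i\<in>UNIV. axis k 1 $ i * f i) = f k" for f :: "'a \<Rightarrow> complex"
    by (simp add: axis_def if_distrib[of "\<lambda>x. x * _"] cong: if_cong)
  show "herm_form M (axis k 1) y = (\<Sum>j\<in>UNIV. M $ k $ j * cnj (y $ j))"
    unfolding herm_form_def using 2[of "\<lambda>i. \<Sum>j\<in>UNIV. M $ i $ j * cnj (y $ j)"]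
    by (simp add: sum_distrib_left mult_ac)
qed

text \<open>Gaussian elimination, one index at a time. Matrices supported on J, positive on vectors
  supported on J, take the place of submatrices, so the index type stays fixed during the
  induction.\<close>

lemma frame_exists_supported:
  fixes M :: "complex^'n^'n"
  assumes "finite J"
  shows "(\<And>i j. M $ j $ i = cnj (M $ i $ j)) \<Longrightarrow> (\<And>i j. i \<notin> J \<Longrightarrow> M $ i $ j = 0) \<Longrightarrow>
    (\<And>v. v \<noteq> 0 \<Longrightarrow> (\<And>i. i \<notin> J \<Longrightarrow> v $ i = 0) \<Longrightarrow> Re (herm_form M v v) > 0) \<Longrightarrow>
    \<exists>E N. frame_of M E N"
  using assms
proof (induction J arbitrary: M rule: finite_induct)
  case empty
  have "frame_of M (\<lambda>_. 0) 0" using empty(2) by (simp add: frame_of_def)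
  then show ?case by blast
next
  case (insert x J)
  note herm = insert.prems(1)
  define d where "d = Re (M $ x $ x)"
  have dM: "M $ x $ x = of_real d" using herm[of x x] by (simp add: d_def complex_eq_iff)
  have hx: "herm_form M (axis x 1) (axis x 1) = M $ x $ x"
    unfolding herm_form_axis by (simp add: axis_def if_distrib[of "\<lambda>x. _ * x"] cong: if_cong)
  have "Re (herm_form M (axis x 1) (axis x 1)) > 0"
    by (rule insert.prems(3)) (auto simp: axis_def vec_eq_iff)
  then have d: "d > 0" unfolding hx d_def .
  \<comment> \<open>The Schur complement of the entry at x. Its form at v is the form of M at v
    corrected by a multiple of \<open>axis x 1\<close>; since v is nonzero at some index other than
    x, the corrected vector is nonzero.\<close>
  define M' where "M' = (\<chi> i j. M $ i $ j - M $ i $ x * M $ x $ j / of_real d)"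
  have "\<exists>E N. frame_of M' E N"
  proof (rule insert.IH)
    fix i j show "M' $ j $ i = cnj (M' $ i $ j)"
      by (simp add: M'_def herm[of i j] herm[of x j] herm[of i x])
  next
    fix i j assume "i \<notin> J"
    then show "M' $ i $ j = 0"
      using insert.prems(2)[of i] d dM by (cases "i = x") (auto simp: M'_def)
  next
    fix v :: "complex^'n" assume v: "v \<noteq> 0" "\<And>i. i \<notin> J \<Longrightarrow> v $ i = 0"
    define s where "s = herm_form M v (axis x 1)"
    have cs: "herm_form M (axis x 1) v = cnj s" unfolding s_def herm_form_cnj[OF herm] ..
    have "herm_form M' v v = herm_form M v v - s * cnj s / of_real d"
    proof -
      have "herm_form M' v v = herm_form M v v - (\<Sum>i\<in>UNIV. \<Sum>j\<in>UNIV. (M $ i $ x * v $ i) * (M $ x $ j * cnj (v $ j))) / of_real d"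
        unfolding herm_form_def M'_def by (simp add: algebra_simps sum_subtractf sum_divide_distrib)
      moreover have "s = (\<Sum>i\<in>UNIV. M $ i $ x * v $ i)" unfolding s_def herm_form_axis ..
      moreover have "cnj s = (\<Sum>j\<in>UNIV. M $ x $ j * cnj (v $ j))" unfolding cs[symmetric] herm_form_axis ..
      ultimately show ?thesis by (simp only: sum_product)
    qed
    also have "\<dots> = herm_form M (v - (s / of_real d) *s axis x 1) (v - (s / of_real d) *s axis x 1)"
      unfolding herm_form_diff_scale cs hx dM s_def[symmetric] using d by (simp add: field_simps)
    finally have eq: "herm_form M' v v = herm_form M (v - (s / of_real d) *s axis x 1) (v - (s / of_real d) *s axis x 1)" .
    show "Re (herm_form M' v v) > 0"
      unfolding eq
    proof (rule insert.prems(3))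
      obtain i where i: "v $ i \<noteq> 0" using v(1) by (auto simp: vec_eq_iff)
      then have "i \<noteq> x" using v(2) insert(2) by auto
      then have "(v - (s / of_real d) *s axis x 1) $ i \<noteq> 0" using i by (simp add: axis_def)
      then show "v - (s / of_real d) *s axis x 1 \<noteq> 0" by (metis zero_index)
    next
      fix i assume "i \<notin> insert x J"
      then show "(v - (s / of_real d) *s axis x 1) $ i = 0" using v(2) by (simp add: axis_def)
    qed
  qed
  then obtain E N where E: "frame_of M' E N" by blast
  define e where "e = (\<chi> j. M $ x $ j / of_real (sqrt d))"
  have "frame_of M (E(N := e)) (Suc N)"
    unfolding frame_of_def
  proof (intro allI)
    fix i j
    have "cnj (e $ i) * e $ j = M $ i $ x * M $ x $ j / of_real d"
    proof -
      have "complex_of_real (sqrt d) * complex_of_real (sqrt d) = of_real d" using d by (simp flip: of_real_mult)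
      then show ?thesis by (simp add: e_def herm[of x i])
    qed
    then show "M $ i $ j = (\<Sum>a<Suc N. cnj ((E(N := e)) a $ i) * (E(N := e)) a $ j)"
    proof -
      have "M' $ i $ j = (\<Sum>a<N. cnj (E a $ i) * E a $ j)" using E by (simp add: frame_of_def)
      then have "M $ i $ j = (\<Sum>a<N. cnj (E a $ i) * E a $ j) + cnj (e $ i) * e $ j"
        unfolding \<open>cnj (e $ i) * e $ j = _\<close> by (simp add: M'_def algebra_simps)
      then show ?thesis by simp
    qed
  qed
  then show ?case by blast
qed

lemma pos_def_pos: "pos_def M \<Longrightarrow> v \<noteq> 0 \<Longrightarrow> Re (herm_form M v v) > 0"
  unfolding pos_def_def by blast

lemma pos_def_nonneg: "pos_def M \<Longrightarrow> Re (herm_form M v v) \<ge> 0"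
  using pos_def_pos[of M v] by (cases "v = 0") (simp_all add: herm_form_def)

text \<open>A small multiple of the rank one matrix of v is split off from M so that the rest stays
  positive definite. A frame of the rest, preceded by the rescaled v, is a frame of M.\<close>

lemma pos_def_frame_through:
  fixes M :: "complex^'n^'n"
  assumes M: "pos_def M"
  shows "\<exists>E N c. frame_of M E N \<and> N > 0 \<and> E 0 = c *s v \<and> c \<noteq> 0"
proof -
  have herm: "M $ j $ i = cnj (M $ i $ j)" for i j using pos_def_sym[OF M] by simp
  \<comment> \<open>The vector that represents pairing with v in the metric M:
    \<open>herm_form M y w\<close> is \<open>ell y\<close>.\<close>
  define w where "w = (\<chi> i. cnj ((matrix_inv M *v (\<chi> i. cnj (v $ i))) $ i))"
  have Mw: "(\<Sum>j\<in>UNIV. M $ i $ j * cnj (w $ j)) = cnj (v $ i)" for i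
  proof -
    have "M *v (matrix_inv M *v (\<chi> i. cnj (v $ i))) = (\<chi> i. cnj (v $ i))"
      unfolding matrix_vector_mul_assoc pos_def_inverse(2)[OF M] by simp
    then have "(M *v (matrix_inv M *v (\<chi> i. cnj (v $ i)))) $ i = cnj (v $ i)" by simp
    then show ?thesis by (subst (asm) matrix_vector_mult_def) (simp add: w_def)
  qed
  define ell where "ell = (\<lambda>y::complex^'n. \<Sum>i\<in>UNIV. cnj (v $ i) * y $ i)"
  have hw: "herm_form M y w = ell y" for y
    unfolding herm_form_def ell_def Mw[symmetric] by (simp add: sum_distrib_left sum_distrib_right mult_ac)
  define q where "q = Re (herm_form M w w)"
  have q0: "q \<ge> 0" unfolding q_def by (rule pos_def_nonneg[OF M])
  have real: "herm_form M y y = of_real (Re (herm_form M y y))" for y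
    using herm_form_cnj[OF herm, of y y] by (simp add: complex_eq_iff)
  \<comment> \<open>By Cauchy-Schwarz |ell y|^2 is at most q times the form of M at y, so any b with
    b q < 1 keeps M' positive; the summand 1 allows q = 0.\<close>
  define b where "b = 1 / (2 * (q + 1))"
  have b: "b > 0" using q0 by (simp add: b_def)
  define M' where "M' = (\<chi> i j. M $ i $ j - of_real b * cnj (v $ i) * v $ j)"
  have form: "herm_form M' y y = herm_form M y y - of_real (b * (norm (ell y))^2)" for y
  proof -
    have "herm_form M' y y = herm_form M y y - of_real b * (\<Sum>i\<in>UNIV. \<Sum>j\<in>UNIV. (cnj (v $ i) * y $ i) * (v $ j * cnj (y $ j)))"
      unfolding herm_form_def M'_def by (simp add: algebra_simps sum_subtractf sum_distrib_left)
    also have "(\<Sum>i\<in>UNIV. \<Sum>j\<in>UNIV. (cnj (v $ i) * y $ i) * (v $ j * cnj (y $ j))) = ell y * cnj (ell y)"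
      unfolding ell_def cnj_sum sum_product by simp
    finally show ?thesis by (simp only: of_real_mult complex_norm_square)
  qed
  have CS: "(norm (ell y))^2 \<le> Re (herm_form M y y) * q" for y
  proof (cases "w = 0")
    case True
    then have "ell y = 0" using hw[of y] by (simp add: herm_form_def)
    then show ?thesis using True by (simp add: q_def herm_form_def)
  next
    case False
    then have q: "q > 0" using pos_def_pos[OF M] by (simp add: q_def)
    have hww: "herm_form M w w = of_real q" unfolding q_def by (rule real)
    have hwy: "herm_form M w y = cnj (ell y)" unfolding hw[symmetric] herm_form_cnj[OF herm] ..
    let ?y = "y - (ell y / of_real q) *s w"
    have "Re (herm_form M ?y ?y) \<ge> 0"
      by (rule pos_def_nonneg[OF M])
    moreover have "herm_form M ?y ?y = herm_form M y y - ell y * cnj (ell y) / of_real q"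
      unfolding herm_form_diff_scale hw hwy hww[unfolded hw] using q by (simp add: field_simps)
    ultimately have "Re (herm_form M y y) - (norm (ell y))^2 / q \<ge> 0"
      unfolding complex_norm_square[symmetric] by (simp flip: of_real_power of_real_divide)
    then show ?thesis using q by (simp add: field_simps)
  qed
  have pos: "Re (herm_form M' y y) > 0" if y: "y \<noteq> 0" for y
  proof -
    have h: "Re (herm_form M y y) > 0" by (rule pos_def_pos[OF M y])
    have "b * (norm (ell y))^2 \<le> b * (Re (herm_form M y y) * q)"
      using CS b by (intro mult_left_mono) auto
    also have "\<dots> = Re (herm_form M y y) * (b * q)" by simp
    also have "\<dots> < Re (herm_form M y y) * 1"
      using h q0 by (intro mult_strict_left_mono) (auto simp: b_def field_simps)
    finally show ?thesis unfolding form by simp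
  qed
  have "\<exists>E N. frame_of M' E N"
  proof (rule frame_exists_supported[of UNIV])
    fix i j show "M' $ j $ i = cnj (M' $ i $ j)"
      by (simp add: M'_def pos_def_sym[OF M])
  qed (use pos in simp_all)
  then obtain E N where E: "frame_of M' E N" by blast
  have "frame_of M (case_nat (of_real (sqrt b) *s v) E) (Suc N)"
    unfolding frame_of_def
  proof (intro allI)
    fix i j
    have "complex_of_real (sqrt b) * complex_of_real (sqrt b) = of_real b" using b by (simp flip: of_real_mult)
    moreover have "cnj ((of_real (sqrt b) *s v) $ i) * (of_real (sqrt b) *s v) $ j
        = (complex_of_real (sqrt b) * complex_of_real (sqrt b)) * (cnj (v $ i) * v $ j)"
      by (simp add: mult_ac)
    ultimately have "M $ i $ j = cnj ((of_real (sqrt b) *s v) $ i) * (of_real (sqrt b) *s v) $ j + M' $ i $ j"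
      by (simp add: M'_def)
    also have "M' $ i $ j = (\<Sum>a<N. cnj (E a $ i) * E a $ j)" using E by (simp add: frame_of_def)
    finally show "M $ i $ j = (\<Sum>a<Suc N. cnj (case_nat (of_real (sqrt b) *s v) E a $ i) * case_nat (of_real (sqrt b) *s v) E a $ j)"
      by (subst sum.lessThan_Suc_shift) simp
  qed
  moreover have "complex_of_real (sqrt b) \<noteq> 0" using b by simp
  ultimately show ?thesis by (intro exI[of _ "case_nat (of_real (sqrt b) *s v) E"] exI[of _ "Suc N"] exI[of _ "complex_of_real (sqrt b)"]) auto
qed

text \<open>Both summands of \<open>two_traces_frame\<close> are nonnegative. If the total vanishes,
  so does the diagonal value at each frame vector, and the frame can be taken through any given
  v.\<close>

lemma two_traces_nonneg:
  assumes M: "pos_def M" and H: "\<And>v. quad_form T v v v v \<in> \<real>\<^sub>\<ge>\<^sub>0"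
  shows "two_traces M T \<in> \<real>\<^sub>\<ge>\<^sub>0"
    and "Re (two_traces M T) = 0 \<Longrightarrow> quad_form T v v v v = 0"
proof -
  obtain E N c where E: "frame_of M E N" "N > 0" "E 0 = c *s v" "c \<noteq> 0"
    using pos_def_frame_through[OF M] by blast
  have s: "(\<Sum>a<N. quad_form T (E a) (E a) (E a) (E a)) \<in> \<real>\<^sub>\<ge>\<^sub>0"
    using H by (induction N) (auto intro: nonneg_Reals_add_I)
  show "two_traces M T \<in> \<real>\<^sub>\<ge>\<^sub>0"
    unfolding two_traces_frame[OF E(1)] by (intro nonneg_Reals_add_I frame_avg_nonneg H s)
  assume "Re (two_traces M T) = 0"
  then have "Re (\<Sum>a<N. quad_form T (E a) (E a) (E a) (E a)) = 0"
    using s frame_avg_nonneg[OF H, of E N 0] unfolding two_traces_frame[OF E(1)] by (auto simp: complex_nonneg_Reals_iff)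
  then have "(\<Sum>a<N. Re (quad_form T (E a) (E a) (E a) (E a))) = 0" by simp
  then have "Re (quad_form T (E 0) (E 0) (E 0) (E 0)) = 0"
    using E(2) H by (subst (asm) sum_nonneg_eq_0_iff) (auto simp: complex_nonneg_Reals_iff)
  then have "quad_form T (E 0) (E 0) (E 0) (E 0) = 0"
    using H[of "E 0"] by (simp add: complex_nonneg_Reals_iff complex_eq_iff)
  then show "quad_form T v v v v = 0" using E(4) by (simp add: E(3) quad_form_scale)
qed

section \<open>Real determinants of complex linear maps\<close>

text \<open>The type \<open>'n bit0\<close> has twice as many elements as \<open>'n\<close>, so
  equality of dimensions provides an isomorphism. A different choice would only rescale all
  integrals by a constant.\<close>

lemma realify_exists:
  "\<exists>f :: real^('n::finite bit0) \<Rightarrow> complex^'n. linear f \<and> (\<exists>g. linear g \<and> (\<forall>x. g (f x) = x) \<and> (\<forall>y. f (g y) = y))"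
proof -
  have "DIM(real^('n bit0)) = DIM(complex^'n)" by simp
  from isomorphisms_UNIV_UNIV[OF this] show ?thesis by metis
qed

definition realify :: "real^('n::finite bit0) \<Rightarrow> complex^'n" where
  "realify = (SOME f. linear f \<and> (\<exists>g. linear g \<and> (\<forall>x. g (f x) = x) \<and> (\<forall>y. f (g y) = y)))"

definition complexify_inv :: "complex^'n \<Rightarrow> real^('n::finite bit0)" where
  "complexify_inv = inv realify"

lemma realify:
  fixes x :: "real^('n::finite bit0)" and y :: "complex^'n"
  shows "linear (realify :: real^('n bit0) \<Rightarrow> complex^'n)" "linear (complexify_inv :: complex^'n \<Rightarrow> real^('n bit0))"
    "complexify_inv (realify x) = x" "realify (complexify_inv y) = y"
proof -
  note * = someI_ex[OF realify_exists[where 'n='n], folded realify_def]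
  obtain g where g: "linear g" "\<And>x. g (realify x) = (x :: real^('n bit0))" "\<And>y. realify (g y) = (y :: complex^'n)"
    using * by blast
  have "complexify_inv = g" unfolding complexify_inv_def by (rule inv_equality) (use g in auto)
  then show "linear (complexify_inv :: complex^'n \<Rightarrow> real^('n bit0))" "complexify_inv (realify x) = x" "realify (complexify_inv y) = y"
    using g by auto
  show "linear (realify :: real^('n bit0) \<Rightarrow> complex^'n)" using * by blast
qed

text \<open>As \<open>realify\<close> is an unspecified isomorphism, matrix entries are out of
  reach. What remains is multiplicativity, hence invariance under conjugation, and the value on real
  scalings; the determinant of a complex linear map is found from these.\<close>

definition real_det :: "(complex^'n \<Rightarrow> complex^'n) \<Rightarrow> real" where
  "real_det f = det (matrix (complexify_inv \<circ> f \<circ> realify :: real^('n::finite bit0) \<Rightarrow> real^('n bit0)))"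

lemma real_det_compose:
  fixes f g :: "complex^'n \<Rightarrow> complex^'n"
  assumes "linear f" "linear g"
  shows "real_det (f \<circ> g) = real_det f * real_det g"
proof -
  have "complexify_inv \<circ> (f \<circ> g) \<circ> realify = (complexify_inv \<circ> f \<circ> realify) \<circ> (complexify_inv \<circ> g \<circ> realify)"
    by (simp add: fun_eq_iff realify)
  moreover have "linear (complexify_inv \<circ> f \<circ> realify)" "linear (complexify_inv \<circ> g \<circ> realify)"
    using assms by (auto intro!: linear_compose realify)
  ultimately show ?thesis
    unfolding real_det_def by (simp only: matrix_compose det_mul)
qed

lemma real_det_id: "real_det (\<lambda>v :: complex^'n. v) = 1"
proof -
  have "complexify_inv \<circ> (\<lambda>v. v) \<circ> realify = (id :: real^('n bit0) \<Rightarrow> _)" by (simp add: fun_eq_iff realify)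
  then show ?thesis unfolding real_det_def by (simp only: matrix_id det_I)
qed

lemma real_det_conj:
  fixes f s s' :: "complex^'n \<Rightarrow> complex^'n"
  assumes "linear f" "linear s" "linear s'" "\<And>v. s (s' v) = v"
  shows "real_det (s \<circ> f \<circ> s') = real_det f"
proof -
  have "s \<circ> s' = (\<lambda>v. v)" using assms by auto
  then have "real_det s * real_det s' = 1" using real_det_compose[OF assms(2,3)] real_det_id by metis
  then show ?thesis
    using assms by (simp add: real_det_compose linear_compose mult.commute mult.left_commute)
qed

section \<open>Elementary column maps and coordinate scalings\<close>

definition col_map :: "'n \<Rightarrow> complex^'n \<Rightarrow> complex^'n \<Rightarrow> complex^'n" where
  "col_map j x v = (\<chi> r. (if r = j then 0 else v $ r) + x $ r * v $ j)"

lemma linear_col_map: "linear (col_map j x)"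
  by (rule linearI) (simp_all add: col_map_def vec_eq_iff algebra_simps)

definition col_matrix :: "'n \<Rightarrow> complex^'n \<Rightarrow> complex^'n^'n" where
  "col_matrix j x = (\<chi> r c. if c = j then x $ r else mat 1 $ r $ c)"

lemma col_matrix_mult: "col_matrix j x *v v = col_map j x v"
proof -
  have "(\<Sum>c\<in>UNIV. (if c = j then x $ r else mat 1 $ r $ c) * v $ c) = (if r = j then 0 else v $ r) + x $ r * v $ j" for r
  proof -
    have "(\<Sum>c\<in>UNIV. (if c = j then x $ r else mat 1 $ r $ c) * v $ c)
       = x $ r * v $ j + (\<Sum>c\<in>UNIV - {j}. (if c = j then x $ r else mat 1 $ r $ c) * v $ c)"
      by (subst sum.remove[of UNIV j]) auto
    also have "(\<Sum>c\<in>UNIV - {j}. (if c = j then x $ r else mat 1 $ r $ c) * v $ c) = (\<Sum>c\<in>UNIV - {j}. if c = r then v $ r else 0)"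
      by (rule sum.cong) (auto simp: mat_def)
    also have "\<dots> = (if r = j then 0 else v $ r)" by simp
    finally show ?thesis by simp
  qed
  then show ?thesis by (simp add: vec_eq_iff matrix_vector_mult_def col_matrix_def col_map_def)
qed

lemma det_col_matrix: "det (col_matrix j (x :: complex^'n)) = x $ j"
proof -
  have "det (\<chi> i k. if k = j then (mat 1 *v x) $ i else (mat 1 :: complex^'n^'n) $ i $ k) = x $ j * det (mat 1 :: complex^'n^'n)"
    by (rule cramer_lemma)
  then show ?thesis unfolding matrix_vector_mul_lid det_I by (simp add: col_matrix_def)
qed

text \<open>Conjugation by a rescaling of coordinate j turns the map into its square. So the
  determinant equals its own square, and it is nonzero because the map is invertible.\<close>

lemma real_det_unipotent:
  assumes "x $ j = 1" shows "real_det (col_map j x) = 1"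
proof -
  let ?s = "col_map j (axis j (1/2))" and ?s' = "col_map j (axis j 2)"
  let ?y = "\<chi> r. if r = j then 1 else - x $ r"
  have "?s \<circ> col_map j x \<circ> ?s' = col_map j x \<circ> col_map j x"
    using assms by (auto simp: fun_eq_iff col_map_def vec_eq_iff axis_def algebra_simps)
  moreover have "?s (?s' v) = v" for v by (simp add: col_map_def vec_eq_iff axis_def)
  ultimately have "real_det (col_map j x) = real_det (col_map j x) * real_det (col_map j x)"
    using real_det_conj[of "col_map j x" ?s ?s'] by (simp add: linear_col_map real_det_compose)
  moreover have "col_map j x \<circ> col_map j ?y = (\<lambda>v. v)"
    using assms by (auto simp: fun_eq_iff col_map_def vec_eq_iff)
  then have "real_det (col_map j x) * real_det (col_map j ?y) = 1"
    using real_det_compose[OF linear_col_map linear_col_map, of j x j ?y] real_det_id by metis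
  ultimately show ?thesis by auto
qed

definition coord_scale :: "'n \<Rightarrow> complex \<Rightarrow> complex^'n \<Rightarrow> complex^'n" where
  "coord_scale j a v = (\<chi> r. if r = j then a * v $ r else v $ r)"

lemma linear_coord_scale: "linear (coord_scale j a)"
  by (rule linearI) (simp_all add: coord_scale_def vec_eq_iff algebra_simps)

lemma real_det_coord_scale_mult:
  "real_det (coord_scale j a) * real_det (coord_scale j b) = real_det (coord_scale j (a * b))"
proof -
  have "coord_scale j a \<circ> coord_scale j b = coord_scale j (a * b)"
    by (auto simp: fun_eq_iff coord_scale_def vec_eq_iff)
  then show ?thesis using real_det_compose[OF linear_coord_scale linear_coord_scale, of j a j b] by simp
qed

lemma real_det_coord_scale_swap:
  fixes j k :: "'n::finite"
  shows "real_det (coord_scale j a) = real_det (coord_scale k a)"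
proof -
  define s :: "complex^'n \<Rightarrow> complex^'n" where "s = (\<lambda>v. \<chi> r. v $ (Transposition.transpose j k r))"
  have "linear s" by (rule linearI) (simp_all add: s_def vec_eq_iff)
  moreover have "s (s v) = v" for v by (simp add: s_def vec_eq_iff)
  moreover have "s \<circ> coord_scale j a \<circ> s = coord_scale k a"
  proof -
    have "(Transposition.transpose j k r = j) = (r = k)" for r by (auto simp: Transposition.transpose_def)
    then show ?thesis by (simp add: fun_eq_iff s_def coord_scale_def vec_eq_iff)
  qed
  ultimately show ?thesis using real_det_conj[OF linear_coord_scale, of s s j a] by simp
qed

text \<open>Conjugation by complex conjugation of one coordinate, which is real linear and therefore
  admissible here.\<close>

lemma real_det_coord_scale_cnj: "real_det (coord_scale j (cnj a)) = real_det (coord_scale j a :: complex^'n \<Rightarrow> _)"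
proof -
  define s :: "complex^'n \<Rightarrow> complex^'n" where "s = (\<lambda>v. \<chi> r. if r = j then cnj (v $ r) else v $ r)"
  have "linear s" by (rule linearI) (simp_all add: s_def vec_eq_iff)
  moreover have "s (s v) = v" for v by (simp add: s_def vec_eq_iff)
  moreover have "s \<circ> coord_scale j a \<circ> s = coord_scale j (cnj a)"
    by (simp add: fun_eq_iff s_def coord_scale_def vec_eq_iff)
  ultimately show ?thesis using real_det_conj[OF linear_coord_scale, of s s j a] by simp
qed

text \<open>Scaling all n coordinates by b is a real scaling, with determinant b ^ (2 n), and by
  symmetry every coordinate contributes the same factor. Its sign is settled by writing it as a
  square, through the square root of b.\<close>

lemma real_det_coord_scale_pos:
  assumes b: "b > 0"
  shows "real_det (coord_scale j (of_real b) :: complex^'n \<Rightarrow> _) = b^2"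
proof -
  let ?r = "real_det (coord_scale j (of_real b) :: complex^'n \<Rightarrow> _)"
  have "?r = (real_det (coord_scale j (of_real (sqrt b)) :: complex^'n \<Rightarrow> _))^2"
    unfolding power2_eq_square real_det_coord_scale_mult using b by (simp flip: of_real_mult)
  then have r0: "?r \<ge> 0" by simp
  have "real_det (\<lambda>v :: complex^'n. \<chi> r. if r \<in> J then of_real b * v $ r else v $ r) = ?r ^ card J" if "finite J" for J
    using that
  proof (induction J rule: finite_induct)
    case empty
    then show ?case using real_det_id[where 'n='n] by simp
  next
    case (insert k J)
    let ?f = "\<lambda>v :: complex^'n. \<chi> r. if r \<in> J then of_real b * v $ r else v $ r"
    have "linear ?f" by (rule linearI) (simp_all add: vec_eq_iff algebra_simps)
    moreover have "coord_scale k (of_real b) \<circ> ?f = (\<lambda>v. \<chi> r. if r \<in> insert k J then of_real b * v $ r else v $ r)"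
      using insert by (auto simp: fun_eq_iff coord_scale_def vec_eq_iff)
    ultimately have "real_det (\<lambda>v :: complex^'n. \<chi> r. if r \<in> insert k J then of_real b * v $ r else v $ r) 
        = real_det (coord_scale k (of_real b) :: complex^'n \<Rightarrow> _) * ?r ^ card J"
      using real_det_compose[OF linear_coord_scale, of ?f k "of_real b"] insert.IH by simp
    then show ?case using insert real_det_coord_scale_swap[of k "of_real b" j] by simp
  qed
  from this[of UNIV] have "real_det (\<lambda>v :: complex^'n. \<chi> r. of_real b * v $ r) = ?r ^ CARD('n)" by simp
  moreover have "complexify_inv \<circ> (\<lambda>v :: complex^'n. \<chi> r. of_real b * v $ r) \<circ> realify = (\<lambda>x. b *\<^sub>R x)"
  proof
    fix x :: "real^('n bit0)"
    have "(\<chi> r. of_real b * realify x $ r) = b *\<^sub>R realify x" by (simp add: vec_eq_iff scaleR_conv_of_real[where 'a=complex])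
    then show "(complexify_inv \<circ> (\<lambda>v :: complex^'n. \<chi> r. of_real b * v $ r) \<circ> realify) x = b *\<^sub>R x"
      by (simp add: linear_cmul[OF realify(2)] realify)
  qed
  then have "real_det (\<lambda>v :: complex^'n. \<chi> r. of_real b * v $ r) = b ^ (2 * CARD('n))"
    unfolding real_det_def by simp
  ultimately have eq: "?r ^ CARD('n) = (b^2) ^ CARD('n)" by (simp add: power_mult)
  show ?thesis by (rule power_eq_imp_eq_base[OF eq r0]) simp_all
qed

text \<open>Scalings by a and by its conjugate have equal determinants, and their product is the
  scaling by |a|^2.\<close>

lemma real_det_coord_scale:
  assumes "a \<noteq> 0"
  shows "\<bar>real_det (coord_scale j a :: complex^'n \<Rightarrow> _)\<bar> = (norm a)^2"
proof -
  let ?r = "real_det (coord_scale j a :: complex^'n \<Rightarrow> _)"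
  have "?r * ?r = real_det (coord_scale j (of_real ((norm a)^2)) :: complex^'n \<Rightarrow> _)"
    using real_det_coord_scale_mult[of j a "cnj a"] unfolding real_det_coord_scale_cnj complex_norm_square .
  also have "\<dots> = ((norm a)^2)^2" using assms by (intro real_det_coord_scale_pos) simp
  finally have "\<bar>?r\<bar>^2 = ((norm a)^2)^2" by (simp add: power2_eq_square)
  then show ?thesis by (rule power_eq_imp_eq_base) auto
qed

section \<open>Reduction of a matrix to elementary factors\<close>

definition det_compat :: "complex^'n^'n \<Rightarrow> bool" where
  "det_compat M \<longleftrightarrow> \<bar>real_det (\<lambda>v. M *v v)\<bar> = (norm (det M))^2"

lemma linear_matrix_mult: "linear (\<lambda>v. (M :: complex^'n^'m) *v v)"
proof (rule linearI)
  fix c :: real and v :: "complex^'n"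
  show "M *v (c *\<^sub>R v) = c *\<^sub>R (M *v v)"
    by (simp add: vec_eq_iff matrix_vector_mult_def scaleR_sum_right)
qed (simp add: matrix_vector_right_distrib)

lemma det_compat_mult: "det_compat M \<Longrightarrow> det_compat N \<Longrightarrow> det_compat (M ** N)"
proof -
  assume *: "det_compat M" "det_compat N"
  have eq: "(\<lambda>v. (M ** N) *v v) = (\<lambda>v. M *v v) \<circ> (\<lambda>v. N *v v)"
    by (simp add: fun_eq_iff matrix_vector_mul_assoc)
  have "real_det (\<lambda>v. (M ** N) *v v) = real_det (\<lambda>v. M *v v) * real_det (\<lambda>v. N *v v)"
    unfolding eq by (rule real_det_compose[OF linear_matrix_mult linear_matrix_mult])
  then show ?thesis
    using * by (simp only: det_compat_def abs_mult det_mul norm_mult power_mult_distrib)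
qed

lemma det_compat_col_matrix:
  assumes a: "x $ j \<noteq> 0"
  shows "det_compat (col_matrix j (x :: complex^'n))"
proof -
  have "col_map j x = col_map j ((1 / x $ j) *s x) \<circ> coord_scale j (x $ j)"
    using a by (auto simp: fun_eq_iff col_map_def coord_scale_def vec_eq_iff)
  then have "real_det (col_map j x) = real_det (coord_scale j (x $ j) :: complex^'n \<Rightarrow> _)"
    using real_det_compose[OF linear_col_map linear_coord_scale, of j "(1 / x $ j) *s x" j "x $ j"] a
    by (simp add: real_det_unipotent)
  then show ?thesis
    using real_det_coord_scale[OF a, of j] by (simp add: det_compat_def col_matrix_mult det_col_matrix)
qed

lemma col_matrix_inverse:
  assumes "x $ j \<noteq> 0"
  obtains B where "col_matrix j x ** B = mat 1" "B ** col_matrix j x = mat 1"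
  using assms invertible_det_nz[of "col_matrix j x"] unfolding det_col_matrix invertible_def by blast

lemma mult_axis: "M *v axis c 1 = column c (M :: complex^'n^'n)"
  by (simp add: vec_eq_iff matrix_vector_mult_def column_def axis_def if_distrib[of "\<lambda>x. _ * x"] cong: if_cong)

lemma col_map_axis: "c \<noteq> j \<Longrightarrow> col_map j x (axis c 1) = axis c 1" "col_map j x (axis j 1) = x"
  by (auto simp: col_map_def vec_eq_iff axis_def)

text \<open>With a nonzero pivot, column j is split off as an elementary factor; the quotient agrees
  with the identity in one more column.\<close>

lemma det_compat_step:
  fixes M :: "complex^'n^'n"
  assumes IH: "\<And>M :: complex^'n^'n. det M \<noteq> 0 \<Longrightarrow> (\<And>c. c \<notin> T \<Longrightarrow> M *v axis c 1 = axis c 1) \<Longrightarrow> det_compat M"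
    and M: "det M \<noteq> 0" "\<And>c. c \<notin> insert j T \<Longrightarrow> M *v axis c 1 = axis c 1" and jj: "M $ j $ j \<noteq> 0"
  shows "det_compat M"
proof -
  let ?C = "col_matrix j (M *v axis j 1)"
  have nz: "(M *v axis j 1) $ j \<noteq> 0" unfolding mult_axis using jj by (simp add: column_def)
  obtain B where B: "?C ** B = mat 1" "B ** ?C = mat 1" using col_matrix_inverse[OF nz] by blast
  have "det_compat (B ** M)"
  proof (rule IH)
    have "det ?C * det B = 1" unfolding det_mul[symmetric] B(1) by simp
    then show "det (B ** M) \<noteq> 0" using M(1) by (auto simp: det_mul)
    fix c assume c: "c \<notin> T"
    have C: "M *v axis c 1 = ?C *v axis c 1"
    proof (cases "c = j")
      case False
      then show ?thesis using M(2)[of c] c by (simp add: col_matrix_mult col_map_axis)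
    qed (simp add: col_matrix_mult col_map_axis)
    have "(B ** M) *v axis c 1 = (B ** ?C) *v axis c 1"
      unfolding matrix_vector_mul_assoc[symmetric] C ..
    then show "(B ** M) *v axis c 1 = axis c 1" unfolding B(2) by simp
  qed
  then have "det_compat (?C ** (B ** M))" by (rule det_compat_mult[OF det_compat_col_matrix[OF nz]])
  then show ?thesis unfolding matrix_mul_assoc B(1) by simp
qed

text \<open>Induction on the set T of columns that may differ from those of the identity. A zero
  pivot is first repaired by a row operation.\<close>

lemma det_compat_if:
  fixes M :: "complex^'n^'n"
  assumes "finite T"
  shows "det M \<noteq> 0 \<Longrightarrow> (\<And>c. c \<notin> T \<Longrightarrow> M *v axis c 1 = axis c 1) \<Longrightarrow> det_compat M"
  using assms
proof (induction T arbitrary: M rule: finite_induct)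
  case empty
  have "column c M = axis c 1" for c using empty(2) mult_axis[of M c] by simp
  then have "M = mat 1" by (simp add: column_def vec_eq_iff mat_def axis_def)
  then show ?case using real_det_id[where 'n='n] by (simp add: det_compat_def)
next
  case (insert j T)
  note IH = insert.IH
  show ?case
  proof (cases "M $ j $ j = 0")
    case False
    then show ?thesis using det_compat_step[OF IH insert.prems] by blast
  next
    case True
    have "\<exists>i\<in>T. M $ i $ j \<noteq> 0"
    proof (rule ccontr)
      assume "\<not> ?thesis"
      then have z: "M $ i $ j = 0" if "i \<in> insert j T" for i using that True by auto
      \<comment> \<open>Suppose column j vanishes in all rows of \<open>insert j T\<close>. It is
        then a combination of columns outside that set, which are unit vectors; v is the resulting
        kernel vector.\<close>
      define v where "v = (\<chi> r. (if r = j then 1 else - M $ r $ j))"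
      have "M *v v = (\<Sum>c\<in>UNIV. v $ c *s (M *v axis c 1))"
        unfolding mult_axis by (simp add: vec_eq_iff matrix_vector_mult_def column_def mult.commute)
      also have "\<dots> = v $ j *s (M *v axis j 1) + (\<Sum>c\<in>UNIV - {j}. v $ c *s (M *v axis c 1))"
        by (rule sum.remove) auto
      also have "(\<Sum>c\<in>UNIV - {j}. v $ c *s (M *v axis c 1)) = (\<Sum>c\<in>UNIV - {j}. - M $ c $ j *s axis c 1)"
      proof (rule sum.cong[OF refl])
        fix c assume c: "c \<in> UNIV - {j}"
        show "v $ c *s (M *v axis c 1) = - M $ c $ j *s axis c 1"
        proof (cases "c \<in> T")
          case True
          then show ?thesis using z[of c] c by (simp add: v_def)
        next
          case False
          then show ?thesis using insert.prems(2)[of c] c by (simp add: v_def)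
        qed
      qed
      also have "v $ j *s (M *v axis j 1) + \<dots> = 0"
      proof -
        have "(v $ j *s (M *v axis j 1) + (\<Sum>c\<in>UNIV - {j}. - M $ c $ j *s axis c 1)) $ r = 0" for r
        proof -
          have "(\<Sum>c\<in>UNIV - {j}. - M $ c $ j *s axis c 1) $ r = (\<Sum>c\<in>UNIV - {j}. if c = r then - M $ r $ j else 0)"
            unfolding sum_component by (rule sum.cong) (auto simp: axis_def)
          also have "\<dots> = - M $ r $ j" using z[of j] by auto
          finally show ?thesis by (simp add: mult_axis column_def v_def)
        qed
        then show ?thesis by (simp add: vec_eq_iff)
      qed
      finally have "M *v v = 0" .
      moreover have "v \<noteq> 0" by (auto simp: v_def vec_eq_iff)
      ultimately have "\<not> (\<exists>B. B ** M = mat 1)" unfolding matrix_left_invertible_ker by blast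
      then show False using insert.prems(1) by (simp add: invertible_det_nz[symmetric] invertible_left_inverse)
    qed
    then obtain i where i: "i \<in> T" "M $ i $ j \<noteq> 0" by blast
    then have ij: "i \<noteq> j" using insert.hyps by auto
    \<comment> \<open>\<open>?C\<close> adds row i to row j, moving the nonzero entry into the
      pivot, and \<open>?B\<close> undoes this; both are themselves elementary factors.\<close>
    let ?C = "col_matrix i (axis i 1 + axis j 1)" and ?B = "col_matrix i (axis i 1 - axis j 1)"
    have BC: "?B ** ?C = mat 1"
    proof -
      have "?B *v (?C *v v) = v" for v
        using ij by (auto simp: col_matrix_mult col_map_def vec_eq_iff axis_def)
      then show ?thesis by (simp add: matrix_eq matrix_vector_mul_assoc[symmetric])
    qed
    have d1: "det ?B = 1" "det ?C = 1" using ij unfolding det_col_matrix by (simp_all add: axis_def)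
    have "det_compat (?C ** M)"
    proof (rule det_compat_step[OF IH])
      show "det (?C ** M) \<noteq> 0" using insert.prems(1) by (simp add: det_mul d1)
      show "(?C ** M) *v axis c 1 = axis c 1" if "c \<notin> insert j T" for c
        using insert.prems(2)[OF that] that i(1)
        by (cases "c = i") (auto simp: matrix_vector_mul_assoc[symmetric] col_matrix_mult col_map_axis)
      have "(?C ** M) $ j $ j = ((?C ** M) *v axis j 1) $ j"
        by (simp only: mult_axis column_def vec_lambda_beta)
      also have "\<dots> = (?C *v (M *v axis j 1)) $ j"
        by (simp only: matrix_vector_mul_assoc)
      also have "\<dots> = M $ i $ j" using True ij
        unfolding mult_axis by (simp add: col_matrix_mult col_map_def column_def axis_def)
      finally show "(?C ** M) $ j $ j \<noteq> 0" using i(2) by simp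
    qed
    moreover have "det_compat ?B" by (rule det_compat_col_matrix) (use ij in \<open>simp add: axis_def\<close>)
    ultimately have "det_compat (?B ** (?C ** M))" using det_compat_mult by blast
    then show ?thesis unfolding matrix_mul_assoc BC by simp
  qed
qed

lemma real_det_complex_linear:
  fixes M :: "complex^'n^'n"
  assumes "det M \<noteq> 0"
  shows "\<bar>real_det (\<lambda>v. M *v v)\<bar> = (norm (det M))^2"
  using det_compat_if[of UNIV M] assms by (simp add: det_compat_def)

section \<open>Integration over complex coordinate space\<close>

definition cint :: "(complex^'n::finite \<Rightarrow> real) \<Rightarrow> real" where
  "cint h = integral UNIV (\<lambda>x :: real^('n bit0). h (realify x))"

definition csupp :: "('e::topological_space \<Rightarrow> real) \<Rightarrow> bool" where
  "csupp h \<longleftrightarrow> continuous_on UNIV h \<and> (\<exists>C. compact C \<and> (\<forall>z. z \<notin> C \<longrightarrow> h z = 0))"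

lemma csuppI: "continuous_on UNIV h \<Longrightarrow> compact C \<Longrightarrow> (\<And>z. z \<notin> C \<Longrightarrow> h z = 0) \<Longrightarrow> csupp h"
  unfolding csupp_def by blast

lemma realify_continuous: "continuous_on S (realify :: real^('n::finite bit0) \<Rightarrow> complex^'n)"
  using realify(1) by (intro linear_continuous_on) (simp add: linear_conv_bounded_linear)

lemma complexify_inv_continuous: "continuous_on S (complexify_inv :: complex^'n::finite \<Rightarrow> _)"
  using realify(2) by (intro linear_continuous_on) (simp add: linear_conv_bounded_linear)

lemma compact_in_box:
  fixes C :: "(complex^'n::finite) set"
  assumes "compact C"
  obtains a :: "real^('n bit0)" where "\<And>x. x \<notin> cbox (-a) a \<Longrightarrow> realify x \<notin> C"
proof -
  have "compact (complexify_inv ` C)" by (intro compact_continuous_image complexify_inv_continuous assms)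
  then obtain a where a: "complexify_inv ` C \<subseteq> cbox (-a) a"
    using bounded_subset_cbox_symmetric compact_imp_bounded by metis
  show thesis
  proof (rule that)
    fix x :: "real^('n bit0)" assume x: "x \<notin> cbox (-a) a"
    show "realify x \<notin> C"
    proof
      assume "realify x \<in> C"
      then have "complexify_inv (realify x) \<in> cbox (-a) a" using a by blast
      then show False using x by (simp add: realify)
    qed
  qed
qed

lemma cint_cbox:
  assumes "\<And>x. x \<notin> cbox a b \<Longrightarrow> h (realify x) = 0"
  shows "cint h = integral (cbox a b) (\<lambda>x. h (realify x))"
proof -
  have "(\<lambda>x. h (realify x)) = (\<lambda>x. if x \<in> cbox a b then h (realify x) else 0)" using assms by auto
  then have "cint h = integral UNIV (\<lambda>x. if x \<in> cbox a b then h (realify x) else 0)"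
    unfolding cint_def by (rule arg_cong)
  also have "\<dots> = integral (cbox a b) (\<lambda>x. h (realify x))"
    by (rule Henstock_Kurzweil_Integration.integral_restrict_UNIV)
  finally show ?thesis .
qed

lemma csupp_absolutely_integrable:
  fixes h :: "complex^'n::finite \<Rightarrow> real"
  assumes "csupp h"
  shows "(\<lambda>x. h (realify x)) absolutely_integrable_on UNIV"
proof -
  obtain C where C: "compact C" "\<And>z. z \<notin> C \<Longrightarrow> h z = 0" and cont: "continuous_on UNIV h"
    using assms by (auto simp: csupp_def)
  obtain a where a: "\<And>x. x \<notin> cbox (-a) a \<Longrightarrow> realify x \<notin> C" using compact_in_box[OF C(1)] by blast
  have eq: "(\<lambda>x. h (realify x)) = (\<lambda>x. if x \<in> cbox (-a) a then h (realify x) else 0)" using a C(2) by auto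
  have "(\<lambda>x. h (realify x)) absolutely_integrable_on cbox (-a) a"
    by (intro absolutely_integrable_continuous continuous_on_compose2[OF cont realify_continuous]) auto
  then have "(\<lambda>x. if x \<in> cbox (-a) a then h (realify x) else 0) absolutely_integrable_on UNIV"
    by (simp only: absolutely_integrable_restrict_UNIV)
  then show ?thesis by (subst eq)
qed

lemma csupp_integrable: "csupp h \<Longrightarrow> (\<lambda>x. h (realify x)) integrable_on UNIV"
  using csupp_absolutely_integrable set_lebesgue_integral_eq_integral(1) by blast

lemma csupp_add: "csupp h \<Longrightarrow> csupp k \<Longrightarrow> csupp (\<lambda>z. h z + k z)"
proof -
  assume "csupp h" "csupp k"
  then obtain C C' where *: "compact C" "\<And>z. z \<notin> C \<Longrightarrow> h z = 0" "continuous_on UNIV h"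
      "compact C'" "\<And>z. z \<notin> C' \<Longrightarrow> k z = 0" "continuous_on UNIV k" by (auto simp: csupp_def)
  show ?thesis by (rule csuppI[of _ "C \<union> C'"]) (use * in \<open>auto intro!: continuous_intros\<close>)
qed

lemma csupp_cmult: "csupp h \<Longrightarrow> csupp (\<lambda>z. c * h z)"
  unfolding csupp_def by (auto intro!: continuous_intros)

lemma csupp_sum: "(\<And>i. i \<in> I \<Longrightarrow> csupp (h i)) \<Longrightarrow> csupp (\<lambda>z. \<Sum>i\<in>I. h i z)"
proof (induction I rule: infinite_finite_induct)
  case (insert x F)
  then show ?case by (simp add: csupp_add)
qed (auto simp: csupp_def)

lemma cint_add: "csupp h \<Longrightarrow> csupp k \<Longrightarrow> cint (\<lambda>z. h z + k z) = cint h + cint k"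
  unfolding cint_def by (intro integral_add csupp_integrable)

lemma cint_cmult: "cint (\<lambda>z. c * h z) = c * cint h"
  unfolding cint_def by simp

lemma cint_zero: "cint (\<lambda>z. 0) = 0"
  unfolding cint_def by simp

lemma cint_sum: "(\<And>i. i \<in> I \<Longrightarrow> csupp (h i)) \<Longrightarrow> cint (\<lambda>z. \<Sum>i\<in>I. h i z) = (\<Sum>i\<in>I. cint (h i))"
proof (induction I rule: infinite_finite_induct)
  case (insert x F)
  then show ?case by (simp add: cint_add csupp_sum)
qed (auto simp: cint_zero)

lemma cint_mono: "csupp h \<Longrightarrow> csupp k \<Longrightarrow> (\<And>z. h z \<le> k z) \<Longrightarrow> cint h \<le> cint k"
  unfolding cint_def by (intro integral_le csupp_integrable)

lemma cint_pos:
  fixes h :: "complex^'n::finite \<Rightarrow> real"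
  assumes h: "csupp h" "\<And>z. h z \<ge> 0" and z0: "h z0 > 0"
  shows "cint h > 0"
proof -
  obtain C where C: "compact C" "\<And>z. z \<notin> C \<Longrightarrow> h z = 0" and cont: "continuous_on UNIV h"
    using h by (auto simp: csupp_def)
  obtain a where a: "\<And>x. x \<notin> cbox (-a) a \<Longrightarrow> realify x \<notin> C" using compact_in_box[OF C(1)] by blast
  define f where "f = (\<lambda>x :: real^('n bit0). h (realify x))"
  have cf: "continuous_on S f" for S
    unfolding f_def by (intro continuous_on_compose2[OF cont realify_continuous]) auto
  define x0 :: "real^('n bit0)" where "x0 = complexify_inv z0"
  have fx0: "f x0 > 0" using z0 by (simp add: f_def x0_def realify)
  \<comment> \<open>An enlarged box that contains the support and x0 and has nonempty interior, as
    the vanishing criterion for nonnegative continuous functions requires.\<close>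
  define b :: "real^('n bit0)" where "b = (\<chi> i. \<bar>a $ i\<bar> + \<bar>x0 $ i\<bar> + 1)"
  have sub: "cbox (-a) a \<subseteq> cbox (-b) b"
    unfolding mem_box_cart subset_iff b_def by (auto simp: abs_le_iff) (smt (verit))+
  have x0b: "x0 \<in> cbox (-b) b" unfolding mem_box_cart b_def by (simp add: abs_if)
  have eq: "cint h = integral (cbox (-b) b) f"
    unfolding f_def by (rule cint_cbox) (use a C(2) sub in auto)
  have int: "(f has_integral cint h) (cbox (-b) b)"
    unfolding eq by (intro integrable_integral integrable_continuous cf)
  have "cint h \<ge> 0" unfolding eq by (intro integral_nonneg integrable_continuous cf) (simp add: f_def h)
  moreover have "cint h \<noteq> 0"
  proof
    assume "cint h = 0"
    then have "(f has_integral 0) (cbox (-b) b)" using int by simp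
    moreover have "box (-b) b \<noteq> {}"
    proof -
      have "0 \<in> box (-b) b" unfolding mem_box_cart b_def by (auto intro: add_nonneg_pos)
      then show ?thesis by blast
    qed
    ultimately have "f x0 = 0"
      by (intro has_integral_0_cbox_imp_0[OF cf _ _ _ x0b]) (auto simp: f_def h)
    then show False using fx0 by simp
  qed
  ultimately show ?thesis by simp
qed

lemma cint_translate:
  fixes h :: "complex^'n::finite \<Rightarrow> real"
  assumes h: "csupp h" shows "cint (\<lambda>z. h (z + v)) = cint h"
proof -
  obtain C where C: "compact C" "\<And>z. z \<notin> C \<Longrightarrow> h z = 0" and cont: "continuous_on UNIV h"
    using h by (auto simp: csupp_def)
  obtain a where a: "\<And>x. x \<notin> cbox (-a) a \<Longrightarrow> realify x \<notin> C" using compact_in_box[OF C(1)] by blast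
  let ?v = "complexify_inv v"
  have r: "realify (x + ?v) = realify x + v" for x
    by (simp only: linear_add[OF realify(1)] realify(4))
  have "((\<lambda>x. h (realify x)) has_integral cint h) (cbox (-a) a)"
    by (subst cint_cbox[of "-a" a]) (use a C(2) in \<open>auto intro!: integrable_integral integrable_continuous continuous_on_compose2[OF cont realify_continuous]\<close>)
  from has_integral_shift_cbox[OF this, of ?v]
  have "((\<lambda>x. h (realify x + v)) has_integral cint h) (cbox (- a - ?v) (a - ?v))"
    unfolding r .
  moreover have "cint (\<lambda>z. h (z + v)) = integral (cbox (- a - ?v) (a - ?v)) (\<lambda>x. h (realify x + v))"
  proof (rule cint_cbox)
    fix x assume "x \<notin> cbox (- a - ?v) (a - ?v)"
    then have "x + ?v \<notin> cbox (-a) a" by (simp add: mem_box_cart algebra_simps)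
    then show "h (realify x + v) = 0" using a C(2) r by metis
  qed
  ultimately show ?thesis by (simp add: integral_unique)
qed

section \<open>Integration by parts\<close>

lemma frechet_derivative_zero_off:
  fixes w :: "'e::real_normed_vector \<Rightarrow> 'f::real_normed_vector"
  assumes "closed C" "\<And>z. z \<notin> C \<Longrightarrow> w z = 0" "z \<notin> C"
  shows "frechet_derivative w (at z) v = 0"
proof -
  have "frechet_derivative w (at z) = frechet_derivative (\<lambda>z. 0 :: 'f) (at z)"
    by (rule frechet_derivative_cong_open[of "- C"]) (use assms in auto)
  then show ?thesis by simp
qed

text \<open>Translation leaves the integral of w unchanged, so its derivative in the translation
  parameter is zero; differentiation under the integral identifies that derivative.\<close>

lemma cint_frechet_derivative:
  fixes w :: "complex^'n::finite \<Rightarrow> real"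
  assumes w: "Ck_on (Suc 0) w UNIV" and C: "compact C" "\<And>z. z \<notin> C \<Longrightarrow> w z = 0"
  shows "cint (\<lambda>z. frechet_derivative w (at z) v) = 0"
proof -
  have cs: "csupp w" using Ck_on_imp_continuous[OF w] C by (intro csuppI)
  have cD: "continuous_on UNIV (\<lambda>z. frechet_derivative w (at z) v)"
    using Ck_on_SucE(2)[OF w] by simp
  obtain B where B: "\<And>z. z \<in> C \<Longrightarrow> norm z \<le> B" using compact_imp_bounded[OF C(1)] bounded_iff by blast
  \<comment> \<open>The box contains the supports of all translates by t v with |t| < 1, so that the
    domain of integration does not depend on t.\<close>
  obtain a where a: "\<And>x. x \<notin> cbox (-a) a \<Longrightarrow> realify x \<notin> cball (0::complex^'n) (B + norm v)"
    using compact_in_box[OF compact_cball] by blast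
  have off: "realify x + t *\<^sub>R v \<notin> C" if "x \<notin> cbox (-a) a" "t \<in> ball 0 1" for x t
  proof
    assume "realify x + t *\<^sub>R v \<in> C"
    then have "norm (realify x + t *\<^sub>R v) \<le> B" by (rule B)
    moreover have "norm (t *\<^sub>R v) \<le> norm v" using that(2) by (simp add: mult_left_le_one_le)
    moreover have "norm (realify x) \<le> norm (realify x + t *\<^sub>R v) + norm (t *\<^sub>R v)"
      using norm_triangle_ineq4[of "realify x + t *\<^sub>R v" "t *\<^sub>R v"] by simp
    ultimately have "realify x \<in> cball (0::complex^'n) (B + norm v)" by simp
    then show False using a[OF that(1)] by blast
  qed
  define \<Phi> where "\<Phi> = (\<lambda>t. integral (cbox (-a) a) (\<lambda>x. w (realify x + t *\<^sub>R v)))"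
  have const: "\<Phi> t = cint w" if "t \<in> ball 0 1" for t
  proof -
    have "cint (\<lambda>z. w (z + t *\<^sub>R v)) = \<Phi> t"
      unfolding \<Phi>_def by (rule cint_cbox) (use off that C(2) in auto)
    then show ?thesis using cint_translate[OF cs] by simp
  qed
  have arg: "continuous_on S (\<lambda>p. realify (snd p) + fst p *\<^sub>R v)" for S
    by (intro continuous_intros continuous_on_compose2[OF realify_continuous[of UNIV]]) auto
  have "(\<Phi> has_field_derivative integral (cbox (-a) a) (\<lambda>x. frechet_derivative w (at (realify x + 0 *\<^sub>R v)) v)) (at 0 within ball 0 1)"
    unfolding \<Phi>_def
  proof (rule leibniz_rule_field_derivative[where fx="\<lambda>t x. frechet_derivative w (at (realify x + t *\<^sub>R v)) v"])
    fix t :: real and x :: "real^('n bit0)"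
    have "((\<lambda>t. realify x + t *\<^sub>R v) has_derivative (\<lambda>s. s *\<^sub>R v)) (at t)"
      by (auto intro!: derivative_eq_intros)
    note has_derivative_compose[OF this Ck_on_SucE(1)[OF w]]
    then have h: "((\<lambda>t. w (realify x + t *\<^sub>R v)) has_derivative (\<lambda>s. frechet_derivative w (at (realify x + t *\<^sub>R v)) (s *\<^sub>R v))) (at t)"
      by simp
    have lin: "linear (frechet_derivative w (at (realify x + t *\<^sub>R v)))"
      using w by (intro linear_frechet_derivative) simp
    show "((\<lambda>t. w (realify x + t *\<^sub>R v)) has_field_derivative frechet_derivative w (at (realify x + t *\<^sub>R v)) v) (at t within ball 0 1)"
      unfolding has_field_derivative_def
      by (rule has_derivative_eq_rhs[OF has_derivative_at_withinI[OF h]]) (simp only: fun_eq_iff linear_cmul[OF lin] real_scaleR_def mult.commute simp_thms)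
  next
    fix t :: real
    have "continuous_on (cbox (-a) a) (\<lambda>x. w (realify x + t *\<^sub>R v))"
      by (intro continuous_on_compose2[OF Ck_on_imp_continuous[OF w]] continuous_intros realify_continuous) auto
    then show "(\<lambda>x. w (realify x + t *\<^sub>R v)) integrable_on cbox (-a) a" by (rule integrable_continuous)
  next
    show "continuous_on (ball 0 1 \<times> cbox (-a) a) (\<lambda>(t, x). frechet_derivative w (at (realify x + t *\<^sub>R v)) v)"
      unfolding case_prod_beta by (intro continuous_on_compose2[OF cD arg]) auto
  qed auto
  then have "(\<Phi> has_field_derivative integral (cbox (-a) a) (\<lambda>x. frechet_derivative w (at (realify x)) v)) (at 0)"
    using at_within_open[of 0 "ball (0::real) 1"] by simp
  moreover have "(\<Phi> has_field_derivative 0) (at 0)"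
  proof (rule has_field_derivative_transform_within_open[of "\<lambda>_. cint w"])
    show "cint w = \<Phi> t" if "t \<in> ball 0 1" for t using const[OF that] by simp
  qed auto
  ultimately have "integral (cbox (-a) a) (\<lambda>x. frechet_derivative w (at (realify x)) v) = 0"
    by (rule DERIV_unique)
  moreover have "cint (\<lambda>z. frechet_derivative w (at z) v) = integral (cbox (-a) a) (\<lambda>x. frechet_derivative w (at (realify x)) v)"
  proof (rule cint_cbox)
    fix x assume "x \<notin> cbox (-a) a"
    then have "realify x \<notin> C" using off[of x 0] by simp
    then show "frechet_derivative w (at (realify x)) v = 0"
      by (intro frechet_derivative_zero_off[OF compact_imp_closed[OF C(1)] C(2)])
  qed
  ultimately show ?thesis by simp
qed

lemma csupp_frechet:
  fixes w :: "complex^'n::finite \<Rightarrow> real"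
  assumes w: "Ck_on (Suc 0) w UNIV" and C: "compact C" "\<And>z. z \<notin> C \<Longrightarrow> w z = 0"
  shows "csupp (\<lambda>z. frechet_derivative w (at z) v)"
  by (rule csuppI[OF _ C(1)]) 
    (use Ck_on_SucE(2)[OF w] frechet_derivative_zero_off[OF compact_imp_closed[OF C(1)] C(2)] in auto)

lemma Re_wirtinger:
  assumes "F differentiable at z"
  shows "Re (d_z i F z) = (1/2) * frechet_derivative (\<lambda>z. Re (F z)) (at z) (axis i 1) + (1/2) * frechet_derivative (\<lambda>z. Im (F z)) (at z) (axis i \<i>)"
    "Re (d_zbar i F z) = (1/2) * frechet_derivative (\<lambda>z. Re (F z)) (at z) (axis i 1) + (-1/2) * frechet_derivative (\<lambda>z. Im (F z)) (at z) (axis i \<i>)"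
proof -
  have r: "frechet_derivative (\<lambda>z. Re (F z)) (at z) = (\<lambda>v. Re (frechet_derivative F (at z) v))"
    using frechet_derivative_at[OF bounded_linear.has_derivative[OF bounded_linear_Re frechet_derivative_works'[OF assms]]] by simp
  have i: "frechet_derivative (\<lambda>z. Im (F z)) (at z) = (\<lambda>v. Im (frechet_derivative F (at z) v))"
    using frechet_derivative_at[OF bounded_linear.has_derivative[OF bounded_linear_Im frechet_derivative_works'[OF assms]]] by simp
  show "Re (d_z i F z) = (1/2) * frechet_derivative (\<lambda>z. Re (F z)) (at z) (axis i 1) + (1/2) * frechet_derivative (\<lambda>z. Im (F z)) (at z) (axis i \<i>)"
    "Re (d_zbar i F z) = (1/2) * frechet_derivative (\<lambda>z. Re (F z)) (at z) (axis i 1) + (-1/2) * frechet_derivative (\<lambda>z. Im (F z)) (at z) (axis i \<i>)"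
    unfolding r i by (simp_all add: d_z_def d_zbar_def)
qed

lemma cint_wirtinger:
  fixes F :: "complex^'n::finite \<Rightarrow> complex"
  assumes F: "Ck_on (Suc 0) F UNIV" and C: "compact C" "\<And>z. z \<notin> C \<Longrightarrow> F z = 0"
  shows "cint (\<lambda>z. Re (d_z i F z)) = 0" "cint (\<lambda>z. Re (d_zbar i F z)) = 0"
proof -
  have R: "Ck_on (Suc 0) (\<lambda>z. Re (F z)) UNIV" by (rule Ck_on_linear_compose[OF open_UNIV bounded_linear_Re F])
  have I: "Ck_on (Suc 0) (\<lambda>z. Im (F z)) UNIV" by (rule Ck_on_linear_compose[OF open_UNIV bounded_linear_Im F])
  have R0: "Re (F z) = 0" "Im (F z) = 0" if "z \<notin> C" for z using C(2)[OF that] by simp_all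
  have *: "csupp (\<lambda>z. frechet_derivative (\<lambda>z. Re (F z)) (at z) v)" "csupp (\<lambda>z. frechet_derivative (\<lambda>z. Im (F z)) (at z) v)" for v
    by (rule csupp_frechet[OF R C(1)], erule R0(1)) (rule csupp_frechet[OF I C(1)], erule R0(2))
  have **: "cint (\<lambda>z. frechet_derivative (\<lambda>z. Re (F z)) (at z) v) = 0" "cint (\<lambda>z. frechet_derivative (\<lambda>z. Im (F z)) (at z) v) = 0" for v
    by (rule cint_frechet_derivative[OF R C(1)], erule R0(1)) (rule cint_frechet_derivative[OF I C(1)], erule R0(2))
  have d: "F differentiable at z" for z using F by simp
  have sum0: "cint (\<lambda>z. (1/2) * frechet_derivative (\<lambda>z. Re (F z)) (at z) v + c * frechet_derivative (\<lambda>z. Im (F z)) (at z) w) = 0" for v w c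
    using cint_add[OF csupp_cmult[OF *(1), of "1/2" v] csupp_cmult[OF *(2), of c w]]
    by (simp only: cint_cmult ** mult_zero_right add_0)
  show "cint (\<lambda>z. Re (d_z i F z)) = 0"
    unfolding Re_wirtinger(1)[OF d] by (rule sum0)
  show "cint (\<lambda>z. Re (d_zbar i F z)) = 0"
    unfolding Re_wirtinger(2)[OF d] by (rule sum0)
qed

lemma Ck_on_mult_compact:
  fixes a W :: "complex^'n::finite \<Rightarrow> complex"
  assumes a: "Ck_on k a UNIV" "\<And>z. z \<notin> C \<Longrightarrow> a z = 0" and C: "compact C" "C \<subseteq> O'" "open O'" and W: "Ck_on k W O'"
  shows "Ck_on k (\<lambda>z. a z * W z) UNIV"
proof -
  have oC: "open (- C)" using compact_imp_closed[OF C(1)] by (rule open_Compl)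
  have "Ck_on k (\<lambda>z. a z * W z) O'" by (intro Ck_on_mult C(3) W Ck_on_subset[OF a(1)]) auto
  moreover have "Ck_on k (\<lambda>z. a z * W z) (- C)"
    by (rule Ck_on_cong[OF oC, of "\<lambda>z. 0", THEN iffD1]) (use a(2) oC in auto)
  moreover have "O' \<union> - C = UNIV" using C(2) by auto
  ultimately show ?thesis using Ck_on_Un[OF C(3) oC] by metis
qed

lemma (in derivation) zero_off:
  assumes "closed C" "\<And>z. z \<notin> C \<Longrightarrow> a z = 0" "z \<notin> C"
  shows "\<delta> a z = 0"
proof -
  have "\<delta> a z = \<delta> (\<lambda>_. 0) z" by (rule cong[of "- C"]) (use assms in auto)
  then show ?thesis by simp
qed

lemma (in derivation) mult_compact:
  assumes a: "a differentiable at z" "\<And>z. z \<notin> C \<Longrightarrow> a z = 0" and C: "closed C" "C \<subseteq> O'"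
    and W: "z \<in> O' \<Longrightarrow> W differentiable at z"
  shows "\<delta> (\<lambda>y. a y * W y) z = a z * \<delta> W z + \<delta> a z * W z"
proof (cases "z \<in> C")
  case True
  then show ?thesis using mult[OF a(1) W] C(2) by auto
next
  case False
  then show ?thesis
    using zero_off[OF C(1) a(2) False] zero_off[of C "\<lambda>y. a y * W y" z] a(2) C(1) by simp
qed

text \<open>W is controlled only on O'. The factor a, which vanishes off the compact set C, lets the
  products be extended by zero to the whole space, where the integral of a derivative
  vanishes.\<close>

lemma cint_by_parts:
  fixes a W :: "complex^'n::finite \<Rightarrow> complex"
  assumes a: "Ck_on 2 a UNIV" "\<And>z. z \<notin> C \<Longrightarrow> a z = 0" and C: "compact C" "C \<subseteq> O'" "open O'" and W: "Ck_on 2 W O'"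
  shows "cint (\<lambda>z. Re (a z * d_z i (d_zbar j W) z)) = cint (\<lambda>z. Re (W z * d_zbar j (d_z i a) z))"
    and "csupp (\<lambda>z. Re (a z * d_z i (d_zbar j W) z))" "csupp (\<lambda>z. Re (W z * d_zbar j (d_z i a) z))"
proof -
  note cl = compact_imp_closed[OF C(1)]
  have a2: "Ck_on (Suc (Suc 0)) a UNIV" and W2: "Ck_on (Suc (Suc 0)) W O'" using a(1) W by (simp_all only: numeral_2_eq_2)
  have a1: "Ck_on (Suc 0) a UNIV" and a0: "Ck_on 0 a UNIV" using Ck_on_SucD a2 by blast+
  have Wb: "Ck_on (Suc 0) (d_zbar j W) O'" by (rule dzb.Ck[OF C(3) W2])
  have Wzb: "Ck_on 0 (d_z i (d_zbar j W)) O'" by (rule dz.Ck[OF C(3) Wb])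
  have az: "Ck_on (Suc 0) (d_z i a) UNIV" by (rule dz.Ck[OF open_UNIV a2])
  have azb: "Ck_on 0 (d_zbar j (d_z i a)) UNIV" by (rule dzb.Ck[OF open_UNIV az])
  have az0: "d_z i a z = 0" if "z \<notin> C" for z by (rule dz.zero_off[OF cl a(2) that])
  have azb0: "d_zbar j (d_z i a) z = 0" if "z \<notin> C" for z by (rule dzb.zero_off[OF cl az0 that])
  have cs: "csupp (\<lambda>z. Re (b z * V z))" if "Ck_on 0 b UNIV" "\<And>z. z \<notin> C \<Longrightarrow> b z = 0" "Ck_on 0 V O'" for b V :: "complex^'n \<Rightarrow> complex"
  proof (rule csuppI[OF _ C(1)])
    have "Ck_on 0 (\<lambda>z. b z * V z) UNIV" by (rule Ck_on_mult_compact[OF that(1,2) C that(3)])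
    then show "continuous_on UNIV (\<lambda>z. Re (b z * V z))" by (intro continuous_on_Re) simp
  qed (simp add: that(2))
  have Wb0: "Ck_on 0 (d_zbar j W) O'" and W0: "Ck_on 0 W O'" and az_0: "Ck_on 0 (d_z i a) UNIV"
    using Ck_on_SucD Wb W2 az by blast+
  note c1 = cs[OF a0 a(2) Wzb]
  have c2: "csupp (\<lambda>z. Re (d_z i a z * d_zbar j W z))" by (rule cs[OF az_0 az0 Wb0])
  have c3: "csupp (\<lambda>z. Re (d_zbar j (d_z i a) z * W z))" by (rule cs[OF azb azb0 W0])
  show "csupp (\<lambda>z. Re (a z * d_z i (d_zbar j W) z))" by (rule c1)
  show c3': "csupp (\<lambda>z. Re (W z * d_zbar j (d_z i a) z))" using c3 by (simp only: mult.commute)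
  have "d_z i (\<lambda>y. a y * d_zbar j W y) z = a z * d_z i (d_zbar j W) z + d_z i a z * d_zbar j W z" for z
    by (rule dz.mult_compact[OF _ a(2) cl C(2)]) (use a1 Wb in auto)
  moreover have "cint (\<lambda>z. Re (d_z i (\<lambda>y. a y * d_zbar j W y) z)) = 0"
    by (rule cint_wirtinger[OF Ck_on_mult_compact[OF a1 a(2) C Wb] C(1)]) (simp_all add: a(2))
  ultimately have 1: "cint (\<lambda>z. Re (a z * d_z i (d_zbar j W) z)) + cint (\<lambda>z. Re (d_z i a z * d_zbar j W z)) = 0"
    using cint_add[OF c1 c2] by simp
  have "d_zbar j (\<lambda>y. d_z i a y * W y) z = d_z i a z * d_zbar j W z + d_zbar j (d_z i a) z * W z" for z
    by (rule dzb.mult_compact[OF _ az0 cl C(2)]) (use az W2 in auto)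
  moreover have "cint (\<lambda>z. Re (d_zbar j (\<lambda>y. d_z i a y * W y) z)) = 0"
    by (rule cint_wirtinger[OF Ck_on_mult_compact[OF az az0 C Ck_on_SucD[OF W2]] C(1)]) (simp_all add: az0)
  ultimately have "cint (\<lambda>z. Re (d_z i a z * d_zbar j W z)) + cint (\<lambda>z. Re (d_zbar j (d_z i a) z * W z)) = 0"
    using cint_add[OF c2 c3] by simp
  with 1 show "cint (\<lambda>z. Re (a z * d_z i (d_zbar j W) z)) = cint (\<lambda>z. Re (W z * d_zbar j (d_z i a) z))"
    by (simp add: mult.commute)
qed

section \<open>Holomorphic change of variables\<close>

definition jac :: "(complex^'n \<Rightarrow> complex^'n) \<Rightarrow> complex^'n \<Rightarrow> complex^'n^'n" where
  "jac \<theta> z = (\<chi> k i. d_z i (\<lambda>y. \<theta> y $ k) z)"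

lemma has_derivative_jac:
  fixes \<theta> :: "complex^'n::finite \<Rightarrow> complex^'n"
  assumes "\<And>k. holo_fun_on (\<lambda>y. \<theta> y $ k) S" "z \<in> S"
  shows "(\<theta> has_derivative (\<lambda>v. jac \<theta> z *v v)) (at z)"
proof -
  have "frechet_derivative (\<lambda>y. \<theta> y $ k) (at z) v = (jac \<theta> z *v v) $ k" for k v
    unfolding frechet_derivative_wirtinger[OF holo_fun_on_differentiable[OF assms]]
    by (simp add: jac_def matrix_vector_mult_def d_zbar_holo[OF assms] mult.commute)
  then have "((\<lambda>y. \<theta> y $ k) has_derivative (\<lambda>v. (jac \<theta> z *v v) $ k)) (at z)" for k
    using holo_fun_onD(1)[OF assms, of k] by presburger
  then show ?thesis
    by (intro has_derivative_componentwise_within[THEN iffD2])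
      (auto simp: Basis_vec_def inner_axis' inner_axis intro!: has_derivative_inner_left)
qed

lemma cint_change_of_variables:
  fixes \<theta> :: "complex^'n::finite \<Rightarrow> complex^'n"
  assumes S: "open S" and inj: "inj_on \<theta> S" and hol: "\<And>k. holo_fun_on (\<lambda>y. \<theta> y $ k) S"
    and det: "\<And>z. z \<in> S \<Longrightarrow> det (jac \<theta> z) \<noteq> 0"
    and h: "csupp h" "\<And>z. z \<notin> \<theta> ` S \<Longrightarrow> h z = 0"
  shows "cint h = cint (\<lambda>z. if z \<in> S then (norm (det (jac \<theta> z)))^2 * h (\<theta> z) else 0)"
proof -
  define T :: "(real^('n bit0)) set" where "T = realify -` S"
  define g :: "real^('n bit0) \<Rightarrow> real^('n bit0)" where "g = complexify_inv \<circ> \<theta> \<circ> realify"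
  define g' where "g' = (\<lambda>x. complexify_inv \<circ> (\<lambda>v. jac \<theta> (realify x) *v v) \<circ> (realify :: real^('n bit0) \<Rightarrow> complex^'n))"
  \<comment> \<open>Values in \<open>real^1\<close> fit the change of variables rule for
    vector-valued functions; \<open>real_det_complex_linear\<close> turns its real determinant into
    a squared modulus.\<close>
  define f :: "real^('n bit0) \<Rightarrow> real^1" where "f = (\<lambda>x. vec (h (realify x)))"
  have "open T" unfolding T_def
    using continuous_on_open_vimage[OF open_UNIV, of realify] realify_continuous[of UNIV] S by auto
  then have T: "T \<in> sets lebesgue" by (intro sets_completionI_sets) (simp add: borel_open)
  have der: "(g has_derivative g' x) (at x within T)" if "x \<in> T" for x
  proof -
    have blr: "bounded_linear (realify :: real^('n bit0) \<Rightarrow> complex^'n)" and blc: "bounded_linear (complexify_inv :: complex^'n \<Rightarrow> _)"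
      using realify(1,2) by (simp_all add: linear_conv_bounded_linear)
    have "(\<theta> has_derivative (\<lambda>v. jac \<theta> (realify x) *v v)) (at (realify x))"
      by (rule has_derivative_jac[OF hol]) (use that in \<open>simp add: T_def\<close>)
    from bounded_linear.has_derivative[OF blc has_derivative_compose[OF bounded_linear_imp_has_derivative[OF blr] this]]
    show ?thesis unfolding g_def g'_def o_def by (rule has_derivative_at_withinI)
  qed
  have inj': "inj_on g T"
  proof (rule inj_onI)
    fix x y assume xy: "x \<in> T" "y \<in> T" "g x = g y"
    then have "\<theta> (realify x) = \<theta> (realify y)" unfolding g_def by (metis comp_apply realify(4))
    then have "realify x = realify y" using inj xy by (auto simp: T_def inj_on_def)
    then show "x = y" by (metis realify(3))
  qed
  have off: "f x = 0" if "x \<notin> g ` T" for x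
  proof -
    have "realify x \<notin> \<theta> ` S"
    proof
      assume "realify x \<in> \<theta> ` S"
      then obtain z where z: "z \<in> S" "realify x = \<theta> z" by blast
      then have "x = g (complexify_inv z)" by (simp add: g_def realify) (metis realify(3))
      moreover have "complexify_inv z \<in> T" using z by (simp add: T_def realify)
      ultimately show False using that by blast
    qed
    then show ?thesis using h(2) by (simp add: f_def vec_eq_iff)
  qed
  have fint: "f absolutely_integrable_on UNIV"
    unfolding absolutely_integrable_on_1_iff f_def using csupp_absolutely_integrable[OF h(1)] by simp
  have fif: "f = (\<lambda>x. if x \<in> g ` T then f x else 0)" using off by auto
  have fint': "f absolutely_integrable_on (g ` T)"
    unfolding absolutely_integrable_restrict_UNIV[of "g ` T" f, symmetric] by (rule subst[where P="\<lambda>k. k absolutely_integrable_on UNIV", OF fif fint])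
  have feq: "integral UNIV f = integral (g ` T) f"
    by (rule trans[OF arg_cong[OF fif, of "integral UNIV"] Henstock_Kurzweil_Integration.integral_restrict_UNIV])
  have "integral (g ` T) f = integral T (\<lambda>x. \<bar>det (matrix (g' x))\<bar> *\<^sub>R f (g x))"
    by (rule integral_change_of_variables[OF T der inj']) (use fint' in auto)
  also have "\<dots> = integral UNIV (\<lambda>x. if x \<in> T then \<bar>det (matrix (g' x))\<bar> *\<^sub>R f (g x) else 0)"
    by (rule Henstock_Kurzweil_Integration.integral_restrict_UNIV[symmetric])
  finally have "integral UNIV f $ 1 = integral UNIV (\<lambda>x. if x \<in> T then \<bar>det (matrix (g' x))\<bar> *\<^sub>R f (g x) else 0) $ 1"
    using feq by simp
  then have "cint h = integral UNIV (\<lambda>x. (if x \<in> T then \<bar>det (matrix (g' x))\<bar> *\<^sub>R f (g x) else 0) $ 1)"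
    unfolding integral_on_1_eq cint_def f_def by simp
  also have "(\<lambda>x. (if x \<in> T then \<bar>det (matrix (g' x))\<bar> *\<^sub>R f (g x) else 0) $ 1)
     = (\<lambda>x. if realify x \<in> S then (norm (det (jac \<theta> (realify x))))^2 * h (\<theta> (realify x)) else 0)"
  proof
    fix x
    have "\<bar>det (matrix (g' x))\<bar> = (norm (det (jac \<theta> (realify x))))^2" if "realify x \<in> S"
      using real_det_complex_linear[OF det[OF that]] unfolding real_det_def g'_def .
    then show "(if x \<in> T then \<bar>det (matrix (g' x))\<bar> *\<^sub>R f (g x) else 0) $ 1
       = (if realify x \<in> S then (norm (det (jac \<theta> (realify x))))^2 * h (\<theta> (realify x)) else 0)"
      by (simp add: T_def f_def g_def realify)
  qed
  finally show ?thesis unfolding cint_def .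
qed

section \<open>Smooth functions and partitions of unity on a complex manifold\<close>

lemma pos_part_power_deriv:
  "((\<lambda>x. (max 0 x) ^ Suc (Suc n)) has_real_derivative real (Suc (Suc n)) * (max 0 x) ^ Suc n) (at x)"
proof (cases x "0 :: real" rule: linorder_cases)
  case less
  have "((\<lambda>x. 0) has_real_derivative 0) (at x)" by simp
  then have "((\<lambda>x::real. (max 0 x) ^ Suc (Suc n)) has_real_derivative 0) (at x)"
    by (rule has_field_derivative_transform_within_open[of _ _ _ "{..<0}"]) (use less in auto)
  then show ?thesis using less by simp
next
  case greater
  have "((\<lambda>x. x ^ Suc (Suc n)) has_real_derivative real (Suc (Suc n)) * x ^ Suc n) (at x)"
    using DERIV_pow[of "Suc (Suc n)" x] by simp
  then have "((\<lambda>x. (max 0 x) ^ Suc (Suc n)) has_real_derivative real (Suc (Suc n)) * x ^ Suc n) (at x)"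
    by (rule has_field_derivative_transform_within_open[of _ _ _ "{0<..}"]) (use greater in auto)
  then show ?thesis using greater by (simp add: max_def)
next
  case equal
  have "isCont (\<lambda>z::real. (max 0 z) ^ Suc n) 0" by (intro continuous_intros)
  then have "((\<lambda>x::real. (max 0 x) ^ Suc (Suc n)) has_real_derivative 0) (at 0)"
    unfolding CARAT_DERIV by (intro exI[of _ "\<lambda>z. (max 0 z) ^ Suc n"]) (auto simp: max_def)
  then show ?thesis using equal by simp
qed

text \<open>The cube of the positive part is the source of all cut-off functions. Two derivatives
  are enough for them, since integration by parts moves exactly two onto the cut-off.\<close>

lemma Ck_on_cubic: "Ck_on 2 (\<lambda>x::real. (max 0 x) ^ 3) UNIV"
proof -
  have 1: "Ck_on (Suc 0) (\<lambda>x::real. (max 0 x) ^ Suc (Suc 0)) UNIV"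
    by (rule Ck_on_field_derivI[OF open_UNIV pos_part_power_deriv]) (auto intro!: continuous_intros)
  have "Ck_on (Suc (Suc 0)) (\<lambda>x::real. (max 0 x) ^ Suc (Suc (Suc 0))) UNIV"
    by (rule Ck_on_field_derivI[OF open_UNIV pos_part_power_deriv Ck_on_mult[OF open_UNIV Ck_on_const[OF open_UNIV] 1]])
  then show ?thesis by (simp only: numeral_2_eq_2 numeral_3_eq_3)
qed

section \<open>Charts, overlaps and transition maps\<close>

abbreviation img :: "('a, 'n) chart \<Rightarrow> (complex^'n) set" where
  "img c \<equiv> snd c ` fst c"

abbreviation par :: "('a, 'n) chart \<Rightarrow> complex^'n \<Rightarrow> 'a" where
  "par c \<equiv> inv_into (fst c) (snd c)"

definition mCk :: "('a, 'n::finite) chart set \<Rightarrow> nat \<Rightarrow> ('a \<Rightarrow> 'b::real_normed_vector) \<Rightarrow> bool" where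
  "mCk A k u \<longleftrightarrow> (\<forall>c\<in>A. Ck_on k (coord_rep c u) (img c))"

locale complex_manifold =
  fixes A :: "('a::t2_space, 'n::finite) chart set"
  assumes compact_UNIV: "compact (UNIV :: 'a set)" and atlas: "complex_atlas A"
begin

definition "tr c d z = snd d (par c z)" for c d :: "('a, 'n) chart"
definition "ov c d = snd c ` (fst c \<inter> fst d)" for c d :: "('a, 'n) chart"

lemma cover: obtains c where "c \<in> A" "p \<in> fst c"
  using atlas unfolding complex_atlas_def by blast

lemma chart:
  assumes "c \<in> A"
  shows "open (fst c)" "open (img c)" "continuous_on (fst c) (snd c)" "continuous_on (img c) (par c)"
    "inj_on (snd c) (fst c)"
proof -
  have *: "open (fst c) \<and> open (img c) \<and> (\<exists>\<psi>. homeomorphism (fst c) (img c) (snd c) \<psi>)"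
    using assms atlas unfolding complex_atlas_def case_prod_beta by blast
  then obtain \<psi> where \<psi>: "homeomorphism (fst c) (img c) (snd c) \<psi>" by blast
  show "open (fst c)" "open (img c)" using * by auto
  show "continuous_on (fst c) (snd c)" using \<psi> by (simp add: homeomorphism_def)
  show inj: "inj_on (snd c) (fst c)" using homeomorphism_apply1[OF \<psi>] by (metis inj_onI)
  have "par c z = \<psi> z" if "z \<in> img c" for z
    using that homeomorphism_apply1[OF \<psi>] inj by auto
  moreover have "continuous_on (img c) \<psi>" using \<psi> by (simp add: homeomorphism_def)
  ultimately show "continuous_on (img c) (par c)" by (metis continuous_on_cong)
qed

lemma par_in: "z \<in> img c \<Longrightarrow> par c z \<in> fst c" "z \<in> img c \<Longrightarrow> snd c (par c z) = z"
  by (auto simp: inv_into_into f_inv_into_f)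

lemma par_snd: "c \<in> A \<Longrightarrow> p \<in> fst c \<Longrightarrow> par c (snd c p) = p"
  using chart(5) by simp

lemma open_chart_image:
  assumes "c \<in> A" "open V"
  shows "open (snd c ` (fst c \<inter> V))"
proof -
  have "snd c ` (fst c \<inter> V) = img c \<inter> par c -` V"
    using par_snd[OF assms(1)] par_in by (auto simp: image_iff)
  then show ?thesis using continuous_open_preimage[OF chart(4)[OF assms(1)] chart(2)[OF assms(1)] assms(2)] by simp
qed

lemma open_ov: "c \<in> A \<Longrightarrow> d \<in> A \<Longrightarrow> open (ov c d)"
  unfolding ov_def by (intro open_chart_image chart(1))

lemma tr_holo: "c \<in> A \<Longrightarrow> d \<in> A \<Longrightarrow> holo_fun_on (\<lambda>z. tr c d z $ k) (ov c d)"
  using atlas unfolding complex_atlas_def coord_rep_def o_def tr_def ov_def by blast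

lemma ovD:
  assumes "c \<in> A" "d \<in> A" "z \<in> ov c d"
  shows "z \<in> img c" "par c z \<in> fst c" "par c z \<in> fst d" "par d (tr c d z) = par c z" "tr c d z \<in> img d" "tr c d z \<in> ov d c"
proof -
  obtain p where p: "p \<in> fst c" "p \<in> fst d" "z = snd c p" using assms(3) by (auto simp: ov_def)
  then have "par c z = p" using par_snd[OF assms(1)] by simp
  then show "z \<in> img c" "par c z \<in> fst c" "par c z \<in> fst d" "par d (tr c d z) = par c z" "tr c d z \<in> img d" "tr c d z \<in> ov d c"
    using p par_snd[OF assms(2)] by (auto simp: tr_def ov_def)
qed

lemma ovI: "c \<in> A \<Longrightarrow> z \<in> img c \<Longrightarrow> par c z \<in> fst d \<Longrightarrow> z \<in> ov c d"
  unfolding ov_def using par_in by (metis IntI image_eqI)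

lemma tr_inj: "c \<in> A \<Longrightarrow> d \<in> A \<Longrightarrow> inj_on (tr c d) (ov c d)"
proof (rule inj_onI)
  fix x y assume *: "c \<in> A" "d \<in> A" "x \<in> ov c d" "y \<in> ov c d" "tr c d x = tr c d y"
  then have "par c x = par c y" using ovD(4) by metis
  then show "x = y" using par_in(2) ovD(1)[OF *(1,2,3)] ovD(1)[OF *(1,2,4)] by metis
qed

lemma tr_image:
  assumes cd: "c \<in> A" "d \<in> A"
  shows "tr c d ` ov c d = ov d c"
proof (intro equalityI subsetI)
  fix w assume w: "w \<in> ov d c"
  have "tr c d (tr d c w) = w"
    unfolding tr_def[of c d] ovD(4)[OF cd(2,1) w] by (rule par_in(2)[OF ovD(1)[OF cd(2,1) w]])
  then show "w \<in> tr c d ` ov c d"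
    by (intro image_eqI[where x="tr d c w"]) (simp_all add: ovD(6)[OF cd(2,1) w])
next
  fix w assume "w \<in> tr c d ` ov c d"
  then obtain z where "z \<in> ov c d" "w = tr c d z" by blast
  then show "w \<in> ov d c" using ovD(6)[OF cd] by simp
qed

lemma coord_rep_tr: "c \<in> A \<Longrightarrow> d \<in> A \<Longrightarrow> z \<in> ov c d \<Longrightarrow> coord_rep c u z = coord_rep d u (tr c d z)"
  unfolding coord_rep_def comp_def by (simp only: ovD(4))

lemma tr_smooth: "c \<in> A \<Longrightarrow> d \<in> A \<Longrightarrow> Ck_on k (tr c d) (ov c d)"
  by (intro Ck_on_vec open_ov holo_fun_on_Ck_on tr_holo)

lemma mCk_chart: "mCk A k u \<Longrightarrow> c \<in> A \<Longrightarrow> Ck_on k (coord_rep c u) (img c)"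
  by (simp add: mCk_def)

lemma continuous_by_charts:
  assumes "\<And>c. c \<in> A \<Longrightarrow> continuous_on (img c) (coord_rep c u)"
  shows "continuous_on UNIV u"
proof (rule continuous_at_imp_continuous_on, rule ballI)
  fix p
  obtain c where c: "c \<in> A" "p \<in> fst c" by (rule cover)
  have "continuous_on (fst c) (\<lambda>q. coord_rep c u (snd c q))"
    by (rule continuous_on_compose2[OF assms[OF c(1)] chart(3)[OF c(1)]]) auto
  moreover have "coord_rep c u (snd c q) = u q" if "q \<in> fst c" for q
    using par_snd[OF c(1) that] by (simp add: coord_rep_def)
  ultimately have "continuous_on (fst c) u" by (rule continuous_on_eq)
  then show "isCont u p"
    by (rule continuous_on_interior) (use c interior_open[OF chart(1)[OF c(1)]] in simp)
qed

lemma mCk_continuous: "mCk A k u \<Longrightarrow> continuous_on UNIV u"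
  by (rule continuous_by_charts, rule Ck_on_imp_continuous, rule mCk_chart)

lemma coord_continuous: "c \<in> A \<Longrightarrow> continuous_on UNIV u \<Longrightarrow> continuous_on (img c) (coord_rep c u)"
  unfolding coord_rep_def o_def by (rule continuous_on_compose2[OF _ chart(4)]) auto

lemma bump_exists:
  assumes c: "c \<in> A" "p \<in> fst c"
  shows "\<exists>(\<beta> :: 'a \<Rightarrow> real) C. mCk A 2 \<beta> \<and> (\<forall>q. 0 \<le> \<beta> q) \<and> 0 < \<beta> p \<and>
     compact C \<and> C \<subseteq> fst c \<and> (\<forall>q. q \<notin> C \<longrightarrow> \<beta> q = 0)"
proof -
  define z0 where "z0 = snd c p"
  obtain r where r: "r > 0" "cball z0 r \<subseteq> img c"
    using chart(2)[OF c(1)] c(2) unfolding z0_def by (meson image_eqI open_contains_cball)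
  define b where "b = (\<lambda>w. (max 0 (r^2 - (w - z0) \<bullet> (w - z0))) ^ 3)"
  define \<beta> where "\<beta> = (\<lambda>q. if q \<in> fst c then b (snd c q) else 0)"
  define C where "C = par c ` cball z0 r"
  have C: "compact C" unfolding C_def
    by (intro compact_continuous_image continuous_on_subset[OF chart(4)[OF c(1)] r(2)]) simp
  have Cc: "C \<subseteq> fst c" unfolding C_def by (rule image_subsetI, rule par_in(1), erule subsetD[OF r(2)])
  have off: "\<beta> q = 0" if "q \<notin> C" for q
  proof (cases "q \<in> fst c")
    case True
    have "snd c q \<notin> cball z0 r"
    proof
      assume "snd c q \<in> cball z0 r"
      then have "par c (snd c q) \<in> C" unfolding C_def by (rule imageI)
      then show False using that par_snd[OF c(1) True] by simp
    qed
    then have "r < norm (snd c q - z0)" by (simp add: dist_norm norm_minus_commute)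
    then have "r^2 \<le> (snd c q - z0) \<bullet> (snd c q - z0)"
      using r(1) by (simp add: power2_norm_eq_inner[symmetric] power_mono)
    then show ?thesis by (simp add: \<beta>_def b_def)
  qed (simp add: \<beta>_def)
  have lin: "Ck_on 2 (\<lambda>w. w - z0) UNIV"
    by (intro Ck_on_diff Ck_on_bounded_linear bounded_linear_ident Ck_on_const open_UNIV)
  have inn: "Ck_on 2 (\<lambda>w. (w - z0) \<bullet> (w - z0)) UNIV"
    by (rule Ck_on_bilinear[OF open_UNIV bounded_bilinear_inner lin lin])
  have sm: "Ck_on 2 b UNIV"
    unfolding b_def
    by (rule Ck_on_compose[OF open_UNIV open_UNIV subset_UNIV Ck_on_diff[OF open_UNIV Ck_on_const[OF open_UNIV] inn] Ck_on_cubic])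
  have "mCk A 2 \<beta>"
    unfolding mCk_def
  proof
    fix d assume d: "d \<in> A"
    have ck1: "Ck_on 2 (\<lambda>z. b (tr d c z)) (ov d c)"
      by (rule Ck_on_compose[OF open_ov[OF d c(1)] open_UNIV _ tr_smooth[OF d c(1)] sm]) auto
    have eq1: "b (tr d c z) = coord_rep d \<beta> z" if "z \<in> ov d c" for z
      using ovD[OF d c(1) that] by (simp add: coord_rep_def \<beta>_def tr_def)
    have 1: "Ck_on 2 (coord_rep d \<beta>) (ov d c)"
      by (rule iffD1[OF Ck_on_cong[OF open_ov[OF d c(1)] eq1] ck1])
    \<comment> \<open>C is compact and so closed in a Hausdorff space. The image of d is then
      covered by two open sets, one where \<beta> is given by b and one where it is zero.\<close>
    let ?V = "snd d ` (fst d \<inter> - C)"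
    have oV: "open ?V" using open_chart_image[OF d] compact_imp_closed[OF C] by blast
    have eq2: "0 = coord_rep d \<beta> z" if "z \<in> ?V" for z
      using that off par_snd[OF d] by (auto simp: coord_rep_def)
    have 2: "Ck_on 2 (coord_rep d \<beta>) ?V"
      by (rule iffD1[OF Ck_on_cong[OF oV eq2] Ck_on_const[OF oV]])
    have "ov d c \<union> ?V = img d" using Cc by (auto simp: ov_def)
    then show "Ck_on 2 (coord_rep d \<beta>) (img d)" using Ck_on_Un[OF open_ov[OF d c(1)] oV 1 2] by simp
  qed
  moreover have "0 < \<beta> p" using c r(1) by (simp add: \<beta>_def b_def z0_def)
  moreover have "0 \<le> \<beta> q" for q by (simp add: \<beta>_def b_def)
  ultimately show ?thesis using C Cc off by blast
qed

definition unity_partition :: "'i set \<Rightarrow> ('i \<Rightarrow> 'a \<Rightarrow> real) \<Rightarrow> ('i \<Rightarrow> ('a, 'n) chart) \<Rightarrow> ('i \<Rightarrow> 'a set) \<Rightarrow> bool" where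
  "unity_partition I \<eta> ch C \<longleftrightarrow> finite I \<and> (\<forall>q. (\<Sum>i\<in>I. \<eta> i q) = 1) \<and>
    (\<forall>i\<in>I. mCk A 2 (\<eta> i) \<and> (\<forall>q. 0 \<le> \<eta> i q) \<and> ch i \<in> A \<and> compact (C i) \<and> C i \<subseteq> fst (ch i) \<and> (\<forall>q. q \<notin> C i \<longrightarrow> \<eta> i q = 0))"

text \<open>The member with chart c0 that is positive at p0 makes it possible to conclude from a
  vanishing sum of integrals that an integrand is zero at a prescribed point.\<close>

lemma unity_partition_exists:
  assumes c0: "c0 \<in> A" "p0 \<in> fst c0"
  shows "\<exists>(I :: 'a set) \<eta> ch C. unity_partition I \<eta> ch C \<and> (\<exists>i\<in>I. ch i = c0 \<and> 0 < \<eta> i p0)"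
proof -
  have "\<exists>x :: ('a \<Rightarrow> real) \<times> ('a, 'n) chart \<times> 'a set. mCk A 2 (fst x) \<and> (\<forall>q. 0 \<le> fst x q) \<and> 0 < fst x p
      \<and> fst (snd x) \<in> A \<and> compact (snd (snd x)) \<and> snd (snd x) \<subseteq> fst (fst (snd x)) \<and> (\<forall>q. q \<notin> snd (snd x) \<longrightarrow> fst x q = 0)
      \<and> (p = p0 \<longrightarrow> fst (snd x) = c0)" for p
  proof -
    have "\<exists>c. c \<in> A \<and> p \<in> fst c \<and> (p = p0 \<longrightarrow> c = c0)"
      using c0 cover[of p] by (cases "p = p0") blast+
    then obtain c where c: "c \<in> A" "p \<in> fst c" "p = p0 \<longrightarrow> c = c0" by blast
    obtain \<beta> :: "'a \<Rightarrow> real" and C where "mCk A 2 \<beta> \<and> (\<forall>q. 0 \<le> \<beta> q) \<and> 0 < \<beta> p \<and> compact C \<and> C \<subseteq> fst c \<and> (\<forall>q. q \<notin> C \<longrightarrow> \<beta> q = 0)"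
      using bump_exists[OF c(1,2)] by (elim exE) (rule that)
    with c show ?thesis by (intro exI[of _ "(\<beta>, c, C)"]) simp
  qed
  then obtain F :: "'a \<Rightarrow> ('a \<Rightarrow> real) \<times> ('a, 'n) chart \<times> 'a set" where F: "\<And>p. mCk A 2 (fst (F p)) \<and> (\<forall>q. 0 \<le> fst (F p) q) \<and> 0 < fst (F p) p
      \<and> fst (snd (F p)) \<in> A \<and> compact (snd (snd (F p))) \<and> snd (snd (F p)) \<subseteq> fst (fst (snd (F p))) \<and> (\<forall>q. q \<notin> snd (snd (F p)) \<longrightarrow> fst (F p) q = 0)
      \<and> (p = p0 \<longrightarrow> fst (snd (F p)) = c0)"
    by (rule choice[OF allI, THEN exE]) (rule that, rule spec)
  define \<beta> where "\<beta> = (\<lambda>p. fst (F p))"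
  define ch where "ch = (\<lambda>p. fst (snd (F p)))"
  define C where "C = (\<lambda>p. snd (snd (F p)))"
  have \<beta>: "mCk A 2 (\<beta> p)" "0 \<le> \<beta> p q" "0 < \<beta> p p"
    "ch p \<in> A" "compact (C p)" "C p \<subseteq> fst (ch p)" "q \<notin> C p \<Longrightarrow> \<beta> p q = 0" for p q
    using F[of p] unfolding \<beta>_def ch_def C_def by simp_all
  have "open {q. 0 < \<beta> p q}" for p
    by (intro open_Collect_less continuous_on_const mCk_continuous[OF \<beta>(1)])
  moreover have "UNIV \<subseteq> (\<Union>p\<in>UNIV. {q. 0 < \<beta> p q})" using \<beta>(3) by blast
  ultimately obtain I0 where I0: "finite I0" "UNIV \<subseteq> (\<Union>p\<in>I0. {q. 0 < \<beta> p q})"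
    by (rule compactE_image[OF compact_UNIV])
  define I where "I = insert p0 I0"
  have I: "finite I" "UNIV \<subseteq> (\<Union>p\<in>I. {q. 0 < \<beta> p q})" "p0 \<in> I"
    using I0 by (auto simp: I_def)
  define \<Theta> where "\<Theta> = (\<lambda>q. \<Sum>p\<in>I. \<beta> p q)"
  have \<Theta>: "\<Theta> q > 0" for q
  proof -
    obtain p where "p \<in> I" "0 < \<beta> p q" using I(2) by blast
    then show ?thesis unfolding \<Theta>_def by (intro sum_pos2[OF I(1)]) (auto simp: \<beta>)
  qed
  have "unity_partition I (\<lambda>p q. \<beta> p q / \<Theta> q) ch C"
    unfolding unity_partition_def
  proof (intro conjI allI ballI impI)
    fix q
    have "(\<Sum>i\<in>I. \<beta> i q / \<Theta> q) = \<Theta> q / \<Theta> q" unfolding \<Theta>_def sum_divide_distrib ..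
    then show "(\<Sum>i\<in>I. \<beta> i q / \<Theta> q) = 1" using \<Theta>[of q] by simp
  next
    fix p assume "p \<in> I"
    show "mCk A 2 (\<lambda>q. \<beta> p q / \<Theta> q)"
      unfolding mCk_def
    proof
      fix d assume d: "d \<in> A"
      have "Ck_on 2 (coord_rep d (\<beta> p)) (img d)" for p using \<beta>(1) d by (simp add: mCk_def)
      then have "Ck_on 2 (\<lambda>z. coord_rep d (\<beta> p) z / (\<Sum>p\<in>I. coord_rep d (\<beta> p) z)) (img d)"
        using \<Theta> unfolding coord_rep_def o_def \<Theta>_def
        by (intro Ck_on_divide Ck_on_sum chart(2)[OF d]) (auto simp: less_imp_neq[symmetric])
      then show "Ck_on 2 (coord_rep d (\<lambda>q. \<beta> p q / \<Theta> q)) (img d)"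
        by (simp add: coord_rep_def o_def \<Theta>_def)
    qed
  qed (use I(1) \<beta> \<Theta> in \<open>auto intro!: divide_nonneg_pos\<close>)
  moreover have "ch p0 = c0" using F[of p0] by (simp add: ch_def)
  moreover have "0 < \<beta> p0 p0 / \<Theta> p0" by (simp add: \<beta>(3) \<Theta>)
  ultimately show ?thesis using I(3) by blast
qed

end

section \<open>Integration on a Hermitian manifold\<close>

locale hermitian_manifold = complex_manifold A
  for A :: "('a::t2_space, 'n::finite) chart set" +
  fixes g :: "('a, 'n) metric"
  assumes metric: "hermitian_metric A g"
begin

abbreviation Gc :: "('a, 'n) chart \<Rightarrow> complex^'n \<Rightarrow> complex^'n^'n" where
  "Gc c \<equiv> coord_rep c (g c)"

lemma coords:
  assumes c: "c \<in> A" shows "hermitian_coords (Gc c) (img c)"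
proof
  show "open (img c)" by (rule chart(2)[OF c])
  show "Ck_on k (\<lambda>z. Gc c z $ i $ j) (img c)" for k i j
  proof -
    have "Ck_on k (coord_rep c (\<lambda>p. g c p $ i $ j)) (img c)"
      using metric c unfolding hermitian_metric_def smooth_fun_on_def by blast
    then show ?thesis by (simp add: coord_rep_def o_def)
  qed
  show "pos_def (Gc c z)" if "z \<in> img c" for z
  proof -
    have m: "\<forall>p\<in>fst c. (\<forall>i j. g c p $ j $ i = cnj (g c p $ i $ j)) \<and>
           (\<forall>v. v \<noteq> 0 \<longrightarrow> Re (\<Sum>i\<in>UNIV. \<Sum>j\<in>UNIV. g c p $ i $ j * v $ i * cnj (v $ j)) > 0)"
      using metric c unfolding hermitian_metric_def by blast
    show ?thesis
      using bspec[OF m par_in(1)[OF that]] unfolding pos_def_def herm_form_def coord_rep_def o_def .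
  qed
qed

lemma jac_transition: "c \<in> A \<Longrightarrow> d \<in> A \<Longrightarrow> z \<in> ov c d \<Longrightarrow> jac (tr c d) z = transition_jacobian c d (par c z)"
proof -
  assume cd: "c \<in> A" "d \<in> A" "z \<in> ov c d"
  have "snd c (par c z) = z" using par_in(2)[OF ovD(1)[OF cd]] .
  then show ?thesis
    unfolding jac_def transition_jacobian_def pd_z_def by (simp add: coord_rep_def o_def tr_def)
qed

section \<open>Transformation rules of the metric and its inverse\<close>

definition cnjm :: "complex^'n^'n \<Rightarrow> complex^'n^'n" where
  "cnjm M = (\<chi> i j. cnj (M $ i $ j))"

lemma metric_transform:
  assumes cd: "c \<in> A" "d \<in> A" "z \<in> ov c d"
  shows "Gc c z = transpose (jac (tr c d) z) ** Gc d (tr c d z) ** cnjm (jac (tr c d) z)"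
proof -
  let ?J = "jac (tr c d) z"
  have p: "par c z \<in> fst c \<inter> fst d" using ovD(2,3)[OF cd] by blast
  have gd: "Gc d (tr c d z) = g d (par c z)" by (simp add: coord_rep_def ovD(4)[OF cd])
  have m: "\<forall>p\<in>fst c \<inter> fst d. \<forall>i j. g c p $ i $ j =
          (\<Sum>k\<in>UNIV. \<Sum>l\<in>UNIV. transition_jacobian c d p $ k $ i
             * cnj (transition_jacobian c d p $ l $ j) * g d p $ k $ l)"
    using metric cd(1,2) unfolding hermitian_metric_def by blast
  have "Gc c z $ i $ j = (\<Sum>k\<in>UNIV. \<Sum>l\<in>UNIV. ?J $ k $ i * cnj (?J $ l $ j) * Gc d (tr c d z) $ k $ l)" for i j
    using bspec[OF m p] unfolding jac_transition[OF cd] gd by (simp add: coord_rep_def)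
  also have "(\<Sum>k\<in>UNIV. \<Sum>l\<in>UNIV. ?J $ k $ i * cnj (?J $ l $ j) * Gc d (tr c d z) $ k $ l)
      = (transpose ?J ** Gc d (tr c d z) ** cnjm ?J) $ i $ j" for i j
    unfolding matrix_matrix_mult_def transpose_def cnjm_def
    by (subst sum.swap) (simp add: sum_distrib_right sum_distrib_left mult_ac)
  finally show ?thesis by (simp add: vec_eq_iff)
qed

lemma det_cnjm: "det (cnjm M) = cnj (det M)"
  unfolding cnjm_def by (rule cnj_det)

lemma det_transform:
  assumes cd: "c \<in> A" "d \<in> A" "z \<in> ov c d"
  shows "det (Gc c z) = of_real ((norm (det (jac (tr c d) z)))^2) * det (Gc d (tr c d z))" "det (jac (tr c d) z) \<noteq> 0"
proof -
  show *: "det (Gc c z) = of_real ((norm (det (jac (tr c d) z)))^2) * det (Gc d (tr c d z))"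
    unfolding metric_transform[OF cd] det_mul det_transpose det_cnjm complex_norm_square by simp
  interpret c: hermitian_coords "Gc c" "img c" by (rule coords[OF cd(1)])
  have "det (Gc c z) \<noteq> 0" using c.D_nz[OF ovD(1)[OF cd]] by (simp add: c.D_def)
  then show "det (jac (tr c d) z) \<noteq> 0" using * by auto
qed

definition inv_metric :: "('a, 'n) chart \<Rightarrow> complex^'n \<Rightarrow> complex^'n^'n" where
  "inv_metric c z = matrix_inv (Gc c z)"

lemma inverse_transform:
  assumes cd: "c \<in> A" "d \<in> A" "z \<in> ov c d"
  shows "inv_metric d (tr c d z) = cnjm (jac (tr c d) z) ** inv_metric c z ** transpose (jac (tr c d) z)"
proof -
  let ?J = "jac (tr c d) z"
  interpret c: hermitian_coords "Gc c" "img c" by (rule coords[OF cd(1)])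
  interpret d: hermitian_coords "Gc d" "img d" by (rule coords[OF cd(2)])
  have "det (cnjm ?J) \<noteq> 0" using det_transform(2)[OF cd] by (simp add: det_cnjm)
  then obtain B where B: "cnjm ?J ** B = mat 1" unfolding invertible_det_nz[symmetric] invertible_def by blast
  have "transpose ?J ** Gc d (tr c d z) = Gc c z ** B"
    unfolding metric_transform[OF cd] by (simp add: B flip: matrix_mul_assoc)
  then have "(cnjm ?J ** inv_metric c z ** transpose ?J) ** Gc d (tr c d z) = cnjm ?J ** (inv_metric c z ** Gc c z) ** B"
    by (simp flip: matrix_mul_assoc)
  also have "\<dots> = mat 1" unfolding inv_metric_def using c.K_G[OF ovD(1)[OF cd]] by (simp add: c.K_def B)
  finally have L: "(cnjm ?J ** inv_metric c z ** transpose ?J) ** Gc d (tr c d z) = mat 1" .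
  have "Gc d (tr c d z) ** inv_metric d (tr c d z) = mat 1"
    unfolding inv_metric_def using d.G_K[OF ovD(5)[OF cd]] by (simp add: d.K_def)
  then show ?thesis using L by (metis matrix_mul_assoc matrix_mul_lid matrix_mul_rid)
qed

section \<open>The complex Laplacian of functions\<close>

definition lap :: "('a, 'n) chart \<Rightarrow> ('a \<Rightarrow> real) \<Rightarrow> complex^'n \<Rightarrow> complex" where
  "lap c \<eta> z = (\<Sum>i\<in>UNIV. \<Sum>j\<in>UNIV. inv_metric c z $ j $ i * d_zbar j (d_z i (coord_rep c (\<lambda>p. complex_of_real (\<eta> p)))) z)"

lemma mCk_of_real: "mCk A k \<eta> \<Longrightarrow> mCk A k (\<lambda>p. complex_of_real (\<eta> p))"
  unfolding mCk_def coord_rep_def o_def by (intro ballI Ck_on_of_real chart(2)) auto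

text \<open>Second derivatives of the transition map do not appear: \<open>d_z i\<close> of its
  components is again holomorphic and is annihilated by \<open>d_zbar j\<close>. The Jacobians that
  remain cancel against those of the inverse metric.\<close>

lemma lap_invariant:
  assumes cd: "c \<in> A" "d \<in> A" "z \<in> ov c d" and \<eta>: "mCk A 2 \<eta>"
  shows "lap c \<eta> z = lap d \<eta> (tr c d z)"
proof -
  let ?J = "jac (tr c d) z" and ?x = "\<lambda>p. complex_of_real (\<eta> p)"
  define F where "F = coord_rep d ?x"
  have F: "Ck_on (Suc (Suc 0)) F (img d)"
    using mCk_chart[OF mCk_of_real[OF \<eta>] cd(2)] unfolding F_def by (simp only: numeral_2_eq_2)
  have Fk: "Ck_on (Suc 0) (d_z k F) (img d)" for k by (rule dz.Ck[OF chart(2)[OF cd(2)] F])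
  have oo: "open (ov c d)" by (rule open_ov[OF cd(1,2)])
  note hol = tr_holo[OF cd(1,2)]
  have J: "d_z i (\<lambda>y. tr c d y $ k) z = ?J $ k $ i" for i k by (simp add: jac_def)
  have hess: "d_zbar j (d_z i (coord_rep c ?x)) z = (\<Sum>k\<in>UNIV. \<Sum>l\<in>UNIV. d_zbar l (d_z k F) (tr c d z) * cnj (?J $ l $ j) * ?J $ k $ i)" for i j
  proof -
    have "d_z i (coord_rep c ?x) y = (\<Sum>k\<in>UNIV. d_z k F (tr c d y) * d_z i (\<lambda>y. tr c d y $ k) y)" if y: "y \<in> ov c d" for y
    proof -
      have "d_z i (coord_rep c ?x) y = d_z i (\<lambda>y. F (tr c d y)) y"
        unfolding F_def by (rule dz.cong[OF oo y coord_rep_tr[OF cd(1,2)]])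
      also have "\<dots> = (\<Sum>k\<in>UNIV. d_z k F (tr c d y) * d_z i (\<lambda>y. tr c d y $ k) y)"
        by (rule wirtinger_chain_holo(1)[OF Ck_on_differentiable[OF F ovD(5)[OF cd(1,2) y]] hol y])
      finally show ?thesis .
    qed
    then have "d_zbar j (d_z i (coord_rep c ?x)) z = d_zbar j (\<lambda>y. \<Sum>k\<in>UNIV. d_z k F (tr c d y) * d_z i (\<lambda>y. tr c d y $ k) y) z"
      by (rule dzb.cong[OF oo cd(3)])
    also have "\<dots> = (\<Sum>k\<in>UNIV. d_zbar j (\<lambda>y. d_z k F (tr c d y)) z * ?J $ k $ i)"
    proof -
      have d1: "(\<lambda>y. d_z k F (tr c d y)) differentiable at z" for k
        by (rule wirtinger_chain_holo(3)[OF Ck_on_differentiable[OF Fk ovD(5)[OF cd]] hol cd(3)])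
      have h2: "holo_fun_on (d_z i (\<lambda>y. tr c d y $ k)) (ov c d)" for k by (rule holo_d_z[OF oo hol])
      have d2: "d_z i (\<lambda>y. tr c d y $ k) differentiable at z" for k by (rule holo_fun_on_differentiable[OF h2 cd(3)])
      show ?thesis
        by (simp add: dzb.sum dzb.mult[OF d1 d2] d_zbar_holo[OF h2 cd(3)] J differentiable_mult d1 d2)
    qed
    also have "\<dots> = (\<Sum>k\<in>UNIV. (\<Sum>l\<in>UNIV. d_zbar l (d_z k F) (tr c d z) * cnj (?J $ l $ j)) * ?J $ k $ i)"
      by (simp add: wirtinger_chain_holo(2)[OF Ck_on_differentiable[OF Fk ovD(5)[OF cd]] hol cd(3)] J)
    finally show ?thesis by (simp add: sum_distrib_right)
  qed
  have K: "inv_metric d (tr c d z) $ l $ k = (\<Sum>i\<in>UNIV. \<Sum>j\<in>UNIV. cnj (?J $ l $ j) * inv_metric c z $ j $ i * ?J $ k $ i)" for l k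
    unfolding inverse_transform[OF cd] by (simp add: matrix_matrix_mult_def cnjm_def transpose_def sum_distrib_right)
  have "lap c \<eta> z = (\<Sum>i\<in>UNIV. \<Sum>j\<in>UNIV. \<Sum>k\<in>UNIV. \<Sum>l\<in>UNIV. (cnj (?J $ l $ j) * inv_metric c z $ j $ i * ?J $ k $ i) * d_zbar l (d_z k F) (tr c d z))"
    unfolding lap_def hess sum_distrib_left by (simp add: mult_ac)
  also have "\<dots> = (\<Sum>i\<in>UNIV. \<Sum>k\<in>UNIV. \<Sum>j\<in>UNIV. \<Sum>l\<in>UNIV. (cnj (?J $ l $ j) * inv_metric c z $ j $ i * ?J $ k $ i) * d_zbar l (d_z k F) (tr c d z))"
    by (rule sum.cong[OF refl], rule sum.swap)
  also have "\<dots> = (\<Sum>i\<in>UNIV. \<Sum>k\<in>UNIV. \<Sum>l\<in>UNIV. \<Sum>j\<in>UNIV. (cnj (?J $ l $ j) * inv_metric c z $ j $ i * ?J $ k $ i) * d_zbar l (d_z k F) (tr c d z))"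
    by (rule sum.cong[OF refl], rule sum.cong[OF refl], rule sum.swap)
  also have "\<dots> = (\<Sum>k\<in>UNIV. \<Sum>i\<in>UNIV. \<Sum>l\<in>UNIV. \<Sum>j\<in>UNIV. (cnj (?J $ l $ j) * inv_metric c z $ j $ i * ?J $ k $ i) * d_zbar l (d_z k F) (tr c d z))"
    by (rule sum.swap)
  also have "\<dots> = (\<Sum>k\<in>UNIV. \<Sum>l\<in>UNIV. \<Sum>i\<in>UNIV. \<Sum>j\<in>UNIV. (cnj (?J $ l $ j) * inv_metric c z $ j $ i * ?J $ k $ i) * d_zbar l (d_z k F) (tr c d z))"
    by (rule sum.cong[OF refl], rule sum.swap)
  also have "\<dots> = lap d \<eta> (tr c d z)"
    unfolding lap_def K F_def sum_distrib_right ..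
  finally show ?thesis .
qed

text \<open>By \<open>lap_invariant\<close> the arbitrary choice of the chart is harmless.\<close>

definition Lap :: "('a \<Rightarrow> real) \<Rightarrow> 'a \<Rightarrow> real" where
  "Lap \<eta> p = (let c = (SOME c. c \<in> A \<and> p \<in> fst c) in Re (lap c \<eta> (snd c p)))"

lemma Lap_chart:
  assumes c: "c \<in> A" "z \<in> img c" and \<eta>: "mCk A 2 \<eta>"
  shows "Lap \<eta> (par c z) = Re (lap c \<eta> z)"
proof -
  let ?p = "par c z"
  define d where "d = (SOME d. d \<in> A \<and> ?p \<in> fst d)"
  have d: "d \<in> A" "?p \<in> fst d"
    using someI_ex[of "\<lambda>d. d \<in> A \<and> ?p \<in> fst d"] cover[of ?p] unfolding d_def by blast+
  have "z \<in> ov c d" by (rule ovI[OF c(1) c(2) d(2)])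
  from lap_invariant[OF c(1) d(1) this \<eta>]
  show ?thesis unfolding Lap_def d_def[symmetric] Let_def by (simp add: tr_def)
qed

lemma Lap_continuous: "mCk A 2 \<eta> \<Longrightarrow> continuous_on UNIV (Lap \<eta>)"
proof (rule continuous_by_charts)
  fix c assume \<eta>: "mCk A 2 \<eta>" and c: "c \<in> A"
  interpret c: hermitian_coords "Gc c" "img c" by (rule coords[OF c])
  have F: "Ck_on (Suc (Suc 0)) (coord_rep c (\<lambda>p. complex_of_real (\<eta> p))) (img c)"
    using mCk_chart[OF mCk_of_real[OF \<eta>] c] by (simp only: numeral_2_eq_2)
  have "Ck_on 0 (d_zbar j (d_z i (coord_rep c (\<lambda>p. complex_of_real (\<eta> p))))) (img c)" for i j
    by (rule dzb.Ck[OF chart(2)[OF c] dz.Ck[OF chart(2)[OF c] F]])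
  then have "Ck_on 0 (\<lambda>z. Re (lap c \<eta> z)) (img c)"
    unfolding lap_def inv_metric_def c.K_def[symmetric]
    by (intro Ck_on_Re Ck_on_sum Ck_on_mult chart(2)[OF c] c.smooth_K)
  then have "continuous_on (img c) (\<lambda>z. Re (lap c \<eta> z))" by simp
  then show "continuous_on (img c) (coord_rep c (Lap \<eta>))"
    by (rule continuous_on_eq) (simp only: coord_rep_def comp_def Lap_chart[OF c _ \<eta>])
qed

lemma chart_closed_image:
  assumes "c \<in> A" "compact C" "C \<subseteq> fst c"
  shows "compact (snd c ` C)" "snd c ` C \<subseteq> img c" "z \<in> img c \<Longrightarrow> z \<notin> snd c ` C \<Longrightarrow> par c z \<notin> C"
proof -
  show "compact (snd c ` C)" using assms by (intro compact_continuous_image continuous_on_subset[OF chart(3)])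
  show "snd c ` C \<subseteq> img c" using assms(3) by blast
  show "par c z \<notin> C" if "z \<in> img c" "z \<notin> snd c ` C"
  proof
    assume "par c z \<in> C"
    then have "snd c (par c z) \<in> snd c ` C" by (rule imageI)
    then show False using that par_in(2) by metis
  qed
qed

lemma Lap_zero_off:
  assumes \<eta>: "mCk A 2 \<eta>" and C: "compact C" "\<And>p. p \<notin> C \<Longrightarrow> \<eta> p = 0" and p: "p \<notin> C"
  shows "Lap \<eta> p = 0"
proof -
  obtain c where c: "c \<in> A" "p \<in> fst c" by (rule cover)
  let ?x = "coord_rep c (\<lambda>p. complex_of_real (\<eta> p))"
  let ?V = "snd c ` (fst c \<inter> - C)"
  have oV: "open ?V" using open_chart_image[OF c(1)] compact_imp_closed[OF C(1)] by blast
  have z: "snd c p \<in> ?V" using c(2) p by blast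
  have x0: "?x y = 0" if "y \<in> ?V" for y using that C(2) par_snd[OF c(1)] by (auto simp: coord_rep_def)
  have 1: "d_z i ?x y = 0" if "y \<in> ?V" for i y
  proof -
    have "d_z i ?x y = d_z i (\<lambda>_. 0) y" by (rule dz.cong[OF oV that x0])
    then show ?thesis by simp
  qed
  have "d_zbar j (d_z i ?x) (snd c p) = 0" for i j
  proof -
    have "d_zbar j (d_z i ?x) (snd c p) = d_zbar j (\<lambda>_. 0) (snd c p)" by (rule dzb.cong[OF oV z 1])
    then show ?thesis by simp
  qed
  then have "lap c \<eta> (snd c p) = 0" by (simp add: lap_def)
  moreover have "Lap \<eta> (par c (snd c p)) = Re (lap c \<eta> (snd c p))"
    by (rule Lap_chart[OF c(1) _ \<eta>]) (use c(2) in blast)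
  ultimately show ?thesis using par_snd[OF c] by simp
qed

section \<open>Integrals of functions supported in a chart\<close>

definition mfun :: "('a, 'n) chart \<Rightarrow> ('a \<Rightarrow> real) \<Rightarrow> complex^'n \<Rightarrow> real" where
  "mfun c k z = (if z \<in> img c then k (par c z) * Re (det (Gc c z)) else 0)"

definition mint :: "('a, 'n) chart \<Rightarrow> ('a \<Rightarrow> real) \<Rightarrow> real" where
  "mint c k = cint (mfun c k)"

text \<open>The chart image and the complement of the compact set are open and cover the space, so
  extension by zero preserves continuity.\<close>

lemma csupp_extend:
  assumes c: "c \<in> A" and f: "continuous_on (img c) f" and C: "compact C" "C \<subseteq> fst c"
    and off: "\<And>z. z \<in> img c \<Longrightarrow> par c z \<notin> C \<Longrightarrow> f z = 0"
  shows "csupp (\<lambda>z. if z \<in> img c then f z else 0)"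
proof (rule csuppI[OF _ chart_closed_image(1)[OF c C]])
  let ?f = "\<lambda>z. if z \<in> img c then f z else 0"
  have z0: "?f z = 0" if "z \<notin> snd c ` C" for z
    using that off chart_closed_image(3)[OF c C] by auto
  have oC: "open (- (snd c ` C))" using compact_imp_closed[OF chart_closed_image(1)[OF c C]] by (rule open_Compl)
  have "continuous_on (img c) ?f" by (rule continuous_on_eq[OF f]) simp
  moreover have "continuous_on (- (snd c ` C)) ?f"
    by (rule continuous_on_eq[OF continuous_on_const[of _ 0]]) (use z0 in auto)
  ultimately have "continuous_on (img c \<union> - (snd c ` C)) ?f"
    by (intro continuous_on_open_Un chart(2)[OF c] oC)
  moreover have "img c \<union> - (snd c ` C) = UNIV" using C(2) by blast
  ultimately show "continuous_on UNIV ?f" by (simp only:)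
  show "?f z = 0" if "z \<notin> snd c ` C" for z by (rule z0[OF that])
qed

lemma csupp_mfun:
  assumes c: "c \<in> A" and k: "continuous_on UNIV k" and C: "compact C" "C \<subseteq> fst c" "\<And>p. p \<notin> C \<Longrightarrow> k p = 0"
  shows "csupp (mfun c k)"
  unfolding mfun_def
proof (rule csupp_extend[OF c _ C(1,2)])
  interpret c: hermitian_coords "Gc c" "img c" by (rule coords[OF c])
  show "continuous_on (img c) (\<lambda>z. k (par c z) * Re (det (Gc c z)))"
    using coord_continuous[OF c k] Ck_on_imp_continuous[OF c.smooth_D[of 0]]
    unfolding c.D_def[abs_def] unfolding coord_rep_def o_def by (intro continuous_intros)
qed (simp add: C(3))

text \<open>The squared modulus of the complex Jacobian determinant appears twice: as the real
  Jacobian of the transition map and as the ratio of the two volume densities.\<close>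

lemma mint_chart_independent:
  assumes cd: "c \<in> A" "d \<in> A" and k: "continuous_on UNIV k"
    and C: "compact C" "C \<subseteq> fst c" "C \<subseteq> fst d" "\<And>p. p \<notin> C \<Longrightarrow> k p = 0"
  shows "mint c k = mint d k"
proof -
  have "cint (mfun d k) = cint (\<lambda>z. if z \<in> ov c d then (norm (det (jac (tr c d) z)))^2 * mfun d k (tr c d z) else 0)"
  proof (rule cint_change_of_variables[OF open_ov[OF cd] tr_inj[OF cd] tr_holo[OF cd] det_transform(2)[OF cd]])
    show "csupp (mfun d k)" by (rule csupp_mfun[OF cd(2) k C(1,3,4)])
    show "mfun d k z = 0" if "z \<notin> tr c d ` ov c d" for z
    proof (cases "z \<in> img d")
      case True
      then have "par d z \<notin> fst c" using that ovI[OF cd(2) True, of c] unfolding tr_image[OF cd] by blast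
      then show ?thesis using C(2,4) by (auto simp: mfun_def)
    qed (simp add: mfun_def)
  qed
  also have "(\<lambda>z. if z \<in> ov c d then (norm (det (jac (tr c d) z)))^2 * mfun d k (tr c d z) else 0) = mfun c k"
  proof
    fix z
    show "(if z \<in> ov c d then (norm (det (jac (tr c d) z)))^2 * mfun d k (tr c d z) else 0) = mfun c k z"
    proof (cases "z \<in> ov c d")
      case True
      then show ?thesis
        using ovD[OF cd True] det_transform(1)[OF cd True] unfolding mfun_def
        by (simp add: algebra_simps flip: of_real_power)
    next
      case False
      then show ?thesis using ovI[OF cd(1), of z d] C(3,4) by (auto simp: mfun_def)
    qed
  qed
  finally show ?thesis unfolding mint_def by simp
qed

lemma mint_sum:
  assumes c: "c \<in> A" and k: "\<And>i. i \<in> I \<Longrightarrow> continuous_on UNIV (k i)" and C: "compact C" "C \<subseteq> fst c" "\<And>i p. i \<in> I \<Longrightarrow> p \<notin> C \<Longrightarrow> k i p = 0"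
  shows "mint c (\<lambda>p. \<Sum>i\<in>I. k i p) = (\<Sum>i\<in>I. mint c (k i))"
proof -
  have "mfun c (\<lambda>p. \<Sum>i\<in>I. k i p) = (\<lambda>z. \<Sum>i\<in>I. mfun c (k i) z)"
    by (auto simp: fun_eq_iff mfun_def sum_distrib_right)
  then show ?thesis unfolding mint_def
    using cint_sum[of I "\<lambda>i. mfun c (k i)"] csupp_mfun[OF c k C(1,2) C(3)] by simp
qed

text \<open>The members add up to the constant 1, whose Laplacian is zero. This is where the
  vanishing of the integral of the adjoint comes from.\<close>

lemma sum_Lap_partition:
  assumes P: "unity_partition I \<eta> ch C"
  shows "(\<Sum>i\<in>I. Lap (\<eta> i) p) = 0"
proof -
  obtain c where c: "c \<in> A" "p \<in> fst c" by (rule cover)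
  let ?z = "snd c p"
  let ?x = "\<lambda>i. coord_rep c (\<lambda>p. complex_of_real (\<eta> i p))"
  have z: "?z \<in> img c" using c(2) by blast
  have \<eta>: "mCk A 2 (\<eta> i)" if "i \<in> I" for i using P that by (simp add: unity_partition_def)
  note oc = chart(2)[OF c(1)]
  have F: "Ck_on (Suc (Suc 0)) (?x i) (img c)" if "i \<in> I" for i
    using mCk_chart[OF mCk_of_real[OF \<eta>[OF that]] c(1)] by (simp only: numeral_2_eq_2)
  have one: "(\<Sum>i\<in>I. ?x i y) = 1" for y
    using P by (simp add: coord_rep_def unity_partition_def flip: of_real_sum)
  have dzsum: "(\<Sum>k\<in>I. d_z i (?x k) y) = 0" if "y \<in> img c" for i y
  proof -
    have "(\<Sum>k\<in>I. d_z i (?x k) y) = d_z i (\<lambda>y. \<Sum>k\<in>I. ?x k y) y"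
      by (rule dz.sum[symmetric]) (rule Ck_on_differentiable[OF F that])
    then show ?thesis unfolding one by simp
  qed
  have hs: "(\<Sum>k\<in>I. d_zbar j (d_z i (?x k)) ?z) = 0" for i j
  proof -
    have "(\<Sum>k\<in>I. d_zbar j (d_z i (?x k)) ?z) = d_zbar j (\<lambda>y. \<Sum>k\<in>I. d_z i (?x k) y) ?z"
      by (rule dzb.sum[symmetric]) (rule Ck_on_differentiable[OF dz.Ck[OF oc F] z])
    also have "\<dots> = d_zbar j (\<lambda>y. 0) ?z" by (rule dzb.cong[OF oc z dzsum])
    finally show ?thesis by simp
  qed
  have "(\<Sum>k\<in>I. lap c (\<eta> k) ?z) = (\<Sum>i\<in>UNIV. \<Sum>j\<in>UNIV. inv_metric c ?z $ j $ i * (\<Sum>k\<in>I. d_zbar j (d_z i (?x k)) ?z))"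
    unfolding lap_def sum_distrib_left by (subst sum.swap, rule sum.cong[OF refl], rule sum.swap)
  then have "(\<Sum>k\<in>I. lap c (\<eta> k) ?z) = 0" by (simp add: hs)
  moreover have "Lap (\<eta> i) p = Re (lap c (\<eta> i) ?z)" if "i \<in> I" for i
    using Lap_chart[OF c(1) z \<eta>[OF that]] par_snd[OF c] by simp
  ultimately show ?thesis by (simp flip: Re_sum)
qed

text \<open>Both derivatives move from u det G times the inverse metric onto the cut-off \<eta>,
  where they form the Laplacian of a function, an object that does not depend on the chart.\<close>

lemma local_by_parts:
  assumes c: "c \<in> A" and \<eta>: "mCk A 2 \<eta>" and C: "compact C" "C \<subseteq> fst c" "\<And>p. p \<notin> C \<Longrightarrow> \<eta> p = 0" and u: "mCk A 2 u"
  shows "cint (\<lambda>z. if z \<in> img c then \<eta> (par c z) * Re (hermitian_coords.adj_lap (Gc c) (\<lambda>y. of_real (u (par c y)) * det (Gc c y)) z) else 0)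
    = mint c (\<lambda>p. u p * Lap \<eta> p)"
proof -
  interpret c: hermitian_coords "Gc c" "img c" by (rule coords[OF c])
  define a where "a = (\<lambda>z. if z \<in> img c then complex_of_real (\<eta> (par c z)) else 0)"
  define W where "W = (\<lambda>i j y. of_real (u (par c y)) * det (Gc c y) * c.K y $ j $ i)"
  let ?C = "snd c ` C"
  note cc = chart_closed_image[OF c C(1,2)]
  note oc = chart(2)[OF c]
  have a0: "a z = 0" if "z \<notin> ?C" for z using that C(3) cc(3) by (auto simp: a_def)
  have oC: "open (- ?C)" using compact_imp_closed[OF cc(1)] by (rule open_Compl)
  have x: "Ck_on 2 (coord_rep c (\<lambda>p. complex_of_real (\<eta> p))) (img c)" by (rule mCk_chart[OF mCk_of_real[OF \<eta>] c])
  have ax: "coord_rep c (\<lambda>p. complex_of_real (\<eta> p)) z = a z" if "z \<in> img c" for z using that by (simp add: a_def coord_rep_def)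
  have a: "Ck_on 2 a UNIV"
  proof -
    have 1: "Ck_on 2 a (img c)" by (rule iffD1[OF Ck_on_cong[OF oc ax] x])
    have z: "0 = a z" if "z \<in> - ?C" for z using a0 that by simp
    have 2: "Ck_on 2 a (- ?C)" by (rule iffD1[OF Ck_on_cong[OF oC z] Ck_on_const[OF oC]])
    have "img c \<union> - ?C = UNIV" using cc(2) by blast
    then show ?thesis using Ck_on_Un[OF oc oC 1 2] by simp
  qed
  have W: "Ck_on 2 (W i j) (img c)" for i j
    unfolding W_def c.D_def[symmetric]
    by (intro Ck_on_mult oc c.smooth_K c.smooth_D) (use mCk_chart[OF mCk_of_real[OF u] c] in \<open>simp add: coord_rep_def o_def\<close>)
  note ibp = cint_by_parts[OF a a0 cc(1,2) oc W]
  have ibp1: "cint (\<lambda>z. Re (a z * d_z i (d_zbar j (W i j)) z)) = cint (\<lambda>z. Re (W i j z * d_zbar j (d_z i a) z))" for i j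
    by (rule ibp(1))
  have cs1: "csupp (\<lambda>z. Re (a z * d_z i (d_zbar j (W i j)) z))" and cs2: "csupp (\<lambda>z. Re (W i j z * d_zbar j (d_z i a) z))" for i j
    by (rule ibp(2), assumption, rule ibp(3), assumption)
  have "(\<lambda>z. if z \<in> img c then \<eta> (par c z) * Re (c.adj_lap (\<lambda>y. of_real (u (par c y)) * det (Gc c y)) z) else 0)
    = (\<lambda>z. \<Sum>i\<in>UNIV. \<Sum>j\<in>UNIV. Re (a z * d_z i (d_zbar j (W i j)) z))"
    unfolding c.adj_lap_def a_def W_def by (auto simp: fun_eq_iff sum_distrib_left)
  then have "cint (\<lambda>z. if z \<in> img c then \<eta> (par c z) * Re (c.adj_lap (\<lambda>y. of_real (u (par c y)) * det (Gc c y)) z) else 0)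
     = (\<Sum>i\<in>UNIV. \<Sum>j\<in>UNIV. cint (\<lambda>z. Re (a z * d_z i (d_zbar j (W i j)) z)))"
    by (simp add: cint_sum csupp_sum cs1 del: times_complex.sel)
  also have "\<dots> = cint (\<lambda>z. \<Sum>i\<in>UNIV. \<Sum>j\<in>UNIV. Re (W i j z * d_zbar j (d_z i a) z))"
    unfolding ibp1 by (simp add: cint_sum csupp_sum cs2 del: times_complex.sel)
  also have "(\<lambda>z. \<Sum>i\<in>UNIV. \<Sum>j\<in>UNIV. Re (W i j z * d_zbar j (d_z i a) z)) = mfun c (\<lambda>p. u p * Lap \<eta> p)"
  proof
    fix z
    show "(\<Sum>i\<in>UNIV. \<Sum>j\<in>UNIV. Re (W i j z * d_zbar j (d_z i a) z)) = mfun c (\<lambda>p. u p * Lap \<eta> p) z"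
    proof (cases "z \<in> img c")
      case True
      have 1: "d_z i (coord_rep c (\<lambda>p. complex_of_real (\<eta> p))) y = d_z i a y" if "y \<in> img c" for i y
        by (rule dz.cong[OF oc that ax])
      have "d_zbar j (d_z i (coord_rep c (\<lambda>p. complex_of_real (\<eta> p)))) z = d_zbar j (d_z i a) z" for i j
        by (rule dzb.cong[OF oc True 1])
      then have lap: "lap c \<eta> z = (\<Sum>i\<in>UNIV. \<Sum>j\<in>UNIV. c.K z $ j $ i * d_zbar j (d_z i a) z)"
        by (simp add: lap_def inv_metric_def c.K_def)
      have "det (Gc c z) = of_real (Re (det (Gc c z)))" using c.D_real[OF True] by (simp add: c.D_def)
      then have W1: "W i j z * d_zbar j (d_z i a) z = of_real (u (par c z) * Re (det (Gc c z))) * (c.K z $ j $ i * d_zbar j (d_z i a) z)" for i j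
        unfolding W_def by (metis (no_types, lifting) mult.assoc of_real_mult)
      have Rr: "Re (of_real r * w) = r * Re w" for r w by simp
      have "(\<Sum>i\<in>UNIV. \<Sum>j\<in>UNIV. Re (W i j z * d_zbar j (d_z i a) z)) = (u (par c z) * Re (det (Gc c z))) * Re (lap c \<eta> z)"
        by (simp only: W1 Rr lap Re_sum sum_distrib_left)
      then show ?thesis using True by (simp only: mfun_def Lap_chart[OF c True \<eta>] if_True mult_ac)
    next
      case False
      then have nC: "z \<notin> ?C" using cc(2) by blast
      have 1: "d_z i a y = 0" if "y \<notin> ?C" for i y by (rule dz.zero_off[OF compact_imp_closed[OF cc(1)] a0 that])
      have "d_zbar j (d_z i a) z = 0" for i j by (rule dzb.zero_off[OF compact_imp_closed[OF cc(1)] 1 nC])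
      then show ?thesis using False by (simp add: mfun_def)
    qed
  qed
  finally show ?thesis unfolding mint_def .
qed

text \<open>The integral of the adjoint Laplacian over \<open>M\<close> vanishes; the partition of unity carries
  it to the charts, since the adjoint Laplacian itself is never defined globally.\<close>

lemma adjoint_integral_zero:
  assumes P: "unity_partition I \<eta> ch C" and u: "mCk A 2 u"
  shows "(\<Sum>i\<in>I. cint (\<lambda>z. if z \<in> img (ch i) then \<eta> i (par (ch i) z) *
      Re (hermitian_coords.adj_lap (Gc (ch i)) (\<lambda>y. of_real (u (par (ch i) y)) * det (Gc (ch i) y)) z) else 0)) = 0"
proof -
  have I: "finite I" "\<And>q. (\<Sum>i\<in>I. \<eta> i q) = 1" using P by (simp_all add: unity_partition_def)
  have P': "mCk A 2 (\<eta> i)" "ch i \<in> A" "compact (C i)" "C i \<subseteq> fst (ch i)" "q \<notin> C i \<Longrightarrow> \<eta> i q = 0" if "i \<in> I" for i q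
    using P that by (auto simp: unity_partition_def)
  \<comment> \<open>The i-th integrand is split by the members j. The piece k i j is supported in
    both charts, so it may be integrated in chart j, where summation over i produces the Laplacian
    of 1.\<close>
  define k where "k = (\<lambda>i j p. \<eta> j p * (u p * Lap (\<eta> i) p))"
  have kc: "continuous_on UNIV (k i j)" if "i \<in> I" "j \<in> I" for i j
    unfolding k_def by (intro continuous_intros mCk_continuous[OF P'(1)] mCk_continuous[OF u] Lap_continuous P'(1) that)
  have L0: "Lap (\<eta> i) p = 0" if "i \<in> I" "p \<notin> C i" for i p
    by (rule Lap_zero_off[OF P'(1,3)[OF that(1)] P'(5)[OF that(1)] that(2)])
  have k0: "k i j p = 0" if "i \<in> I" "j \<in> I" "p \<notin> C i \<inter> C j" for i j p
    using that L0[OF that(1)] P'(5)[OF that(2)] by (auto simp: k_def)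
  have "(\<Sum>i\<in>I. mint (ch i) (\<lambda>p. u p * Lap (\<eta> i) p)) = (\<Sum>i\<in>I. \<Sum>j\<in>I. mint (ch i) (k i j))"
  proof (rule sum.cong[OF refl])
    fix i assume i: "i \<in> I"
    have "(\<lambda>p. u p * Lap (\<eta> i) p) = (\<lambda>p. \<Sum>j\<in>I. k i j p)"
      unfolding k_def sum_distrib_right[symmetric] I(2) by simp
    then show "mint (ch i) (\<lambda>p. u p * Lap (\<eta> i) p) = (\<Sum>j\<in>I. mint (ch i) (k i j))"
      using mint_sum[OF P'(2)[OF i] kc[OF i] P'(3,4)[OF i], of I] k0[OF i] by auto
  qed
  also have "\<dots> = (\<Sum>i\<in>I. \<Sum>j\<in>I. mint (ch j) (k i j))"
  proof (intro sum.cong refl)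
    fix i j assume ij: "i \<in> I" "j \<in> I"
    show "mint (ch i) (k i j) = mint (ch j) (k i j)"
    proof (rule mint_chart_independent[OF P'(2)[OF ij(1)] P'(2)[OF ij(2)] kc[OF ij]])
      show "compact (C i \<inter> C j)" using P'(3) ij by (intro compact_Int)
      show "C i \<inter> C j \<subseteq> fst (ch i)" "C i \<inter> C j \<subseteq> fst (ch j)" using P'(4) ij by blast+
    qed (rule k0[OF ij])
  qed
  also have "\<dots> = (\<Sum>j\<in>I. \<Sum>i\<in>I. mint (ch j) (k i j))" by (rule sum.swap)
  also have "\<dots> = (\<Sum>j\<in>I. mint (ch j) (\<lambda>p. \<Sum>i\<in>I. k i j p))"
  proof (rule sum.cong[OF refl])
    fix j assume j: "j \<in> I"
    show "(\<Sum>i\<in>I. mint (ch j) (k i j)) = mint (ch j) (\<lambda>p. \<Sum>i\<in>I. k i j p)"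
      using mint_sum[OF P'(2)[OF j] kc[OF _ j] P'(3,4)[OF j], of I] k0[OF _ j] by auto
  qed
  also have "\<dots> = 0"
  proof -
    have "(\<Sum>i\<in>I. k i j p) = 0" for j p
      unfolding k_def sum_distrib_left[symmetric] sum_Lap_partition[OF P] by simp
    moreover have "mfun c (\<lambda>p. 0) = (\<lambda>z. 0)" for c by (simp add: mfun_def fun_eq_iff)
    ultimately show ?thesis by (simp add: mint_def cint_zero)
  qed
  finally have "(\<Sum>i\<in>I. mint (ch i) (\<lambda>p. u p * Lap (\<eta> i) p)) = 0" .
  moreover have "cint (\<lambda>z. if z \<in> img (ch i) then \<eta> i (par (ch i) z) *
      Re (hermitian_coords.adj_lap (Gc (ch i)) (\<lambda>y. of_real (u (par (ch i) y)) * det (Gc (ch i) y)) z) else 0) = mint (ch i) (\<lambda>p. u p * Lap (\<eta> i) p)" if "i \<in> I" for i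
    by (rule local_by_parts[OF P'(2,1,3,4)[OF that] P'(5)[OF that] u])
  ultimately show ?thesis by simp
qed

end

section \<open>The pointwise lower bound for the adjoint Laplacian\<close>

context hermitian_coords
begin

definition "total_scal z = scal z + scal_hat z"

lemma pos_def_K: "z \<in> U \<Longrightarrow> pos_def (K z)"
proof -
  assume z: "z \<in> U"
  have "Re (herm_form (K z) v v) > 0" if "v \<noteq> 0" for v
  proof -
    have "cnjv v \<noteq> 0" using that by (auto simp: cnjv_def vec_eq_iff)
    then have "Re (qf z (cnjv v) (cnjv (cnjv v))) > 0" by (rule qf_pos[OF z])
    moreover have "herm_form (K z) v v = qf z (cnjv v) v"
      unfolding herm_form_def qf_def by (subst sum.swap) (simp add: cnjv_def mult_ac)
    ultimately show ?thesis by (simp add: cnjv_simps)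
  qed
  then show ?thesis unfolding pos_def_def using K_herm[OF z] by metis
qed

lemma total_scal_two_traces: "total_scal z = two_traces (K z) (\<lambda>i j k l. R i j z $ k $ l)"
proof -
  have 1: "K z $ j $ i * trace (K z ** R i j z) = (\<Sum>k\<in>UNIV. \<Sum>l\<in>UNIV. K z $ j $ i * K z $ l $ k * R i j z $ k $ l)" for i j
    unfolding trace_def matrix_matrix_mult_def
    by (subst sum.swap) (simp add: sum_distrib_left mult_ac)
  have 2: "(K z ** R i j z ** K z) $ j $ i = (\<Sum>k\<in>UNIV. \<Sum>l\<in>UNIV. K z $ l $ i * K z $ j $ k * R i j z $ k $ l)" for i j
    unfolding matrix_matrix_mult_def
    by (subst sum.swap) (simp add: sum_distrib_right sum_distrib_left mult_ac)
  show ?thesis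
    unfolding total_scal_def scal_def scal_hat_def two_traces_def 1 2 by (simp add: sum.distrib distrib_right)
qed

lemma adj_lap_cong:
  assumes "z \<in> U" "\<And>y. y \<in> U \<Longrightarrow> e y = e' y"
  shows "adj_lap e z = adj_lap e' z"
proof -
  have 1: "d_zbar j (\<lambda>y. e y * K y $ j $ i) y = d_zbar j (\<lambda>y. e' y * K y $ j $ i) y" if "y \<in> U" for i j y
    by (rule dzb.cong[OF open_U that]) (simp add: assms(2))
  have "d_z i (d_zbar j (\<lambda>y. e y * K y $ j $ i)) z = d_z i (d_zbar j (\<lambda>y. e' y * K y $ j $ i)) z" for i j
    by (rule dz.cong[OF open_U assms(1) 1])
  then show ?thesis by (simp add: adj_lap_def)
qed

lemma continuous_adj_lap:
  assumes e: "Ck_on 2 e U" shows "continuous_on U (adj_lap e)"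
proof -
  have "Ck_on (Suc (Suc 0)) (\<lambda>y. e y * K y $ j $ i) U" for i j
    using Ck_on_mult[OF open_U e smooth_K] by (simp only: numeral_2_eq_2)
  then have "Ck_on 0 (d_z i (d_zbar j (\<lambda>y. e y * K y $ j $ i))) U" for i j
    by (intro dz.Ck[OF open_U] dzb.Ck[OF open_U])
  then have "Ck_on 0 (\<lambda>z. adj_lap e z) U" unfolding adj_lap_def by (intro Ck_on_sum open_U)
  then show ?thesis by simp
qed

lemma smooth_R: "Ck_on k (\<lambda>z. R i j z $ a $ b) U"
proof -
  have "Ck_on k (\<lambda>z. mat_op (d_z i) (Y j) z $ a $ b) U"
    unfolding mat_op_def by (simp add: dz.Ck[OF open_U smooth_Y])
  then show ?thesis
    unfolding R_def matrix_matrix_mult_def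
    by (simp, intro Ck_on_diff Ck_on_sum Ck_on_mult open_U smooth_X smooth_K smooth_Y)
qed

lemma smooth_total_scal: "Ck_on k total_scal U"
proof -
  have "Ck_on k (\<lambda>z. total_scal z) U"
    unfolding total_scal_two_traces two_traces_def
    by (intro Ck_on_sum Ck_on_mult Ck_on_add open_U smooth_K smooth_R)
  then show ?thesis .
qed

lemma smooth_na: "Ck_on k (\<lambda>z. na z $ i) U"
  unfolding na_def trace_def matrix_matrix_mult_def
  by (simp, intro Ck_on_sum Ck_on_mult open_U smooth_K smooth_X)

lemma smooth_tor_low: "Ck_on k (\<lambda>z. tor_low z $ i) U"
proof -
  have "Ck_on k (\<lambda>z. d_z i (\<lambda>y. K y $ a $ b) z) U" for i a b by (rule dz.Ck[OF open_U smooth_K])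
  then show ?thesis
    unfolding tor_low_def tor_def matrix_vector_mult_def mat_op_def
    by (simp, intro Ck_on_sum Ck_on_mult open_U smooth_G)
qed

end

context section_coords
begin

text \<open>The form \<open>\<alpha>\<close> of the introduction, multiplied by \<open>f\<close> so that it extends over the zeros of \<open>f\<close>.\<close>

definition "tw z = (\<chi> j. 2 / of_nat m * d_z j f z) + f z *s (tor_low z - na z)"

definition "low z = (norm (f z))^2 / (Re (D z)) ^ (2 * m) * (Q z + 1) powr (1 / m - 1) * Re (D z)
   * ((norm (f z))^2 * Re (total_scal z) + Re (qf z (tw z) (cnjv (tw z))))"

text \<open>In \<open>adj_lap_e_nonzero\<close> the term with the factor m - 1 is nonnegative and is
  discarded, the curvature term is bounded below uniformly in \<epsilon>, and the term with
  \<open>adj_lap D\<close> is the error. At a zero of f only the error is left.\<close>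

lemma adj_lap_e_lower:
  assumes e: "0 < \<epsilon>" "\<epsilon> \<le> 1" and z: "z \<in> U" and S: "total_scal z \<in> \<real>\<^sub>\<ge>\<^sub>0"
  shows "Re (adj_lap (e \<epsilon>) z) \<ge> low z - \<epsilon> powr (1 / m) * norm (adj_lap D z)"
proof (cases "f z = 0")
  case True
  have "u \<epsilon> z = \<epsilon> powr (1 / m)" by (simp add: u_def Q_def True)
  moreover have "- norm (adj_lap D z) \<le> Re (adj_lap D z)" using abs_Re_le_cmod[of "adj_lap D z"] by linarith
  then have "\<epsilon> powr (1 / m) * (- norm (adj_lap D z)) \<le> \<epsilon> powr (1 / m) * Re (adj_lap D z)"
    by (rule mult_left_mono) simp
  ultimately have "Re (adj_lap (e \<epsilon>) z) \<ge> - (\<epsilon> powr (1 / m) * norm (adj_lap D z))"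
    unfolding adj_lap_e_zero[OF e(1) z True] by simp
  then show ?thesis by (simp add: low_def True)
next
  case False
  define t where "t = Q z / (Q z + \<epsilon>)"
  define p where "p = (\<chi> j. 2 / of_nat m * (d_z j f z / f z)) - 2 *s na z"
  define \<alpha> where "\<alpha> = p + (na z + tor_low z)"
  define d where "d = Re (D z)"
  have Dd: "D z = of_real d" using D_real[OF z] by (simp add: d_def)
  have d0: "d > 0" using D_pos[OF z] by (simp add: d_def)
  have Q0: "Q z \<ge> 0" by (rule Q_nonneg[OF z])
  have tw: "tw z = f z *s \<alpha>"
    using False unfolding tw_def \<alpha>_def p_def by (simp add: vec_eq_iff field_simps)
  have q: "Re (qf z (tw z) (cnjv (tw z))) = (norm (f z))^2 * Re (qf z \<alpha> (cnjv \<alpha>))"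
  proof -
    have "qf z (tw z) (cnjv (tw z)) = of_real ((norm (f z))^2) * qf z \<alpha> (cnjv \<alpha>)"
      unfolding tw cnjv_simps qf_scale complex_norm_square by simp
    then show ?thesis by simp
  qed
  define X where "X = Re (total_scal z) + Re (qf z \<alpha> (cnjv \<alpha>))"
  have X0: "X \<ge> 0" unfolding X_def using S qf_nonneg[OF z, of \<alpha>] by (simp add: complex_nonneg_Reals_iff)
  have low: "low z = Q z * (Q z + 1) powr (1 / m - 1) * d * X"
    unfolding low_def q Q_def X_def d_def by (simp add: algebra_simps power2_eq_square power4_eq_xxxx)
  have u0: "u \<epsilon> z > 0" using Q0 e by (simp add: u_def)
  have t: "0 \<le> t" "t \<le> 1" using Q0 e by (simp_all add: t_def)
  have up: "u \<epsilon> z / (Q z + \<epsilon>) = (Q z + \<epsilon>) powr (1 / m - 1)"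
    using Q0 e by (simp add: u_def powr_diff)
  have m1: "1 / m - 1 \<le> 0" using m by simp
  \<comment> \<open>The exponent 1 / m - 1 is nonpositive, so enlarging \<epsilon> to 1 decreases
    the power.\<close>
  have ut: "u \<epsilon> z * t \<ge> Q z * (Q z + 1) powr (1 / m - 1)"
  proof -
    have "(Q z + 1) powr (1 / m - 1) \<le> (Q z + \<epsilon>) powr (1 / m - 1)"
      by (rule powr_mono2'[OF m1]) (use Q0 e in auto)
    then have "Q z * (Q z + 1) powr (1 / m - 1) \<le> Q z * (u \<epsilon> z / (Q z + \<epsilon>))"
      unfolding up using Q0 by (rule mult_left_mono)
    then show ?thesis by (simp add: t_def mult.commute)
  qed
  \<comment> \<open>Here the base is decreased to \<epsilon> instead, which increases the
    power.\<close>
  have u1: "u \<epsilon> z * (1 - t) \<le> \<epsilon> powr (1 / m)"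
  proof -
    have "(Q z + \<epsilon>) powr (1 / m - 1) \<le> \<epsilon> powr (1 / m - 1)"
      by (rule powr_mono2'[OF m1]) (use Q0 e in auto)
    then have "\<epsilon> * (u \<epsilon> z / (Q z + \<epsilon>)) \<le> \<epsilon> * \<epsilon> powr (1 / m - 1)"
      unfolding up using e by (intro mult_left_mono) auto
    moreover have "1 - t = \<epsilon> / (Q z + \<epsilon>)" using Q0 e by (simp add: t_def field_simps)
    moreover have "\<epsilon> * \<epsilon> powr (1 / m - 1) = \<epsilon> powr (1 / m)" using e by (simp add: powr_diff)
    ultimately show ?thesis by (simp add: mult.commute)
  qed
  have "Re (adj_lap (e \<epsilon>) z) = u \<epsilon> z * (t * d * X + (1 - t) * Re (adj_lap D z) + ((real m - 1) * t * (1 - t)) * d * Re (qf z p (cnjv p)))"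
    unfolding adj_lap_e_nonzero[OF e(1) z False] t_def[symmetric] p_def[symmetric] \<alpha>_def[symmetric] X_def Dd total_scal_def
    by (simp add: algebra_simps)
  also have "\<dots> = u \<epsilon> z * t * (d * X) + (u \<epsilon> z * (1 - t)) * Re (adj_lap D z) + u \<epsilon> z * (((real m - 1) * t * (1 - t)) * d * Re (qf z p (cnjv p)))"
    by (simp add: algebra_simps)
  finally have *: "Re (adj_lap (e \<epsilon>) z) = \<dots>" .
  have a: "low z \<le> u \<epsilon> z * t * (d * X)"
    unfolding low using mult_right_mono[OF ut, of "d * X"] d0 X0 by (simp add: mult_ac)
  have b: "- (\<epsilon> powr (1 / m) * norm (adj_lap D z)) \<le> (u \<epsilon> z * (1 - t)) * Re (adj_lap D z)"
  proof -
    have "\<bar>(u \<epsilon> z * (1 - t)) * Re (adj_lap D z)\<bar> \<le> \<epsilon> powr (1 / m) * norm (adj_lap D z)"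
      unfolding abs_mult using u1 u0 t abs_Re_le_cmod by (intro mult_mono) auto
    then show ?thesis by linarith
  qed
  have c: "0 \<le> u \<epsilon> z * (((real m - 1) * t * (1 - t)) * d * Re (qf z p (cnjv p)))"
    using u0 t d0 m qf_nonneg[OF z, of p] by (intro mult_nonneg_nonneg) auto
  show ?thesis unfolding * using a b c by linarith
qed

lemma low_nonneg: "z \<in> U \<Longrightarrow> total_scal z \<in> \<real>\<^sub>\<ge>\<^sub>0 \<Longrightarrow> low z \<ge> 0"
  unfolding low_def using qf_nonneg[of z "tw z"] D_pos[of z]
  by (intro mult_nonneg_nonneg add_nonneg_nonneg divide_nonneg_nonneg) (auto simp: complex_nonneg_Reals_iff)

lemma low_zeroD:
  assumes z: "z \<in> U" and S: "total_scal z \<in> \<real>\<^sub>\<ge>\<^sub>0" and f: "f z \<noteq> 0" and low: "low z = 0"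
  shows "total_scal z = 0" "tw z = 0"
proof -
  define c where "c = (norm (f z))^2 / (Re (D z)) ^ (2 * m) * (Q z + 1) powr (1 / m - 1) * Re (D z)"
  have "0 < c"
    using f D_pos[OF z] Q_nonneg[OF z] by (simp add: c_def)
  moreover have "c * ((norm (f z))^2 * Re (total_scal z) + Re (qf z (tw z) (cnjv (tw z)))) = 0"
    using low unfolding low_def c_def .
  ultimately have *: "(norm (f z))^2 * Re (total_scal z) + Re (qf z (tw z) (cnjv (tw z))) = 0"
    by (metis less_irrefl mult_eq_0_iff)
  moreover have S': "0 \<le> Re (total_scal z)" "Im (total_scal z) = 0" using S by (auto simp: complex_nonneg_Reals_iff)
  moreover have "0 \<le> (norm (f z))^2 * Re (total_scal z)" using S' by simp
  moreover note qf_nonneg[OF z, of "tw z"]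
  ultimately have 0: "(norm (f z))^2 * Re (total_scal z) = 0" "Re (qf z (tw z) (cnjv (tw z))) = 0" by linarith+
  show "total_scal z = 0" using 0(1) f S' by (auto intro: complex_eqI)
  show "tw z = 0" using 0(2) qf_pos[OF z, of "tw z"] by auto
qed

lemma continuous_low: "continuous_on U low"
proof -
  have "tw z $ i = 2 / of_nat m * d_z i f z + f z * (tor_low z $ i - na z $ i)" for z i
    by (simp add: tw_def algebra_simps)
  then have tw: "Ck_on 0 (\<lambda>z. tw z $ i) U" for i
    by (simp only:, intro Ck_on_add Ck_on_mult Ck_on_diff Ck_on_const open_U smooth_df smooth_f smooth_na smooth_tor_low)
  have "Ck_on 0 (\<lambda>z. qf z (tw z) (cnjv (tw z))) U"
    unfolding qf_def cnjv_def by (simp only: vec_lambda_beta, intro Ck_on_sum Ck_on_mult Ck_on_cnj open_U smooth_K tw)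
  then have "continuous_on U (\<lambda>z. qf z (tw z) (cnjv (tw z)))" by simp
  then have "continuous_on U (\<lambda>z. low z)"
    unfolding low_def
    using D_pos Q_nonneg
    by (intro continuous_intros Ck_on_imp_continuous[OF smooth_D] Ck_on_imp_continuous[OF smooth_Q]
      Ck_on_imp_continuous[OF smooth_f] Ck_on_imp_continuous[OF smooth_total_scal]) force+
  then show ?thesis by simp
qed

lemma tw_zero:
  assumes "tw z = 0"
  shows "d_z j f z = f z * (of_nat m / 2 * (na z $ j - tor_low z $ j))"
proof -
  have "tw z $ j = 0" using assms by simp
  then have "2 / of_nat m * d_z j f z = f z * (na z $ j - tor_low z $ j)"
    unfolding tw_def by (simp add: algebra_simps)
  then show ?thesis using m by (simp add: field_simps)
qed

text \<open>Multiplying the metric by a factor whose power \<open>n - 1\<close> is \<open>Q powr (1 / m)\<close> makes it balanced.\<close>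

lemma divergence_zero:
  assumes z: "z \<in> U" and nz: "\<And>y. y \<in> U \<Longrightarrow> f y \<noteq> 0" and tw: "tw z = 0"
  shows "(\<Sum>k\<in>UNIV. d_z k (\<lambda>y. of_real (Q y powr (1 / m)) * D y * K y $ j $ k) z) = 0"
    and "(\<Sum>k\<in>UNIV. d_zbar k (\<lambda>y. of_real (Q y powr (1 / m)) * D y * K y $ k $ j) z) = 0"
proof -
  have Q0: "Q y > 0" if "y \<in> U" for y using nz[OF that] D_pos[OF that] by (simp add: Q_def)
  define p where "p = (\<chi> j. 2 / of_nat m * (d_z j f z / f z)) - 2 *s na z"
  define \<rho> where "\<rho> = (\<lambda>y. Q y powr (1 / m))"
  have dQ: "d_z k (\<lambda>y. of_real (Q y)) z = of_real (Q z) * (of_nat m * p $ k)" for k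
  proof -
    have "d_z k (\<lambda>y. of_real (Q y)) z = cnj (d_zbar k (\<lambda>y. of_real (Q y)) z)"
      by (rule d_z_real[OF z]) (use Ck_on_differentiable[OF Ck_on_of_real[OF open_U smooth_Q] z] in auto)
    also have "\<dots> = cnj (f z) ^ 2 * (2 * f z * d_z k f z - 2 * of_nat m * na z $ k * f z ^ 2) * inverse (D z ^ (2 * m))"
      unfolding d_zbar_Q[OF z] H_def trace_KY[OF z] by (simp add: D_cnj[OF z])
    also have "\<dots> = of_real (Q z) * (of_nat m * p $ k)"
    proof -
      have mp: "of_nat m * p $ k = 2 * (d_z k f z / f z) - 2 * of_nat m * na z $ k"
        using m by (simp add: p_def field_simps)
      have fp: "f z * (of_nat m * p $ k) = 2 * d_z k f z - 2 * of_nat m * na z $ k * f z"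
        unfolding mp using nz[OF z] by (simp add: field_simps)
      have "f z ^ 2 * (of_nat m * p $ k) = f z * (f z * (of_nat m * p $ k))"
        by (simp only: power2_eq_square mult.assoc)
      also have "\<dots> = 2 * f z * d_z k f z - 2 * of_nat m * na z $ k * f z ^ 2"
        unfolding fp by (simp add: power2_eq_square algebra_simps)
      finally have f2: "f z ^ 2 * (of_nat m * p $ k) = 2 * f z * d_z k f z - 2 * of_nat m * na z $ k * f z ^ 2" .
      show ?thesis
        unfolding Q_complex[OF z] f2[symmetric] by (simp only: mult_ac)
    qed
    finally show ?thesis .
  qed
  have d\<rho>: "d_z k (\<lambda>y. of_real (\<rho> y)) z = of_real (\<rho> z) * p $ k" for k
  proof -
    have "((\<lambda>q. q powr (1 / m)) has_real_derivative (1 / m) * Q z powr (1 / m - 1)) (at (Q z))"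
      by (rule has_real_derivative_powr[OF Q0[OF z]])
    from dz.real_compose[OF differentiable_Q[OF z] this]
    have "d_z k (\<lambda>y. of_real (\<rho> y)) z = of_real ((1 / m) * Q z powr (1 / m - 1)) * (of_real (Q z) * (of_nat m * p $ k))"
      by (simp only: \<rho>_def dQ)
    also have "\<dots> = of_real ((1 / m) * Q z powr (1 / m - 1) * Q z * m) * p $ k" by simp
    also have "(1 / m) * Q z powr (1 / m - 1) * Q z * m = \<rho> z"
      using Q0[OF z] m by (simp add: \<rho>_def powr_diff)
    finally show ?thesis .
  qed
  have s\<rho>: "Ck_on k \<rho> U" for k
    unfolding \<rho>_def by (rule Ck_on_compose[OF open_U _ _ smooth_Q Ck_on_powr]) (use Q0 in auto)
  have diff: "(\<lambda>y. complex_of_real (\<rho> y)) differentiable at z"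
    using Ck_on_differentiable[OF Ck_on_of_real[OF open_U s\<rho>] z] .
  have d1: "d_z k (\<lambda>y. of_real (\<rho> y) * D y * K y $ j $ k) z
      = of_real (\<rho> z) * D z * (K z $ j $ k * (p $ k + na z $ k) + mat_op (d_z k) K z $ j $ k)" for j k
    by (simp add: dz.mult diff differentiable_D[OF z] differentiable_K[OF z] differentiable_mult d\<rho> d_z_D[OF z] na_def mat_op_def algebra_simps)
  \<comment> \<open>Dividing \<open>tw z = 0\<close> by f shows that log (u D) has gradient minus
    the lowered divergence of K; this is exactly what cancels in the product rule for u D K.\<close>
  have p: "p + na z = - tor_low z"
    using tw_zero[OF tw] nz[OF z] m unfolding p_def by (simp add: vec_eq_iff field_simps)
  have mv: "K z *v (- w) = - (K z *v w)" for w
    by (simp add: matrix_vector_mult_def vec_eq_iff sum_negf)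
  have "K z *v (p + na z) = - tor z"
    unfolding p tor_low_def mv by (simp add: matrix_vector_mul_assoc K_G[OF z])
  then have tor0: "(\<Sum>k\<in>UNIV. K z $ j $ k * (p $ k + na z $ k)) + tor z $ j = 0" for j
    unfolding vec_eq_iff matrix_vector_mult_def by simp
  have main: "(\<Sum>k\<in>UNIV. d_z k (\<lambda>y. of_real (\<rho> y) * D y * K y $ j $ k) z) = 0" for j
    unfolding d1 sum_distrib_left[symmetric] sum.distrib using tor0[of j] by (simp add: tor_def)
  show "(\<Sum>k\<in>UNIV. d_z k (\<lambda>y. of_real (Q y powr (1 / m)) * D y * K y $ j $ k) z) = 0"
    using main unfolding \<rho>_def .
  have "d_zbar k (\<lambda>y. of_real (\<rho> y) * D y * K y $ k $ j) z = cnj (d_z k (\<lambda>y. of_real (\<rho> y) * D y * K y $ j $ k) z)" for k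
  proof -
    have "d_zbar k (\<lambda>y. of_real (\<rho> y) * D y * K y $ k $ j) z = d_zbar k (\<lambda>y. cnj (of_real (\<rho> y) * D y * K y $ j $ k)) z"
      by (rule dzb.cong[OF open_U z]) (simp add: D_cnj K_herm)
    also have "\<dots> = cnj (d_z k (\<lambda>y. of_real (\<rho> y) * D y * K y $ j $ k) z)"
      by (rule d_zbar_cnj) (intro differentiable_mult diff differentiable_D[OF z] differentiable_K[OF z])
    finally show ?thesis .
  qed
  then have "(\<Sum>k\<in>UNIV. d_zbar k (\<lambda>y. of_real (\<rho> y) * D y * K y $ k $ j) z) = cnj (\<Sum>k\<in>UNIV. d_z k (\<lambda>y. of_real (\<rho> y) * D y * K y $ j $ k) z)"
    by simp
  then show "(\<Sum>k\<in>UNIV. d_zbar k (\<lambda>y. of_real (Q y powr (1 / m)) * D y * K y $ k $ j) z) = 0"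
    unfolding main unfolding \<rho>_def by simp
qed

end

section \<open>Pluricanonical sections under nonnegative curvature\<close>

context hermitian_manifold
begin

lemma curvature_chart:
  assumes c: "c \<in> A" and z: "z \<in> img c"
  shows "chern_curvature g c (par c z) i j k l = hermitian_coords.R (Gc c) i j z $ k $ l"
proof -
  interpret c: hermitian_coords "Gc c" "img c" by (rule coords[OF c])
  have s: "snd c (par c w) = w" if "w \<in> img c" for w by (rule par_in(2)[OF that])
  have r: "coord_rep c (\<lambda>y. g c y $ a $ b) = (\<lambda>w. Gc c w $ a $ b)" for a b by (simp add: coord_rep_def o_def)
  have X: "pd_z c i (\<lambda>y. g c y $ a $ b) (par c z) = c.X i z $ a $ b" for a b
    by (simp add: pd_z_def s[OF z] r c.X_def mat_op_def)
  have Y: "pd_zbar c j (\<lambda>y. g c y $ a $ b) (par c w) = c.Y j w $ a $ b" if "w \<in> img c" for a b w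
    by (simp add: pd_zbar_def s[OF that] r c.Y_def mat_op_def)
  have XY: "pd_z c i (pd_zbar c j (\<lambda>y. g c y $ k $ l)) (par c z) = mat_op (d_z i) (c.Y j) z $ k $ l"
  proof -
    have "d_z i (coord_rep c (pd_zbar c j (\<lambda>y. g c y $ k $ l))) z = d_z i (\<lambda>w. c.Y j w $ k $ l) z"
      by (rule dz.cong[OF chart(2)[OF c] z]) (simp only: coord_rep_def comp_def Y)
    then show ?thesis by (simp add: pd_z_def s[OF z] mat_op_def)
  qed
  have K: "metric_inv g c (par c z) p q = c.K z $ q $ p" for p q
    unfolding metric_inv_def c.K_def unfolding coord_rep_def comp_def ..
  have "(\<Sum>p\<in>UNIV. \<Sum>q\<in>UNIV. c.K z $ q $ p * c.X i z $ k $ q * c.Y j z $ p $ l) = (c.X i z ** c.K z ** c.Y j z) $ k $ l"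
    unfolding matrix_matrix_mult_def by (simp add: sum_distrib_left sum_distrib_right mult_ac)
  then show ?thesis
    unfolding chern_curvature_def X Y[OF z] XY K c.R_def by simp
qed

lemma hol_sect_curv_chart:
  assumes "c \<in> A" "z \<in> img c"
  shows "hol_sect_curv g c (par c z) v = quad_form (\<lambda>i j k l. hermitian_coords.R (Gc c) i j z $ k $ l) v v v v"
  unfolding hol_sect_curv_def quad_form_def curvature_chart[OF assms] ..

lemma
  assumes nonneg: "HSC_nonneg A g" and c: "c \<in> A" and z: "z \<in> img c"
  shows total_scal_nonneg: "hermitian_coords.total_scal (Gc c) z \<in> \<real>\<^sub>\<ge>\<^sub>0"
    and total_scal_zeroD: "hermitian_coords.total_scal (Gc c) z = 0 \<Longrightarrow> hol_sect_curv g c (par c z) v = 0"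
proof -
  interpret c: hermitian_coords "Gc c" "img c" by (rule coords[OF c])
  have H: "quad_form (\<lambda>i j k l. c.R i j z $ k $ l) v v v v \<in> \<real>\<^sub>\<ge>\<^sub>0" for v
    using nonneg c par_in(1)[OF z] unfolding HSC_nonneg_def hol_sect_curv_chart[OF c z, symmetric] by blast
  show "c.total_scal z \<in> \<real>\<^sub>\<ge>\<^sub>0"
    unfolding c.total_scal_two_traces by (rule two_traces_nonneg(1)[OF c.pos_def_K[OF z] H])
  assume "c.total_scal z = 0"
  then have "Re (two_traces (c.K z) (\<lambda>i j k l. c.R i j z $ k $ l)) = 0"
    unfolding c.total_scal_two_traces by simp
  then show "hol_sect_curv g c (par c z) v = 0"
    unfolding hol_sect_curv_chart[OF c z] by (rule two_traces_nonneg(2)[OF c.pos_def_K[OF z] H])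
qed

end

text \<open>The derivative is assumed only where \<phi> is nonzero, because only there is a section
  known to satisfy its equation. The argument therefore stops at the first zero t0, before which
  |\<phi>|^2 times an exponential strictly increases.\<close>

lemma nonvanishing_ode:
  fixes \<phi> k :: "real \<Rightarrow> complex"
  assumes cont: "continuous_on {0..1} \<phi>" "continuous_on {0..1} k"
    and der: "\<And>t. t \<in> {0..1} \<Longrightarrow> \<phi> t \<noteq> 0 \<Longrightarrow> (\<phi> has_vector_derivative \<phi> t * k t) (at t)"
    and 0: "\<phi> 0 \<noteq> 0"
  shows "\<phi> 1 \<noteq> 0"
proof
  assume 1: "\<phi> 1 = 0"
  define Z where "Z = {t \<in> {0..1}. \<phi> t = 0}"
  have "closed Z" unfolding Z_def by (rule continuous_closed_preimage_constant[OF cont(1)]) simp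
  then have "compact ({0..1} \<inter> Z)" by (intro compact_Int_closed) simp_all
  moreover have "{0..1} \<inter> Z = Z" by (auto simp: Z_def)
  ultimately have "compact Z" by simp
  moreover have "Z \<noteq> {}" using 1 by (auto simp: Z_def intro!: exI[of _ 1])
  ultimately have "\<exists>s\<in>Z. \<forall>t\<in>Z. s \<le> t" by (rule compact_attains_inf)
  then obtain t0 where t0: "t0 \<in> Z" "\<And>t. t \<in> Z \<Longrightarrow> t0 \<le> t" by blast
  have "bounded (k ` {0..1})" by (intro compact_imp_bounded compact_continuous_image cont(2)) simp
  then have "\<exists>C. \<forall>t\<in>{0..1}. norm (k t) \<le> C" by (simp add: bounded_iff)
  then obtain C where C: "\<And>t. t \<in> {0..1} \<Longrightarrow> norm (k t) \<le> C" by blast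
  \<comment> \<open>The rate 2 C outweighs any decay of |\<phi>|^2 caused by k, and the additional 1
    makes the derivative strictly positive.\<close>
  define \<psi> where "\<psi> = (\<lambda>t. (\<phi> t \<bullet> \<phi> t) * exp ((2 * C + 1) * t))"
  have pos: "t0 > 0" using t0(1) 0 by (cases "t0 = 0") (auto simp: Z_def)
  have t01: "t0 \<le> 1" "\<phi> t0 = 0" using t0(1) by (auto simp: Z_def)
  have "\<psi> 0 < \<psi> t0"
  proof (rule DERIV_pos_imp_increasing_open[OF pos])
    fix t assume t: "0 < t" "t < t0"
    then have tt: "t \<in> {0..1}" "\<phi> t \<noteq> 0" using t01 t0(2)[of t] by (auto simp: Z_def)
    have "((\<lambda>t. \<phi> t \<bullet> \<phi> t) has_vector_derivative \<phi> t \<bullet> (\<phi> t * k t) + (\<phi> t * k t) \<bullet> \<phi> t) (at t)"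
      by (rule bounded_bilinear.has_vector_derivative[OF bounded_bilinear_inner der[OF tt] der[OF tt]])
    then have d: "((\<lambda>t. \<phi> t \<bullet> \<phi> t) has_real_derivative 2 * (\<phi> t \<bullet> (\<phi> t * k t))) (at t)"
      by (simp add: has_real_derivative_iff_has_vector_derivative inner_commute)
    have d2: "(\<psi> has_real_derivative (2 * (\<phi> t \<bullet> (\<phi> t * k t)) + (2 * C + 1) * (\<phi> t \<bullet> \<phi> t)) * exp ((2 * C + 1) * t)) (at t)"
      unfolding \<psi>_def by (rule derivative_eq_intros d refl)+ (simp add: algebra_simps)
    have d3: "0 < 2 * (\<phi> t \<bullet> (\<phi> t * k t)) + (2 * C + 1) * (\<phi> t \<bullet> \<phi> t)"
    proof -
      have "\<bar>\<phi> t \<bullet> (\<phi> t * k t)\<bar> \<le> norm (\<phi> t) * norm (\<phi> t * k t)" by (rule Cauchy_Schwarz_ineq2)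
      also have "\<dots> = (norm (\<phi> t))^2 * norm (k t)" by (simp add: norm_mult power2_eq_square)
      also have "\<dots> \<le> (norm (\<phi> t))^2 * C" by (intro mult_left_mono C tt) simp
      finally have "\<bar>\<phi> t \<bullet> (\<phi> t * k t)\<bar> \<le> (norm (\<phi> t))^2 * C" .
      moreover have "(norm (\<phi> t))^2 > 0" using tt by simp
      moreover have "(2 * C + 1) * (\<phi> t \<bullet> \<phi> t) = 2 * ((norm (\<phi> t))^2 * C) + (norm (\<phi> t))^2"
        unfolding power2_norm_eq_inner by (simp only: algebra_simps)
      ultimately show ?thesis by linarith
    qed
    show "\<exists>y. (\<psi> has_real_derivative y) (at t) \<and> y > 0"
      using mult_pos_pos[OF d3 exp_gt_zero] d2 by blast
  next
    have "continuous_on {0..t0} \<phi>" by (rule continuous_on_subset[OF cont(1)]) (use t01 in auto)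
    then show "continuous_on {0..t0} \<psi>" unfolding \<psi>_def by (intro continuous_intros)
  qed
  moreover have "\<psi> t0 = 0" "\<psi> 0 \<ge> 0" using t01 by (simp_all add: \<psi>_def)
  ultimately show False by simp
qed

section \<open>Vanishing of the lower bound for a pluricanonical section\<close>

locale pluricanonical_section = hermitian_manifold A g
  for A :: "('a::t2_space, 'n::finite) chart set" and g :: "('a, 'n) metric" +
  fixes \<sigma> :: "('a, 'n) chart \<Rightarrow> 'a \<Rightarrow> complex" and m :: nat
  assumes nonneg: "HSC_nonneg A g"
    and \<sigma>: "\<sigma> \<in> hol_sections A (bundle_power m canonical_bundle)" and m: "m > 0"
begin

abbreviation fc :: "('a, 'n) chart \<Rightarrow> complex^'n \<Rightarrow> complex" where
  "fc c \<equiv> coord_rep c (\<sigma> c)"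

lemma local_section: "c \<in> A \<Longrightarrow> section_coords (Gc c) (img c) (fc c) m"
  using \<sigma> m coords by (auto simp: section_coords_def section_coords_axioms_def hol_sections_def)

lemma section_transform:
  assumes cd: "c \<in> A" "d \<in> A" "z \<in> ov c d"
  shows "fc c z = det (jac (tr c d) z) ^ m * fc d (tr c d z)"
proof -
  have "par c z \<in> fst c \<inter> fst d" using ovD(2,3)[OF cd] by blast
  then have "\<sigma> c (par c z) = bundle_power m canonical_bundle c d (par c z) * \<sigma> d (par c z)"
    using \<sigma> cd(1,2) unfolding hol_sections_def by blast
  then show ?thesis
    by (simp add: coord_rep_def ovD(4)[OF cd] bundle_power_def canonical_bundle_def jac_transition[OF cd])
qed

definition W :: "'a \<Rightarrow> real" where
  "W p = (let c = (SOME c. c \<in> A \<and> p \<in> fst c) in section_coords.Q (Gc c) (fc c) m (snd c p))"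

text \<open>A change of chart multiplies |f| ^ 4 and the power 2 m of det G by the same factor, so
  \<open>Q\<close> defines one function on the manifold.\<close>

lemma W_chart:
  assumes c: "c \<in> A" "z \<in> img c"
  shows "W (par c z) = section_coords.Q (Gc c) (fc c) m z"
proof -
  let ?p = "par c z"
  define d where "d = (SOME d. d \<in> A \<and> ?p \<in> fst d)"
  have d: "d \<in> A" "?p \<in> fst d"
    using someI_ex[of "\<lambda>d. d \<in> A \<and> ?p \<in> fst d"] cover[of ?p] unfolding d_def by blast+
  have cd: "c \<in> A" "d \<in> A" "z \<in> ov c d" using c d ovI[OF c d(2)] by auto
  interpret c: section_coords "Gc c" "img c" "fc c" m by (rule local_section[OF c(1)])
  interpret d: section_coords "Gc d" "img d" "fc d" m by (rule local_section[OF d(1)])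
  define J where "J = det (jac (tr c d) z)"
  have J: "norm J > 0" using det_transform(2)[OF cd] by (simp add: J_def)
  have "c.D z = of_real ((norm J)^2) * d.D (tr c d z)"
    using det_transform(1)[OF cd] by (simp add: c.D_def d.D_def J_def)
  then have "Re (c.D z) = (norm J)^2 * Re (d.D (tr c d z))" by (simp flip: of_real_power)
  moreover have "norm (fc c z) = (norm J) ^ m * norm (fc d (tr c d z))"
    unfolding section_transform[OF cd] by (simp add: norm_mult norm_power J_def)
  moreover have "((norm J) ^ m) ^ 4 = ((norm J)^2) ^ (2 * m)" by (simp flip: power_mult add: mult_ac)
  ultimately have "c.Q z = d.Q (tr c d z)"
    using J unfolding c.Q_def d.Q_def by (simp add: power_mult_distrib)
  then show ?thesis unfolding W_def d_def[symmetric] Let_def by (simp add: tr_def)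
qed

lemma W_eq_0_iff:
  assumes c: "c \<in> A" "p \<in> fst c"
  shows "W p = 0 \<longleftrightarrow> \<sigma> c p = 0" "W p \<ge> 0"
proof -
  interpret c: section_coords "Gc c" "img c" "fc c" m by (rule local_section[OF c(1)])
  have z: "snd c p \<in> img c" using c(2) by blast
  have W: "W p = c.Q (snd c p)" using W_chart[OF c(1) z] par_snd[OF c] by simp
  show "W p = 0 \<longleftrightarrow> \<sigma> c p = 0"
    unfolding W c.Q_def using c.D_pos[OF z] by (simp add: coord_rep_def par_snd[OF c])
  show "W p \<ge> 0" unfolding W by (rule c.Q_nonneg[OF z])
qed

lemma mCk_W: "mCk A k W"
  unfolding mCk_def
proof
  fix c assume c: "c \<in> A"
  interpret c: section_coords "Gc c" "img c" "fc c" m by (rule local_section[OF c])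
  have eq: "c.Q z = coord_rep c W z" if "z \<in> img c" for z using W_chart[OF c that] by (simp add: coord_rep_def)
  show "Ck_on k (coord_rep c W) (img c)" by (rule iffD1[OF Ck_on_cong[OF chart(2)[OF c] eq] c.smooth_Q])
qed

lemma mCk_u: "\<epsilon> > 0 \<Longrightarrow> mCk A k (\<lambda>p. (W p + \<epsilon>) powr (1 / m))"
  unfolding mCk_def
proof
  fix c assume \<epsilon>: "\<epsilon> > 0" and c: "c \<in> A"
  interpret c: section_coords "Gc c" "img c" "fc c" m by (rule local_section[OF c])
  have eq: "c.u \<epsilon> z = coord_rep c (\<lambda>p. (W p + \<epsilon>) powr (1 / m)) z" if "z \<in> img c" for z
    unfolding c.u_def W_chart[OF c that, symmetric] unfolding coord_rep_def comp_def ..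
  show "Ck_on k (coord_rep c (\<lambda>p. (W p + \<epsilon>) powr (1 / m))) (img c)"
    by (rule iffD1[OF Ck_on_cong[OF chart(2)[OF c] eq] c.smooth_u[OF \<epsilon>]])
qed

text \<open>Integrating \<open>adj_lap_e_lower\<close> against the partition gives L \<le> s N for
  all s in (0, 1], where L is the total integral of the lower bound and N that of the error. So L =
  0, and every local integral is zero because all are nonnegative. The partition is chosen with a
  member in chart c0 that is positive at the point in question.\<close>

lemma low_zero:
  assumes c0: "c0 \<in> A" "z0 \<in> img c0"
  shows "section_coords.low (Gc c0) (fc c0) m z0 = 0"
proof -
  obtain I :: "'a set" and \<eta> ch C i0 where P: "unity_partition I \<eta> ch C" and i0: "i0 \<in> I" "ch i0 = c0" "0 < \<eta> i0 (par c0 z0)"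
    using unity_partition_exists[OF c0(1) par_in(1)[OF c0(2)]] by blast
  have I: "finite I" using P by (simp add: unity_partition_def)
  have P': "mCk A 2 (\<eta> i)" "ch i \<in> A" "compact (C i)" "C i \<subseteq> fst (ch i)" "q \<notin> C i \<Longrightarrow> \<eta> i q = 0" "0 \<le> \<eta> i q" if "i \<in> I" for i q
    using P that by (auto simp: unity_partition_def)
  define ext where "ext = (\<lambda>i F z. if z \<in> img (ch i) then \<eta> i (par (ch i) z) * F z else 0 :: real)"
  define low where "low = (\<lambda>i. section_coords.low (Gc (ch i)) (fc (ch i)) m)"
  define n where "n = (\<lambda>i z. norm (hermitian_coords.adj_lap (Gc (ch i)) (hermitian_coords.D (Gc (ch i))) z))"
  define \<Phi> where "\<Phi> = (\<lambda>\<epsilon> i z. Re (hermitian_coords.adj_lap (Gc (ch i)) (\<lambda>y. of_real ((W (par (ch i) y) + \<epsilon>) powr (1 / m)) * det (Gc (ch i) y)) z))"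
  have cs: "csupp (ext i F)" if "i \<in> I" "continuous_on (img (ch i)) F" for i F
    unfolding ext_def
  proof (rule csupp_extend[OF P'(2)[OF that(1)] _ P'(3,4)[OF that(1)]])
    show "continuous_on (img (ch i)) (\<lambda>z. \<eta> i (par (ch i) z) * F z)"
      using coord_continuous[OF P'(2)[OF that(1)] mCk_continuous[OF P'(1)[OF that(1)]]] that(2)
      unfolding coord_rep_def o_def by (rule continuous_on_mult)
  qed (simp add: P'(5)[OF that(1)])
  have low_cs: "csupp (ext i (low i))" and n_cs: "csupp (ext i (n i))" and \<Phi>_cs: "\<epsilon> > 0 \<Longrightarrow> csupp (ext i (\<Phi> \<epsilon> i))"
    and low0: "ext i (low i) z \<ge> 0"
    and lb: "0 < \<epsilon> \<Longrightarrow> \<epsilon> \<le> 1 \<Longrightarrow> ext i (low i) z + (- (\<epsilon> powr (1 / m))) * ext i (n i) z \<le> ext i (\<Phi> \<epsilon> i) z"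
    if i: "i \<in> I" for i \<epsilon> z
  proof -
    note c = P'(2)[OF i]
    interpret c: section_coords "Gc (ch i)" "img (ch i)" "fc (ch i)" m by (rule local_section[OF c])
    show "csupp (ext i (low i))" unfolding low_def by (rule cs[OF i c.continuous_low])
    show "csupp (ext i (n i))" unfolding n_def
      by (rule cs[OF i]) (intro continuous_intros c.continuous_adj_lap c.smooth_D)
    have \<Phi>: "\<Phi> \<epsilon> i z = Re (c.adj_lap (c.e \<epsilon>) z)" if "z \<in> img (ch i)" for \<epsilon> z
    proof -
      have "c.adj_lap (\<lambda>y. of_real ((W (par (ch i) y) + \<epsilon>) powr (1 / m)) * det (Gc (ch i) y)) z = c.adj_lap (c.e \<epsilon>) z"
        by (rule c.adj_lap_cong[OF that]) (simp only: W_chart[OF c] c.e_def c.u_def c.D_def)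
      then show ?thesis by (simp add: \<Phi>_def)
    qed
    show "csupp (ext i (\<Phi> \<epsilon> i))" if e: "\<epsilon> > 0"
    proof (rule cs[OF i])
      have "Ck_on 2 (\<lambda>y. c.e \<epsilon> y) (img (ch i))"
        unfolding c.e_def by (intro Ck_on_mult Ck_on_of_real c.smooth_u c.smooth_D e chart(2)[OF c])
      then have "continuous_on (img (ch i)) (\<lambda>z. Re (c.adj_lap (c.e \<epsilon>) z))"
        by (intro continuous_intros c.continuous_adj_lap)
      then show "continuous_on (img (ch i)) (\<Phi> \<epsilon> i)" by (rule continuous_on_eq) (simp only: \<Phi>)
    qed
    note S = total_scal_nonneg[OF nonneg c]
    show "ext i (low i) z \<ge> 0"
      unfolding ext_def low_def using c.low_nonneg[OF _ S] P'(6)[OF i] by simp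
    show "ext i (low i) z + (- (\<epsilon> powr (1 / m))) * ext i (n i) z \<le> ext i (\<Phi> \<epsilon> i) z" if e: "0 < \<epsilon>" "\<epsilon> \<le> 1"
    proof (cases "z \<in> img (ch i)")
      case True
      have "low i z - \<epsilon> powr (1 / m) * n i z \<le> \<Phi> \<epsilon> i z"
        unfolding \<Phi>[OF True] low_def n_def by (rule c.adj_lap_e_lower[OF e True S[OF True]])
      from mult_left_mono[OF this P'(6)[OF i, of "par (ch i) z"]] show ?thesis
        using True by (simp add: ext_def algebra_simps)
    qed (simp add: ext_def)
  qed
  define L N where "L = (\<Sum>i\<in>I. cint (ext i (low i)))" and "N = (\<Sum>i\<in>I. cint (ext i (n i)))"
  have zero_cs: "csupp (\<lambda>z :: complex^'n. 0 :: real)" by (rule csuppI[of _ "{}"]) auto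
  have Lpos: "0 \<le> cint (ext i (low i))" if "i \<in> I" for i
    using cint_mono[OF zero_cs low_cs[OF that] low0[OF that]] by (simp add: cint_zero)
  have LN: "L \<le> s * N" if s: "0 < s" "s \<le> 1" for s :: real
  proof -
    \<comment> \<open>Chosen so that \<epsilon> powr (1 / m) is s.\<close>
    define \<epsilon> where "\<epsilon> = s ^ m"
    have e: "0 < \<epsilon>" "\<epsilon> \<le> 1" using s by (simp_all add: \<epsilon>_def power_le_one)
    have es: "\<epsilon> powr (1 / m) = s" using s m by (simp add: \<epsilon>_def powr_powr flip: powr_realpow)
    have "cint (ext i (low i)) + (- s) * cint (ext i (n i)) \<le> cint (ext i (\<Phi> \<epsilon> i))" if i: "i \<in> I" for i
    proof -
      have "cint (\<lambda>z. ext i (low i) z + (- s) * ext i (n i) z) \<le> cint (ext i (\<Phi> \<epsilon> i))"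
        using lb[OF i e] unfolding es
        by (intro cint_mono csupp_add csupp_cmult low_cs n_cs \<Phi>_cs e i)
      then show ?thesis by (simp only: cint_add[OF low_cs[OF i] csupp_cmult[OF n_cs[OF i]]] cint_cmult)
    qed
    from sum_mono[OF this] have "L - s * N \<le> (\<Sum>i\<in>I. cint (ext i (\<Phi> \<epsilon> i)))"
      unfolding L_def N_def by (simp add: sum_subtractf sum_distrib_left)
    also have "\<dots> = 0" unfolding ext_def \<Phi>_def by (rule adjoint_integral_zero[OF P mCk_u[OF e(1)]])
    finally show ?thesis by simp
  qed
  have "L \<le> 0"
  proof (rule ccontr)
    assume "\<not> L \<le> 0"
    moreover from this have "N > 0" "L \<le> N" using LN[of 1] by auto
    \<comment> \<open>The value s = 1 gives L \<le> N, so s = L / (2 N) is admissible and yields L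
      \<le> L / 2.\<close>
    ultimately show False using LN[of "L / (2 * N)"] by (simp add: field_simps)
  qed
  then have "L = 0" unfolding L_def using Lpos by (intro antisym sum_nonneg)
  then have c00: "cint (ext i0 (low i0)) = 0"
    using sum_nonneg_eq_0_iff[OF I, of "\<lambda>i. cint (ext i (low i))"] Lpos i0(1) unfolding L_def by blast
  have "ext i0 (low i0) z0 \<le> 0"
    using cint_pos[OF low_cs[OF i0(1)] low0[OF i0(1)], of z0] c00 by linarith
  then have "\<eta> i0 (par c0 z0) * low i0 z0 \<le> 0" using c0(2) i0(2) by (simp add: ext_def)
  moreover have "0 \<le> low i0 z0"
    unfolding low_def i0(2)
    by (rule section_coords.low_nonneg[OF local_section[OF c0(1)] c0(2) total_scal_nonneg[OF nonneg c0]])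
  ultimately have "low i0 z0 = 0" using i0(3) by (simp add: mult_le_0_iff)
  then show ?thesis by (simp add: low_def i0(2))
qed

lemma
  assumes c: "c \<in> A" "z \<in> img c" and nz: "fc c z \<noteq> 0"
  shows section_total_scal_zero: "hermitian_coords.total_scal (Gc c) z = 0"
    and section_tw_zero: "section_coords.tw (Gc c) (fc c) m z = 0"
  using section_coords.low_zeroD[OF local_section[OF c(1)] c(2) total_scal_nonneg[OF nonneg c] nz low_zero[OF c]] by auto

text \<open>The nonzero value at z1 is carried to the centre along a segment, on which the
  derivative of f is f times a continuous function as long as f is nonzero.\<close>

lemma nonvanishing_ball:
  assumes c: "c \<in> A" and b: "ball z r \<subseteq> img c" and z1: "z1 \<in> ball z r" "fc c z1 \<noteq> 0"
  shows "fc c z \<noteq> 0"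
proof -
  interpret c: section_coords "Gc c" "img c" "fc c" m by (rule local_section[OF c])
  define l where "l = (\<lambda>t. z1 + t *\<^sub>R (z - z1))"
  have l: "l t \<in> img c" if "t \<in> {0..1}" for t
  proof -
    have "z \<in> ball z r" using z1(1) zero_le_dist[of z z1] by (simp del: zero_le_dist)
    then have "(1 - t) *\<^sub>R z1 + t *\<^sub>R z \<in> ball z r" by (intro convexD[OF convex_ball] z1(1)) (use that in auto)
    moreover have "(1 - t) *\<^sub>R z1 + t *\<^sub>R z = l t" by (simp add: l_def algebra_simps)
    ultimately show ?thesis using b by auto
  qed
  have lc: "continuous_on {0..1} l" unfolding l_def by (intro continuous_intros)
  define k where "k = (\<lambda>y. \<Sum>j\<in>UNIV. (z - z1) $ j * (of_nat m / 2 * (c.na y $ j - c.tor_low y $ j)))"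
  have kc: "continuous_on (img c) k"
    unfolding k_def by (intro continuous_intros Ck_on_imp_continuous[OF c.smooth_na] Ck_on_imp_continuous[OF c.smooth_tor_low])
  have "fc c (l 1) \<noteq> 0"
  proof (rule nonvanishing_ode[where \<phi>="\<lambda>t. fc c (l t)" and k="\<lambda>t. k (l t)"])
    show "continuous_on {0..1} (\<lambda>t. fc c (l t))" "continuous_on {0..1} (\<lambda>t. k (l t))"
      using l by (intro continuous_on_compose2[OF Ck_on_imp_continuous[OF c.smooth_f[of 0]] lc] continuous_on_compose2[OF kc lc]; auto)+
    show "fc c (l 0) \<noteq> 0" using z1(2) by (simp add: l_def)
    fix t assume t: "t \<in> {0..1 :: real}" "fc c (l t) \<noteq> 0"
    have tw: "c.tw (l t) = 0" by (rule section_tw_zero[OF c l[OF t(1)] t(2)])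
    have fd: "(fc c has_derivative frechet_derivative (fc c) (at (l t))) (at (l t))"
      by (rule holo_fun_onD(1)[OF c.f l[OF t(1)]])
    have ld: "(l has_derivative (\<lambda>h. h *\<^sub>R (z - z1))) (at t)"
      unfolding l_def by (auto intro!: derivative_eq_intros)
    have "((\<lambda>t. fc c (l t)) has_derivative (\<lambda>h. frechet_derivative (fc c) (at (l t)) (h *\<^sub>R (z - z1)))) (at t)"
      by (rule has_derivative_compose[OF ld fd])
    moreover have "frechet_derivative (fc c) (at (l t)) (h *\<^sub>R (z - z1)) = h *\<^sub>R frechet_derivative (fc c) (at (l t)) (z - z1)" for h
      using has_derivative_linear[OF fd] by (simp add: linear_scale)
    moreover have "frechet_derivative (fc c) (at (l t)) (z - z1) = fc c (l t) * k (l t)"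
      unfolding frechet_derivative_wirtinger[OF c.differentiable_f[OF l[OF t(1)]]] d_zbar_holo[OF c.f l[OF t(1)]] c.tw_zero[OF tw] k_def
      by (simp add: sum_distrib_left mult_ac)
    ultimately show "((\<lambda>t. fc c (l t)) has_vector_derivative fc c (l t) * k (l t)) (at t)"
      unfolding has_vector_derivative_def by simp
  qed
  then show ?thesis by (simp add: l_def)
qed

text \<open>By \<open>nonvanishing_ball\<close>, a zero at the centre of a coordinate ball forces
  zeros on the whole ball. The zero set is thus open as well as closed.\<close>

lemma nowhere_zero:
  assumes conn: "connected (UNIV :: 'a set)" and p0: "W p0 \<noteq> 0"
  shows "W p \<noteq> 0"
proof -
  let ?N = "{p. W p \<noteq> 0}"
  have "open ?N"
    using continuous_on_open_vimage[OF open_UNIV, THEN iffD1, OF mCk_continuous[OF mCk_W[of 0]], rule_format, of "- {0}"]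
    by (simp add: vimage_def Int_def open_Compl)
  moreover have "open (- ?N)"
  proof (subst open_subopen, rule ballI)
    fix p assume "p \<in> - ?N"
    then have Wp: "W p = 0" by simp
    obtain c where c: "c \<in> A" "p \<in> fst c" by (rule cover)
    obtain r where r: "r > 0" "ball (snd c p) r \<subseteq> img c"
      using chart(2)[OF c(1)] c(2) by (meson image_eqI open_contains_ball)
    let ?T = "fst c \<inter> snd c -` ball (snd c p) r"
    have "open ?T" by (rule continuous_open_preimage[OF chart(3)[OF c(1)] chart(1)[OF c(1)] open_ball])
    moreover have "p \<in> ?T" using c r by simp
    moreover have "?T \<subseteq> - ?N"
    proof
      fix q assume q: "q \<in> ?T"
      have fq: "fc c (snd c q') = \<sigma> c q'" if "q' \<in> fst c" for q' using par_snd[OF c(1) that] by (simp add: coord_rep_def)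
      have "fc c (snd c p) = 0" using Wp W_eq_0_iff(1)[OF c] fq[OF c(2)] by simp
      then have "fc c (snd c q) = 0" using nonvanishing_ball[OF c(1) r(2), of "snd c q"] q by blast
      then show "q \<in> - ?N" using W_eq_0_iff(1)[OF c(1), of q] fq[of q] q by simp
    qed
    ultimately show "\<exists>T. open T \<and> p \<in> T \<and> T \<subseteq> - ?N" by blast
  qed
  ultimately have "?N \<inter> UNIV = {} \<or> - ?N \<inter> UNIV = {}"
    by (rule connectedD[OF conn]) auto
  then show ?thesis using p0 by blast
qed

end

section \<open>Consequences of a section without zeros\<close>

lemma det_scaleR: "det (r *\<^sub>R M) = of_real (r ^ CARD('n)) * det (M :: complex^'n^'n)"
proof -
  have "r *\<^sub>R M = (\<chi> i. of_real r *s M $ i)"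
    by (simp add: vec_eq_iff scaleR_conv_of_real[where 'a=complex])
  then show ?thesis using det_rows_mul[of "\<lambda>_. complex_of_real r" "\<lambda>i. M $ i"] by simp
qed

lemma holo_fun_on_compose_field:
  assumes f: "holo_fun_on f S" and h: "\<And>z. z \<in> S \<Longrightarrow> h field_differentiable at (f z)"
  shows "holo_fun_on (\<lambda>z. h (f z)) S"
  unfolding holo_fun_on_def
proof
  fix z assume z: "z \<in> S"
  obtain d where d: "(h has_field_derivative d) (at (f z))" using h[OF z] by (auto simp: field_differentiable_def)
  have "((\<lambda>z. h (f z)) has_derivative (\<lambda>v. d * frechet_derivative f (at z) v)) (at z)"
    using has_derivative_compose[OF holo_fun_onD(1)[OF f z] d[unfolded has_field_derivative_def]] .
  then show "\<exists>D. ((\<lambda>z. h (f z)) has_derivative D) (at z) \<and> (\<forall>a v. D (a *s v) = a * D v)"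
    by (intro exI conjI, assumption) (simp add: holo_fun_onD(2)[OF f z])
qed

lemma holo_fun_on_diff_cmult:
  assumes f: "holo_fun_on f S" and h: "holo_fun_on h S"
  shows "holo_fun_on (\<lambda>z. f z - c * h z) S"
  unfolding holo_fun_on_def
proof
  fix z assume z: "z \<in> S"
  have "((\<lambda>z. f z - c * h z) has_derivative (\<lambda>v. frechet_derivative f (at z) v - c * frechet_derivative h (at z) v)) (at z)"
    by (intro has_derivative_diff has_derivative_mult_right holo_fun_onD(1)[OF f z] holo_fun_onD(1)[OF h z])
  then show "\<exists>D. ((\<lambda>z. f z - c * h z) has_derivative D) (at z) \<and> (\<forall>a v. D (a *s v) = a * D v)"
    by (intro exI conjI, assumption) (simp add: holo_fun_onD(2)[OF f z] holo_fun_onD(2)[OF h z] algebra_simps)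
qed

context pluricanonical_section
begin

lemma conformally_balanced_of_nowhere_zero:
  assumes nz: "\<And>p. W p \<noteq> 0" and n: "CARD('n) \<ge> 2"
  shows "conformally_balanced A g"
proof -
  obtain k where k: "CARD('n) = Suc k" "k > 0" using n by (cases "CARD('n)") auto
  have W0: "W p > 0" for p
  proof -
    obtain c where "c \<in> A" "p \<in> fst c" by (rule cover)
    from W_eq_0_iff(2)[OF this] nz[of p] show ?thesis by simp
  qed
  \<comment> \<open>With r = exp u this makes r ^ (n - 1) equal to Q powr (1 / m). That is the
    factor by which det G times the inverse changes: the determinant scales by r ^ n, the inverse by
    1 / r.\<close>
  define u where "u = (\<lambda>p. ln (W p) * (1 / (m * k)))"
  have "smooth_on_manifold A u"
    unfolding smooth_on_manifold_def smooth_fun_on_def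
  proof (intro ballI allI)
    fix c j assume c: "c \<in> A"
    have "Ck_on j (\<lambda>z. ln (coord_rep c W z)) (img c)"
      by (rule Ck_on_compose[OF chart(2)[OF c] open_greaterThan _ mCk_chart[OF mCk_W c] Ck_on_ln])
        (use W0 in \<open>auto simp: coord_rep_def\<close>)
    then have "Ck_on j (\<lambda>z. ln (coord_rep c W z) * (1 / (m * k))) (img c)"
      by (intro Ck_on_mult Ck_on_const chart(2)[OF c])
    then show "Ck_on j (coord_rep c u) (img c)" by (simp add: coord_rep_def o_def u_def)
  qed
  moreover have "balanced A (\<lambda>c p. exp (u p) *\<^sub>R g c p)"
    unfolding balanced_def
  proof (intro ballI allI)
    fix c z v assume c: "c \<in> A" and z: "z \<in> img c"
    interpret c: section_coords "Gc c" "img c" "fc c" m by (rule local_section[OF c])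
    define r where "r = (\<lambda>y. exp (u (par c y)))"
    define G' where "G' = (\<lambda>y. r y *\<^sub>R Gc c y)"
    define K' where "K' = (\<lambda>y. inverse (r y) *\<^sub>R c.K y)"
    have r0: "r y > 0" for y by (simp add: r_def)
    have rk: "r y ^ k = c.Q y powr (1 / m)" if "y \<in> img c" for y
    proof -
      have "r y ^ k = exp (real k * u (par c y))" by (simp add: r_def exp_of_nat_mult)
      also have "real k * u (par c y) = (1 / m) * ln (W (par c y))" using k(2) by (simp add: u_def)
      also have "exp \<dots> = W (par c y) powr (1 / m)" using W0[of "par c y"] by (simp add: powr_def)
      finally show ?thesis by (simp only: W_chart[OF c that])
    qed
    have sr: "Ck_on j r (img c)" for j
    proof -
      have "Ck_on j (\<lambda>z. coord_rep c W z powr (1 / (m * k))) (img c)"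
        by (rule Ck_on_compose[OF chart(2)[OF c] open_greaterThan _ mCk_chart[OF mCk_W c] Ck_on_powr])
          (use W0 in \<open>auto simp: coord_rep_def\<close>)
      moreover have "coord_rep c W z powr (1 / (m * k)) = r z" for z
        using W0[of "par c z"] by (simp add: r_def u_def powr_def coord_rep_def)
      ultimately show ?thesis by simp
    qed
    have sri: "Ck_on j (\<lambda>y. inverse (r y)) (img c)" for j
      by (rule Ck_on_inverse_compose[OF chart(2)[OF c] _ sr]) (use r0 in \<open>simp add: less_imp_neq[symmetric]\<close>)
    have G's: "Ck_on j (\<lambda>y. G' y $ a $ b) (img c)" and K's: "Ck_on j (\<lambda>y. K' y $ a $ b) (img c)" for j a b
      unfolding G'_def K'_def by (simp_all add: Ck_on_scaleR chart(2)[OF c] sr sri c.smooth_G c.smooth_K)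
    have detK: "det (G' y) * K' y $ a $ b = of_real (c.Q y powr (1 / m)) * c.D y * c.K y $ a $ b" if "y \<in> img c" for y a b
    proof -
      have "r y ^ Suc k * inverse (r y) = r y ^ k" using r0[of y] by simp
      then have "complex_of_real (r y ^ Suc k) * of_real (inverse (r y)) = of_real (c.Q y powr (1 / m))"
        unfolding rk[OF that, symmetric] by (simp only: of_real_mult[symmetric])
      moreover have "det (G' y) * K' y $ a $ b = (of_real (r y ^ Suc k) * of_real (inverse (r y))) * c.D y * c.K y $ a $ b"
        unfolding G'_def K'_def det_scaleR k(1) c.D_def by (simp add: scaleR_conv_of_real[where 'a=complex])
      ultimately show ?thesis by simp
    qed
    have fnz: "fc c y \<noteq> 0" if "y \<in> img c" for y
      using W_eq_0_iff(1)[OF c par_in(1)[OF that]] nz by (simp add: coord_rep_def)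
    note tw = section_tw_zero[OF c z fnz[OF z]]
    have "ext_deriv (2 * k) (\<lambda>y. wedge_power2 (fundamental_form (G' y)) k) z v = 0"
    proof (rule ext_deriv_power_eq_0[where G=G' and K=K', OF chart(2)[OF c] z _ _ _ _ _ _ k(1)])
      show "K' y ** G' y = mat 1" if "y \<in> img c" for y
      proof -
        have "K' y ** G' y = (inverse (r y) * r y) *\<^sub>R (c.K y ** Gc c y)"
          unfolding K'_def G'_def by (simp add: matrix_matrix_mult_def vec_eq_iff scaleR_sum_right mult.commute)
        then show ?thesis using r0[of y] c.K_G[OF that] by simp
      qed
      show "mat_differentiable G' z" "mat_differentiable K' z"
        unfolding mat_differentiable_def by (intro allI Ck_on_differentiable[OF G's z] Ck_on_differentiable[OF K's z])+
      show "(\<lambda>y. det (G' y)) differentiable at z"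
        by (rule Ck_on_differentiable[OF Ck_on_det[OF chart(2)[OF c] G's] z])
      fix j
      have "d_z a (\<lambda>y. det (G' y) * K' y $ j $ a) z = d_z a (\<lambda>y. of_real (c.Q y powr (1 / m)) * c.D y * c.K y $ j $ a) z" for a
        by (rule dz.cong[OF chart(2)[OF c] z detK])
      then show "(\<Sum>a\<in>UNIV. d_z a (\<lambda>y. det (G' y) * K' y $ j $ a) z) = 0"
        using c.divergence_zero(1)[OF z fnz tw] by simp
      have "d_zbar a (\<lambda>y. det (G' y) * K' y $ a $ j) z = d_zbar a (\<lambda>y. of_real (c.Q y powr (1 / m)) * c.D y * c.K y $ a $ j) z" for a
        by (rule dzb.cong[OF chart(2)[OF c] z detK])
      then show "(\<Sum>a\<in>UNIV. d_zbar a (\<lambda>y. det (G' y) * K' y $ a $ j) z) = 0"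
        using c.divergence_zero(2)[OF z fnz tw] by simp
    qed
    moreover have "coord_rep c (\<lambda>p. exp (u p) *\<^sub>R g c p) y = G' y" for y
      by (simp add: coord_rep_def G'_def r_def)
    ultimately show "ext_deriv (2 * (CARD('n) - 1))
          (\<lambda>y. wedge_power2 (fundamental_form (coord_rep c (\<lambda>p. exp (u p) *\<^sub>R g c p) y)) (CARD('n) - 1)) z v = 0"
      using k(1) by simp
  qed
  ultimately show ?thesis unfolding conformally_balanced_def by blast
qed

lemma HSC_zero_of_nowhere_zero:
  assumes "\<And>p. W p \<noteq> 0" shows "HSC_zero A g"
  unfolding HSC_zero_def
proof (intro ballI allI)
  fix c p v assume c: "c \<in> A" "p \<in> fst c"
  have z: "snd c p \<in> img c" using c(2) by blast
  have "fc c (snd c p) \<noteq> 0" using W_eq_0_iff(1)[OF c] assms by (simp add: coord_rep_def par_snd[OF c])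
  from total_scal_zeroD[OF nonneg c(1) z section_total_scal_zero[OF c(1) z this], of v]
  show "hol_sect_curv g c p v = 0" by (simp add: par_snd[OF c])
qed

lemma hol_torsion_of_nowhere_zero:
  assumes "\<And>p. W p \<noteq> 0" shows "hol_torsion A canonical_bundle"
proof -
  have nz: "\<sigma> c p \<noteq> 0" if "c \<in> A" "p \<in> fst c" for c p using W_eq_0_iff(1)[OF that] assms by simp
  have 1: "holo_fun_on (coord_rep c (\<lambda>p. inverse (\<sigma> c p))) (img c)" if c: "c \<in> A" for c
  proof -
    have "holo_fun_on (\<lambda>z. inverse (fc c z)) (img c)"
    proof (rule holo_fun_on_compose_field[where f="fc c" and h=inverse])
      show "holo_fun_on (fc c) (img c)" using \<sigma> c by (simp add: hol_sections_def)
      show "inverse field_differentiable at (fc c z)" if "z \<in> img c" for z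
        using nz[OF c par_in(1)[OF that]] by (intro field_differentiable_inverse field_differentiable_ident) (simp add: coord_rep_def)
    qed
    then show ?thesis by (simp add: coord_rep_def o_def)
  qed
  have 2: "inverse (\<sigma> c p) * bundle_power m canonical_bundle c d p = trivial_bundle c d p * inverse (\<sigma> d p)"
    if cd: "c \<in> A" "d \<in> A" "p \<in> fst c \<inter> fst d" for c d p
  proof -
    have eq: "\<sigma> c p = bundle_power m canonical_bundle c d p * \<sigma> d p" using \<sigma> cd unfolding hol_sections_def by blast
    have "\<sigma> c p \<noteq> 0" using nz cd by blast
    then have "bundle_power m canonical_bundle c d p \<noteq> 0" "\<sigma> d p \<noteq> 0" unfolding eq by auto
    then show ?thesis unfolding eq by (simp add: trivial_bundle_def)
  qed
  have "inverse (\<sigma> c p) \<noteq> 0" if "c \<in> A" "p \<in> fst c" for c p using nz[OF that] by simp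
  then have "bundle_iso A (bundle_power m canonical_bundle) trivial_bundle"
    unfolding bundle_iso_def by (intro exI[of _ "\<lambda>c p. inverse (\<sigma> c p)"] conjI ballI 1 2)
  then show ?thesis unfolding hol_torsion_def using m by blast
qed

end

section \<open>Dimensions of spaces of sections\<close>

interpretation sections: vector_space section_scale by (rule vector_space_section_scale)

lemma hol_sections_diff:
  assumes "s \<in> hol_sections A t" "s' \<in> hol_sections A t"
  shows "(\<lambda>c p. s c p - a * s' c p) \<in> hol_sections A t"
proof -
  have s: "\<And>c. c \<in> A \<Longrightarrow> holo_fun_on (coord_rep c (s c)) (snd c ` fst c)"
      "\<And>c d p. c \<in> A \<Longrightarrow> d \<in> A \<Longrightarrow> p \<in> fst c \<inter> fst d \<Longrightarrow> s c p = t c d p * s d p"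
      "\<And>c p. c \<notin> A \<or> p \<notin> fst c \<Longrightarrow> s c p = 0"
    using assms(1) unfolding hol_sections_def by blast+
  have s': "\<And>c. c \<in> A \<Longrightarrow> holo_fun_on (coord_rep c (s' c)) (snd c ` fst c)"
      "\<And>c d p. c \<in> A \<Longrightarrow> d \<in> A \<Longrightarrow> p \<in> fst c \<inter> fst d \<Longrightarrow> s' c p = t c d p * s' d p"
      "\<And>c p. c \<notin> A \<or> p \<notin> fst c \<Longrightarrow> s' c p = 0"
    using assms(2) unfolding hol_sections_def by blast+
  show ?thesis
    unfolding hol_sections_def
  proof (intro CollectI conjI ballI allI impI)
    fix c assume c: "c \<in> A"
    show "holo_fun_on (coord_rep c (\<lambda>p. s c p - a * s' c p)) (snd c ` fst c)"
      using holo_fun_on_diff_cmult[OF s(1)[OF c] s'(1)[OF c]] by (simp add: coord_rep_def o_def)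
  next
    fix c d p assume cdp: "c \<in> A" "d \<in> A" "p \<in> fst c \<inter> fst d"
    show "s c p - a * s' c p = t c d p * (s d p - a * s' d p)"
      unfolding s(2)[OF cdp] s'(2)[OF cdp] by (simp add: algebra_simps)
  qed (simp add: s(3) s'(3))
qed

context hermitian_manifold
begin

context
  assumes nonneg: "HSC_nonneg A g" and conn: "connected (UNIV :: 'a set)"
begin

lemma section_zero_or_nowhere_zero:
  assumes m: "m > 0" and s: "s \<in> hol_sections A (bundle_power m canonical_bundle)" and c: "c \<in> A" "p \<in> fst c" "s c p = 0"
  shows "s = 0"
proof -
  interpret pluricanonical_section A g s m by unfold_locales (rule nonneg s m)+
  have "s d q = 0" for d q
  proof (cases "d \<in> A \<and> q \<in> fst d")
    case True
    have "W p = 0" using W_eq_0_iff(1)[OF c(1,2)] c(3) by simp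
    then have "W q = 0" using nowhere_zero[OF conn] by blast
    then show ?thesis using W_eq_0_iff(1)[of d q] True by simp
  next
    case False
    then show ?thesis using s unfolding hol_sections_def by blast
  qed
  then show ?thesis by (simp add: fun_eq_iff)
qed

lemma h0_eq_1:
  assumes m: "m > 0" and s: "s \<in> hol_sections A (bundle_power m canonical_bundle)" "s \<noteq> 0"
  shows "h0 A (bundle_power m canonical_bundle) = 1"
proof -
  let ?V = "hol_sections A (bundle_power m canonical_bundle)"
  obtain c p where c: "c \<in> A" "p \<in> fst c" using cover by blast
  have nz: "s c p \<noteq> 0" using section_zero_or_nowhere_zero[OF m s(1) c] s(2) by blast
  have "t \<in> sections.span {s}" if t: "t \<in> ?V" for t
  proof -
    have "(\<lambda>d q. t d q - t c p / s c p * s d q) = 0"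
      by (rule section_zero_or_nowhere_zero[OF m hol_sections_diff[OF t s(1)] c]) (simp add: nz)
    then have "t = section_scale (t c p / s c p) s"
      by (simp add: fun_eq_iff section_scale_def)
    then show ?thesis by (metis insertI1 sections.span_base sections.span_scale)
  qed
  then show ?thesis
    unfolding h0_def using s by (intro sections.dim_unique[of "{s}"]) auto
qed

lemma h0_cases:
  assumes m: "m > 0"
  obtains "h0 A (bundle_power m canonical_bundle) = 0"
  | s where "s \<in> hol_sections A (bundle_power m canonical_bundle)" "s \<noteq> 0" "h0 A (bundle_power m canonical_bundle) = 1"
proof (cases "hol_sections A (bundle_power m canonical_bundle) \<subseteq> {0}")
  case True
  then have "sections.dim (hol_sections A (bundle_power m canonical_bundle)) = 0"
    using sections.dim_le_card[of "hol_sections A (bundle_power m canonical_bundle)" "{}"] by simp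
  then show ?thesis using that(1) by (simp add: h0_def)
next
  case False
  then show ?thesis using that(2) h0_eq_1[OF m] by blast
qed

lemma conditions_of_h0:
  assumes m: "m > 0" and h: "h0 A (bundle_power m canonical_bundle) \<noteq> 0" and n: "CARD('n) \<ge> 2"
  shows "HSC_zero A g \<and> conformally_balanced A g \<and> hol_torsion A canonical_bundle"
proof -
  obtain s where s: "s \<in> hol_sections A (bundle_power m canonical_bundle)" "s \<noteq> 0"
    using h0_cases[OF m] h by metis
  interpret pluricanonical_section A g s m by unfold_locales (rule nonneg s m)+
  have nz: "W p \<noteq> 0" for p
  proof -
    obtain c where c: "c \<in> A" "p \<in> fst c" by (rule cover)
    show ?thesis using section_zero_or_nowhere_zero[OF m s(1) c] s(2) W_eq_0_iff(1)[OF c] by blast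
  qed
  show ?thesis
    using HSC_zero_of_nowhere_zero[OF nz] conformally_balanced_of_nowhere_zero[OF nz n] hol_torsion_of_nowhere_zero[OF nz] by blast
qed

end

text \<open>The inverse of a trivialisation is a section, and its powers are sections at all
  multiples of m; the upper limit in \<open>kodaira_dim\<close> calls for arbitrarily large
  indices.\<close>

lemma torsion_h0:
  assumes h: "\<And>c. c \<in> A \<Longrightarrow> holo_fun_on (coord_rep c (h c)) (img c)" "\<And>c p. c \<in> A \<Longrightarrow> p \<in> fst c \<Longrightarrow> h c p \<noteq> 0"
      "\<And>c d p. c \<in> A \<Longrightarrow> d \<in> A \<Longrightarrow> p \<in> fst c \<inter> fst d \<Longrightarrow> h c p * bundle_power m canonical_bundle c d p = h d p"
  shows "\<exists>s \<in> hol_sections A (bundle_power (m * k) canonical_bundle). s \<noteq> 0"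
proof -
  define s where "s = (\<lambda>c p. if c \<in> A \<and> p \<in> fst c then inverse (h c p) ^ k else 0)"
  have "holo_fun_on (coord_rep c (s c)) (img c)" if c: "c \<in> A" for c
  proof -
    have 1: "holo_fun_on (\<lambda>z. inverse (coord_rep c (h c) z) ^ k) (img c)"
    proof (rule holo_fun_on_compose_field[where h="\<lambda>w. inverse w ^ k", OF h(1)[OF c]])
      fix z assume "z \<in> img c"
      then have "coord_rep c (h c) z \<noteq> 0" using h(2)[OF c par_in(1)] by (simp add: coord_rep_def)
      then show "(\<lambda>w. inverse w ^ k) field_differentiable at (coord_rep c (h c) z)"
        by (intro field_differentiable_power field_differentiable_inverse field_differentiable_ident)
    qed
    have 2: "inverse (coord_rep c (h c) z) ^ k = coord_rep c (s c) z" if "z \<in> img c" for z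
      using c par_in(1)[OF that] by (simp add: coord_rep_def s_def)
    show ?thesis by (rule iffD1[OF holo_fun_on_cong[OF chart(2)[OF c] 2] 1])
  qed
  moreover have "s c p = bundle_power (m * k) canonical_bundle c d p * s d p" if cd: "c \<in> A" "d \<in> A" "p \<in> fst c \<inter> fst d" for c d p
  proof -
    have eq: "h d p = h c p * bundle_power m canonical_bundle c d p" by (rule h(3)[OF cd, symmetric])
    have "h d p \<noteq> 0" using h(2) cd by blast
    then have "bundle_power m canonical_bundle c d p \<noteq> 0" unfolding eq by simp
    then have "inverse (h c p) = bundle_power m canonical_bundle c d p * inverse (h d p)" unfolding eq by simp
    then show ?thesis using cd by (simp add: s_def bundle_power_def power_mult power_mult_distrib)
  qed
  moreover have "\<forall>c p. c \<notin> A \<or> p \<notin> fst c \<longrightarrow> s c p = 0" by (auto simp: s_def)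
  ultimately have "s \<in> hol_sections A (bundle_power (m * k) canonical_bundle)" unfolding hol_sections_def by blast
  moreover obtain c p where c: "c \<in> A" "p \<in> fst c" using cover by blast
  have "s c p \<noteq> 0" using c h(2)[OF c] by (simp add: s_def)
  then have "s \<noteq> 0" by auto
  ultimately show ?thesis by blast
qed

end

theorem theorem1p1:
  fixes A :: "('a::t2_space, 'n::finite) chart set"
    and g :: "('a, 'n) metric"
  assumes "compact (UNIV :: 'a set)"
    and "connected (UNIV :: 'a set)"
    and "complex_atlas A"
    and "CARD('n) \<ge> 2"
    and "hermitian_metric A g"
    and "HSC_nonneg A g"
  shows "kodaira_dim A \<le> 0 \<and>
         (kodaira_dim A = 0 \<longleftrightarrow>
            HSC_zero A g \<and> conformally_balanced A g \<and> hol_torsion A canonical_bundle)"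
proof -
  interpret hermitian_manifold A g by unfold_locales (rule assms)+
  define h where "h = (\<lambda>m. h0 A (bundle_power m canonical_bundle))"
  define T where "T = (\<lambda>m. if h m = 0 then - \<infinity> else ereal (ln (real (h m)) / ln (real m)))"
  have kd: "kodaira_dim A = limsup T" unfolding kodaira_dim_def T_def h_def Let_def ..
  \<comment> \<open>The dimension is 0 or 1, and ln 1 = 0; at m = 1 the quotient 0 / 0 is 0 as
    well.\<close>
  have T: "T m = (if h m = 0 then - \<infinity> else 0)" if "m > 0" for m
  proof (rule h0_cases[OF assms(6,2) that])
    assume "h0 A (bundle_power m canonical_bundle) = 0"
    then show ?thesis by (simp add: T_def h_def)
  next
    assume "h0 A (bundle_power m canonical_bundle) = 1"
    then have "h m = 1" by (simp add: h_def)
    then show ?thesis by (simp add: T_def)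
  qed
  have ev: "eventually (\<lambda>m. m > 0) sequentially" by (rule eventually_gt_at_top)
  have le: "kodaira_dim A \<le> 0"
    unfolding kd by (rule Limsup_bounded, rule eventually_mono[OF ev]) (simp add: T)
  have "HSC_zero A g \<and> conformally_balanced A g \<and> hol_torsion A canonical_bundle" if "kodaira_dim A = 0"
  proof -
    have "\<exists>m>0. h m \<noteq> 0"
    proof (rule ccontr)
      assume "\<not> ?thesis"
      then have h0: "h m = 0" if "m > 0" for m using that by blast
      have "limsup T \<le> - \<infinity>" by (intro Limsup_bounded eventually_mono[OF ev]) (simp add: T h0)
      then show False using that kd by simp
    qed
    then show ?thesis using conditions_of_h0[OF assms(6,2)] assms(4) unfolding h_def by blast
  qed
  moreover have "kodaira_dim A = 0" if tors: "hol_torsion A canonical_bundle"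
  proof -
    obtain m where m: "m > 0" "bundle_iso A (bundle_power m canonical_bundle) trivial_bundle"
      using tors unfolding hol_torsion_def by blast
    then obtain h' where H: "(\<forall>c\<in>A. holo_fun_on (coord_rep c (h' c)) (img c) \<and> (\<forall>p\<in>fst c. h' c p \<noteq> 0)) \<and>
          (\<forall>c\<in>A. \<forall>d\<in>A. \<forall>p\<in>fst c \<inter> fst d. h' c p * bundle_power m canonical_bundle c d p = trivial_bundle c d p * h' d p)"
      unfolding bundle_iso_def by blast
    have h': "\<And>c. c \<in> A \<Longrightarrow> holo_fun_on (coord_rep c (h' c)) (img c)" "\<And>c p. c \<in> A \<Longrightarrow> p \<in> fst c \<Longrightarrow> h' c p \<noteq> 0"
      "\<And>c d p. c \<in> A \<Longrightarrow> d \<in> A \<Longrightarrow> p \<in> fst c \<inter> fst d \<Longrightarrow> h' c p * bundle_power m canonical_bundle c d p = h' d p"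
      using H by (blast, blast, simp add: trivial_bundle_def)
    \<comment> \<open>Vanishing along all multiples of m excludes a negative upper limit.\<close>
    have T0: "T (m * k) = 0" if k: "k > 0" for k
    proof -
      have mk: "m * k > 0" using m(1) k by simp
      obtain s where s: "s \<in> hol_sections A (bundle_power (m * k) canonical_bundle)" "s \<noteq> 0"
        using torsion_h0[OF h', of k] by blast
      have "h (m * k) \<noteq> 0" unfolding h_def h0_eq_1[OF assms(6,2) mk s] by simp
      then show ?thesis using T[OF mk] by simp
    qed
    have "\<not> limsup T < 0"
    proof
      assume "limsup T < 0"
      then have "eventually (\<lambda>n. T n < 0) sequentially" by (rule Limsup_lessD)
      then obtain N where N: "\<And>n. n \<ge> N \<Longrightarrow> T n < 0" by (auto simp: eventually_sequentially)
      have "T (m * Suc N) < 0" by (rule N) (use m(1) in \<open>cases m, auto\<close>)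
      then show False using T0[of "Suc N"] by simp
    qed
    then show ?thesis using le kd by simp
  qed
  ultimately show ?thesis using le by blast
qed

end
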